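(* Let $\Omega\subset\mathbb{R}^n$ be a connected, bounded, open set with smooth boundary. Let $1<q<p$, with $p,q\to\infty$ (along a sequence of pairs $(p,q)$), be such that $$\ell := \lim_{p,q\to\infty}\frac{q}{p}<1.$$ Then, for any sequence $\{u_{p,q}\}_{p,q}$ of (positive) eigenfunctions of $$-\Delta_p u=\Lambda_{p,q}(\Omega)\,\|u\|_{L^q(\Omega)}^{p-q}|u|^{q-2}u \ \text{ in }\Omega,\qquad u=0\ \text{ on }\partial\Omega,$$ normalized such that $\|u_{p,q}\|_{L^q(\Omega)}=1$, there exists a function $v_\ell$ such that, up to a subsequence, $$\lim_{p,q\to\infty}u_{p,q}(x)=v_\ell(x)\quad\text{uniformly in }\overline\Omega,$$ and $v_\ell$ is a viscosity solution of $$\min\left\{-\Delta_\infty v_\ell,\ |\nabla v_\ell|-\lambda_{1,\infty}(\Omega)\,v_\ell^{\ell}\right\}=0\ \text{ in }\Omega,\qquad v_\ell=0\ \text{ on }\partial\Omega,$$ with $\|v_\ell\|_{L^\infty(\Omega)}=1$.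
   Context: $\Delta_p u=\mathrm{div}(|\nabla u|^{p-2}\nabla u)$ and $\Delta_\infty u=\sum_{i,j=1}^n \frac{\partial u}{\partial x_j}\frac{\partial^2u}{\partial x_j\partial x_i}\frac{\partial u}{\partial x_i}$. $\Lambda_{p,q}(\Omega)=\inf\{\int_\Omega|\nabla u|^p\,dx : u\in W^{1,p}_0(\Omega),\ \|u\|_{L^q(\Omega)}=1\}$. An eigenfunction $u_{p,q}$ is a function in $W^{1,p}_0(\Omega)\cap C(\Omega)$, taken positive in $\Omega$, which is a weak solution: $\int_\Omega|\nabla u|^{p-2}\nabla u\cdot\nabla\phi\,dx=\int_\Omega \Lambda_{p,q}(\Omega)\|u\|_{L^q(\Omega)}^{p-q}|u|^{q-2}u\,\phi\,dx$ for all $\phi\in C_0^\infty(\Omega)$. $\lambda_{1,\infty}(\Omega)=\inf_{u\in W^{1,\infty}_0(\Omega)\setminus\{0\}}\|\nabla u\|_{L^\infty(\Omega)}/\|u\|_{L^\infty(\Omega)}$, which equals $1/\mathfrak{R}$ with $\mathfrak{R}$ the radius of the biggest ball contained in $\Omega$. A non-negative $u\in C(\Omega)$ is a viscosity solution of $\min\{-\Delta_\infty u,\ |\nabla u|-\lambda_{1,\infty}(\Omega)u^\ell\}=0$ in $\Omega$ if: (1) whenever $x_0\in\Omega$ and $\phi\in C^2(\Omega)$ satisfy $u(x_0)=\phi(x_0)$ and $u(x)<\phi(x)$ for $x\neq x_0$, then $-\Delta_\infty\phi(x_0)\le0$ or $|\nabla\phi(x_0)|-\lambda_{1,\infty}(\Omega)\phi^\ell(x_0)\le0$;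 (2) whenever $x_0\in\Omega$ and $\phi\in C^2(\Omega)$ satisfy $u(x_0)=\phi(x_0)$ and $u(x)>\phi(x)$ for $x\neq x_0$, then $-\Delta_\infty\phi(x_0)\ge0$ and $|\nabla\phi(x_0)|-\lambda_{1,\infty}(\Omega)\phi^\ell(x_0)\ge0$. The boundary condition means that $u$ extends continuously to $\overline\Omega$ with value $0$ on $\partial\Omega$. *)

theory Defs
  imports "HOL-Analysis.Analysis" "HOL-Probability.Essential_Supremum"
begin

definition partial_deriv :: "'a::euclidean_space \<Rightarrow> ('a \<Rightarrow> real) \<Rightarrow> 'a \<Rightarrow> real" where
  "partial_deriv i f x = frechet_derivative f (at x) i"

definition grad :: "('a::euclidean_space \<Rightarrow> real) \<Rightarrow> 'a \<Rightarrow> 'a" where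
  "grad f x = (\<Sum>i\<in>Basis. partial_deriv i f x *\<^sub>R i)"

definition infinity_laplacian :: "('a::euclidean_space \<Rightarrow> real) \<Rightarrow> 'a \<Rightarrow> real" where
  "infinity_laplacian f x =
     (\<Sum>i\<in>Basis. \<Sum>j\<in>Basis.
        partial_deriv j f x * partial_deriv j (partial_deriv i f) x * partial_deriv i f x)"

(* Intended for open S only, where "at x" and "at x within S" agree. *)
primrec C_on :: "nat \<Rightarrow> 'a::euclidean_space set \<Rightarrow> ('a \<Rightarrow> real) \<Rightarrow> bool" where
  "C_on 0 S f \<longleftrightarrow> continuous_on S f"
| "C_on (Suc k) S f \<longleftrightarrow>
     (\<forall>x\<in>S. f differentiable (at x)) \<and> (\<forall>i\<in>Basis. C_on k S (partial_deriv i f))"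

definition smooth_on :: "'a::euclidean_space set \<Rightarrow> ('a \<Rightarrow> real) \<Rightarrow> bool" where
  "smooth_on S f \<longleftrightarrow> (\<forall>k. C_on k S f)"

(* Up to a rigid motion, Omega is locally the region above the graph of a smooth function of
   n - 1 variables; here e is the "vertical" unit direction, and a function of the other n - 1
   variables is a function on the whole space that is constant along e. *)
definition smooth_boundary :: "'a::euclidean_space set \<Rightarrow> bool" where
  "smooth_boundary \<Omega> \<longleftrightarrow>
     (\<forall>x0\<in>frontier \<Omega>. \<exists>r>0. \<exists>e \<gamma>. norm e = 1 \<and> smooth_on UNIV \<gamma> \<and>
        (\<forall>x t. \<gamma> (x + t *\<^sub>R e) = \<gamma> x) \<and>
        \<Omega> \<inter> ball x0 r = {x \<in> ball x0 r. \<gamma> x < x \<bullet> e})"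

(* The space of smooth functions with compact support in Omega, extended by zero. *)
definition test_function :: "'a::euclidean_space set \<Rightarrow> ('a \<Rightarrow> real) \<Rightarrow> bool" where
  "test_function \<Omega> \<phi> \<longleftrightarrow>
     smooth_on UNIV \<phi> \<and> compact (closure {x. \<phi> x \<noteq> 0}) \<and> closure {x. \<phi> x \<noteq> 0} \<subseteq> \<Omega>"

definition in_Lp ::
  "real \<Rightarrow> 'a::euclidean_space set \<Rightarrow> ('a \<Rightarrow> 'b::euclidean_space) \<Rightarrow> bool" where
  "in_Lp p \<Omega> f \<longleftrightarrow>
     f \<in> borel_measurable (lebesgue_on \<Omega>) \<and> integrable (lebesgue_on \<Omega>) (\<lambda>x. norm (f x) powr p)"

definition Lp_norm ::
  "real \<Rightarrow> 'a::euclidean_space set \<Rightarrow> ('a \<Rightarrow> 'b::euclidean_space) \<Rightarrow> real" where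
  "Lp_norm p \<Omega> f = (\<integral>x. norm (f x) powr p \<partial>lebesgue_on \<Omega>) powr (1 / p)"

definition in_Linf :: "'a::euclidean_space set \<Rightarrow> ('a \<Rightarrow> 'b::euclidean_space) \<Rightarrow> bool" where
  "in_Linf \<Omega> f \<longleftrightarrow>
     f \<in> borel_measurable (lebesgue_on \<Omega>) \<and>
     esssup (lebesgue_on \<Omega>) (\<lambda>x. ereal (norm (f x))) < \<infinity>"

definition Linf_norm :: "'a::euclidean_space set \<Rightarrow> ('a \<Rightarrow> 'b::euclidean_space) \<Rightarrow> real" where
  "Linf_norm \<Omega> f = real_of_ereal (esssup (lebesgue_on \<Omega>) (\<lambda>x. ereal (norm (f x))))"

definition locally_integrable_on ::
  "'a::euclidean_space set \<Rightarrow> ('a \<Rightarrow> 'b::euclidean_space) \<Rightarrow> bool" where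
  "locally_integrable_on \<Omega> f \<longleftrightarrow> (\<forall>K. compact K \<and> K \<subseteq> \<Omega> \<longrightarrow> set_integrable lebesgue K f)"

(* Weak gradients are determined only almost everywhere, hence a relation rather than a function:
   G is (a representative of) the distributional gradient of u in Omega. *)
definition weak_gradient ::
  "'a::euclidean_space set \<Rightarrow> ('a \<Rightarrow> real) \<Rightarrow> ('a \<Rightarrow> 'a) \<Rightarrow> bool" where
  "weak_gradient \<Omega> u G \<longleftrightarrow>
     locally_integrable_on \<Omega> u \<and> locally_integrable_on \<Omega> G \<and>
     (\<forall>\<phi>. test_function \<Omega> \<phi> \<longrightarrow> (\<forall>i\<in>Basis.
        (\<integral>x. u x * partial_deriv i \<phi> x \<partial>lebesgue_on \<Omega>) =
        - (\<integral>x. (G x \<bullet> i) * \<phi> x \<partial>lebesgue_on \<Omega>)))"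

(* u lies in the Sobolev space of exponent p and G is its weak gradient. *)
definition W1p :: "real \<Rightarrow> 'a::euclidean_space set \<Rightarrow> ('a \<Rightarrow> real) \<Rightarrow> ('a \<Rightarrow> 'a) \<Rightarrow> bool" where
  "W1p p \<Omega> u G \<longleftrightarrow> in_Lp p \<Omega> u \<and> in_Lp p \<Omega> G \<and> weak_gradient \<Omega> u G"

(* The closure of the test functions in the Sobolev norm. *)
definition W1p0 :: "real \<Rightarrow> 'a::euclidean_space set \<Rightarrow> ('a \<Rightarrow> real) \<Rightarrow> ('a \<Rightarrow> 'a) \<Rightarrow> bool" where
  "W1p0 p \<Omega> u G \<longleftrightarrow>
     W1p p \<Omega> u G \<and>
     (\<exists>\<phi>. (\<forall>k::nat. test_function \<Omega> (\<phi> k)) \<and>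
        (\<lambda>k. Lp_norm p \<Omega> (\<lambda>x. u x - \<phi> k x)) \<longlonglongrightarrow> 0 \<and>
        (\<lambda>k. Lp_norm p \<Omega> (\<lambda>x. G x - grad (\<phi> k) x)) \<longlonglongrightarrow> 0)"

(* For exponent infinity the closure of the test functions would contain only C^1 functions;
   as usual, the space is the essentially bounded functions with essentially bounded gradient that
   vanish on the boundary in the sense of the exponent-1 space. *)
definition W1inf0 :: "'a::euclidean_space set \<Rightarrow> ('a \<Rightarrow> real) \<Rightarrow> ('a \<Rightarrow> 'a) \<Rightarrow> bool" where
  "W1inf0 \<Omega> u G \<longleftrightarrow> in_Linf \<Omega> u \<and> in_Linf \<Omega> G \<and> W1p0 1 \<Omega> u G"

definition Lambda_pq :: "real \<Rightarrow> real \<Rightarrow> 'a::euclidean_space set \<Rightarrow> real" where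
  "Lambda_pq p q \<Omega> =
     Inf {(\<integral>x. norm (G x) powr p \<partial>lebesgue_on \<Omega>) | u G. W1p0 p \<Omega> u G \<and> Lp_norm q \<Omega> u = 1}"

definition lambda_1_inf :: "'a::euclidean_space set \<Rightarrow> real" where
  "lambda_1_inf \<Omega> =
     Inf {Linf_norm \<Omega> G / Linf_norm \<Omega> u | u G.
            W1inf0 \<Omega> u G \<and> \<not> (AE x in lebesgue_on \<Omega>. u x = 0)}"

(* Positive weak solutions. The condition on the frontier only fixes the pointwise values of u
   there, u being a priori continuous just in the open set; the boundary condition proper is
   membership in W1p0. *)
definition eigenfunction ::
  "real \<Rightarrow> real \<Rightarrow> 'a::euclidean_space set \<Rightarrow> ('a \<Rightarrow> real) \<Rightarrow> bool" where
  "eigenfunction p q \<Omega> u \<longleftrightarrow>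
     continuous_on \<Omega> u \<and> (\<forall>x\<in>\<Omega>. 0 < u x) \<and> (\<forall>x\<in>frontier \<Omega>. u x = 0) \<and>
     (\<exists>G. W1p0 p \<Omega> u G \<and>
        (\<forall>\<phi>. test_function \<Omega> \<phi> \<longrightarrow>
           (\<integral>x. norm (G x) powr (p - 2) * (G x \<bullet> grad \<phi> x) \<partial>lebesgue_on \<Omega>) =
           (\<integral>x. Lambda_pq p q \<Omega> * Lp_norm q \<Omega> u powr (p - q) *
                 \<bar>u x\<bar> powr (q - 2) * u x * \<phi> x \<partial>lebesgue_on \<Omega>)))"

(* t^a with the convention 0^0 = 1, whereas 0 powr 0 = 0; needed since the exponent may be 0. *)
definition rpow :: "real \<Rightarrow> real \<Rightarrow> real" where
  "rpow t a = (if a = 0 then 1 else t powr a)"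

(* Non-negative viscosity solutions in Omega of
   min {- infinity_laplacian u, |grad u| - lambda_1_inf Omega * u^l} = 0. *)
definition viscosity_solution :: "real \<Rightarrow> 'a::euclidean_space set \<Rightarrow> ('a \<Rightarrow> real) \<Rightarrow> bool" where
  "viscosity_solution l \<Omega> u \<longleftrightarrow>
     continuous_on \<Omega> u \<and> (\<forall>x\<in>\<Omega>. 0 \<le> u x) \<and>
     (\<forall>x0\<in>\<Omega>. \<forall>\<phi>. C_on 2 \<Omega> \<phi> \<and> u x0 = \<phi> x0 \<and> (\<forall>x\<in>\<Omega>. x \<noteq> x0 \<longrightarrow> u x < \<phi> x) \<longrightarrow>
        - infinity_laplacian \<phi> x0 \<le> 0 \<or>
        norm (grad \<phi> x0) - lambda_1_inf \<Omega> * rpow (\<phi> x0) l \<le> 0) \<and>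
     (\<forall>x0\<in>\<Omega>. \<forall>\<phi>. C_on 2 \<Omega> \<phi> \<and> u x0 = \<phi> x0 \<and> (\<forall>x\<in>\<Omega>. x \<noteq> x0 \<longrightarrow> u x > \<phi> x) \<longrightarrow>
        - infinity_laplacian \<phi> x0 \<ge> 0 \<and>
        norm (grad \<phi> x0) - lambda_1_inf \<Omega> * rpow (\<phi> x0) l \<ge> 0)"

end

theory Submission
  imports Defs "HOL-Complex_Analysis.Great_Picard" "HOL-Real_Asymp.Real_Asymp"
begin

text \<open>
  The sequence is compact by Morrey's inequality, its limit equation is identified by a comparison
  principle, and the constant in the limit equation is the reciprocal of the inradius \<open>R\<close>.

  Compactness. Testing the equation of an eigenfunction with the function itself gives
  \<open>\<integral>|\<nabla>u|^p = \<Lambda>\<close>, and a mollified cone over the largest ball in \<open>\<Omega>\<close> shows that the upper limit of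
  \<open>\<Lambda>^(1/p)\<close> is at most \<open>1/R\<close> (\<open>Lambda_pq_limsup\<close>). Once \<open>p\<close> exceeds twice the dimension \<open>n\<close>, Morrey's
  inequality for the fixed exponent \<open>2n\<close> therefore bounds the extensions by zero of the eigenfunctions
  in one Hoelder class of exponent 1/2 (\<open>zero_ext_regular\<close>), and Arzela-Ascoli gives a uniform limit
  \<open>v\<close>. The normalisation in \<open>L^q\<close> with \<open>q \<rightarrow> \<infinity>\<close> turns into \<open>max v = 1\<close> (\<open>limit_maximum\<close>).

  The constant. Along a further subsequence \<open>\<Lambda>^(1/p)\<close> converges to some \<open>L \<le> 1/R\<close>. The Hoelder bound is
  too crude to bound \<open>L\<close> from below, but means over balls of a fixed radius are not: by Hoelder's
  inequality the mean of an eigenfunction over a ball of volume \<open>m\<close> is Lipschitz in the centre with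
  constant \<open>m^(-1/p) \<Lambda>^(1/p)\<close>, and this tends to \<open>L\<close> whatever the radius. Thus \<open>v\<close> is \<open>L\<close>-Lipschitz
  (\<open>limit_lipschitz\<close>). It is zero outside \<open>\<Omega>\<close> and takes the value 1 at a point that is at distance
  at most \<open>R\<close> from the complement, so \<open>L \<ge> 1/R\<close>. The same means, applied to functions in
  \<open>W^(1,1)_0\<close> with bounded gradient, show that \<open>1/R\<close> is the first eigenvalue \<open>\<lambda>_(1,\<infinity>)\<close>
  (\<open>W11_sup_bound\<close>, \<open>lambda_1_inf_eq\<close>); the smoothness of the boundary enters there, through
  exterior points near every boundary point (\<open>smooth_boundary_exterior\<close>).

  The limit equation. The heart of the matter is a comparison principle between a weak solution \<open>u\<close>
  of \<open>-\<Delta>_p u = h\<close> and a function \<open>b\<close> of class \<open>C^2\<close> with \<open>-\<Delta>_p b < h\<close> (\<open>weak_comparison\<close>). It is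
  proved with the test function \<open>((b - u)^+)^2\<close>; since \<open>u\<close> is a uniform limit of smooth functions
  whose gradients converge in \<open>L^p\<close>, only \<open>C^1\<close> test functions and classical integration by parts are
  needed. If now \<open>\<phi>\<close> touches \<open>v\<close> from below at \<open>x0\<close>, then \<open>\<phi>\<close> plus a small constant lies below \<open>v\<close> on
  a small sphere about \<open>x0\<close> and above it at \<open>x0\<close>. By comparison, \<open>\<phi>\<close> cannot be a strict
  subsolution near \<open>x0\<close> for all large \<open>p\<close>. But
  \<open>\<Delta>_p \<phi> = |\<nabla>\<phi>|^(p-4) (|\<nabla>\<phi>|^2 \<Delta>\<phi> + (p-2) \<Delta>_\<infinity> \<phi>)\<close> is positive for large \<open>p\<close> where
  \<open>\<Delta>_\<infinity> \<phi> > 0\<close>, whereas the right-hand side \<open>(\<Lambda>^(1/p) u^((q-1)/p))^p\<close> is nonnegative and behaves like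
  \<open>(L v^l)^p\<close>, so that it dominates \<open>\<Delta>_p \<phi>\<close> where \<open>|\<nabla>\<phi>| < L v^l\<close>. Both alternatives are
  thus excluded (\<open>supersolution_inf_laplace\<close>, \<open>supersolution_gradient\<close>). Touching from
  above is symmetric (\<open>subsolution\<close>): \<open>\<Delta>_\<infinity> \<phi> < 0\<close> and \<open>|\<nabla>\<phi>| > L v^l\<close> together make \<open>-\<Delta>_p \<phi>\<close>,
  which is at least \<open>|\<nabla>\<phi>|^(p-4)\<close> for large \<open>p\<close>, exceed the right-hand side. The asymptotics of the right-hand
  side from below use that \<open>v\<close> is positive in \<open>\<Omega>\<close>; this follows by comparison with the barriers
  \<open>exp (- \<alpha> |x - y|^2)\<close> and connectedness (\<open>positivity_spreads\<close>, \<open>v_positive\<close>).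
\<close>

section \<open>Gradients and functions of class \<open>C^k\<close>\<close>

lemma GDERIV_grad:
  assumes "f differentiable (at x)"
  shows "GDERIV f x :> grad f x"
proof -
  let ?D = "frechet_derivative f (at x)"
  have D: "(f has_derivative ?D) (at x)" using assms frechet_derivative_works by blast
  then have lin: "linear ?D" by (rule has_derivative_linear)
  have "?D h = h \<bullet> grad f x" for h
  proof -
    have "?D h = ?D (\<Sum>i\<in>Basis. (h\<bullet>i) *\<^sub>R i)" by (simp add: euclidean_representation)
    also have "... = (\<Sum>i\<in>Basis. (h\<bullet>i) * ?D i)" using lin by (simp add: linear_sum linear_scale)
    also have "... = h \<bullet> grad f x"
      by (simp add: grad_def partial_deriv_def inner_sum_right mult.commute)
    finally show ?thesis .
  qed
  then have "?D = (\<lambda>h. h \<bullet> grad f x)" by auto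
  with D show ?thesis unfolding gderiv_def by simp
qed

lemma GDERIV_unique:
  assumes "GDERIV f x :> g" "GDERIV f x :> g'"
  shows "g = g'"
proof -
  have "(\<lambda>h. h \<bullet> g) = (\<lambda>h. h \<bullet> g')"
    using assms has_derivative_unique unfolding gderiv_def by blast
  then have "h \<bullet> (g - g') = 0" for h by (metis inner_diff_right right_minus_eq)
  then show ?thesis by (metis inner_eq_zero_iff right_minus_eq)
qed

lemma GDERIV_differentiable: "GDERIV f x :> g \<Longrightarrow> f differentiable (at x)"
  unfolding gderiv_def differentiable_def by blast

lemma grad_eqI: "GDERIV f x :> g \<Longrightarrow> grad f x = g"
  using GDERIV_unique GDERIV_grad GDERIV_differentiable by blast

lemma grad_inner_Basis: "i \<in> Basis \<Longrightarrow> grad f x \<bullet> i = partial_deriv i f x"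
  unfolding grad_def by (simp add: inner_sum_left inner_Basis if_distrib cong: if_cong)

lemma partial_deriv_eqI: "i \<in> Basis \<Longrightarrow> GDERIV f x :> g \<Longrightarrow> partial_deriv i f x = g \<bullet> i"
  using grad_inner_Basis grad_eqI by metis

lemma GDERIV_continuous: "GDERIV f x :> g \<Longrightarrow> isCont f x"
  unfolding gderiv_def by (rule has_derivative_continuous)

lemma GDERIV_continuous_on:
  assumes "\<And>x. GDERIV f x :> g x"
  shows "continuous_on UNIV f"
  using GDERIV_continuous[OF assms] by (intro continuous_at_imp_continuous_on ballI)

lemma continuous_on_vectorI:
  fixes g :: "'b::t2_space \<Rightarrow> 'a::euclidean_space"
  assumes "\<And>i. i \<in> Basis \<Longrightarrow> continuous_on S (\<lambda>x. g x \<bullet> i)"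
  shows "continuous_on S g"
  by (rule iffD2[OF continuous_on_componentwise]) (use assms in blast)

lemma C_on_Suc_continuous_grad:
  assumes "C_on (Suc 0) S f"
  shows "\<And>x. x \<in> S \<Longrightarrow> GDERIV f x :> grad f x" "continuous_on S (grad f)"
  proof -
  show "GDERIV f x :> grad f x" if "x \<in> S" for x
    using assms that GDERIV_grad unfolding C_on.simps(2) by blast
  show "continuous_on S (grad f)"
    by (rule continuous_on_vectorI) (use assms in \<open>simp add: grad_inner_Basis\<close>)
qed

lemma C_on_SucD: "C_on (Suc k) S f \<Longrightarrow> C_on k S f"
proof (induction k arbitrary: f)
  case 0
  then show ?case
    using differentiable_at_imp_differentiable_on[of S f] differentiable_imp_continuous_on[of f S] by simp
next
  case (Suc k)
  have "\<forall>x\<in>S. f differentiable (at x)" "\<forall>i\<in>Basis. C_on (Suc k) S (partial_deriv i f)"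
    using Suc.prems unfolding C_on.simps(2)[of "Suc k"] by blast+
  then show ?case unfolding C_on.simps(2)[of k S f] using Suc.IH by blast
qed

lemma smooth_on_D:
  assumes "smooth_on S f"
  shows "\<And>x. x \<in> S \<Longrightarrow> GDERIV f x :> grad f x" "continuous_on S (grad f)" "continuous_on S f"
    and "\<And>i. i \<in> Basis \<Longrightarrow> smooth_on S (partial_deriv i f)"
proof -
  have "C_on (Suc 0) S f" "C_on 0 S f" using assms unfolding smooth_on_def by blast+
  then show "\<And>x. x \<in> S \<Longrightarrow> GDERIV f x :> grad f x" "continuous_on S (grad f)" "continuous_on S f"
    using C_on_Suc_continuous_grad[of S f] by simp_all
  show "smooth_on S (partial_deriv i f)" if "i \<in> Basis" for i
    using assms that unfolding smooth_on_def using C_on.simps(2) by blast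
qed

lemma C_on_SucI:
  assumes "\<And>x. GDERIV f x :> g x" "\<And>i. i \<in> Basis \<Longrightarrow> C_on k UNIV (\<lambda>x. g x \<bullet> i)"
  shows "C_on (Suc k) UNIV f"
proof -
  have "partial_deriv i f = (\<lambda>x. g x \<bullet> i)" if "i \<in> Basis" for i
    using partial_deriv_eqI[OF that assms(1)] by (rule ext)
  then show ?thesis unfolding C_on.simps(2) using assms(2) GDERIV_differentiable[OF assms(1)] by simp
qed

lemma C_on_SucE:
  assumes "C_on (Suc k) UNIV f"
  shows "\<And>x. GDERIV f x :> grad f x" "\<And>i. i \<in> Basis \<Longrightarrow> C_on k UNIV (\<lambda>x. grad f x \<bullet> i)"
proof -
  show "\<And>x. GDERIV f x :> grad f x" using assms GDERIV_grad unfolding C_on.simps(2) by blast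
  fix i :: 'a assume i: "i \<in> Basis"
  have "(\<lambda>x. grad f x \<bullet> i) = partial_deriv i f" using grad_inner_Basis[OF i] by (rule ext)
  then show "C_on k UNIV (\<lambda>x. grad f x \<bullet> i)" using assms i unfolding C_on.simps(2) by simp
qed

lemma C_on_const: "C_on k UNIV (\<lambda>x. c)"
proof (induction k arbitrary: c)
  case (Suc k)
  show ?case using Suc.IH by (intro C_on_SucI[OF GDERIV_const]) simp
qed simp

lemma C_on_add: "C_on k UNIV f \<Longrightarrow> C_on k UNIV g \<Longrightarrow> C_on k UNIV (\<lambda>x. f x + g x)"
proof (induction k arbitrary: f g)
  case 0 then show ?case by (auto intro: continuous_intros)
next
  case (Suc k)
  show ?case
    using Suc.IH C_on_SucE(2)[OF Suc.prems(1)] C_on_SucE(2)[OF Suc.prems(2)]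
    by (intro C_on_SucI[OF GDERIV_add[OF C_on_SucE(1)[OF Suc.prems(1)] C_on_SucE(1)[OF Suc.prems(2)]]])
       (simp add: inner_add_left)
qed

lemma C_on_mult: "C_on k UNIV f \<Longrightarrow> C_on k UNIV g \<Longrightarrow> C_on k UNIV (\<lambda>x. f x * g x)"
proof (induction k arbitrary: f g)
  case 0 then show ?case by (auto intro: continuous_intros)
next
  case (Suc k)
  have "C_on k UNIV f" "C_on k UNIV g" using Suc.prems C_on_SucD by blast+
  then show ?case
    using Suc.IH C_on_SucE(2)[OF Suc.prems(1)] C_on_SucE(2)[OF Suc.prems(2)]
    by (intro C_on_SucI[OF GDERIV_mult[OF C_on_SucE(1)[OF Suc.prems(1)] C_on_SucE(1)[OF Suc.prems(2)]]])
       (simp add: inner_add_left C_on_add)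
qed

lemma GDERIV_inner_const: "GDERIV (\<lambda>x. x \<bullet> i) x :> i"
  unfolding gderiv_def by (auto intro!: derivative_eq_intros)

lemma C_on_inner: "C_on k UNIV (\<lambda>x. x \<bullet> i)"
proof (cases k)
  case 0 then show ?thesis by (auto intro: continuous_intros)
next
  case (Suc m)
  show ?thesis unfolding Suc by (rule C_on_SucI[OF GDERIV_inner_const]) (rule C_on_const)
qed

section \<open>A smooth bump function\<close>

text \<open>The functions \<open>t^(-k) exp (-1/t)\<close>, continued by zero to \<open>t \<le> 0\<close>. Differentiation does not leave the
  linear span of the family, so the smoothness of \<open>flat k\<close> composed with \<open>c - |x|^2\<close> follows by
  induction for all \<open>k\<close> at once.\<close>

definition flat :: "nat \<Rightarrow> real \<Rightarrow> real" where
  "flat k t = (if t \<le> 0 then 0 else inverse t ^ k * exp (- inverse t))"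

lemma DERIV_flat: "DERIV (flat k) t :> flat (k + 2) t - real k * flat (k + 1) t"
proof (cases "t = 0")
  case False
  consider "t < 0" | "t > 0" using False by linarith
  then show ?thesis
  proof cases
    case 1
    have "DERIV (\<lambda>_. 0::real) t :> 0" by simp
    then have "DERIV (flat k) t :> 0"
      by (rule has_field_derivative_transform_within_open[of _ _ _ "{..<0}"])
         (use 1 in \<open>auto simp: flat_def\<close>)
    then show ?thesis using 1 by (simp add: flat_def)
  next
    case 2
    have eq: "exp (- (real k * ln s) - inverse s) = inverse s ^ k * exp (- inverse s)" if "s > 0" for s :: real
      using that by (simp add: exp_diff exp_minus exp_of_nat_mult power_inverse divide_inverse)
    have "DERIV (\<lambda>t. exp (- (real k * ln t) - inverse t)) t :>
        exp (- (real k * ln t) - inverse t) * (inverse t * inverse t - real k * inverse t)"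
      using 2 by (auto intro!: derivative_eq_intros simp: field_simps)
    moreover have "exp (- (real k * ln t) - inverse t) * (inverse t * inverse t - real k * inverse t) =
        flat (k + 2) t - real k * flat (k + 1) t"
      using 2 unfolding eq[OF 2] by (simp add: flat_def algebra_simps)
    ultimately have "DERIV (\<lambda>t. exp (- (real k * ln t) - inverse t)) t :>
        flat (k + 2) t - real k * flat (k + 1) t" by simp
    then show ?thesis
      by (rule has_field_derivative_transform_within_open[of _ _ _ "{0<..}"])
         (use 2 eq in \<open>auto simp: flat_def\<close>)
  qed
next
  \<comment> \<open>At \<open>t = 0\<close> the exponential beats every power of \<open>1/t\<close>.\<close>
  case True
  have r: "((\<lambda>h. flat k h / h) \<longlongrightarrow> 0) (at_right 0)"
  proof -
    have "((\<lambda>h. (\<lambda>x. x ^ Suc k / exp x) (inverse h)) \<longlongrightarrow> (0::real)) (at_right 0)"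
      by (rule filterlim_compose[OF tendsto_power_div_exp_0 filterlim_inverse_at_top_right])
    moreover have "eventually (\<lambda>h. (\<lambda>x. x ^ Suc k / exp x) (inverse h) = flat k h / h) (at_right (0::real))"
      using eventually_at_right_less[of 0]
      by eventually_elim (simp add: flat_def exp_minus field_simps)
    ultimately show ?thesis using filterlim_cong[OF refl refl] by fastforce
  qed
  have l: "((\<lambda>h. flat k h / h) \<longlongrightarrow> 0) (at_left 0)"
  proof (rule tendsto_eventually)
    show "eventually (\<lambda>h. flat k h / h = 0) (at_left (0::real))"
      by (auto simp: eventually_at_filter flat_def)
  qed
  have "((\<lambda>h. flat k h / h) \<longlongrightarrow> 0) (at 0)" using filterlim_split_at[OF l r] .
  then have "DERIV (flat k) 0 :> 0" by (simp add: DERIV_def flat_def)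
  then show ?thesis using True by (simp add: flat_def)
qed

lemma GDERIV_norm_sq: "GDERIV (\<lambda>x. c - x \<bullet> x) x :> - (2 *\<^sub>R x)"
  unfolding gderiv_def by (auto intro!: derivative_eq_intros simp: inner_commute)

lemma C_on_flat: "C_on m UNIV (\<lambda>x::'a::euclidean_space. flat k (c - x \<bullet> x))"
proof (induction m arbitrary: k)
  case 0
  have "isCont (\<lambda>x::'a. flat k (c - x \<bullet> x)) x" for x
    by (rule GDERIV_continuous[OF GDERIV_DERIV_compose[OF GDERIV_norm_sq DERIV_flat]])
  then show ?case by (simp add: continuous_on_eq_continuous_at)
next
  case (Suc m)
  show ?case
  proof (rule C_on_SucI[OF GDERIV_DERIV_compose[OF GDERIV_norm_sq DERIV_flat]])
    fix i :: 'a assume "i \<in> Basis"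
    have "C_on m UNIV (\<lambda>x::'a. (flat (k + 2) (c - x \<bullet> x) + (- real k) * flat (k + 1) (c - x \<bullet> x))
       * ((-2) * (x \<bullet> i)))"
      by (intro C_on_mult C_on_add C_on_const C_on_inner Suc)
    then show "C_on m UNIV (\<lambda>x::'a. (flat (k + 2) (c - x \<bullet> x) - real k * flat (k + 1) (c - x \<bullet> x))
       *\<^sub>R (- (2 *\<^sub>R x)) \<bullet> i)"
      by (simp add: algebra_simps)
  qed
qed

lemma continuous_supp_integrable:
  fixes f :: "'a::euclidean_space \<Rightarrow> 'b::euclidean_space"
  assumes "continuous_on UNIV f" "compact K" "\<And>x. x \<notin> K \<Longrightarrow> f x = 0"
  shows "integrable lborel f"
proof -
  have "integrable lborel (\<lambda>x. indicator K x *\<^sub>R f x)"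
    using assms by (intro borel_integrable_compact) (auto intro: continuous_on_subset)
  also have "(\<lambda>x. indicator K x *\<^sub>R f x) = f" using assms(3) by (auto simp: indicator_def)
  finally show ?thesis .
qed

text \<open>The bump \<open>flat 0 (e^2 - |x|^2)\<close>, divided by its integral.\<close>

lemma mollifier_exists:
  fixes e :: real assumes "e > 0"
  obtains \<eta> :: "'a::euclidean_space \<Rightarrow> real"
  where "smooth_on UNIV \<eta>" "\<And>x. 0 \<le> \<eta> x" "\<And>x. norm x \<ge> e \<Longrightarrow> \<eta> x = 0"
    "integral\<^sup>L lborel \<eta> = 1"
proof -
  define b where "b = (\<lambda>x::'a. flat 0 (e\<^sup>2 - x \<bullet> x))"
  have sm: "C_on m UNIV b" for m unfolding b_def by (rule C_on_flat)
  have cont: "continuous_on UNIV b" using sm[of 0] by simp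
  have nn: "0 \<le> b x" for x by (simp add: b_def flat_def)
  have z: "b x = 0" if "norm x \<ge> e" for x
  proof -
    have "e\<^sup>2 \<le> (norm x)\<^sup>2" using that assms by (intro power_mono) auto
    then show ?thesis by (simp add: b_def flat_def power2_norm_eq_inner)
  qed
  have int: "integrable lborel b"
    by (rule continuous_supp_integrable[OF cont, of "cball 0 e"]) (auto intro: z)
  have "integral\<^sup>L lborel b > 0"
  proof (rule ccontr)
    assume "\<not> ?thesis"
    moreover have "integral\<^sup>L lborel b \<ge> 0"
      by (rule Bochner_Integration.integral_nonneg) (rule nn)
    ultimately have "integral\<^sup>L lborel b = 0" by simp
    then have "AE x in lborel. b x = 0"
      using integral_nonneg_eq_0_iff_AE[OF int] nn by auto
    then have "AE x in lborel. x \<notin> ball (0::'a) e"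
    proof (eventually_elim)
      case (elim x)
      then show ?case
        using assms by (auto simp: b_def flat_def dot_square_norm power2_le_iff_abs_le split: if_splits)
    qed
    then have "emeasure lborel (ball (0::'a) e) = 0"
      by (subst (asm) AE_iff_measurable[of "ball (0::'a) e"]) auto
    then have "measure lborel (ball (0::'a) e) = 0" by (simp add: measure_def)
    moreover have "measure lborel (ball (0::'a) e) > 0" using content_ball_pos[OF assms] .
    ultimately show False by simp
  qed
  note pos = this
  show ?thesis
  proof (rule that[of "\<lambda>x. b x * (1 / integral\<^sup>L lborel b)"])
    show "smooth_on UNIV (\<lambda>x. b x * (1 / integral\<^sup>L lborel b))"
      unfolding smooth_on_def using sm by (intro allI C_on_mult C_on_const)
  qed (use nn z pos in auto)
qed

section \<open>Mollification\<close>

lemma lborel_integral_affine: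
  fixes f :: "'a::euclidean_space \<Rightarrow> 'b::euclidean_space"
  assumes "f \<in> borel_measurable borel" "c \<noteq> 0"
  shows "integral\<^sup>L lborel f = (\<bar>c\<bar> ^ DIM('a)) *\<^sub>R (\<integral>x. f (t + c *\<^sub>R x) \<partial>lborel)"
proof -
  have [measurable]: "f \<in> borel_measurable borel" by fact
  show ?thesis
    by (subst lborel_affine[OF assms(2), of t])
       (simp add: integral_density integral_distr)
qed

text \<open>The factor \<open>f\<close> is supported in one box, so the convolution is an integral over a box and may be
  differentiated under the integral sign.\<close>

lemma conv_GDERIV:
  fixes f \<psi> :: "'a::euclidean_space \<Rightarrow> real"
  assumes f: "continuous_on UNIV f" "compact K" "\<And>x. x \<notin> K \<Longrightarrow> f x = 0"
    and \<psi>: "\<And>x. GDERIV \<psi> x :> \<Psi> x" "continuous_on UNIV \<Psi>"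
  shows "GDERIV (\<lambda>x. \<integral>y. f y * \<psi> (x - y) \<partial>lborel) x :> (\<integral>y. f y *\<^sub>R \<Psi> (x - y) \<partial>lborel)"
proof -
  obtain a b where ab: "K \<subseteq> cbox a b"
    by (rule bounded_subset_cbox_symmetric[OF compact_imp_bounded[OF f(2)]])
  have c\<psi>: "continuous_on UNIV \<psi>"
    by (rule GDERIV_continuous_on[OF \<psi>(1)])
  have lb: "integral\<^sup>L lborel h = integral (cbox a b) h"
    if "continuous_on UNIV h" "\<And>y. y \<notin> K \<Longrightarrow> h y = 0"
    for h :: "'a \<Rightarrow> 'c::euclidean_space"
  proof -
    have "integral\<^sup>L lborel h = integral UNIV h"
      by (rule integral_lborel[symmetric, OF continuous_supp_integrable[OF that(1) f(2) that(2)]])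
    moreover have "(\<lambda>x. if x \<in> cbox a b then h x else 0) = h"
      using ab that(2) by (intro ext) (metis subsetD)
    ultimately show ?thesis using integral_restrict_UNIV[of "cbox a b" h] by simp
  qed
  have e1: "(\<lambda>x. \<integral>y. f y * \<psi> (x - y) \<partial>lborel) = (\<lambda>x. integral (cbox a b) (\<lambda>y. f y * \<psi> (x - y)))"
    by (intro ext lb continuous_intros f continuous_on_compose2[OF c\<psi>]) (auto simp: f)
  have cF: "continuous_on UNIV (\<lambda>y. f y *\<^sub>R \<Psi> (x - y))"
    by (intro continuous_intros f continuous_on_compose2[OF \<psi>(2)]) auto
  have e2: "(\<integral>y. f y *\<^sub>R \<Psi> (x - y) \<partial>lborel) = integral (cbox a b) (\<lambda>y. f y *\<^sub>R \<Psi> (x - y))"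
    by (intro lb cF) (auto simp: f)
  let ?F = "\<lambda>x t. f t *\<^sub>R blinfun_inner_left (\<Psi> (x - t))"
  have "((\<lambda>x. integral (cbox a b) (\<lambda>y. f y * \<psi> (x - y))) has_derivative
     blinfun_apply (integral (cbox a b) (?F x))) (at x within UNIV)"
  proof (rule leibniz_rule)
    fix x t
    have "((\<lambda>x. \<psi> (x - t)) has_derivative (\<lambda>h. h \<bullet> \<Psi> (x - t))) (at x within UNIV)"
      using \<psi>(1)[of "x - t"] unfolding gderiv_def
      by (rule has_derivative_compose[rotated]) (auto intro!: derivative_eq_intros)
    then show "((\<lambda>x. f t * \<psi> (x - t)) has_derivative blinfun_apply (?F x t)) (at x within UNIV)"
      by (auto intro!: derivative_eq_intros simp: blinfun.scaleR_left)
  next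
    fix x
    show "(\<lambda>y. f y * \<psi> (x - y)) integrable_on cbox a b"
      by (intro integrable_continuous continuous_intros continuous_on_subset[OF f(1)]
          continuous_on_compose2[OF c\<psi>]) auto
  next
    show "continuous_on (UNIV \<times> cbox a b) (\<lambda>(x, t). ?F x t)"
      unfolding split_def
      by (intro continuous_intros continuous_on_compose2[OF f(1)]
          bounded_linear.continuous_on[OF bounded_linear_blinfun_inner_left]
          continuous_on_compose2[OF \<psi>(2)]) auto
  qed auto
  moreover have "blinfun_apply (integral (cbox a b) (?F x)) h =
     h \<bullet> integral (cbox a b) (\<lambda>y. f y *\<^sub>R \<Psi> (x - y))" for h
  proof -
    have i1: "?F x integrable_on cbox a b"
      by (intro integrable_continuous continuous_intros continuous_on_subset[OF f(1)]
          bounded_linear.continuous_on[OF bounded_linear_blinfun_inner_left]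
          continuous_on_compose2[OF \<psi>(2)]) auto
    have i2: "(\<lambda>y. f y *\<^sub>R \<Psi> (x - y)) integrable_on cbox a b"
      by (intro integrable_continuous continuous_on_subset[OF cF]) auto
    have "blinfun_apply (integral (cbox a b) (?F x)) h = integral (cbox a b) (\<lambda>t. blinfun_apply (?F x t) h)"
      using integral_linear[OF i1 blinfun.bounded_linear_left[of h]] by (simp add: o_def)
    also have "... = integral (cbox a b) (\<lambda>t. h \<bullet> (f t *\<^sub>R \<Psi> (x - t)))"
      by (simp add: blinfun.scaleR_left)
    also have "... = h \<bullet> integral (cbox a b) (\<lambda>y. f y *\<^sub>R \<Psi> (x - y))"
      using integral_linear[OF i2 bounded_linear_inner_right[of h]] by (simp add: o_def)
    finally show ?thesis .
  qed
  ultimately show ?thesis unfolding gderiv_def e1 e2 by (metis (no_types, lifting) ext)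
qed

text \<open>Every partial derivative of the convolution is the convolution with a partial derivative of
  the smooth factor, so the induction runs over the order of differentiation with \<open>\<psi>\<close> arbitrary.\<close>

lemma conv_smooth:
  assumes f: "continuous_on UNIV f" "compact K" "\<And>x. x \<notin> K \<Longrightarrow> f x = 0"
    and \<psi>: "smooth_on UNIV \<psi>"
  shows "smooth_on UNIV (\<lambda>x. \<integral>y. f y * \<psi> (x - y) \<partial>lborel)"
proof -
  have "C_on k UNIV (\<lambda>x. \<integral>y. f y * \<psi> (x - y) \<partial>lborel)" for k
    using \<psi>
  proof (induction k arbitrary: \<psi>)
    case 0
    have "isCont (\<lambda>x. \<integral>y. f y * \<psi> (x - y) \<partial>lborel) x" for x
      by (rule GDERIV_continuous[OF conv_GDERIV[OF f smooth_on_D(1,2)[OF 0]]]) auto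
    then show ?case by (simp add: continuous_on_eq_continuous_at)
  next
    case (Suc k)
    show ?case
    proof (rule C_on_SucI[OF conv_GDERIV[OF f smooth_on_D(1,2)[OF Suc.prems]]])
      fix i :: 'a assume i: "i \<in> Basis"
      have "(\<integral>y. f y *\<^sub>R grad \<psi> (x - y) \<partial>lborel) \<bullet> i = (\<integral>y. f y * partial_deriv i \<psi> (x - y) \<partial>lborel)" for x
      proof -
        have "integrable lborel (\<lambda>y. f y *\<^sub>R grad \<psi> (x - y))"
          by (rule continuous_supp_integrable[OF _ f(2)])
             (auto simp: f intro!: continuous_intros f continuous_on_compose2[OF smooth_on_D(2)[OF Suc.prems]])
        then have "(\<integral>y. (f y *\<^sub>R grad \<psi> (x - y)) \<bullet> i \<partial>lborel) = (\<integral>y. f y *\<^sub>R grad \<psi> (x - y) \<partial>lborel) \<bullet> i"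
          by (intro integral_inner_left)
        then show ?thesis by (simp add: grad_inner_Basis[OF i])
      qed
      then show "C_on k UNIV (\<lambda>x. (\<integral>y. f y *\<^sub>R grad \<psi> (x - y) \<partial>lborel) \<bullet> i)"
        using Suc.IH[OF smooth_on_D(4)[OF Suc.prems i]] by simp
    qed auto
  qed
  then show ?thesis by (simp add: smooth_on_def)
qed

lemma conv_commute:
  fixes f g :: "'a::euclidean_space \<Rightarrow> real"
  assumes [measurable]: "f \<in> borel_measurable borel" "g \<in> borel_measurable borel"
  shows "(\<integral>y. f y * g (x - y) \<partial>lborel) = (\<integral>y. g y * f (x - y) \<partial>lborel)"
  by (subst lborel_integral_affine[of _ "-1" x]) (auto simp: mult.commute)

lemma mollify_close:
  fixes F :: "'a::euclidean_space \<Rightarrow> 'b::euclidean_space"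
  assumes \<eta>: "continuous_on UNIV \<eta>" "\<And>x. 0 \<le> \<eta> x" "\<And>x. norm x \<ge> e \<Longrightarrow> \<eta> x = 0"
    "integral\<^sup>L lborel \<eta> = 1"
    and F: "continuous_on UNIV F"
    and d: "\<And>y. norm y \<le> e \<Longrightarrow> norm (F (x - y) - F x) \<le> d"
  shows "norm ((\<integral>y. \<eta> y *\<^sub>R F (x - y) \<partial>lborel) - F x) \<le> d"
proof -
  have i0: "integrable lborel \<eta>"
    by (rule continuous_supp_integrable[OF \<eta>(1), of "cball 0 e"]) (auto simp: \<eta>)
  have i1: "integrable lborel (\<lambda>y. \<eta> y *\<^sub>R F (x - y))"
    by (rule continuous_supp_integrable[of _ "cball 0 e"])
       (auto simp: \<eta> intro!: continuous_intros \<eta> continuous_on_compose2[OF F])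
  have "(\<integral>y. \<eta> y *\<^sub>R F (x - y) \<partial>lborel) - F x = (\<integral>y. \<eta> y *\<^sub>R F (x - y) - \<eta> y *\<^sub>R F x \<partial>lborel)"
    using i0 i1 \<eta>(4) by (subst Bochner_Integration.integral_diff) auto
  also have "norm ... \<le> (\<integral>y. \<eta> y * d \<partial>lborel)"
  proof (rule Bochner_Integration.integral_norm_bound_integral)
    show "norm (\<eta> y *\<^sub>R F (x - y) - \<eta> y *\<^sub>R F x) \<le> \<eta> y * d" for y
      using d[of y] \<eta>(2)[of y] \<eta>(3)[of y]
      by (cases "norm y \<le> e") (auto simp flip: scaleR_diff_right intro: mult_left_mono)
  qed (use i0 i1 in auto)
  also have "... = d" using \<eta>(4) by simp
  finally show ?thesis .
qed

lemma test_functionI: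
  assumes "smooth_on UNIV \<phi>" "compact K" "K \<subseteq> \<Omega>" "\<And>x. x \<notin> K \<Longrightarrow> \<phi> x = 0"
  shows "test_function \<Omega> \<phi>"
proof -
  have "closure {x. \<phi> x \<noteq> 0} \<subseteq> K"
    using assms(2,4) by (intro closure_minimal) (auto simp: compact_imp_closed)
  moreover from this have "compact (closure {x. \<phi> x \<noteq> 0})"
    using compact_Int_closed[OF assms(2) closed_closure[of "{x. \<phi> x \<noteq> 0}"]] by (simp only: Int_absorb1)
  ultimately show ?thesis unfolding test_function_def using assms(1,3) by blast
qed

lemma mollify_test_function:
  assumes \<psi>: "continuous_on UNIV \<psi>" "compact K" "\<And>x. x \<notin> K \<Longrightarrow> \<psi> x = 0"
    and sub: "(\<Union>x\<in>K. cball x e) \<subseteq> \<Omega>"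
    and \<eta>: "smooth_on UNIV \<eta>" "\<And>x. norm x \<ge> e \<Longrightarrow> \<eta> x = 0"
  shows "test_function \<Omega> (\<lambda>x. \<integral>y. \<psi> y * \<eta> (x - y) \<partial>lborel)"
proof (rule test_functionI[OF conv_smooth[OF \<psi> \<eta>(1)]])
  show "compact ((\<lambda>(x, y). x + y) ` (K \<times> cball 0 e))"
    by (intro compact_continuous_image compact_Times \<psi>) (auto intro!: continuous_intros simp: split_def)
  show "(\<lambda>(x, y). x + y) ` (K \<times> cball 0 e) \<subseteq> \<Omega>"
    using sub by (force simp: dist_norm)
  fix x assume x: "x \<notin> (\<lambda>(x, y). x + y) ` (K \<times> cball 0 e)"
  have "\<psi> y * \<eta> (x - y) = 0" for y
  proof (cases "y \<in> K")
    case True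
    have "\<not> norm (x - y) \<le> e"
    proof
      assume "norm (x - y) \<le> e"
      then have "(y, x - y) \<in> K \<times> cball 0 e" using True by simp
      then have "(\<lambda>(x, y). x + y) (y, x - y) \<in> (\<lambda>(x, y). x + y) ` (K \<times> cball 0 e)" by (rule imageI)
      then show False using x by simp
    qed
    then show ?thesis using \<eta>(2) by simp
  qed (use \<psi> in simp)
  then have "(\<lambda>y. \<psi> y * \<eta> (x - y)) = (\<lambda>y. 0)" by (rule ext)
  then show "(\<integral>y. \<psi> y * \<eta> (x - y) \<partial>lborel) = 0" by (simp only: Bochner_Integration.integral_zero)
qed

lemma GDERIV_zero_outside:
  fixes f :: "'a::euclidean_space \<Rightarrow> real"
  assumes "GDERIV f x :> g" "closed K" "\<And>x. x \<notin> K \<Longrightarrow> f x = 0" "x \<notin> K"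
  shows "g = 0"
proof -
  have o: "open (- K)" using assms(2) by (simp add: open_Compl)
  have "(f has_derivative (\<lambda>h. h \<bullet> 0)) (at x)"
    by (rule has_derivative_transform_within_open[OF GDERIV_const[of 0 x, unfolded gderiv_def] o])
       (simp_all add: assms(3,4))
  then have "GDERIV f x :> 0" unfolding gderiv_def .
  from GDERIV_unique[OF assms(1) this] show ?thesis .
qed

text \<open>Mollification at a scale below the moduli of continuity of \<open>\<psi>\<close> and \<open>\<Psi>\<close> and below the distance of
  \<open>K\<close> to the complement of \<open>\<Omega>\<close>; the gradient of the mollification is the mollification of \<open>\<Psi>\<close>. This
  is what allows test functions of class \<open>C^1\<close> in weak equations.\<close>

lemma C1_approx:
  fixes \<psi> :: "'a::euclidean_space \<Rightarrow> real"
  assumes "open \<Omega>" "compact K" "K \<subseteq> \<Omega>" "\<And>x. x \<notin> K \<Longrightarrow> \<psi> x = 0"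
    and \<psi>: "\<And>x. GDERIV \<psi> x :> \<Psi> x" "continuous_on UNIV \<Psi>" and "e > 0"
  obtains \<theta> where "test_function \<Omega> \<theta>" "\<And>x. \<bar>\<theta> x - \<psi> x\<bar> \<le> e" "\<And>x. norm (grad \<theta> x - \<Psi> x) \<le> e"
proof -
  have c\<psi>: "continuous_on UNIV \<psi>"
    by (rule GDERIV_continuous_on[OF \<psi>(1)])
  have z: "\<Psi> x = 0" if "x \<notin> K" for x
    by (rule GDERIV_zero_outside[OF \<psi>(1) compact_imp_closed[OF assms(2)] assms(4) that])
  \<comment> \<open>Both \<open>\<psi>\<close> and \<open>\<Psi>\<close> are uniformly continuous: off a
    neighbourhood of \<open>K\<close> they vanish.\<close>
  have uc: "\<exists>d>0. \<forall>x y. norm y \<le> d \<longrightarrow> norm (F (x - y) - F x) \<le> e"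
    if "continuous_on UNIV F" "\<And>x. x \<notin> K \<Longrightarrow> F x = 0" for F :: "'a \<Rightarrow> 'b::euclidean_space"
  proof -
    obtain K' where K': "compact K'" "\<And>x y. x \<in> K \<Longrightarrow> norm y \<le> 1 \<Longrightarrow> x + y \<in> K'" "K \<subseteq> K'"
    proof
      show "compact {x + y |x y. x \<in> K \<and> y \<in> cball (0::'a) 1}" using assms(2) by (intro compact_sums) auto
      show "K \<subseteq> {x + y |x y. x \<in> K \<and> y \<in> cball (0::'a) 1}" by force
    qed auto
    have "uniformly_continuous_on K' F"
      using K'(1) that(1) by (intro compact_uniformly_continuous) (auto intro: continuous_on_subset)
    then obtain d where d: "d > 0" "\<And>x y. x \<in> K' \<Longrightarrow> y \<in> K' \<Longrightarrow> dist y x < d \<Longrightarrow> dist (F y) (F x) < e"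
      unfolding uniformly_continuous_on_def using \<open>e > 0\<close> by metis
    have "norm (F (x - y) - F x) \<le> e" if y: "norm y \<le> min (d/2) 1" for x y
    proof (cases "x \<in> K \<or> x - y \<in> K")
      case True
      then have "x \<in> K'" "x - y \<in> K'"
        using K'(2)[of x "-y"] K'(2)[of "x - y" y] K'(3) y by auto
      then show ?thesis using d(2)[of x "x - y"] y d(1) by (auto simp: dist_norm)
    next
      case False then show ?thesis using \<open>\<And>x. x \<notin> K \<Longrightarrow> F x = 0\<close> \<open>e > 0\<close> by simp
    qed
    then show ?thesis using d(1) by (intro exI[of _ "min (d/2) 1"]) auto
  qed
  obtain d1 where d1: "d1 > 0" "\<And>x y. norm y \<le> d1 \<Longrightarrow> norm (\<psi> (x - y) - \<psi> x) \<le> e"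
    using uc[OF c\<psi> assms(4)] by blast
  obtain d2 where d2: "d2 > 0" "\<And>x y. norm y \<le> d2 \<Longrightarrow> norm (\<Psi> (x - y) - \<Psi> x) \<le> e"
    using uc[OF \<psi>(2) z] by blast
  obtain d3 where d3: "d3 > 0" "(\<Union>x\<in>K. cball x d3) \<subseteq> \<Omega>"
    using compact_subset_open_imp_cball_epsilon_subset[OF assms(2,1,3)] by blast
  define d where "d = min d1 (min d2 d3)"
  have "d > 0" using d1 d2 d3 by (simp add: d_def)
  then obtain \<eta> :: "'a \<Rightarrow> real" where \<eta>: "smooth_on UNIV \<eta>" "\<And>x. 0 \<le> \<eta> x" "\<And>x. norm x \<ge> d \<Longrightarrow> \<eta> x = 0"
    "integral\<^sup>L lborel \<eta> = 1" using mollifier_exists by blast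
  note c\<eta> = smooth_on_D(3)[OF \<eta>(1)]
  let ?\<theta> = "\<lambda>x. \<integral>y. \<psi> y * \<eta> (x - y) \<partial>lborel"
  have eq: "(\<integral>y. \<psi> y * \<eta> (x - y) \<partial>lborel) = (\<integral>y. \<eta> y * \<psi> (x - y) \<partial>lborel)" for x
    by (intro conv_commute borel_measurable_continuous_onI c\<eta> c\<psi>)
  show ?thesis
  proof
    show "test_function \<Omega> ?\<theta>"
      by (rule mollify_test_function[OF c\<psi> assms(2,4) _ \<eta>(1,3)])
         (use d3(2) in \<open>auto simp: d_def subset_iff\<close>)
    show "\<bar>?\<theta> x - \<psi> x\<bar> \<le> e" for x
      unfolding eq using mollify_close[OF c\<eta> \<eta>(2,3,4) c\<psi>, of d x e] d1(2) by (simp add: d_def)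
    have "GDERIV ?\<theta> x :> (\<integral>y. \<eta> y *\<^sub>R \<Psi> (x - y) \<partial>lborel)" for x
      unfolding eq by (rule conv_GDERIV[OF c\<eta>, of "cball 0 d"]) (use \<eta> \<psi> in auto)
    from grad_eqI[OF this] show "norm (grad ?\<theta> x - \<Psi> x) \<le> e" for x
      using mollify_close[OF c\<eta> \<eta>(2,3,4) \<psi>(2), of d x e] d2(2) by (simp add: d_def)
  qed
qed

lemma GDERIV_le_lipschitz:
  fixes f :: "'a::euclidean_space \<Rightarrow> real"
  assumes "GDERIV f x :> g" "\<And>y. \<bar>f y - f x\<bar> \<le> L * norm (y - x)"
  shows "norm g \<le> L"
proof (rule ccontr)
  assume "\<not> ?thesis"
  then have g: "norm g > L" by simp
  have "L \<ge> 0" using assms(2)[of "x + (SOME i. i \<in> Basis)"] norm_Basis[of "SOME i::'a. i \<in> Basis"]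
    some_in_eq nonempty_Basis by force
  \<comment> \<open>The difference quotient in the direction of \<open>g\<close> itself tends to
    \<open>|g|^2\<close> and is at most \<open>L |g|\<close>.\<close>
  have "((\<lambda>t. f (x + t *\<^sub>R g)) has_derivative (\<lambda>h. (h *\<^sub>R g) \<bullet> g)) (at 0)"
    using assms(1) unfolding gderiv_def
    by (intro has_derivative_compose[of _ "\<lambda>h. h *\<^sub>R g" _ _ f]) (auto intro!: derivative_eq_intros)
  then have "DERIV (\<lambda>t. f (x + t *\<^sub>R g)) 0 :> g \<bullet> g"
    by (simp add: has_field_derivative_def mult_commute_abs)
  then have "((\<lambda>h. (f (x + h *\<^sub>R g) - f x) / h) \<longlongrightarrow> g \<bullet> g) (at 0)"
    by (simp add: DERIV_def)
  then have "((\<lambda>h. (f (x + h *\<^sub>R g) - f x) / h) \<longlongrightarrow> g \<bullet> g) (at_right 0)"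
    using filterlim_at_split by blast
  moreover have "eventually (\<lambda>h. (f (x + h *\<^sub>R g) - f x) / h \<le> L * norm g) (at_right (0::real))"
    using eventually_at_right_less[of 0]
  proof eventually_elim
    case (elim h)
    then show ?case using assms(2)[of "x + h *\<^sub>R g"] by (simp add: field_simps abs_le_iff)
  qed
  ultimately have "g \<bullet> g \<le> L * norm g"
    using tendsto_upperbound trivial_limit_at_right_real by blast
  then have "norm g * norm g \<le> L * norm g" by (simp add: dot_square_norm power2_eq_square)
  then show False using g \<open>L \<ge> 0\<close> by (simp add: mult_le_cancel_right split: if_splits)
qed

text \<open>The cone \<open>max 0 (r - |x - x0|)\<close> has Lipschitz constant 1 and is highest among such functions
  supported in a ball of radius \<open>r\<close>. Mollification preserves the Lipschitz constant, so a slightly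
  smaller cone, smoothed, is an almost optimal competitor for \<open>\<lambda>_(1,\<infinity>)\<close> and, for large exponents,
  for \<open>\<Lambda>_(p,q)\<close>.\<close>

lemma mollified_cone:
  fixes x0 :: "'a::euclidean_space"
  assumes "R > 0" "ball x0 R \<subseteq> \<Omega>" "d > 0"
  obtains \<theta> where "test_function \<Omega> \<theta>" "\<And>x. norm (grad \<theta> x) \<le> 1" "\<theta> x0 \<ge> R - d"
proof -
  define e where "e = min (d/3) (R/3)"
  have e: "e > 0" "3 * e \<le> d" "3 * e \<le> R" using assms by (auto simp: e_def)
  \<comment> \<open>The mollification loses at most \<open>e\<close> in height and gains \<open>e\<close> in the
    radius of the support, so the radius \<open>R - 2 e\<close> suffices for both.\<close>
  define r where "r = R - 2 * e"
  have r: "r > 0" using e by (simp add: r_def)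
  define c where "c = (\<lambda>x. max 0 (r - norm (x - x0)))"
  have cc: "continuous_on UNIV c" unfolding c_def by (intro continuous_intros)
  have lip: "\<bar>c x - c y\<bar> \<le> norm (x - y)" for x y
  proof -
    have "\<bar>norm (x - x0) - norm (y - x0)\<bar> \<le> norm (x - y)"
      using norm_triangle_ineq3[of "x - x0" "y - x0"] by simp
    then show ?thesis unfolding c_def max_def by (auto split: if_splits)
  qed
  have cz: "c x = 0" if "x \<notin> cball x0 r" for x
    using that by (simp add: c_def dist_norm norm_minus_commute)
  obtain \<eta> :: "'a \<Rightarrow> real" where \<eta>: "smooth_on UNIV \<eta>" "\<And>x. 0 \<le> \<eta> x" "\<And>x. norm x \<ge> e \<Longrightarrow> \<eta> x = 0"
    "integral\<^sup>L lborel \<eta> = 1" using mollifier_exists e(1) by blast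
  note c\<eta> = smooth_on_D(3)[OF \<eta>(1)]
  let ?\<theta> = "\<lambda>x. \<integral>y. c y * \<eta> (x - y) \<partial>lborel"
  have eq: "(\<integral>y. c y * \<eta> (x - y) \<partial>lborel) = (\<integral>y. \<eta> y * c (x - y) \<partial>lborel)" for x
    by (intro conv_commute borel_measurable_continuous_onI c\<eta> cc)
  show ?thesis
  proof
    show t: "test_function \<Omega> ?\<theta>"
    proof (rule mollify_test_function[OF cc _ cz _ \<eta>(1,3)])
      have "cball x e \<subseteq> ball x0 R" if "x \<in> cball x0 r" for x
      proof
        fix y assume "y \<in> cball x e"
        then show "y \<in> ball x0 R" using that e(1) dist_triangle[of x0 y x] by (simp add: r_def)
      qed
      then show "(\<Union>x\<in>cball x0 r. cball x e) \<subseteq> \<Omega>" using assms(2) by blast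
    qed auto
    show "?\<theta> x0 \<ge> R - d"
    proof -
      have "norm (c (x0 - y) - c x0) \<le> e" if "norm y \<le> e" for y using lip[of "x0 - y" x0] that by simp
      then have "norm ((\<integral>y. \<eta> y *\<^sub>R c (x0 - y) \<partial>lborel) - c x0) \<le> e"
        by (intro mollify_close[OF c\<eta> \<eta>(2,3,4) cc]) blast
      then have "?\<theta> x0 \<ge> c x0 - e" unfolding eq by simp
      moreover have "c x0 = r" using r by (simp add: c_def)
      ultimately show ?thesis using e r_def by linarith
    qed
    have sm: "smooth_on UNIV ?\<theta>" using t by (simp add: test_function_def)
    have i: "integrable lborel (\<lambda>y. \<eta> y * c (x - y))" for x
      by (rule continuous_supp_integrable[of _ "cball 0 e"])
         (auto simp: \<eta> intro!: continuous_intros c\<eta> continuous_on_compose2[OF cc])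
    have i0: "integrable lborel \<eta>"
      by (rule continuous_supp_integrable[OF c\<eta>, of "cball 0 e"]) (auto simp: \<eta>)
    have "\<bar>?\<theta> y - ?\<theta> x\<bar> \<le> 1 * norm (y - x)" for x y
    proof -
      have "?\<theta> y - ?\<theta> x = (\<integral>z. \<eta> z * c (y - z) - \<eta> z * c (x - z) \<partial>lborel)"
        unfolding eq using i by simp
      also have "norm ... \<le> (\<integral>z. \<eta> z * norm (y - x) \<partial>lborel)"
      proof (rule Bochner_Integration.integral_norm_bound_integral)
        show "norm (\<eta> z * c (y - z) - \<eta> z * c (x - z)) \<le> \<eta> z * norm (y - x)" for z
          using lip[of "y - z" "x - z"] \<eta>(2)[of z]
          by (auto simp: abs_mult simp flip: right_diff_distrib intro: mult_left_mono)
      qed (use i i0 in auto)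
      finally show ?thesis using \<eta>(4) by simp
    qed
    then show "norm (grad ?\<theta> x) \<le> 1" for x
      by (intro GDERIV_le_lipschitz[OF smooth_on_D(1)[OF sm]]) auto
  qed
qed

section \<open>Integral inequalities\<close>

text \<open>Young's inequality, applied to the functions normalised to norm 1; the unnormalised inequality
  gives integrability of the product.\<close>

lemma Holder:
  fixes f g :: "'b \<Rightarrow> real"
  assumes p: "1 < p" "1 < q" "1/p + 1/q = 1"
    and fm: "f \<in> borel_measurable M" and gm: "g \<in> borel_measurable M"
    and nn: "\<And>x. 0 \<le> f x" "\<And>x. 0 \<le> g x"
    and int: "integrable M (\<lambda>x. f x powr p)" "integrable M (\<lambda>x. g x powr q)"
  shows "integrable M (\<lambda>x. f x * g x)"
    and "(\<integral>x. f x * g x \<partial>M) \<le> (\<integral>x. f x powr p \<partial>M) powr (1/p) * (\<integral>x. g x powr q \<partial>M) powr (1/q)"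
proof -
  note [measurable] = fm gm
  have Y: "f x * g x \<le> f x powr p / p + g x powr q / q" for x
    using Youngs_inequality p nn by blast
  show i: "integrable M (\<lambda>x. f x * g x)"
  proof (rule Bochner_Integration.integrable_bound[of M "\<lambda>x. f x powr p / p + g x powr q / q"])
    show "AE x in M. norm (f x * g x) \<le> norm (f x powr p / p + g x powr q / q)"
    proof (rule AE_I2)
      fix x
      have "0 \<le> f x * g x" using nn by simp
      then show "norm (f x * g x) \<le> norm (f x powr p / p + g x powr q / q)" using Y[of x] by simp
    qed
  qed (use int in auto)
  define A where "A = (\<integral>x. f x powr p \<partial>M)"
  define B where "B = (\<integral>x. g x powr q \<partial>M)"
  have AB: "A \<ge> 0" "B \<ge> 0" unfolding A_def B_def by (intro Bochner_Integration.integral_nonneg; simp)+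
  have "(\<integral>x. f x * g x \<partial>M) \<le> A powr (1/p) * B powr (1/q)"
  proof (cases "A = 0 \<or> B = 0")
    case True
    then have "AE x in M. f x * g x = 0"
    proof
      assume "A = 0"
      then have "AE x in M. f x powr p = 0"
        using integral_nonneg_eq_0_iff_AE[OF int(1)] by (simp add: A_def)
      then show ?thesis by eventually_elim simp
    next
      assume "B = 0"
      then have "AE x in M. g x powr q = 0"
        using integral_nonneg_eq_0_iff_AE[OF int(2)] by (simp add: B_def)
      then show ?thesis by eventually_elim simp
    qed
    then have "(\<integral>x. f x * g x \<partial>M) = 0" by (rule integral_eq_zero_AE)
    then show ?thesis by simp
  next
    case False
    define a where "a = A powr (1/p)"
    define b where "b = B powr (1/q)"
    have ab: "a > 0" "b > 0" using False AB by (auto simp: a_def b_def)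
    have pw: "a powr p = A" "b powr q = B" using False AB p by (auto simp: a_def b_def powr_powr)
    have "(\<integral>x. (f x * g x) / (a * b) \<partial>M) \<le> (\<integral>x. f x powr p / A / p + g x powr q / B / q \<partial>M)"
    proof (rule integral_mono)
      fix x
      have "(f x / a) * (g x / b) \<le> (f x / a) powr p / p + (g x / b) powr q / q"
        using Youngs_inequality[of p q "f x / a" "g x / b"] p nn ab by (simp add: less_imp_le)
      then show "(f x * g x) / (a * b) \<le> f x powr p / A / p + g x powr q / B / q"
        using ab nn by (simp add: powr_divide pw)
    qed (use i int in auto)
    also have "... = 1/p + 1/q" using int False by (simp add: A_def[symmetric] B_def[symmetric])
    also have "... = 1" using p by simp
    finally have "(\<integral>x. f x * g x \<partial>M) / (a * b) \<le> 1" by simp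
    then show ?thesis using ab by (simp add: a_def b_def field_simps)
  qed
  then show "(\<integral>x. f x * g x \<partial>M) \<le> (\<integral>x. f x powr p \<partial>M) powr (1/p) * (\<integral>x. g x powr q \<partial>M) powr (1/q)"
    unfolding A_def B_def .
qed

lemma conj_exponent:
  assumes "1 < (p::real)" shows "1 < p / (p - 1)" "1/p + 1 / (p / (p - 1)) = 1"
  using assms by (auto simp: field_simps)

lemma Holder_indicator:
  fixes h :: "'b \<Rightarrow> real"
  assumes m: "1 < m" and hm: "h \<in> borel_measurable M" and nn: "\<And>x. 0 \<le> h x"
    and int: "integrable M (\<lambda>x. h x powr m)" and B: "B \<in> sets M" "emeasure M B < \<infinity>"
  shows "integrable M (\<lambda>x. h x * indicator B x)"
    and "(\<integral>x. h x * indicator B x \<partial>M) \<le> measure M B powr (1 - 1/m) * (\<integral>x. h x powr m \<partial>M) powr (1/m)"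
proof -
  note c = conj_exponent[OF m]
  have e: "(\<lambda>x. (indicator B x :: real) powr (m / (m - 1))) = indicator B" by (auto simp: indicator_def)
  have i2: "integrable M (\<lambda>x. (indicator B x :: real) powr (m / (m - 1)))"
    unfolding e using B by (simp add: integrable_indicator_iff)
  have im: "(indicator B :: 'b \<Rightarrow> real) \<in> borel_measurable M" using B(1) by simp
  note H = Holder[OF m c hm im nn _ int i2]
  show "integrable M (\<lambda>x. h x * indicator B x)" by (rule H(1)) simp
  have "1 / (m / (m - 1)) = 1 - 1 / m" using m by (simp add: field_simps)
  moreover have "(\<integral>x. h x * indicator B x \<partial>M) \<le> (\<integral>x. h x powr m \<partial>M) powr (1/m) *
     (\<integral>x. indicator B x powr (m / (m - 1)) \<partial>M) powr (1 / (m / (m - 1)))"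
    by (rule H(2)) simp
  moreover have "(\<integral>x. indicator B x \<partial>M) = measure M B" using B(1)
    by (simp add: sets.Int_space_eq1 Int_absorb1 sets.sets_into_space Int_commute)
  ultimately show "(\<integral>x. h x * indicator B x \<partial>M) \<le> measure M B powr (1 - 1/m) * (\<integral>x. h x powr m \<partial>M) powr (1/m)"
    unfolding e by (simp add: mult.commute)
qed

lemma nn_Holder_indicator:
  fixes h :: "'b \<Rightarrow> real"
  assumes m: "1 < m" and hm: "h \<in> borel_measurable M" and nn: "\<And>x. 0 \<le> h x"
    and int: "integrable M (\<lambda>x. h x powr m)" and B: "B \<in> sets M" "emeasure M B < \<infinity>"
  shows "(\<integral>\<^sup>+x. ennreal (h x) * indicator B x \<partial>M) \<le>
    ennreal (measure M B powr (1 - 1/m) * (\<integral>x. h x powr m \<partial>M) powr (1/m))"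
proof -
  note H = Holder_indicator[OF assms]
  have "(\<integral>\<^sup>+x. ennreal (h x) * indicator B x \<partial>M) = (\<integral>\<^sup>+x. ennreal (h x * indicator B x) \<partial>M)"
    by (intro nn_integral_cong) (auto simp: indicator_def)
  also have "... = ennreal (\<integral>x. h x * indicator B x \<partial>M)"
    by (rule nn_integral_eq_integral[OF H(1)]) (simp add: nn)
  also have "... \<le> ennreal (measure M B powr (1 - 1/m) * (\<integral>x. h x powr m \<partial>M) powr (1/m))"
    by (rule ennreal_leI[OF H(2)])
  finally show ?thesis .
qed

text \<open>Hoelder's inequality for \<open>h^m\<close> and the constant 1 on the whole space, with exponent \<open>p/m\<close>.\<close>

lemma powr_norm_mono_exponent:
  fixes h :: "'b \<Rightarrow> real"
  assumes "finite_measure M" and m: "0 < m" "m < p"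
    and hm: "h \<in> borel_measurable M" and nn: "\<And>x. 0 \<le> h x"
    and int: "integrable M (\<lambda>x. h x powr p)"
  shows "integrable M (\<lambda>x. h x powr m)"
    and "(\<integral>x. h x powr m \<partial>M) powr (1/m) \<le>
      measure M (space M) powr (1/m - 1/p) * (\<integral>x. h x powr p \<partial>M) powr (1/p)"
proof -
  interpret finite_measure M by fact
  have e: "(\<lambda>x. (h x powr m) powr (p/m)) = (\<lambda>x. h x powr p)" using m by (simp add: powr_powr)
  have pm: "1 < p / m" using m by simp
  have fin: "emeasure M (space M) < \<infinity>" by (metis emeasure_finite infinity_ennreal_def less_top)
  have mm: "(\<lambda>x. h x powr m) \<in> borel_measurable M" using hm by measurable
  note H = Holder_indicator[OF pm mm _ _ sets.top fin, unfolded e, OF _ int]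
  have i: "integrable M (\<lambda>x. h x powr m * indicator (space M) x)" by (rule H(1)) simp
  have cong: "(\<integral>x. h x powr m * indicator (space M) x \<partial>M) = (\<integral>x. h x powr m \<partial>M)"
    by (intro Bochner_Integration.integral_cong) auto
  show "integrable M (\<lambda>x. h x powr m)"
    using i by (subst Bochner_Integration.integrable_cong[OF refl, of _ _ "\<lambda>x. h x powr m * indicator (space M) x"]) auto
  have "(\<integral>x. h x powr m \<partial>M) \<le> measure M (space M) powr (1 - 1/(p/m)) * (\<integral>x. h x powr p \<partial>M) powr (1/(p/m))"
    using H(2) by (simp add: cong)
  then have "(\<integral>x. h x powr m \<partial>M) powr (1/m) \<le>
     (measure M (space M) powr (1 - 1/(p/m)) * (\<integral>x. h x powr p \<partial>M) powr (1/(p/m))) powr (1/m)"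
    using m by (intro powr_mono2) (auto intro: Bochner_Integration.integral_nonneg)
  also have "... = measure M (space M) powr ((1 - 1/(p/m)) * (1/m)) * (\<integral>x. h x powr p \<partial>M) powr ((1/(p/m)) * (1/m))"
    by (simp add: powr_mult powr_powr)
  also have "(1 - 1/(p/m)) * (1/m) = 1/m - 1/p" using m by (simp add: field_simps)
  also have "(1/(p/m)) * (1/m) = 1/p" using m by (simp add: field_simps)
  finally show "(\<integral>x. h x powr m \<partial>M) powr (1/m) \<le>
      measure M (space M) powr (1/m - 1/p) * (\<integral>x. h x powr p \<partial>M) powr (1/p)" .
qed

section \<open>Differences of a C1 function along segments\<close>

text \<open>The fundamental theorem of calculus along the segment from \<open>a\<close> to \<open>b\<close>, phrased with Lebesgue
  integrals so that Fubini's theorem applies to it.\<close>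

lemma FTC_segment:
  fixes f :: "'a::euclidean_space \<Rightarrow> real"
  assumes GD: "\<And>x. GDERIV f x :> g x" and cg: "continuous_on UNIV g"
  shows "integrable lborel (\<lambda>s. indicator {0..1} s *\<^sub>R ((b - a) \<bullet> g (a + s *\<^sub>R (b - a))))"
    and "(\<integral>s. indicator {0..1} s *\<^sub>R ((b - a) \<bullet> g (a + s *\<^sub>R (b - a))) \<partial>lborel) = f b - f a"
proof -
  have c: "continuous_on {0..1} (\<lambda>s. (b - a) \<bullet> g (a + s *\<^sub>R (b - a)))"
    by (intro continuous_intros continuous_on_compose2[OF cg]) auto
  then show "integrable lborel (\<lambda>s. indicator {0..1} s *\<^sub>R ((b - a) \<bullet> g (a + s *\<^sub>R (b - a))))"
    by (intro borel_integrable_compact) auto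
  have d: "((\<lambda>s. f (a + s *\<^sub>R (b - a))) has_vector_derivative (b - a) \<bullet> g (a + s *\<^sub>R (b - a))) (at s within {0..1})" for s
  proof -
    have "((\<lambda>s. f (a + s *\<^sub>R (b - a))) has_derivative (\<lambda>h. (h *\<^sub>R (b - a)) \<bullet> g (a + s *\<^sub>R (b - a)))) (at s within {0..1})"
      using GD[of "a + s *\<^sub>R (b - a)"] unfolding gderiv_def
      by (intro has_derivative_compose[of "\<lambda>s. a + s *\<^sub>R (b - a)" "\<lambda>h. h *\<^sub>R (b - a)" s "{0..1}" f])
         (auto intro!: derivative_eq_intros)
    then show ?thesis by (simp add: has_vector_derivative_def)
  qed
  have "(\<integral>s. indicator {0..1} s *\<^sub>R ((b - a) \<bullet> g (a + s *\<^sub>R (b - a))) \<partial>lborel) =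
    (\<lambda>s. f (a + s *\<^sub>R (b - a))) 1 - (\<lambda>s. f (a + s *\<^sub>R (b - a))) 0"
    by (rule integral_FTC_atLeastAtMost[OF _ d c]) auto
  then show "(\<integral>s. indicator {0..1} s *\<^sub>R ((b - a) \<bullet> g (a + s *\<^sub>R (b - a))) \<partial>lborel) = f b - f a"
    by simp
qed

lemma segment_abs_bound:
  fixes f :: "'a::euclidean_space \<Rightarrow> real"
  assumes GD: "\<And>x. GDERIV f x :> g x" and cg: "continuous_on UNIV g" and D: "norm (b - a) \<le> D"
  shows "ennreal \<bar>f b - f a\<bar> \<le>
    (\<integral>\<^sup>+s. ennreal D * ennreal (norm (g (a + s *\<^sub>R (b - a)))) * indicator {0..1} s \<partial>lborel)"
proof -
  note F = FTC_segment[OF GD cg, of b a]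
  have "ennreal \<bar>f b - f a\<bar> \<le>
    (\<integral>\<^sup>+s. ennreal (norm (indicator {0..1} s *\<^sub>R ((b - a) \<bullet> g (a + s *\<^sub>R (b - a))))) \<partial>lborel)"
    using integral_norm_bound_ennreal[OF F(1)] unfolding F(2) by simp
  also have "... \<le> (\<integral>\<^sup>+s. ennreal D * ennreal (norm (g (a + s *\<^sub>R (b - a)))) * indicator {0..1} s \<partial>lborel)"
  proof (rule nn_integral_mono)
    fix s :: real
    have "D \<ge> 0" using D norm_ge_zero order_trans by blast
    have "\<bar>(b - a) \<bullet> g (a + s *\<^sub>R (b - a))\<bar> \<le> norm (b - a) * norm (g (a + s *\<^sub>R (b - a)))"
      by (rule Cauchy_Schwarz_ineq2)
    also have "... \<le> D * norm (g (a + s *\<^sub>R (b - a)))" using D by (intro mult_right_mono) auto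
    finally show "ennreal (norm (indicator {0..1} s *\<^sub>R ((b - a) \<bullet> g (a + s *\<^sub>R (b - a)))))
        \<le> ennreal D * ennreal (norm (g (a + s *\<^sub>R (b - a)))) * indicator {0..1} s"
      using \<open>D \<ge> 0\<close> by (auto simp: indicator_def ennreal_mult[symmetric] intro: ennreal_leI)
  qed
  finally show ?thesis .
qed

text \<open>Fubini's theorem: the mean over \<open>z\<close> of the increments of \<open>f\<close> from \<open>P z\<close> to \<open>Q z\<close> is controlled by
  the integrals of \<open>|\<nabla>f|\<close> over the intermediate images of \<open>B\<close>. With a fixed starting point this gives
  Morrey's inequality, with a fixed difference \<open>Q z - P z\<close> it gives the translation estimates.\<close>

lemma segment_bound:
  fixes f :: "'a::euclidean_space \<Rightarrow> real" and P Q :: "'a \<Rightarrow> 'a"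
  assumes GD: "\<And>x. GDERIV f x :> g x" and cg: "continuous_on UNIV g"
    and P: "P \<in> borel_measurable borel" and Q: "Q \<in> borel_measurable borel" and B: "B \<in> sets borel"
    and D: "\<And>z. z \<in> B \<Longrightarrow> norm (Q z - P z) \<le> D"
    and N: "\<And>s. 0 < s \<Longrightarrow> s \<le> 1 \<Longrightarrow>
      (\<integral>\<^sup>+z. ennreal (norm (g (P z + s *\<^sub>R (Q z - P z)))) * indicator B z \<partial>lborel) \<le> N s"
    and Nm: "N \<in> borel_measurable borel"
  shows "(\<integral>\<^sup>+z. ennreal \<bar>f (Q z) - f (P z)\<bar> * indicator B z \<partial>lborel) \<le>
    ennreal D * (\<integral>\<^sup>+s. N s * indicator {0..1} s \<partial>lborel)"
proof -
  note [measurable] = P Q B Nm borel_measurable_continuous_onI[OF cg]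
  let ?F = "\<lambda>z s. ennreal D * ennreal (norm (g (P z + s *\<^sub>R (Q z - P z)))) * indicator {0..1} s * indicator B z"
  have "(\<integral>\<^sup>+z. ennreal \<bar>f (Q z) - f (P z)\<bar> * indicator B z \<partial>lborel) \<le> (\<integral>\<^sup>+z. (\<integral>\<^sup>+s. ?F z s \<partial>lborel) \<partial>lborel)"
  proof (rule nn_integral_mono)
    fix z
    show "ennreal \<bar>f (Q z) - f (P z)\<bar> * indicator B z \<le> (\<integral>\<^sup>+s. ?F z s \<partial>lborel)"
      using segment_abs_bound[OF GD cg D[of z]] by (cases "z \<in> B") simp_all
  qed
  also have "... = (\<integral>\<^sup>+s. (\<integral>\<^sup>+z. ?F z s \<partial>lborel) \<partial>lborel)"
    by (rule lborel_pair.Fubini'[symmetric]) measurable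
  also have "... = (\<integral>\<^sup>+s. ennreal D * (indicator {0..1} s *
      (\<integral>\<^sup>+z. ennreal (norm (g (P z + s *\<^sub>R (Q z - P z)))) * indicator B z \<partial>lborel)) \<partial>lborel)"
  proof (rule nn_integral_cong)
    fix s :: real
    have "(\<integral>\<^sup>+z. ?F z s \<partial>lborel) = (\<integral>\<^sup>+z. (ennreal D * indicator {0..1} s) *
        (ennreal (norm (g (P z + s *\<^sub>R (Q z - P z)))) * indicator B z) \<partial>lborel)"
      by (intro nn_integral_cong) (simp add: ac_simps)
    also have "... = (ennreal D * indicator {0..1} s) *
        (\<integral>\<^sup>+z. ennreal (norm (g (P z + s *\<^sub>R (Q z - P z)))) * indicator B z \<partial>lborel)"
      by (rule nn_integral_cmult) measurable
    finally show "(\<integral>\<^sup>+z. ?F z s \<partial>lborel) = ennreal D * (indicator {0..1} s *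
      (\<integral>\<^sup>+z. ennreal (norm (g (P z + s *\<^sub>R (Q z - P z)))) * indicator B z \<partial>lborel))"
      by (simp add: ac_simps)
  qed
  \<comment> \<open>The bound by \<open>N\<close> holds for \<open>s > 0\<close> only, that is, almost everywhere.\<close>
  also have "... \<le> (\<integral>\<^sup>+s. ennreal D * (N s * indicator {0..1} s) \<partial>lborel)"
  proof (rule nn_integral_mono_AE)
    have "AE s in lborel. s \<noteq> (0::real)" by (rule AE_lborel_singleton)
    then show "AE s in lborel. ennreal D * (indicator {0..1} s *
      (\<integral>\<^sup>+z. ennreal (norm (g (P z + s *\<^sub>R (Q z - P z)))) * indicator B z \<partial>lborel))
      \<le> ennreal D * (N s * indicator {0..1} s)"
    proof eventually_elim
      case (elim s)
      then show ?case using N[of s] by (cases "s \<in> {0..1}") (auto intro: mult_left_mono)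
    qed
  qed
  also have "... = ennreal D * (\<integral>\<^sup>+s. N s * indicator {0..1} s \<partial>lborel)"
    by (rule nn_integral_cmult) measurable
  finally show ?thesis .
qed

lemma nn_integral_lborel_shift:
  fixes f :: "'a::euclidean_space \<Rightarrow> ennreal"
  assumes [measurable]: "f \<in> borel_measurable borel"
  shows "(\<integral>\<^sup>+x. f (c + x) \<partial>lborel) = (\<integral>\<^sup>+x. f x \<partial>lborel)"
proof -
  have "(\<integral>\<^sup>+x. f x \<partial>lborel) = (\<integral>\<^sup>+x. f x \<partial>distr lborel borel ((+) c))" by (simp add: lborel_distr_plus)
  also have "... = (\<integral>\<^sup>+x. f (c + x) \<partial>lborel)" by (subst nn_integral_distr) auto
  finally show ?thesis by simp
qed

lemma average_translate_bound:
  fixes f :: "'a::euclidean_space \<Rightarrow> real"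
  assumes GD: "\<And>x. GDERIV f x :> g x" and cg: "continuous_on UNIV g" and B: "B \<in> sets borel"
    and N: "\<And>w. (\<integral>\<^sup>+z. ennreal (norm (g (w + z))) * indicator B z \<partial>lborel) \<le> N"
  shows "(\<integral>\<^sup>+z. ennreal \<bar>f (y + z) - f (x + z)\<bar> * indicator B z \<partial>lborel) \<le> ennreal (norm (y - x)) * N"
proof -
  have "(\<integral>\<^sup>+z. ennreal \<bar>f (y + z) - f (x + z)\<bar> * indicator B z \<partial>lborel) \<le>
    ennreal (norm (y - x)) * (\<integral>\<^sup>+s. N * indicator {0..1} (s::real) \<partial>lborel)"
  proof (rule segment_bound[OF GD cg _ _ B])
    fix s :: real
    have e: "x + z + s *\<^sub>R (y + z - (x + z)) = (x + s *\<^sub>R (y - x)) + z" for z by (simp add: algebra_simps)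
    show "(\<integral>\<^sup>+z. ennreal (norm (g (x + z + s *\<^sub>R (y + z - (x + z))))) * indicator B z \<partial>lborel) \<le> N"
      unfolding e by (rule N)
  qed auto
  also have "(\<integral>\<^sup>+s. N * indicator {0..1} (s::real) \<partial>lborel) = N" by (simp add: nn_integral_cmult_indicator)
  finally show ?thesis .
qed

lemma translate_L1_bound:
  fixes f :: "'a::euclidean_space \<Rightarrow> real"
  assumes GD: "\<And>x. GDERIV f x :> g x" and cg: "continuous_on UNIV g"
  shows "(\<integral>\<^sup>+x. ennreal \<bar>f (x + z) - f x\<bar> \<partial>lborel) \<le> ennreal (norm z) * (\<integral>\<^sup>+x. ennreal (norm (g x)) \<partial>lborel)"
proof -
  note [measurable] = borel_measurable_continuous_onI[OF cg]
  have "(\<integral>\<^sup>+x. ennreal \<bar>f (x + z) - f x\<bar> * indicator UNIV x \<partial>lborel) \<le>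
    ennreal (norm z) * (\<integral>\<^sup>+s. (\<integral>\<^sup>+x. ennreal (norm (g x)) \<partial>lborel) * indicator {0..1} (s::real) \<partial>lborel)"
  proof (rule segment_bound[OF GD cg])
    fix s :: real
    have e: "x + s *\<^sub>R (x + z - x) = s *\<^sub>R z + x" for x by simp
    show "(\<integral>\<^sup>+x. ennreal (norm (g (x + s *\<^sub>R (x + z - x)))) * indicator UNIV x \<partial>lborel) \<le> (\<integral>\<^sup>+x. ennreal (norm (g x)) \<partial>lborel)"
      unfolding e by (simp add: nn_integral_lborel_shift[of "\<lambda>x. ennreal (norm (g x))"])
  qed auto
  then show ?thesis by (simp add: nn_integral_cmult_indicator)
qed

section \<open>Morrey's inequality\<close>

lemma nn_integral_inverse_sqrt:
  assumes "c \<ge> 0"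
  shows "(\<integral>\<^sup>+s. ennreal (c * s powr (-1/2)) * indicator {0..1} s \<partial>lborel) = ennreal (2 * c)"
proof -
  have "((\<lambda>s. s powr (-1/2)) has_integral 1 powr (-1/2 + 1) / (-1/2 + 1)) {0..1::real}"
    by (rule has_integral_powr_from_0) auto
  then have "((\<lambda>s. c * s powr (-1/2)) has_integral c * 2) {0..1::real}"
    by (intro has_integral_mult_right) simp
  then have "((\<lambda>s. if s \<in> {0..1} then c * s powr (-1/2) else 0) has_integral c * 2) (UNIV :: real set)"
    by (simp only: has_integral_restrict_UNIV)
  then have "(\<integral>\<^sup>+s. ennreal (if s \<in> {0..1} then c * s powr (-1/2) else 0) \<partial>lborel) = ennreal (c * 2)"
    using assms by (intro nn_integral_has_integral_lborel) auto
  also have "(\<integral>\<^sup>+s. ennreal (if s \<in> {0..1} then c * s powr (-1/2) else 0) \<partial>lborel) =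
     (\<integral>\<^sup>+s. ennreal (c * s powr (-1/2)) * indicator {0..1} s \<partial>lborel)"
    by (intro nn_integral_cong) (auto simp: indicator_def)
  finally show ?thesis by (simp only: mult.commute)
qed

lemma continuous_on_norm_powr:
  fixes g :: "'b::topological_space \<Rightarrow> 'a::real_normed_vector"
  assumes "continuous_on S g" "m > 0"
  shows "continuous_on S (\<lambda>x. norm (g x) powr m)"
  using assms by (intro continuous_on_powr' continuous_intros) auto

text \<open>At time \<open>s\<close> the ball has been contracted towards \<open>a\<close> by the factor \<open>s\<close>. Hoelder's inequality with
  exponent \<open>m\<close> and the change of variables cost a factor \<open>s^(-n/m)\<close>, where \<open>n\<close> is the dimension. The
  choice \<open>m = 2n\<close> makes it \<open>s^(-1/2)\<close>, which is integrable.\<close>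

lemma morrey_average:
  fixes f :: "'a::euclidean_space \<Rightarrow> real"
  defines "m \<equiv> 2 * real DIM('a)"
  assumes GD: "\<And>x. GDERIV f x :> g x" and cg: "continuous_on UNIV g"
    and K: "compact K" "\<And>x. x \<notin> K \<Longrightarrow> g x = 0" and a: "a \<in> cball x r"
  shows "(\<integral>\<^sup>+z. ennreal \<bar>f z - f a\<bar> * indicator (cball x r) z \<partial>lborel) \<le>
    ennreal (4 * r * (measure lborel (cball x r) powr (1 - 1/m) * (\<integral>z. norm (g z) powr m \<partial>lborel) powr (1/m)))"
proof -
  have n1: "real DIM('a) \<ge> 1" using DIM_positive[where 'a='a] by linarith
  have m: "m > 1" "m > 0" using n1 unfolding m_def by linarith+
  have r: "r \<ge> 0" using a zero_le_dist order_trans unfolding mem_cball by blast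
  note [measurable] = borel_measurable_continuous_onI[OF cg]
  define I where "I = (\<integral>z. norm (g z) powr m \<partial>lborel)"
  have I: "I \<ge> 0" unfolding I_def by (rule Bochner_Integration.integral_nonneg) simp
  define c where "c = measure lborel (cball x r) powr (1 - 1/m) * I powr (1/m)"
  have c: "c \<ge> 0" by (simp add: c_def)
  have "(\<integral>\<^sup>+z. ennreal \<bar>f z - f a\<bar> * indicator (cball x r) z \<partial>lborel) \<le>
    ennreal (2 * r) * (\<integral>\<^sup>+s. ennreal (c * s powr (-1/2)) * indicator {0..1} s \<partial>lborel)"
  proof (rule segment_bound[OF GD cg])
    show "norm (z - a) \<le> 2 * r" if "z \<in> cball x r" for z
      using that a norm_triangle_ineq4[of "z - x" "a - x"] by (simp add: dist_norm norm_minus_commute)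
  next
    fix s :: real assume s: "0 < s" "s \<le> 1"
    define h where "h = (\<lambda>z. norm (g (a + s *\<^sub>R (z - a))))"
    have ch: "continuous_on UNIV (\<lambda>z. g (a + s *\<^sub>R (z - a)))"
      by (intro continuous_intros continuous_on_compose2[OF cg]) auto
    have ih: "integrable lborel (\<lambda>z. h z powr m)"
    proof (rule continuous_supp_integrable)
      show "continuous_on UNIV (\<lambda>z. h z powr m)"
        unfolding h_def by (intro continuous_on_norm_powr ch m)
      show "compact ((\<lambda>w. a + (1/s) *\<^sub>R (w - a)) ` K)"
        by (intro compact_continuous_image K continuous_intros)
      fix z assume z: "z \<notin> (\<lambda>w. a + (1/s) *\<^sub>R (w - a)) ` K"
      have "z = (\<lambda>w. a + (1/s) *\<^sub>R (w - a)) (a + s *\<^sub>R (z - a))" using s by simp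
      then have "a + s *\<^sub>R (z - a) \<notin> K" using z by (metis image_eqI)
      then show "h z powr m = 0" using K(2) by (simp add: h_def)
    qed
    have e: "a + s *\<^sub>R (z - a) = (a - s *\<^sub>R a) + s *\<^sub>R z" for z by (simp add: algebra_simps)
    \<comment> \<open>The change of variables \<open>z \<mapsto> a + s (z - a)\<close>; its Jacobian gives the
      power of \<open>s\<close>.\<close>
    have "I = (\<bar>s\<bar> ^ DIM('a)) *\<^sub>R (\<integral>z. norm (g ((a - s *\<^sub>R a) + s *\<^sub>R z)) powr m \<partial>lborel)"
      unfolding I_def by (rule lborel_integral_affine) (use s in auto)
    then have "(\<integral>z. h z powr m \<partial>lborel) = I / s ^ DIM('a)"
      using s unfolding h_def e by simp
    then have "(\<integral>z. h z powr m \<partial>lborel) powr (1/m) = I powr (1/m) / (s ^ DIM('a)) powr (1/m)"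
      using I s by (simp add: powr_divide)
    also have "(s ^ DIM('a)) powr (1/m) = s powr (1/2)"
      using s n1 by (simp add: powr_realpow[symmetric] powr_powr m_def)
    finally have "(\<integral>z. h z powr m \<partial>lborel) powr (1/m) = I powr (1/m) * inverse (s powr (1/2))"
      by (simp only: divide_inverse)
    moreover have "s powr (-1/2) = inverse (s powr (1/2))"
      using powr_minus[of s "1/2"] by (simp only: minus_divide_left)
    ultimately have "(\<integral>z. h z powr m \<partial>lborel) powr (1/m) = I powr (1/m) * s powr (-1/2)" by (simp only:)
    then have cs: "measure lborel (cball x r) powr (1 - 1/m) * (\<integral>z. h z powr m \<partial>lborel) powr (1/m) = c * s powr (-1/2)"
      by (simp only: c_def mult.assoc)
    have "(\<integral>\<^sup>+z. ennreal (h z) * indicator (cball x r) z \<partial>lborel) \<le>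
      ennreal (measure lborel (cball x r) powr (1 - 1/m) * (\<integral>z. h z powr m \<partial>lborel) powr (1/m))"
      by (rule nn_Holder_indicator[OF m(1) _ _ ih _ emeasure_lborel_cball_finite])
         (auto simp: h_def)
    then show "(\<integral>\<^sup>+z. ennreal (norm (g (a + s *\<^sub>R (z - a)))) * indicator (cball x r) z \<partial>lborel) \<le> ennreal (c * s powr (-1/2))"
      unfolding cs unfolding h_def .
  qed auto
  also have "... = ennreal (2 * r) * ennreal (2 * c)"
    unfolding nn_integral_inverse_sqrt[OF c] ..
  also have "... = ennreal (4 * r * c)" using r c by (simp add: ennreal_mult[symmetric])
  finally show ?thesis unfolding c_def I_def .
qed

text \<open>Compare both \<open>f x\<close> and \<open>f y\<close> with \<open>f z\<close> and average over \<open>z\<close> in the ball about \<open>x\<close> with radius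
  \<open>|x - y|\<close>, which contains both points.\<close>

lemma morrey:
  fixes f :: "'a::euclidean_space \<Rightarrow> real"
  defines "m \<equiv> 2 * real DIM('a)"
  assumes GD: "\<And>x. GDERIV f x :> g x" and cg: "continuous_on UNIV g"
    and K: "compact K" "\<And>x. x \<notin> K \<Longrightarrow> g x = 0"
  shows "\<bar>f x - f y\<bar> \<le> 8 * measure lborel (ball (0::'a) 1) powr (-1/m) * sqrt (norm (x - y)) *
     (\<integral>z. norm (g z) powr m \<partial>lborel) powr (1/m)"
proof (cases "x = y")
  case False
  have n1: "real DIM('a) \<ge> 1" using DIM_positive[where 'a='a] by linarith
  have m: "m > 1" "m > 0" using n1 unfolding m_def by linarith+
  define r where "r = norm (x - y)"
  have r: "r > 0" using False by (simp add: r_def)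
  define B where "B = cball x r"
  define v where "v = measure lborel B"
  define w where "w = measure lborel (ball (0::'a) 1)"
  define k where "k = (\<integral>z. norm (g z) powr m \<partial>lborel) powr (1/m)"
  have k: "k \<ge> 0" by (simp add: k_def)
  have w: "w > 0" unfolding w_def by (rule content_ball_pos) simp
  have v: "v = r ^ DIM('a) * w"
    unfolding v_def B_def w_def content_cball_conv_ball using content_ball_conv_unit_ball[of r x] r by simp
  have vp: "v > 0" using v w r by simp
  have f_cont: "continuous_on UNIV f" by (rule GDERIV_continuous_on[OF GD])
  note [measurable] = borel_measurable_continuous_onI[OF f_cont]
  have xB: "x \<in> B" "y \<in> B" using r by (auto simp: B_def r_def dist_norm)
  have Bf: "emeasure lborel B = ennreal v"
    unfolding v_def B_def using emeasure_lborel_cball_finite[of x r] by (simp add: emeasure_eq_ennreal_measure less_top)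
  have [measurable]: "B \<in> sets borel" by (simp add: B_def)
  have "ennreal (\<bar>f x - f y\<bar> * v) = (\<integral>\<^sup>+z. ennreal \<bar>f x - f y\<bar> * indicator B z \<partial>lborel)"
    using vp by (subst nn_integral_cmult_indicator) (auto simp: Bf ennreal_mult)
  also have "... \<le> (\<integral>\<^sup>+z. ennreal \<bar>f z - f x\<bar> * indicator B z + ennreal \<bar>f z - f y\<bar> * indicator B z \<partial>lborel)"
    by (intro nn_integral_mono) (auto simp: indicator_def ennreal_plus[symmetric] simp del: ennreal_plus intro!: ennreal_leI)
  also have "... = (\<integral>\<^sup>+z. ennreal \<bar>f z - f x\<bar> * indicator B z \<partial>lborel) + (\<integral>\<^sup>+z. ennreal \<bar>f z - f y\<bar> * indicator B z \<partial>lborel)"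
    by (rule nn_integral_add) measurable
  also have "... \<le> ennreal (4 * r * (v powr (1 - 1/m) * k)) + ennreal (4 * r * (v powr (1 - 1/m) * k))"
    unfolding k_def v_def B_def m_def
    by (intro add_mono morrey_average[OF GD cg K]) (use xB in \<open>auto simp: B_def\<close>)
  also have "... = ennreal (8 * r * (v powr (1 - 1/m) * k))"
    using r k by (subst ennreal_plus[symmetric]) auto
  finally have "\<bar>f x - f y\<bar> * v \<le> 8 * r * (v powr (1 - 1/m) * k)"
    using r k by (subst (asm) ennreal_le_iff) auto
  also have "v powr (1 - 1/m) = v * v powr (- 1/m)" using vp by (simp add: powr_diff powr_minus divide_inverse)
  finally have "\<bar>f x - f y\<bar> * v \<le> (8 * r * v powr (- 1/m) * k) * v" by (simp add: ac_simps)
  then have "\<bar>f x - f y\<bar> \<le> 8 * r * v powr (- 1/m) * k" using vp by (simp only: mult_le_cancel_right_pos)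
  also have "v powr (- 1/m) = (r ^ DIM('a)) powr (- 1/m) * w powr (- 1/m)" using r w v by (simp add: powr_mult)
  also have "(r ^ DIM('a)) powr (- 1/m) = r powr (- 1/2)"
    using r n1 by (simp add: powr_realpow[symmetric] powr_powr m_def)
  also have "8 * r * (r powr (- 1/2) * w powr (- 1/m)) * k = 8 * w powr (- 1/m) * (r * r powr (- 1/2)) * k"
    by (simp add: ac_simps)
  also have "r * r powr (- 1/2) = sqrt r"
    using r powr_add[of r 1 "-1/2"] by (simp add: powr_half_sqrt)
  finally show ?thesis unfolding w_def r_def k_def .
qed simp

section \<open>Integration by parts\<close>

text \<open>Integrate \<open>f (x + b) - f x = \<integral>_0^1 \<nabla>f (x + s b) \<bullet> b ds\<close> over \<open>x\<close>: the left-hand side vanishes and each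
  \<open>s\<close> contributes the same amount on the right, by translation invariance. Unlike an
  iterated integral over coordinates, this works in an arbitrary Euclidean space.\<close>

lemma integral_partial_zero:
  fixes f :: "'a::euclidean_space \<Rightarrow> real"
  assumes GD: "\<And>x. GDERIV f x :> g x" and cg: "continuous_on UNIV g"
    and K: "compact K" "\<And>x. x \<notin> K \<Longrightarrow> f x = 0" "\<And>x. x \<notin> K \<Longrightarrow> g x = 0"
  shows "(\<integral>x. g x \<bullet> b \<partial>lborel) = 0"
proof -
  have cf: "continuous_on UNIV f" by (rule GDERIV_continuous_on[OF GD])
  define K' where "K' = (\<lambda>(x, s). x - s *\<^sub>R b) ` (K \<times> {0..1::real})"
  have K': "compact K'" unfolding K'_def
    by (intro compact_continuous_image compact_Times K) (auto simp: split_def intro!: continuous_intros)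
  define F where "F = (\<lambda>x s. indicator {0..1} s *\<^sub>R (b \<bullet> g (x + s *\<^sub>R b)))"
  have Fz: "F x s = 0" if "x \<notin> K'" for x s
  proof (cases "s \<in> {0..1}")
    case True
    have "x + s *\<^sub>R b \<notin> K"
    proof
      assume "x + s *\<^sub>R b \<in> K"
      then have "(\<lambda>(x, s). x - s *\<^sub>R b) (x + s *\<^sub>R b, s) \<in> K'" unfolding K'_def using True by blast
      then show False using that by simp
    qed
    then show ?thesis using K(3) by (simp add: F_def)
  qed (simp add: F_def)
  have "integrable lborel (\<lambda>z. indicator (K' \<times> {0..1::real}) z *\<^sub>R (b \<bullet> g (fst z + snd z *\<^sub>R b)))"
    by (intro borel_integrable_compact compact_Times K' continuous_intros continuous_on_compose2[OF cg]) auto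
  also have "(\<lambda>z. indicator (K' \<times> {0..1::real}) z *\<^sub>R (b \<bullet> g (fst z + snd z *\<^sub>R b))) = (\<lambda>(x, s). F x s)"
  proof
    fix z :: "'a \<times> real"
    show "indicator (K' \<times> {0..1::real}) z *\<^sub>R (b \<bullet> g (fst z + snd z *\<^sub>R b)) = (\<lambda>(x, s). F x s) z"
      using Fz[of "fst z" "snd z"] by (cases "fst z \<in> K'") (auto simp: F_def indicator_def split_def mem_Times_iff)
  qed
  finally have "integrable (lborel \<Otimes>\<^sub>M lborel) (\<lambda>(x, s). F x s)" by (simp add: lborel_prod)
  then have Fub: "(\<integral>s. \<integral>x. F x s \<partial>lborel \<partial>lborel) = (\<integral>x. \<integral>s. F x s \<partial>lborel \<partial>lborel)"
    by (rule lborel_pair.Fubini_integral)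
  have "(\<integral>s. F x s \<partial>lborel) = f (x + b) - f x" for x
    using FTC_segment(2)[OF GD cg, of "x + b" x] by (simp add: F_def)
  then have "(\<integral>x. \<integral>s. F x s \<partial>lborel \<partial>lborel) = (\<integral>x. f (x + b) - f x \<partial>lborel)" by simp
  also have "... = 0"
  proof -
    have i1: "integrable lborel f" by (rule continuous_supp_integrable[OF cf K(1,2)])
    have i2: "integrable lborel (\<lambda>x. f (x + b))"
    proof (rule continuous_supp_integrable[OF _ K'])
      show "continuous_on UNIV (\<lambda>x. f (x + b))" by (intro continuous_intros continuous_on_compose2[OF cf]) auto
      fix x assume x: "x \<notin> K'"
      have "x + b \<notin> K"
      proof
        assume "x + b \<in> K"
        then have "(\<lambda>(x, s). x - s *\<^sub>R b) (x + b, 1) \<in> K'" unfolding K'_def by (intro imageI) simp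
        then show False using x by simp
      qed
      then show "f (x + b) = 0" by (rule K(2))
    qed
    have "integral\<^sup>L lborel f = (\<integral>x. f (x + b) \<partial>lborel)"
      using lborel_integral_affine[of f 1 b] borel_measurable_continuous_onI[OF cf] by (simp add: add.commute)
    then show ?thesis using i1 i2 by simp
  qed
  finally have z: "(\<integral>s. \<integral>x. F x s \<partial>lborel \<partial>lborel) = 0" using Fub by simp
  have "(\<integral>x. F x s \<partial>lborel) = indicator {0..1} s *\<^sub>R (\<integral>x. g x \<bullet> b \<partial>lborel)" for s
  proof -
    have [measurable]: "g \<in> borel_measurable borel" by (rule borel_measurable_continuous_onI[OF cg])
    have "(\<integral>x. g x \<bullet> b \<partial>lborel) = (\<integral>x. b \<bullet> g (x + s *\<^sub>R b) \<partial>lborel)"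
      using lborel_integral_affine[of "\<lambda>x. g x \<bullet> b" 1 "s *\<^sub>R b"] by (simp add: add.commute inner_commute)
    then show ?thesis by (simp add: F_def)
  qed
  then have "(\<integral>s. \<integral>x. F x s \<partial>lborel \<partial>lborel) = (\<integral>s. indicator {0..1} s *\<^sub>R (\<integral>x. g x \<bullet> b \<partial>lborel) \<partial>(lborel :: real measure))"
    by simp
  also have "... = (\<integral>x. g x \<bullet> b \<partial>lborel)" by simp
  finally show ?thesis using z by simp
qed

section \<open>Test functions and Lebesgue spaces on a bounded open set\<close>

lemma test_function_C1:
  assumes "test_function \<Omega> \<phi>"
  shows "\<And>x. GDERIV \<phi> x :> grad \<phi> x" "continuous_on UNIV \<phi>" "continuous_on UNIV (grad \<phi>)"
  using smooth_on_D[of UNIV \<phi>] assms unfolding test_function_def by simp_all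

lemma test_function_support:
  assumes t: "test_function \<Omega> \<phi>"
  obtains K where "compact K" "K \<subseteq> \<Omega>" "\<And>x. x \<notin> K \<Longrightarrow> \<phi> x = 0" "\<And>x. x \<notin> K \<Longrightarrow> grad \<phi> x = 0"
proof
  let ?K = "closure {x. \<phi> x \<noteq> 0}"
  show "compact ?K" "?K \<subseteq> \<Omega>" using t unfolding test_function_def by blast+
  show z: "\<phi> x = 0" if "x \<notin> ?K" for x
    using that closure_subset[of "{x. \<phi> x \<noteq> 0}"] by blast
  show "grad \<phi> x = 0" if "x \<notin> ?K" for x
    by (rule GDERIV_zero_outside[OF test_function_C1(1)[OF t] closed_closure z that])
qed

lemma compact_support_bounded:
  fixes f :: "'a::euclidean_space \<Rightarrow> 'b::euclidean_space"
  assumes "continuous_on UNIV f" "compact K" "\<And>x. x \<notin> K \<Longrightarrow> f x = 0"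
  obtains B where "\<And>x. norm (f x) \<le> B" "B \<ge> 0"
proof -
  have "compact (f ` K)" using assms by (intro compact_continuous_image) (auto intro: continuous_on_subset)
  then obtain B where B: "\<forall>y\<in>f ` K. norm y \<le> B" using compact_imp_bounded bounded_iff by blast
  have "norm (f x) \<le> max B 0" for x
    using B assms(3)[of x] by (cases "x \<in> K") (auto simp: le_max_iff_disj)
  then show ?thesis using that[of "max B 0"] by simp
qed

lemma finite_measure_bounded_open:
  fixes \<Omega> :: "'a::euclidean_space set"
  assumes "open \<Omega>" "bounded \<Omega>"
  shows "finite_measure (lebesgue_on \<Omega>)"
  using assms by (intro finite_measure_lebesgue_on lmeasurable_open)

lemma open_lebesgue: "open \<Omega> \<Longrightarrow> \<Omega> \<in> sets lebesgue"
  by (metis borel_open sets_completionI_sets sets_lborel)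

lemma borel_imp_lebesgue_on:
  fixes f :: "'a::euclidean_space \<Rightarrow> 'b::euclidean_space"
  assumes "f \<in> borel_measurable borel"
  shows "f \<in> borel_measurable (lebesgue_on \<Omega>)"
proof -
  have "f \<in> borel_measurable lborel" using assms by simp
  then show ?thesis by (intro measurable_restrict_space1 measurable_completion)
qed

lemma nn_integral_lebesgue_on:
  fixes \<Omega> :: "'a::euclidean_space set"
  assumes "open \<Omega>"
  shows "(\<integral>\<^sup>+x. f x \<partial>lebesgue_on \<Omega>) = (\<integral>\<^sup>+x. f x * indicator \<Omega> x \<partial>lborel)"
proof -
  have "(\<integral>\<^sup>+x. f x \<partial>lebesgue_on \<Omega>) = (\<integral>\<^sup>+x. f x * indicator \<Omega> x \<partial>lebesgue)"
    using open_lebesgue[OF assms] by (intro nn_integral_restrict_space) simp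
  then show ?thesis by (simp only: nn_integral_completion)
qed

lemma integral_lebesgue_on_supp:
  fixes h :: "'a::euclidean_space \<Rightarrow> 'b::euclidean_space"
  assumes "open \<Omega>" and hm: "h \<in> borel_measurable borel" and "\<And>x. x \<notin> \<Omega> \<Longrightarrow> h x = 0"
  shows "(\<integral>x. h x \<partial>lebesgue_on \<Omega>) = (\<integral>x. h x \<partial>lborel)"
proof -
  have e: "(\<lambda>x. indicator \<Omega> x *\<^sub>R h x) = h" using assms(3) by (auto simp: indicator_def)
  have "(\<integral>x. h x \<partial>lebesgue_on \<Omega>) = (\<integral>x. indicator \<Omega> x *\<^sub>R h x \<partial>lebesgue)"
    using open_lebesgue[OF assms(1)] by (intro integral_restrict_space) simp
  also have "... = (\<integral>x. h x \<partial>lborel)" unfolding e using hm by (intro integral_completion) simp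
  finally show ?thesis .
qed

lemma powr_sum_le:
  fixes a b p :: real
  assumes "p \<ge> 0" "a \<ge> 0" "b \<ge> 0"
  shows "(a + b) powr p \<le> 2 powr p * (a powr p + b powr p)"
proof -
  have "(a + b) powr p \<le> (2 * max a b) powr p" using assms by (intro powr_mono2) auto
  also have "... = 2 powr p * max a b powr p" by (rule powr_mult)
  also have "... \<le> 2 powr p * (a powr p + b powr p)"
    by (intro mult_left_mono) (auto simp: max_def)
  finally show ?thesis .
qed

lemma norm_powr_diff_le:
  fixes a b :: "'b::real_normed_vector"
  assumes "p \<ge> 0"
  shows "norm (a - b) powr p \<le> 2 powr p * (norm a powr p + norm b powr p)"
proof -
  have "norm (a - b) powr p \<le> (norm a + norm b) powr p"
    using assms by (intro powr_mono2 norm_triangle_ineq4) auto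
  also have "... \<le> 2 powr p * (norm a powr p + norm b powr p)" by (rule powr_sum_le) (use assms in auto)
  finally show ?thesis .
qed

lemma in_Lp_diff:
  assumes "p \<ge> 0" "in_Lp p \<Omega> f" "in_Lp p \<Omega> g"
  shows "in_Lp p \<Omega> (\<lambda>x. f x - g x)"
proof -
  have [measurable]: "f \<in> borel_measurable (lebesgue_on \<Omega>)" "g \<in> borel_measurable (lebesgue_on \<Omega>)"
    and i: "integrable (lebesgue_on \<Omega>) (\<lambda>x. norm (f x) powr p)" "integrable (lebesgue_on \<Omega>) (\<lambda>x. norm (g x) powr p)"
    using assms unfolding in_Lp_def by auto
  have "integrable (lebesgue_on \<Omega>) (\<lambda>x. norm (f x - g x) powr p)"
  proof (rule Bochner_Integration.integrable_bound)
    show "integrable (lebesgue_on \<Omega>) (\<lambda>x. 2 powr p * (norm (f x) powr p + norm (g x) powr p))" using i by simp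
    show "AE x in lebesgue_on \<Omega>. norm (norm (f x - g x) powr p) \<le> norm (2 powr p * (norm (f x) powr p + norm (g x) powr p))"
      using norm_powr_diff_le[OF assms(1)] by (intro AE_I2) simp
  qed simp
  then show ?thesis unfolding in_Lp_def by simp
qed

lemma in_Lp_bounded:
  assumes "open \<Omega>" "bounded \<Omega>" "p \<ge> 0" "f \<in> borel_measurable (lebesgue_on \<Omega>)" "\<And>x. x \<in> \<Omega> \<Longrightarrow> norm (f x) \<le> B"
  shows "in_Lp p \<Omega> f"
proof -
  interpret finite_measure "lebesgue_on \<Omega>" by (rule finite_measure_bounded_open[OF assms(1,2)])
  have [measurable]: "f \<in> borel_measurable (lebesgue_on \<Omega>)" by fact
  have "AE x in lebesgue_on \<Omega>. norm (norm (f x) powr p) \<le> B powr p"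
    using assms(3,5) by (intro AE_I2) (auto intro: powr_mono2)
  then have "integrable (lebesgue_on \<Omega>) (\<lambda>x. norm (f x) powr p)"
    by (rule integrable_const_bound) simp
  then show ?thesis unfolding in_Lp_def using assms(4) by simp
qed

lemma in_Lp_continuous_support:
  assumes "open \<Omega>" "bounded \<Omega>" "p \<ge> 0" "continuous_on UNIV f" "compact K" "\<And>x. x \<notin> K \<Longrightarrow> f x = 0"
  shows "in_Lp p \<Omega> f"
proof -
  obtain B where B: "\<And>x. norm (f x) \<le> B" using compact_support_bounded[OF assms(4,5,6)] by metis
  show ?thesis
    by (rule in_Lp_bounded[OF assms(1,2,3) _ B]) (intro borel_imp_lebesgue_on borel_measurable_continuous_onI assms)
qed

lemma in_Lp_test:
  assumes "open \<Omega>" "bounded \<Omega>" "p \<ge> 0" "test_function \<Omega> \<phi>"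
  shows "in_Lp p \<Omega> \<phi>" "in_Lp p \<Omega> (grad \<phi>)"
proof -
  obtain K where K: "compact K" "\<And>x. x \<notin> K \<Longrightarrow> \<phi> x = 0" "\<And>x. x \<notin> K \<Longrightarrow> grad \<phi> x = 0"
    using test_function_support[OF assms(4)] by metis
  show "in_Lp p \<Omega> \<phi>" by (rule in_Lp_continuous_support[OF assms(1-3) test_function_C1(2)[OF assms(4)] K(1,2)])
  show "in_Lp p \<Omega> (grad \<phi>)" by (rule in_Lp_continuous_support[OF assms(1-3) test_function_C1(3)[OF assms(4)] K(1,3)])
qed

lemma Lp_norm_tendsto_0:
  assumes "p > 0" "(\<lambda>k. Lp_norm p \<Omega> (f k)) \<longlonglongrightarrow> 0"
  shows "(\<lambda>k. \<integral>x. norm (f k x) powr p \<partial>lebesgue_on \<Omega>) \<longlonglongrightarrow> 0"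
proof -
  have "(\<lambda>k. Lp_norm p \<Omega> (f k) powr p) \<longlonglongrightarrow> 0 powr p"
    by (rule tendsto_powr'[OF assms(2) tendsto_const]) (use assms(1) in \<open>auto simp: Lp_norm_def\<close>)
  moreover have "Lp_norm p \<Omega> (f k) powr p = (\<integral>x. norm (f k x) powr p \<partial>lebesgue_on \<Omega>)" for k
  proof -
    have "0 \<le> (\<integral>x. norm (f k x) powr p \<partial>lebesgue_on \<Omega>)" by (rule Bochner_Integration.integral_nonneg) simp
    then show ?thesis using assms(1) by (simp add: Lp_norm_def powr_powr)
  qed
  ultimately show ?thesis using assms(1) by simp
qed

lemma W1p0_approx:
  assumes "open \<Omega>" "bounded \<Omega>" "p > 0" "W1p0 p \<Omega> u G"
  obtains \<phi> where "\<And>k::nat. test_function \<Omega> (\<phi> k)" "in_Lp p \<Omega> u" "in_Lp p \<Omega> G"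
    "\<And>k. in_Lp p \<Omega> (\<lambda>x. u x - \<phi> k x)" "\<And>k. in_Lp p \<Omega> (\<lambda>x. G x - grad (\<phi> k) x)"
    "(\<lambda>k. \<integral>x. norm (u x - \<phi> k x) powr p \<partial>lebesgue_on \<Omega>) \<longlonglongrightarrow> 0"
    "(\<lambda>k. \<integral>x. norm (G x - grad (\<phi> k) x) powr p \<partial>lebesgue_on \<Omega>) \<longlonglongrightarrow> 0"
proof -
  have L: "in_Lp p \<Omega> u" "in_Lp p \<Omega> G" using assms(4) unfolding W1p0_def W1p_def by auto
  obtain \<phi> where \<phi>: "\<And>k::nat. test_function \<Omega> (\<phi> k)"
    "(\<lambda>k. Lp_norm p \<Omega> (\<lambda>x. u x - \<phi> k x)) \<longlonglongrightarrow> 0"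
    "(\<lambda>k. Lp_norm p \<Omega> (\<lambda>x. G x - grad (\<phi> k) x)) \<longlonglongrightarrow> 0"
    using assms(4) unfolding W1p0_def by blast
  have p: "p \<ge> 0" using assms(3) by simp
  show ?thesis
  proof (rule that[OF \<phi>(1) L _ _ Lp_norm_tendsto_0[OF assms(3) \<phi>(2)] Lp_norm_tendsto_0[OF assms(3) \<phi>(3)]])
    show "in_Lp p \<Omega> (\<lambda>x. u x - \<phi> k x)" for k
      by (rule in_Lp_diff[OF p L(1) in_Lp_test(1)[OF assms(1,2) p \<phi>(1)]])
    show "in_Lp p \<Omega> (\<lambda>x. G x - grad (\<phi> k) x)" for k
      by (rule in_Lp_diff[OF p L(2) in_Lp_test(2)[OF assms(1,2) p \<phi>(1)]])
  qed
qed

text \<open>The case \<open>p = 1\<close> is separated because Hoelder's inequality is stated for exponents above 1.\<close>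

lemma in_Lp_integrable:
  fixes f :: "'a::euclidean_space \<Rightarrow> 'b::euclidean_space"
  assumes "open \<Omega>" "bounded \<Omega>" "p \<ge> 1" "in_Lp p \<Omega> f"
  shows "integrable (lebesgue_on \<Omega>) f"
    and "(\<integral>x. norm (f x) \<partial>lebesgue_on \<Omega>) \<le>
      measure (lebesgue_on \<Omega>) \<Omega> powr (1 - 1/p) * (\<integral>x. norm (f x) powr p \<partial>lebesgue_on \<Omega>) powr (1/p) \<or> p = 1"
proof -
  have fm: "f \<in> borel_measurable (lebesgue_on \<Omega>)" and i: "integrable (lebesgue_on \<Omega>) (\<lambda>x. norm (f x) powr p)"
    using assms(4) unfolding in_Lp_def by auto
  have nm: "(\<lambda>x. norm (f x)) \<in> borel_measurable (lebesgue_on \<Omega>)" using fm by measurable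
  have "integrable (lebesgue_on \<Omega>) (\<lambda>x. norm (f x)) \<and> ((\<integral>x. norm (f x) \<partial>lebesgue_on \<Omega>) \<le>
      measure (lebesgue_on \<Omega>) \<Omega> powr (1 - 1/p) * (\<integral>x. norm (f x) powr p \<partial>lebesgue_on \<Omega>) powr (1/p) \<or> p = 1)"
  proof (cases "p = 1")
    case True then show ?thesis using i by simp
  next
    case False
    then have p: "1 < p" using assms(3) by simp
    note P = powr_norm_mono_exponent[OF finite_measure_bounded_open[OF assms(1,2)] zero_less_one p nm norm_ge_zero i]
    have "(\<lambda>x. norm (f x) powr 1) = (\<lambda>x. norm (f x))" by simp
    moreover have "0 \<le> (\<integral>x. norm (f x) \<partial>lebesgue_on \<Omega>)" by (rule Bochner_Integration.integral_nonneg) simp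
    ultimately show ?thesis using P by (simp add: space_restrict_space)
  qed
  then show "integrable (lebesgue_on \<Omega>) f"
    "(\<integral>x. norm (f x) \<partial>lebesgue_on \<Omega>) \<le>
      measure (lebesgue_on \<Omega>) \<Omega> powr (1 - 1/p) * (\<integral>x. norm (f x) powr p \<partial>lebesgue_on \<Omega>) powr (1/p) \<or> p = 1"
    using integrable_norm_cancel[OF _ fm] by blast+
qed

lemma Lp_tendsto_imp_L1:
  fixes f :: "nat \<Rightarrow> 'a::euclidean_space \<Rightarrow> 'b::euclidean_space"
  assumes "open \<Omega>" "bounded \<Omega>" "p \<ge> 1" "\<And>k. in_Lp p \<Omega> (f k)"
    and lim: "(\<lambda>k. \<integral>x. norm (f k x) powr p \<partial>lebesgue_on \<Omega>) \<longlonglongrightarrow> 0"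
  shows "(\<lambda>k. \<integral>x. norm (f k x) \<partial>lebesgue_on \<Omega>) \<longlonglongrightarrow> 0"
proof (cases "p = 1")
  case True then show ?thesis using lim by simp
next
  case False
  have "(\<lambda>k. (\<integral>x. norm (f k x) powr p \<partial>lebesgue_on \<Omega>) powr (1/p)) \<longlonglongrightarrow> 0 powr (1/p)"
    by (rule tendsto_powr'[OF lim tendsto_const])
       (use assms(3) in \<open>auto intro!: always_eventually Bochner_Integration.integral_nonneg\<close>)
  then have "(\<lambda>k. measure (lebesgue_on \<Omega>) \<Omega> powr (1 - 1/p) * (\<integral>x. norm (f k x) powr p \<partial>lebesgue_on \<Omega>) powr (1/p)) \<longlonglongrightarrow> 0"
    using tendsto_mult_right_zero by force
  then show ?thesis
  proof (rule tendsto_0_le[where K=1], intro always_eventually allI)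
    fix k
    have "0 \<le> (\<integral>x. norm (f k x) \<partial>lebesgue_on \<Omega>)" by (rule Bochner_Integration.integral_nonneg) simp
    then show "norm (\<integral>x. norm (f k x) \<partial>lebesgue_on \<Omega>) \<le>
      norm (measure (lebesgue_on \<Omega>) \<Omega> powr (1 - 1/p) * (\<integral>x. norm (f k x) powr p \<partial>lebesgue_on \<Omega>) powr (1/p)) * 1"
      using in_Lp_integrable(2)[OF assms(1-4), of k] False by simp
  qed
qed

section \<open>Averages of functions with bounded weak gradient\<close>

lemma nn_integral_support:
  fixes F :: "'a::euclidean_space \<Rightarrow> ennreal"
  assumes "open \<Omega>" "\<And>x. x \<notin> \<Omega> \<Longrightarrow> F x = 0"
  shows "(\<integral>\<^sup>+x. F x \<partial>lborel) = (\<integral>\<^sup>+x. F x \<partial>lebesgue_on \<Omega>)"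
  unfolding nn_integral_lebesgue_on[OF assms(1)]
  by (intro nn_integral_cong) (use assms(2) in \<open>auto simp: indicator_def\<close>)

text \<open>Along the segment from \<open>x\<close> to \<open>y\<close> the ball of radius \<open>e\<close> is only translated, so the increment of the
  mean is at most \<open>|y - x|\<close> times the largest integral of \<open>|\<nabla>\<phi>|\<close> over such a ball. The gradient of
  \<open>\<phi>\<close> is then replaced by the limit gradient \<open>G\<close>. No power of the radius is lost, in contrast to
  Morrey's inequality, and this is what makes the Lipschitz constant of the limit sharp.\<close>

lemma test_average_bound:
  fixes \<phi> :: "'a::euclidean_space \<Rightarrow> real"
  assumes "open \<Omega>" "bounded \<Omega>" and t: "test_function \<Omega> \<phi>"
    and G: "integrable (lebesgue_on \<Omega>) G"
    and N: "\<And>c. (\<integral>\<^sup>+x. ennreal (norm (G x)) * indicator (cball c e) x \<partial>lebesgue_on \<Omega>) \<le> ennreal N"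
    and b: "(\<integral>x. norm (G x - grad \<phi> x) \<partial>lebesgue_on \<Omega>) \<le> b" and "N \<ge> 0"
  shows "(\<integral>\<^sup>+z. ennreal \<bar>\<phi> (y + z) - \<phi> (x + z)\<bar> * indicator (cball 0 e) z \<partial>lborel) \<le> ennreal (norm (y - x) * (N + b))"
proof -
  obtain K where K: "compact K" "K \<subseteq> \<Omega>" "\<And>x. x \<notin> K \<Longrightarrow> \<phi> x = 0" "\<And>x. x \<notin> K \<Longrightarrow> grad \<phi> x = 0"
    using test_function_support[OF t] by metis
  note C = test_function_C1[OF t]
  have [measurable]: "grad \<phi> \<in> borel_measurable borel" by (rule borel_measurable_continuous_onI[OF C(3)])
  have ig: "integrable (lebesgue_on \<Omega>) (grad \<phi>)"
    by (rule in_Lp_integrable(1)[OF assms(1,2), of 1]) (use in_Lp_test[OF assms(1,2) _ t] in auto)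
  have [measurable]: "grad \<phi> \<in> borel_measurable (lebesgue_on \<Omega>)" "G \<in> borel_measurable (lebesgue_on \<Omega>)"
    using ig G by auto
  have cm [measurable]: "cball c e \<inter> \<Omega> \<in> sets (lebesgue_on \<Omega>)" for c
    using open_lebesgue[OF assms(1)] by (simp add: sets_restrict_space_iff sets.Int)
  have "0 \<le> (\<integral>x. norm (G x - grad \<phi> x) \<partial>lebesgue_on \<Omega>)" by (rule Bochner_Integration.integral_nonneg) simp
  with b have bn: "b \<ge> 0" by linarith
  have "(\<integral>\<^sup>+z. ennreal (norm (grad \<phi> (w + z))) * indicator (cball 0 e) z \<partial>lborel) \<le> ennreal (N + b)" for w
  proof -
    have "(\<integral>\<^sup>+z. ennreal (norm (grad \<phi> (w + z))) * indicator (cball 0 e) z \<partial>lborel) =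
      (\<integral>\<^sup>+z. (\<lambda>x. ennreal (norm (grad \<phi> x)) * indicator (cball w e) x) (w + z) \<partial>lborel)"
      by (intro nn_integral_cong) (auto simp: indicator_def dist_norm)
    also have "... = (\<integral>\<^sup>+x. ennreal (norm (grad \<phi> x)) * indicator (cball w e) x \<partial>lborel)"
    proof (rule nn_integral_lborel_shift)
      have [measurable]: "cball w e \<in> sets borel" by simp
      show "(\<lambda>x. ennreal (norm (grad \<phi> x)) * indicator (cball w e) x) \<in> borel_measurable borel" by measurable
    qed
    also have "... = (\<integral>\<^sup>+x. ennreal (norm (grad \<phi> x)) * indicator (cball w e) x \<partial>lebesgue_on \<Omega>)"
      using K by (intro nn_integral_support assms) auto
    also have "... \<le> (\<integral>\<^sup>+x. ennreal (norm (G x)) * indicator (cball w e \<inter> \<Omega>) x + ennreal (norm (G x - grad \<phi> x)) \<partial>lebesgue_on \<Omega>)"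
    proof (rule nn_integral_mono)
      fix x assume "x \<in> space (lebesgue_on \<Omega>)"
      then have x: "x \<in> \<Omega>" by (simp add: space_restrict_space)
      have "norm (grad \<phi> x) \<le> norm (G x) + norm (G x - grad \<phi> x)"
        using norm_triangle_ineq4[of "G x" "G x - grad \<phi> x"] by simp
      then show "ennreal (norm (grad \<phi> x)) * indicator (cball w e) x \<le>
         ennreal (norm (G x)) * indicator (cball w e \<inter> \<Omega>) x + ennreal (norm (G x - grad \<phi> x))"
        using x by (auto simp: indicator_def ennreal_plus[symmetric] simp del: ennreal_plus intro!: ennreal_leI)
    qed
    also have "... = (\<integral>\<^sup>+x. ennreal (norm (G x)) * indicator (cball w e \<inter> \<Omega>) x \<partial>lebesgue_on \<Omega>) + (\<integral>\<^sup>+x. ennreal (norm (G x - grad \<phi> x)) \<partial>lebesgue_on \<Omega>)"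
      by (rule nn_integral_add) measurable
    also have "(\<integral>\<^sup>+x. ennreal (norm (G x)) * indicator (cball w e \<inter> \<Omega>) x \<partial>lebesgue_on \<Omega>) =
       (\<integral>\<^sup>+x. ennreal (norm (G x)) * indicator (cball w e) x \<partial>lebesgue_on \<Omega>)"
      by (intro nn_integral_cong) (auto simp: indicator_def space_restrict_space)
    also have "(\<integral>\<^sup>+x. ennreal (norm (G x - grad \<phi> x)) \<partial>lebesgue_on \<Omega>) = ennreal (\<integral>x. norm (G x - grad \<phi> x) \<partial>lebesgue_on \<Omega>)"
      using G ig by (intro nn_integral_eq_integral) auto
    also have "(\<integral>\<^sup>+x. ennreal (norm (G x)) * indicator (cball w e) x \<partial>lebesgue_on \<Omega>) + ennreal (\<integral>x. norm (G x - grad \<phi> x) \<partial>lebesgue_on \<Omega>)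
        \<le> ennreal N + ennreal b"
      by (intro add_mono N ennreal_leI b)
    finally show ?thesis using \<open>N \<ge> 0\<close> bn by simp
  qed
  then have "(\<integral>\<^sup>+z. ennreal \<bar>\<phi> (y + z) - \<phi> (x + z)\<bar> * indicator (cball 0 e) z \<partial>lborel) \<le> ennreal (norm (y - x)) * ennreal (N + b)"
    by (intro average_translate_bound[OF C(1,3)]) auto
  then show ?thesis using \<open>N \<ge> 0\<close> bn by (simp add: ennreal_mult)
qed

definition ball_average :: "real \<Rightarrow> ('a::euclidean_space \<Rightarrow> real) \<Rightarrow> 'a \<Rightarrow> real" where
  "ball_average e f x = (\<integral>z. indicator (cball 0 e) z *\<^sub>R f (x + z) \<partial>lborel) / measure lborel (cball (0::'a) e)"

lemma ball_average_integrable: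
  fixes f :: "'a::euclidean_space \<Rightarrow> real"
  assumes "continuous_on UNIV f"
  shows "integrable lborel (\<lambda>z. indicator (cball 0 e) z *\<^sub>R f (x + z))"
  by (intro borel_integrable_compact continuous_on_compose2[OF assms] continuous_intros) auto

lemma ball_average_diff:
  fixes f :: "'a::euclidean_space \<Rightarrow> real"
  assumes f: "continuous_on UNIV f" and e: "e > 0" and c: "c \<ge> 0"
    and le: "(\<integral>\<^sup>+z. ennreal \<bar>f (y + z) - f (x + z)\<bar> * indicator (cball 0 e) z \<partial>lborel) \<le> ennreal (c * measure lborel (cball (0::'a) e))"
  shows "\<bar>ball_average e f y - ball_average e f x\<bar> \<le> c"
proof -
  define v where "v = measure lborel (cball (0::'a) e)"
  have v: "v > 0" unfolding v_def using content_cball_pos[OF e] .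
  note i = ball_average_integrable[OF f, of e]
  have "ball_average e f y - ball_average e f x =
     (\<integral>z. indicator (cball 0 e) z *\<^sub>R f (y + z) - indicator (cball 0 e) z *\<^sub>R f (x + z) \<partial>lborel) / v"
    unfolding ball_average_def v_def using Bochner_Integration.integral_diff[OF i[of y] i[of x]]
    by (simp add: diff_divide_distrib)
  moreover have "ennreal (norm (\<integral>z. indicator (cball 0 e) z *\<^sub>R f (y + z) - indicator (cball 0 e) z *\<^sub>R f (x + z) \<partial>lborel))
     \<le> (\<integral>\<^sup>+z. ennreal (norm (indicator (cball 0 e) z *\<^sub>R f (y + z) - indicator (cball 0 e) z *\<^sub>R f (x + z))) \<partial>lborel)"
    by (intro integral_norm_bound_ennreal Bochner_Integration.integrable_diff i)
  moreover have "(\<integral>\<^sup>+z. ennreal (norm (indicator (cball 0 e) z *\<^sub>R f (y + z) - indicator (cball 0 e) z *\<^sub>R f (x + z))) \<partial>lborel)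
     = (\<integral>\<^sup>+z. ennreal \<bar>f (y + z) - f (x + z)\<bar> * indicator (cball 0 e) z \<partial>lborel)"
    by (intro nn_integral_cong) (auto simp: indicator_def)
  ultimately have "ennreal (\<bar>ball_average e f y - ball_average e f x\<bar> * v) \<le> ennreal (c * v)"
    using le v by (simp add: abs_divide v_def[symmetric])
  then have "\<bar>ball_average e f y - ball_average e f x\<bar> * v \<le> c * v"
    using c v by (subst (asm) ennreal_le_iff) auto
  then show ?thesis using v by (simp only: mult_le_cancel_right_pos)
qed

text \<open>Fubini's theorem reduces the claim to translations by vectors of length at most \<open>e\<close>.\<close>

lemma ball_average_close_L1:
  fixes f :: "'a::euclidean_space \<Rightarrow> real"
  assumes GD: "\<And>x. GDERIV f x :> g x" and cg: "continuous_on UNIV g" and e: "e > 0"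
    and bm: "ball_average e f \<in> borel_measurable borel"
  shows "(\<integral>\<^sup>+x. ennreal \<bar>ball_average e f x - f x\<bar> \<partial>lborel) \<le> ennreal e * (\<integral>\<^sup>+x. ennreal (norm (g x)) \<partial>lborel)"
proof -
  have cf: "continuous_on UNIV f" by (rule GDERIV_continuous_on[OF GD])
  note [measurable] = borel_measurable_continuous_onI[OF cf] borel_measurable_continuous_onI[OF cg]
  define v where "v = measure lborel (cball (0::'a) e)"
  have v: "v > 0" unfolding v_def using content_cball_pos[OF e] .
  have ev: "emeasure lborel (cball (0::'a) e) = ennreal v"
    unfolding v_def using emeasure_lborel_cball_finite[of "0::'a" e] by (simp add: emeasure_eq_ennreal_measure less_top)
  define I where "I = (\<integral>\<^sup>+x. ennreal (norm (g x)) \<partial>lborel)"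
  have pt: "ennreal v * ennreal \<bar>ball_average e f x - f x\<bar> \<le> (\<integral>\<^sup>+z. ennreal \<bar>f (x + z) - f x\<bar> * indicator (cball 0 e) z \<partial>lborel)" for x
  proof -
    note i = ball_average_integrable[OF cf, of e x]
    have i2: "integrable lborel (\<lambda>z. indicator (cball 0 e) z *\<^sub>R f x)"
      by (intro borel_integrable_compact) auto
    have iv: "(\<integral>z. indicator (cball (0::'a) e) z *\<^sub>R f x \<partial>lborel) = v * f x" by (simp add: v_def)
    have "v * (ball_average e f x - f x) = (\<integral>z. indicator (cball 0 e) z *\<^sub>R f (x + z) \<partial>lborel) - v * f x"
      using v by (simp add: ball_average_def v_def[symmetric] right_diff_distrib)
    also have "... = (\<integral>z. indicator (cball 0 e) z *\<^sub>R f (x + z) - indicator (cball 0 e) z *\<^sub>R f x \<partial>lborel)"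
      unfolding Bochner_Integration.integral_diff[OF i i2] iv ..
    finally have "ennreal (norm (v * (ball_average e f x - f x))) \<le>
       (\<integral>\<^sup>+z. ennreal (norm (indicator (cball 0 e) z *\<^sub>R f (x + z) - indicator (cball 0 e) z *\<^sub>R f x)) \<partial>lborel)"
      using integral_norm_bound_ennreal[OF Bochner_Integration.integrable_diff[OF i i2]] by simp
    also have "... = (\<integral>\<^sup>+z. ennreal \<bar>f (x + z) - f x\<bar> * indicator (cball 0 e) z \<partial>lborel)"
      by (intro nn_integral_cong) (auto simp: indicator_def)
    finally show ?thesis using v by (simp add: abs_mult ennreal_mult)
  qed
  note [measurable] = bm
  have [measurable]: "cball (0::'a) e \<in> sets borel" by simp
  have "ennreal v * (\<integral>\<^sup>+x. ennreal \<bar>ball_average e f x - f x\<bar> \<partial>lborel) = (\<integral>\<^sup>+x. ennreal v * ennreal \<bar>ball_average e f x - f x\<bar> \<partial>lborel)"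
    by (rule nn_integral_cmult[symmetric]) measurable
  also have "... \<le> (\<integral>\<^sup>+x. (\<integral>\<^sup>+z. ennreal \<bar>f (x + z) - f x\<bar> * indicator (cball 0 e) z \<partial>lborel) \<partial>lborel)"
    by (intro nn_integral_mono pt)
  also have "... = (\<integral>\<^sup>+z. (\<integral>\<^sup>+x. ennreal \<bar>f (x + z) - f x\<bar> * indicator (cball 0 e) z \<partial>lborel) \<partial>lborel)"
    by (rule lborel_pair.Fubini'[symmetric]) measurable
  also have "... \<le> (\<integral>\<^sup>+z. (ennreal e * I) * indicator (cball (0::'a) e) z \<partial>lborel)"
  proof (rule nn_integral_mono)
    fix z :: 'a
    have "(\<integral>\<^sup>+x. ennreal \<bar>f (x + z) - f x\<bar> \<partial>lborel) \<le> ennreal e * I" if "z \<in> cball 0 e"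
    proof -
      have "(\<integral>\<^sup>+x. ennreal \<bar>f (x + z) - f x\<bar> \<partial>lborel) \<le> ennreal (norm z) * I"
        unfolding I_def by (rule translate_L1_bound[OF GD cg])
      also have "... \<le> ennreal e * I" using that by (intro mult_right_mono ennreal_leI) auto
      finally show ?thesis .
    qed
    then show "(\<integral>\<^sup>+x. ennreal \<bar>f (x + z) - f x\<bar> * indicator (cball 0 e) z \<partial>lborel) \<le> (ennreal e * I) * indicator (cball (0::'a) e) z"
      by (cases "z \<in> cball 0 e") auto
  qed
  also have "... = (ennreal e * I) * ennreal v" by (simp add: nn_integral_cmult_indicator ev)
  finally have "ennreal v * (\<integral>\<^sup>+x. ennreal \<bar>ball_average e f x - f x\<bar> \<partial>lborel) \<le> ennreal v * (ennreal e * I)"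
    by (simp add: mult.commute)
  then show ?thesis unfolding I_def[symmetric] using v
    by (simp add: ennreal_mult_le_mult_iff)
qed

lemma continuous_on_lipschitz_bound:
  fixes f :: "'a::euclidean_space \<Rightarrow> real"
  assumes "\<And>x y. \<bar>f y - f x\<bar> \<le> L * norm (y - x)"
  shows "continuous_on UNIV f"
proof (rule lipschitz_on_continuous_on[of "max L 0"], rule lipschitz_onI)
  fix x y
  have "\<bar>f x - f y\<bar> \<le> L * norm (x - y)" by (rule assms)
  also have "... \<le> max L 0 * norm (x - y)" by (intro mult_right_mono) auto
  finally show "dist (f x) (f y) \<le> max L 0 * dist x y" by (simp add: dist_norm)
qed simp

text \<open>Means of approximating test functions over small balls are Lipschitz with a constant tending to
  \<open>L\<close>, converge to \<open>u\<close> in \<open>L^1\<close> and vanish at any interior point of the complement once the radius is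
  small. Such a point exists within \<open>R + d\<close> of every point of \<open>\<Omega>\<close>, for each \<open>d > 0\<close>.\<close>

lemma W11_sup_bound:
  fixes \<Omega> :: "'a::euclidean_space set"
  assumes "open \<Omega>" "bounded \<Omega>"
    and ext: "\<And>y d. y \<notin> \<Omega> \<Longrightarrow> d > 0 \<Longrightarrow> \<exists>y'. dist y y' < d \<and> y' \<in> interior (- \<Omega>)"
    and R: "\<And>x. x \<in> \<Omega> \<Longrightarrow> infdist x (- \<Omega>) \<le> R" and ne: "\<Omega> \<noteq> UNIV"
    and W: "W1p0 1 \<Omega> u G" and L: "AE x in lebesgue_on \<Omega>. norm (G x) \<le> L" and "L \<ge> 0"
  shows "AE x in lebesgue_on \<Omega>. \<bar>u x\<bar> \<le> L * R"
proof -
  obtain \<phi> where \<phi>: "\<And>k::nat. test_function \<Omega> (\<phi> k)" "in_Lp 1 \<Omega> u" "in_Lp 1 \<Omega> G"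
    "\<And>k. in_Lp 1 \<Omega> (\<lambda>x. u x - \<phi> k x)" "\<And>k. in_Lp 1 \<Omega> (\<lambda>x. G x - grad (\<phi> k) x)"
    "(\<lambda>k. \<integral>x. norm (u x - \<phi> k x) powr 1 \<partial>lebesgue_on \<Omega>) \<longlonglongrightarrow> 0"
    "(\<lambda>k. \<integral>x. norm (G x - grad (\<phi> k) x) powr 1 \<partial>lebesgue_on \<Omega>) \<longlonglongrightarrow> 0"
    using W1p0_approx[OF assms(1,2) zero_less_one W] by blast
  have iu: "integrable (lebesgue_on \<Omega>) u" and iG: "integrable (lebesgue_on \<Omega>) G"
    using in_Lp_integrable(1)[OF assms(1,2), of 1] \<phi> by auto
  define e where "e = (\<lambda>n::nat. inverse (real (Suc n)))"
  have e: "e n > 0" for n by (simp add: e_def)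
  have elim: "e \<longlonglongrightarrow> 0" unfolding e_def by (rule LIMSEQ_inverse_real_of_nat)
  define v where "v = (\<lambda>n. measure lborel (cball (0::'a) (e n)))"
  have v: "v n > 0" for n unfolding v_def using content_cball_pos[OF e] .
  \<comment> \<open>The gradients must be close relative to the volume \<open>v n\<close> of the ball over which
    they are averaged.\<close>
  have "\<exists>j. (\<integral>x. norm (u x - \<phi> j x) \<partial>lebesgue_on \<Omega>) \<le> e n \<and> (\<integral>x. norm (G x - grad (\<phi> j) x) \<partial>lebesgue_on \<Omega>) \<le> v n * e n" for n
  proof -
    have a: "(\<lambda>k. \<integral>x. norm (u x - \<phi> k x) \<partial>lebesgue_on \<Omega>) \<longlonglongrightarrow> 0"
      and b: "(\<lambda>k. \<integral>x. norm (G x - grad (\<phi> k) x) \<partial>lebesgue_on \<Omega>) \<longlonglongrightarrow> 0"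
      using \<phi>(6,7) by simp_all
    have "eventually (\<lambda>k. (\<integral>x. norm (u x - \<phi> k x) \<partial>lebesgue_on \<Omega>) < e n) sequentially"
      by (rule order_tendstoD(2)[OF a e])
    moreover have "eventually (\<lambda>k. (\<integral>x. norm (G x - grad (\<phi> k) x) \<partial>lebesgue_on \<Omega>) < v n * e n) sequentially"
      by (rule order_tendstoD(2)[OF b]) (use e v in simp)
    ultimately have "eventually (\<lambda>k. (\<integral>x. norm (u x - \<phi> k x) \<partial>lebesgue_on \<Omega>) < e n \<and>
       (\<integral>x. norm (G x - grad (\<phi> k) x) \<partial>lebesgue_on \<Omega>) < v n * e n) sequentially" by (rule eventually_conj)
    then show ?thesis by (metis (no_types, lifting) eventually_happens' less_imp_le trivial_limit_sequentially)
  qed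
  then obtain j where j: "\<And>n. (\<integral>x. norm (u x - \<phi> (j n) x) \<partial>lebesgue_on \<Omega>) \<le> e n"
     "\<And>n. (\<integral>x. norm (G x - grad (\<phi> (j n)) x) \<partial>lebesgue_on \<Omega>) \<le> v n * e n" by metis
  define \<psi> where "\<psi> = (\<lambda>n. \<phi> (j n))"
  have \<psi>t: "test_function \<Omega> (\<psi> n)" for n unfolding \<psi>_def by (rule \<phi>(1))
  note C = test_function_C1[OF \<psi>t]
  define A where "A = (\<lambda>n. ball_average (e n) (\<psi> n))"
  have lip: "\<bar>A n y - A n x\<bar> \<le> (L + e n) * norm (y - x)" for n x y
  proof -
    have "(\<integral>\<^sup>+z. ennreal \<bar>\<psi> n (y + z) - \<psi> n (x + z)\<bar> * indicator (cball 0 (e n)) z \<partial>lborel)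
      \<le> ennreal (norm (y - x) * (L * v n + v n * e n))"
    proof (rule test_average_bound[OF assms(1,2) \<psi>t iG])
      fix c
      have "(\<integral>\<^sup>+x. ennreal (norm (G x)) * indicator (cball c (e n)) x \<partial>lebesgue_on \<Omega>) \<le>
         (\<integral>\<^sup>+x. ennreal L * indicator (cball c (e n)) x \<partial>lebesgue_on \<Omega>)"
      proof (rule nn_integral_mono_AE)
        show "AE x in lebesgue_on \<Omega>. ennreal (norm (G x)) * indicator (cball c (e n)) x \<le> ennreal L * indicator (cball c (e n)) x"
          using L by eventually_elim (auto simp: indicator_def intro: ennreal_leI)
      qed
      also have "... \<le> (\<integral>\<^sup>+x. ennreal L * indicator (cball c (e n)) x \<partial>lborel)"
        unfolding nn_integral_lebesgue_on[OF assms(1)] by (intro nn_integral_mono) (auto simp: indicator_def)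
      also have "... = ennreal L * emeasure lborel (cball c (e n))" by (intro nn_integral_cmult_indicator) simp
      also have "emeasure lborel (cball c (e n)) = ennreal (v n)"
      proof -
        have "emeasure lborel (cball c (e n)) = ennreal (measure lborel (cball c (e n)))"
          using emeasure_lborel_cball_finite[of c "e n"] by (simp add: emeasure_eq_ennreal_measure less_top)
        moreover have "measure lborel (cball c (e n)) = v n"
          unfolding v_def content_cball_conv_ball
          using content_ball_conv_unit_ball[of "e n" c] content_ball_conv_unit_ball[of "e n" "0::'a"] e[of n] by simp
        ultimately show ?thesis by simp
      qed
      finally show "(\<integral>\<^sup>+x. ennreal (norm (G x)) * indicator (cball c (e n)) x \<partial>lebesgue_on \<Omega>) \<le> ennreal (L * v n)"
        using \<open>L \<ge> 0\<close> v[of n] by (simp add: ennreal_mult)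
    qed (use j \<open>L \<ge> 0\<close> v[of n] in \<open>auto simp: \<psi>_def\<close>)
    also have "norm (y - x) * (L * v n + v n * e n) = ((L + e n) * norm (y - x)) * v n"
      by (simp add: algebra_simps)
    finally have le: "(\<integral>\<^sup>+z. ennreal \<bar>\<psi> n (y + z) - \<psi> n (x + z)\<bar> * indicator (cball 0 (e n)) z \<partial>lborel)
      \<le> ennreal (((L + e n) * norm (y - x)) * measure lborel (cball (0::'a) (e n)))" by (simp only: v_def)
    have "0 \<le> (L + e n) * norm (y - x)" using \<open>L \<ge> 0\<close> e[of n] by simp
    from ball_average_diff[OF C(2) e this le] show ?thesis unfolding A_def .
  qed
  have A0: "A n y = 0" if "cball y (e n) \<subseteq> - \<Omega>" for n y
  proof -
    obtain K where K: "K \<subseteq> \<Omega>" "\<And>x. x \<notin> K \<Longrightarrow> \<psi> n x = 0" using test_function_support[OF \<psi>t[of n]] by metis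
    have z0: "indicator (cball 0 (e n)) z *\<^sub>R \<psi> n (y + z) = (0::real)" for z
    proof (cases "z \<in> cball 0 (e n)")
      case True
      then have "y + z \<in> cball y (e n)" by (simp add: dist_norm)
      then have "y + z \<notin> K" using that K(1) by blast
      then show ?thesis using K(2) by simp
    qed simp
    have "(\<lambda>z. indicator (cball 0 (e n)) z *\<^sub>R \<psi> n (y + z)) = (\<lambda>z. 0::real)" by (simp only: z0)
    then show ?thesis unfolding A_def ball_average_def by (simp only: Bochner_Integration.integral_zero div_0)
  qed
  have Ab: "A n \<in> borel_measurable borel" for n
    by (rule borel_measurable_continuous_onI, rule continuous_on_lipschitz_bound[where f="A n" and L="L + e n"], rule lip)
  have Am: "A n \<in> borel_measurable (lebesgue_on \<Omega>)" for n
    by (rule borel_imp_lebesgue_on[OF Ab])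
  have um: "u \<in> borel_measurable (lebesgue_on \<Omega>)" using iu by auto
  define M where "M = (\<integral>x. norm (G x) \<partial>lebesgue_on \<Omega>)"
  have M: "M \<ge> 0" unfolding M_def by (rule Bochner_Integration.integral_nonneg) simp
  have bound: "(\<integral>\<^sup>+x. ennreal (norm (A n x - u x)) \<partial>lebesgue_on \<Omega>) \<le> ennreal (e n * (M + v n * e n) + e n)" for n
  proof -
    have ip: "integrable (lebesgue_on \<Omega>) (\<lambda>x. u x - \<psi> n x)" "integrable (lebesgue_on \<Omega>) (\<lambda>x. G x - grad (\<psi> n) x)"
      "integrable (lebesgue_on \<Omega>) (\<psi> n)" "integrable (lebesgue_on \<Omega>) (grad (\<psi> n))"
      using in_Lp_integrable(1)[OF assms(1,2), of 1] \<phi>(4,5) in_Lp_test[OF assms(1,2) _ \<psi>t[of n], of 1] unfolding \<psi>_def by auto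
    have [measurable]: "A n \<in> borel_measurable (lebesgue_on \<Omega>)" "u \<in> borel_measurable (lebesgue_on \<Omega>)"
      "\<psi> n \<in> borel_measurable (lebesgue_on \<Omega>)" using Am um ip by auto
    have g: "(\<integral>\<^sup>+x. ennreal (norm (grad (\<psi> n) x)) \<partial>lborel) \<le> ennreal (M + v n * e n)"
    proof -
      obtain K where K: "K \<subseteq> \<Omega>" "\<And>x. x \<notin> K \<Longrightarrow> grad (\<psi> n) x = 0" using test_function_support[OF \<psi>t[of n]] by metis
      have "(\<integral>\<^sup>+x. ennreal (norm (grad (\<psi> n) x)) \<partial>lborel) = (\<integral>\<^sup>+x. ennreal (norm (grad (\<psi> n) x)) \<partial>lebesgue_on \<Omega>)"
        by (intro nn_integral_support assms) (use K in auto)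
      also have "... = ennreal (\<integral>x. norm (grad (\<psi> n) x) \<partial>lebesgue_on \<Omega>)"
        using ip(4) by (intro nn_integral_eq_integral) auto
      also have "... \<le> ennreal (M + v n * e n)"
      proof (rule ennreal_leI)
        have "(\<integral>x. norm (grad (\<psi> n) x) \<partial>lebesgue_on \<Omega>) \<le> (\<integral>x. norm (G x) + norm (G x - grad (\<psi> n) x) \<partial>lebesgue_on \<Omega>)"
          using ip iG norm_triangle_ineq4[of "G x" "G x - grad (\<psi> n) x" for x] by (intro integral_mono) auto
        also have "... = M + (\<integral>x. norm (G x - grad (\<psi> n) x) \<partial>lebesgue_on \<Omega>)"
          unfolding M_def using ip iG by (intro Bochner_Integration.integral_add) auto
        also have "... \<le> M + v n * e n" using j(2)[of n] by (simp add: \<psi>_def)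
        finally show "(\<integral>x. norm (grad (\<psi> n) x) \<partial>lebesgue_on \<Omega>) \<le> M + v n * e n" .
      qed
      finally show ?thesis .
    qed
    have "(\<integral>\<^sup>+x. ennreal (norm (A n x - u x)) \<partial>lebesgue_on \<Omega>) \<le>
       (\<integral>\<^sup>+x. ennreal \<bar>A n x - \<psi> n x\<bar> + ennreal (norm (u x - \<psi> n x)) \<partial>lebesgue_on \<Omega>)"
      by (intro nn_integral_mono) (auto simp: ennreal_plus[symmetric] simp del: ennreal_plus intro!: ennreal_leI)
    also have "... = (\<integral>\<^sup>+x. ennreal \<bar>A n x - \<psi> n x\<bar> \<partial>lebesgue_on \<Omega>) + (\<integral>\<^sup>+x. ennreal (norm (u x - \<psi> n x)) \<partial>lebesgue_on \<Omega>)"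
      by (rule nn_integral_add) measurable
    also have "(\<integral>\<^sup>+x. ennreal (norm (u x - \<psi> n x)) \<partial>lebesgue_on \<Omega>) = ennreal (\<integral>x. norm (u x - \<psi> n x) \<partial>lebesgue_on \<Omega>)"
      using ip by (intro nn_integral_eq_integral) auto
    also have "(\<integral>\<^sup>+x. ennreal \<bar>A n x - \<psi> n x\<bar> \<partial>lebesgue_on \<Omega>) \<le> (\<integral>\<^sup>+x. ennreal \<bar>A n x - \<psi> n x\<bar> \<partial>lborel)"
      unfolding nn_integral_lebesgue_on[OF assms(1)] by (intro nn_integral_mono) (auto simp: indicator_def)
    also have "... \<le> ennreal (e n) * (\<integral>\<^sup>+x. ennreal (norm (grad (\<psi> n) x)) \<partial>lborel)"
      unfolding A_def by (rule ball_average_close_L1[OF C(1,3) e Ab[unfolded A_def]])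
    also have "... \<le> ennreal (e n) * ennreal (M + v n * e n)" by (intro mult_left_mono g) simp
    also have "ennreal (\<integral>x. norm (u x - \<psi> n x) \<partial>lebesgue_on \<Omega>) \<le> ennreal (e n)"
      using j(1)[of n] by (intro ennreal_leI) (simp add: \<psi>_def)
    finally show ?thesis using M v[of n] e[of n] by (simp add: ennreal_mult)
  qed
  have iA: "integrable (lebesgue_on \<Omega>) (\<lambda>x. A n x - u x)" for n
  proof (rule integrableI_bounded)
    show "(\<lambda>x. A n x - u x) \<in> borel_measurable (lebesgue_on \<Omega>)" by (rule borel_measurable_diff[OF Am um])
    show "(\<integral>\<^sup>+x. ennreal (norm (A n x - u x)) \<partial>lebesgue_on \<Omega>) < \<infinity>"
      by (rule le_less_trans[OF bound]) simp
  qed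
  have v1: "v n \<le> measure lborel (cball (0::'a) 1)" for n
  proof -
    have "e n \<le> 1" by (simp add: e_def inverse_le_1_iff)
    then show ?thesis unfolding v_def
      by (intro measure_mono_fmeasurable[OF subset_cball _ fmeasurableI[OF _ emeasure_lborel_cball_finite]]) simp_all
  qed
  have "(\<lambda>n. \<integral>x. norm (A n x - u x) \<partial>lebesgue_on \<Omega>) \<longlonglongrightarrow> 0"
  proof (rule tendsto_sandwich[OF _ _ tendsto_const])
    show "\<forall>\<^sub>F n in sequentially. 0 \<le> (\<integral>x. norm (A n x - u x) \<partial>lebesgue_on \<Omega>)"
      by (intro always_eventually allI Bochner_Integration.integral_nonneg) simp
    show "\<forall>\<^sub>F n in sequentially. (\<integral>x. norm (A n x - u x) \<partial>lebesgue_on \<Omega>) \<le> e n * (M + measure lborel (cball (0::'a) 1) * e n) + e n"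
    proof (intro always_eventually allI)
      fix n
      have "ennreal (\<integral>x. norm (A n x - u x) \<partial>lebesgue_on \<Omega>) = (\<integral>\<^sup>+x. ennreal (norm (A n x - u x)) \<partial>lebesgue_on \<Omega>)"
        using iA by (intro nn_integral_eq_integral[symmetric]) auto
      then have "ennreal (\<integral>x. norm (A n x - u x) \<partial>lebesgue_on \<Omega>) \<le> ennreal (e n * (M + v n * e n) + e n)"
        using bound[of n] by simp
      then have "(\<integral>x. norm (A n x - u x) \<partial>lebesgue_on \<Omega>) \<le> e n * (M + v n * e n) + e n"
        using M v[of n] e[of n] by (subst (asm) ennreal_le_iff) auto
      also have "... \<le> e n * (M + measure lborel (cball (0::'a) 1) * e n) + e n"
        using v1[of n] e[of n] by (intro add_mono mult_left_mono mult_right_mono) auto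
      finally show "(\<integral>x. norm (A n x - u x) \<partial>lebesgue_on \<Omega>) \<le> e n * (M + measure lborel (cball (0::'a) 1) * e n) + e n" .
    qed
    have "(\<lambda>n. e n * (M + measure lborel (cball (0::'a) 1) * e n) + e n) \<longlonglongrightarrow> 0 * (M + measure lborel (cball (0::'a) 1) * 0) + 0"
      by (intro tendsto_intros elim)
    then show "(\<lambda>n. e n * (M + measure lborel (cball (0::'a) 1) * e n) + e n) \<longlonglongrightarrow> 0" by simp
  qed
  from tendsto_L1_AE_subseq[OF iA this] obtain r where r: "strict_mono r"
    "AE x in lebesgue_on \<Omega>. (\<lambda>n. A (r n) x - u x) \<longlonglongrightarrow> 0" by blast
  have er: "(\<lambda>n. e (r n)) \<longlonglongrightarrow> 0" using LIMSEQ_subseq_LIMSEQ[OF elim r(1)] by (simp add: o_def)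
  show ?thesis
    using r(2) AE_space
  proof eventually_elim
    case (elim x)
    then have x: "x \<in> \<Omega>" by (simp add: space_restrict_space)
    have lim: "(\<lambda>n. A (r n) x) \<longlonglongrightarrow> u x" using elim(1) by (simp add: LIM_zero_iff)
    have "\<bar>u x\<bar> \<le> L * (R + d)" if d: "d > 0" for d
    proof -
      have "infdist x (- \<Omega>) < R + d/2" using R[OF x] d by simp
      moreover have ne': "- \<Omega> \<noteq> {}" using ne by blast
      ultimately have "(INF y\<in>- \<Omega>. dist x y) < R + d/2" using infdist_notempty[OF ne', of x] by simp
      moreover have "bdd_below (dist x ` (- \<Omega>))" by (rule bdd_belowI2[where m=0]) simp
      ultimately have "\<exists>y\<in>- \<Omega>. dist x y < R + d/2" using cINF_less_iff[OF ne'] by metis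
      then obtain y where y: "y \<notin> \<Omega>" "dist x y < R + d/2" by blast
      obtain y' where y': "dist y y' < d/2" "y' \<in> interior (- \<Omega>)" using ext[OF y(1), of "d/2"] d by auto
      have dx: "norm (x - y') \<le> R + d" using y y' dist_triangle[of x y' y] by (simp add: dist_norm)
      obtain \<rho> where \<rho>: "\<rho> > 0" "cball y' \<rho> \<subseteq> - \<Omega>" using y'(2) mem_interior_cball by blast
      have ev: "eventually (\<lambda>n. e (r n) < \<rho>) sequentially" by (rule order_tendstoD(2)[OF er \<rho>(1)])
      have le: "eventually (\<lambda>n. \<bar>A (r n) x\<bar> \<le> (L + e (r n)) * (R + d)) sequentially"
        using ev
      proof eventually_elim
        case (elim n)
        then have "A (r n) y' = 0" using \<rho>(2) by (intro A0) (auto simp: subset_iff)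
        then have "\<bar>A (r n) x\<bar> \<le> (L + e (r n)) * norm (x - y')" using lip[of "r n" x y'] by simp
        also have "... \<le> (L + e (r n)) * (R + d)" using dx \<open>L \<ge> 0\<close> e[of "r n"] by (intro mult_left_mono) auto
        finally show ?case .
      qed
      have "(\<lambda>n. (L + e (r n)) * (R + d)) \<longlonglongrightarrow> (L + 0) * (R + d)" by (intro tendsto_intros er)
      from tendsto_le[OF trivial_limit_sequentially this tendsto_rabs[OF lim] le]
      have "\<bar>u x\<bar> \<le> (L + 0) * (R + d)" .
      then show ?thesis by simp
    qed
    note bnd = this
    have "((\<lambda>d. L * (R + d)) \<longlongrightarrow> L * (R + 0)) (at_right 0)" by (intro tendsto_intros)
    moreover have "eventually (\<lambda>d. \<bar>u x\<bar> \<le> L * (R + d)) (at_right 0)"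
      using eventually_at_right_less[of 0] by eventually_elim (rule bnd)
    ultimately have "\<bar>u x\<bar> \<le> L * (R + 0)" by (rule tendsto_lowerbound) simp
    then show ?case by simp
  qed
qed

section \<open>Regularity of Sobolev functions for large exponents\<close>

text \<open>The constant of Morrey's inequality for the exponent \<open>2n\<close>, with a factor that absorbs the passage
  from that exponent to any larger \<open>p\<close>. It is essential that it does not depend on \<open>p\<close>.\<close>

definition morrey_const :: "'a::euclidean_space set \<Rightarrow> real" where
  "morrey_const \<Omega> = 8 * measure lborel (ball (0::'a) 1) powr (-1 / (2 * real DIM('a))) *
     max 1 (measure (lebesgue_on \<Omega>) \<Omega>)"

lemma morrey_const_nonneg: "morrey_const \<Omega> \<ge> 0"
  unfolding morrey_const_def by (intro mult_nonneg_nonneg) auto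

lemma morrey_on:
  fixes f :: "'a::euclidean_space \<Rightarrow> real"
  assumes "open \<Omega>" "bounded \<Omega>" and p: "2 * real DIM('a) < p"
    and GD: "\<And>x. GDERIV f x :> g x" and cg: "continuous_on UNIV g"
    and K: "compact K" "K \<subseteq> \<Omega>" "\<And>x. x \<notin> K \<Longrightarrow> g x = 0"
  shows "\<bar>f x - f y\<bar> \<le> morrey_const \<Omega> * sqrt (norm (x - y)) *
    (\<integral>z. norm (g z) powr p \<partial>lebesgue_on \<Omega>) powr (1/p)"
proof -
  define m where "m = 2 * real DIM('a)"
  have n1: "real DIM('a) \<ge> 1" using DIM_positive[where 'a='a] by linarith
  have m: "m > 1" "m > 0" "m < p" using n1 p unfolding m_def by linarith+
  define \<mu> where "\<mu> = measure (lebesgue_on \<Omega>) \<Omega>"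
  have \<mu>: "\<mu> \<ge> 0" by (simp add: \<mu>_def)
  define I where "I = (\<integral>z. norm (g z) powr p \<partial>lebesgue_on \<Omega>) powr (1/p)"
  have I: "I \<ge> 0" by (simp add: I_def)
  have cm: "(\<lambda>x. norm (g x)) \<in> borel_measurable (lebesgue_on \<Omega>)"
    by (intro borel_imp_lebesgue_on borel_measurable_continuous_onI continuous_intros cg)
  have p0: "p \<ge> 0" using m by linarith
  have i: "integrable (lebesgue_on \<Omega>) (\<lambda>x. norm (g x) powr p)"
    using in_Lp_continuous_support[OF assms(1,2) p0 cg K(1,3)] unfolding in_Lp_def by simp
  have e: "(\<integral>z. norm (g z) powr m \<partial>lborel) = (\<integral>z. norm (g z) powr m \<partial>lebesgue_on \<Omega>)"
  proof (rule integral_lebesgue_on_supp[symmetric, OF assms(1)])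
    show "(\<lambda>z. norm (g z) powr m) \<in> borel_measurable borel"
      by (intro borel_measurable_continuous_onI continuous_on_norm_powr cg m)
    show "norm (g x) powr m = 0" if "x \<notin> \<Omega>" for x using K that by auto
  qed
  have "(\<integral>z. norm (g z) powr m \<partial>lebesgue_on \<Omega>) powr (1/m) \<le> \<mu> powr (1/m - 1/p) * I"
    using powr_norm_mono_exponent(2)[OF finite_measure_bounded_open[OF assms(1,2)] m(2,3) cm norm_ge_zero i]
    by (simp add: space_restrict_space \<mu>_def I_def)
  also have "\<mu> powr (1/m - 1/p) \<le> max 1 \<mu>"
  proof -
    have "1/p \<le> 1/m" "1/m \<le> 1" "0 \<le> 1/p" using m by (auto intro: frac_le)
    then have ex: "0 \<le> 1/m - 1/p" "1/m - 1/p \<le> 1" by linarith+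
    have "\<mu> powr (1/m - 1/p) \<le> (max 1 \<mu>) powr (1/m - 1/p)" using \<mu> ex by (intro powr_mono2) auto
    also have "... \<le> (max 1 \<mu>) powr 1" using ex by (intro powr_mono) auto
    finally show ?thesis by simp
  qed
  finally have k: "(\<integral>z. norm (g z) powr m \<partial>lborel) powr (1/m) \<le> max 1 \<mu> * I" unfolding e using I
    by (meson mult_right_mono order_trans)
  have "\<bar>f x - f y\<bar> \<le> 8 * measure lborel (ball (0::'a) 1) powr (-1/m) * sqrt (norm (x - y)) *
     (\<integral>z. norm (g z) powr m \<partial>lborel) powr (1/m)"
    unfolding m_def by (rule morrey[OF GD cg K(1,3)])
  also have "... \<le> 8 * measure lborel (ball (0::'a) 1) powr (-1/m) * sqrt (norm (x - y)) * (max 1 \<mu> * I)"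
    by (intro mult_left_mono k) auto
  also have "... = morrey_const \<Omega> * sqrt (norm (x - y)) * I"
    by (simp only: morrey_const_def m_def \<mu>_def mult_ac)
  finally show ?thesis unfolding I_def .
qed

definition zero_ext :: "'a set \<Rightarrow> ('a \<Rightarrow> real) \<Rightarrow> 'a \<Rightarrow> real" where
  "zero_ext \<Omega> u x = (if x \<in> \<Omega> then u x else 0)"

text \<open>The set where a continuous function exceeds \<open>c\<close> is open, and a nonempty open set has positive
  measure.\<close>

lemma AE_lebesgue_on_open_imp:
  fixes f :: "'a::euclidean_space \<Rightarrow> real"
  assumes "open \<Omega>" "continuous_on \<Omega> f" "AE x in lebesgue_on \<Omega>. f x \<le> c" "x \<in> \<Omega>"
  shows "f x \<le> c"
proof (rule ccontr)
  assume n: "\<not> f x \<le> c"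
  define S where "S = \<Omega> \<inter> f -` {c<..}"
  have "open S" unfolding S_def using continuous_openin_preimage_gen[OF assms(2), of "{c<..}"]
    assms(1) openin_open_trans[of \<Omega> "\<Omega> \<inter> f -` {c<..}"] by (metis open_greaterThan openin_open_eq)
  moreover have "x \<in> S" using n assms(4) by (simp add: S_def)
  ultimately obtain r where r: "r > 0" "ball x r \<subseteq> S" using open_contains_ball by blast
  have "AE x in lebesgue. x \<in> \<Omega> \<longrightarrow> f x \<le> c"
    using assms(3) open_lebesgue[OF assms(1)] by (subst (asm) AE_restrict_space_iff) auto
  then have "AE y in lebesgue. y \<notin> ball x r"
  proof eventually_elim
    case (elim y)
    show ?case
    proof
      assume "y \<in> ball x r"
      then have "y \<in> S" using r(2) by blast
      then show False using elim by (simp add: S_def)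
    qed
  qed
  then have "ball x r \<in> null_sets lebesgue" by (subst AE_iff_null_sets) auto
  then have "measure lebesgue (ball x r) = 0" by (rule measure_eq_0_null_sets)
  then have "measure lborel (ball x r) = 0" by simp
  then show False using content_ball_pos[OF r(1), of x] by simp
qed

lemma ball_average_dist:
  fixes f g :: "'a::euclidean_space \<Rightarrow> real"
  assumes f: "continuous_on UNIV f" and g: "continuous_on UNIV g" and e: "e > 0"
    and d: "\<And>z. norm z \<le> e \<Longrightarrow> \<bar>f (x + z) - g (y + z)\<bar> \<le> d"
  shows "\<bar>ball_average e f x - ball_average e g y\<bar> \<le> d"
proof -
  define v where "v = measure lborel (cball (0::'a) e)"
  have v: "v > 0" unfolding v_def using content_cball_pos[OF e] .
  note i = ball_average_integrable[OF f, of e x] ball_average_integrable[OF g, of e y]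
  have id: "integrable lborel (\<lambda>z. indicator (cball (0::'a) e) z *\<^sub>R d)"
    by (intro borel_integrable_compact) auto
  let ?J = "\<integral>z. indicator (cball 0 e) z *\<^sub>R f (x + z) - indicator (cball 0 e) z *\<^sub>R g (y + z) \<partial>lborel"
  have J: "ball_average e f x - ball_average e g y = ?J / v"
    unfolding ball_average_def v_def using Bochner_Integration.integral_diff[OF i]
    by (simp add: diff_divide_distrib)
  have "\<bar>?J\<bar> \<le> (\<integral>z. indicator (cball (0::'a) e) z *\<^sub>R d \<partial>lborel)"
    using i id d by (intro integral_abs_bound_integral) (auto simp: indicator_def)
  also have "... = d * v" by (simp add: v_def)
  finally have "\<bar>?J\<bar> / v \<le> d" using v by (simp only: pos_divide_le_eq)
  then show ?thesis using v by (simp only: J abs_divide abs_of_pos)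
qed

text \<open>By Morrey's inequality a sequence of test functions that is Cauchy in \<open>W^(1,p)\<close> is uniformly
  Cauchy. Its uniform limit agrees with \<open>u\<close> almost everywhere in \<open>\<Omega>\<close>, hence everywhere by continuity,
  and it is zero outside. In particular \<open>u\<close> has boundary values zero.\<close>

lemma W1p0_uniform_approx:
  fixes \<Omega> :: "'a::euclidean_space set"
  assumes "open \<Omega>" "bounded \<Omega>" and p: "2 * real DIM('a) < p" and W: "W1p0 p \<Omega> u G"
    and cu: "continuous_on \<Omega> u"
  obtains \<phi> where "\<And>k::nat. test_function \<Omega> (\<phi> k)"
    "uniform_limit UNIV \<phi> (zero_ext \<Omega> u) sequentially"
    "\<And>k. in_Lp p \<Omega> (\<lambda>x. grad (\<phi> k) x - G x)"
    "(\<lambda>k. \<integral>x. norm (grad (\<phi> k) x - G x) powr p \<partial>lebesgue_on \<Omega>) \<longlonglongrightarrow> 0"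
proof -
  have n1: "real DIM('a) \<ge> 1" using DIM_positive[where 'a='a] by linarith
  have p0: "p > 0" "p \<ge> 0" "p \<ge> 1" "p \<noteq> 0" using p n1 by linarith+
  obtain \<phi> where \<phi>: "\<And>k::nat. test_function \<Omega> (\<phi> k)" "in_Lp p \<Omega> u" "in_Lp p \<Omega> G"
    "\<And>k. in_Lp p \<Omega> (\<lambda>x. u x - \<phi> k x)" "\<And>k. in_Lp p \<Omega> (\<lambda>x. G x - grad (\<phi> k) x)"
    "(\<lambda>k. \<integral>x. norm (u x - \<phi> k x) powr p \<partial>lebesgue_on \<Omega>) \<longlonglongrightarrow> 0"
    "(\<lambda>k. \<integral>x. norm (G x - grad (\<phi> k) x) powr p \<partial>lebesgue_on \<Omega>) \<longlonglongrightarrow> 0"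
    by (rule W1p0_approx[OF assms(1,2) p0(1) W]) (rule that)
  define a where "a = (\<lambda>k. \<integral>x. norm (G x - grad (\<phi> k) x) powr p \<partial>lebesgue_on \<Omega>)"
  have a0: "a k \<ge> 0" for k unfolding a_def by (rule Bochner_Integration.integral_nonneg) simp
  have alim: "a \<longlonglongrightarrow> 0" using \<phi>(7) unfolding a_def .
  obtain \<rho> where \<rho>: "\<rho> > 0" "\<And>x. x \<in> \<Omega> \<Longrightarrow> norm x < \<rho>"
    using bounded_pos_less[of \<Omega>] assms(2) by metis
  obtain i0 :: 'a where i0: "i0 \<in> Basis" using nonempty_Basis by blast
  \<comment> \<open>At this point outside \<open>\<Omega>\<close> all test functions vanish, so Morrey's
    inequality for the difference \<open>\<phi> i - \<phi> j\<close> bounds its values and not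
    only its oscillation.\<close>
  define y where "y = \<rho> *\<^sub>R i0"
  have y: "norm y = \<rho>" "y \<notin> \<Omega>" using \<rho> i0 \<rho>(2)[of y] by (auto simp: y_def)
  define C where "C = morrey_const \<Omega> * sqrt (2 * \<rho>)"
  have C: "C \<ge> 0" using morrey_const_nonneg[of \<Omega>] \<rho>(1) by (simp add: C_def)
  define b where "b = (\<lambda>k. C * (2 * (2 * a k) powr (1/p)))"
  have blim: "b \<longlonglongrightarrow> 0"
  proof -
    have "(\<lambda>k. (2 * a k) powr (1/p)) \<longlonglongrightarrow> (2 * 0) powr (1/p)"
      by (rule tendsto_powr'[OF tendsto_mult[OF tendsto_const alim] tendsto_const]) (use p0 a0 in \<open>auto intro!: always_eventually\<close>)
    then have "(\<lambda>k. C * (2 * (2 * a k) powr (1/p))) \<longlonglongrightarrow> C * (2 * (2 * 0) powr (1/p))" by (intro tendsto_mult_left)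
    then show ?thesis using p0 by (simp add: b_def)
  qed
  have diff: "\<bar>\<phi> i x - \<phi> j x\<bar> \<le> b i + b j" for i j x
  proof (cases "x \<in> \<Omega>")
    case True
    obtain K1 where K1: "compact K1" "K1 \<subseteq> \<Omega>" "\<And>x. x \<notin> K1 \<Longrightarrow> \<phi> i x = 0" "\<And>x. x \<notin> K1 \<Longrightarrow> grad (\<phi> i) x = 0"
      using test_function_support[OF \<phi>(1)[of i]] by metis
    obtain K2 where K2: "compact K2" "K2 \<subseteq> \<Omega>" "\<And>x. x \<notin> K2 \<Longrightarrow> \<phi> j x = 0" "\<And>x. x \<notin> K2 \<Longrightarrow> grad (\<phi> j) x = 0"
      using test_function_support[OF \<phi>(1)[of j]] by metis
    note C1 = test_function_C1[OF \<phi>(1)[of i]] and C2 = test_function_C1[OF \<phi>(1)[of j]]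
    define I where "I = (\<integral>z. norm (grad (\<phi> i) z - grad (\<phi> j) z) powr p \<partial>lebesgue_on \<Omega>)"
    have yK: "y \<notin> K1" "y \<notin> K2" using K1(2) K2(2) y(2) by blast+
    have yz: "\<phi> i y = 0" "\<phi> j y = 0" by (rule K1(3)[OF yK(1)], rule K2(3)[OF yK(2)])
    have I0: "0 \<le> I" unfolding I_def by (rule Bochner_Integration.integral_nonneg) simp
    have m1: "\<bar>(\<phi> i x - \<phi> j x) - (\<phi> i y - \<phi> j y)\<bar> \<le> morrey_const \<Omega> * sqrt (norm (x - y)) * I powr (1/p)"
      unfolding I_def
      by (rule morrey_on[OF assms(1,2) p GDERIV_diff[OF C1(1) C2(1)] continuous_on_diff[OF C1(3) C2(3)], of "K1 \<union> K2"])
         (simp_all add: K1 K2 compact_Un)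
    have "norm (x - y) \<le> 2 * \<rho>" using norm_triangle_ineq4[of x y] \<rho>(2)[OF True] y by simp
    then have sq: "sqrt (norm (x - y)) \<le> sqrt (2 * \<rho>)" by simp
    have "I \<le> (\<integral>z. 2 powr p * (norm (G z - grad (\<phi> j) z) powr p + norm (G z - grad (\<phi> i) z) powr p) \<partial>lebesgue_on \<Omega>)"
      unfolding I_def
    proof (rule integral_mono)
      show "integrable (lebesgue_on \<Omega>) (\<lambda>z. norm (grad (\<phi> i) z - grad (\<phi> j) z) powr p)"
        using in_Lp_diff[OF p0(2) in_Lp_test(2)[OF assms(1,2) p0(2) \<phi>(1)[of i]] in_Lp_test(2)[OF assms(1,2) p0(2) \<phi>(1)[of j]]]
        unfolding in_Lp_def by simp
      show "integrable (lebesgue_on \<Omega>) (\<lambda>z. 2 powr p * (norm (G z - grad (\<phi> j) z) powr p + norm (G z - grad (\<phi> i) z) powr p))"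
        using \<phi>(5)[of i] \<phi>(5)[of j] unfolding in_Lp_def by simp
      show "norm (grad (\<phi> i) z - grad (\<phi> j) z) powr p \<le> 2 powr p * (norm (G z - grad (\<phi> j) z) powr p + norm (G z - grad (\<phi> i) z) powr p)" for z
        using norm_powr_diff_le[OF p0(2), of "G z - grad (\<phi> j) z" "G z - grad (\<phi> i) z"] by simp
    qed
    also have "... = 2 powr p * (a j + a i)"
      using \<phi>(5)[of i] \<phi>(5)[of j] unfolding in_Lp_def a_def by simp
    also have "... \<le> 2 powr p * (2 * max (a i) (a j))" by (intro mult_left_mono) auto
    finally have "I powr (1/p) \<le> (2 powr p * (2 * max (a i) (a j))) powr (1/p)"
      using I0 p0 by (intro powr_mono2) auto
    also have "... = 2 * (2 * max (a i) (a j)) powr (1/p)"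
      using p0 by (simp add: powr_mult powr_powr)
    finally have Ib: "I powr (1/p) \<le> 2 * (2 * max (a i) (a j)) powr (1/p)" .
    have "\<bar>\<phi> i x - \<phi> j x\<bar> \<le> morrey_const \<Omega> * sqrt (norm (x - y)) * I powr (1/p)"
      using m1 yz by simp
    also have "... \<le> C * (2 * (2 * max (a i) (a j)) powr (1/p))"
      unfolding C_def using morrey_const_nonneg[of \<Omega>] sq Ib \<rho>(1)
      by (intro mult_mono mult_left_mono) (auto intro!: mult_nonneg_nonneg)
    also have "... \<le> b i + b j"
      using C by (auto simp: b_def max_def)
    finally show ?thesis .
  next
    case False
    have "\<phi> k x = 0" for k
    proof -
      obtain K1 where "K1 \<subseteq> \<Omega>" "\<And>x. x \<notin> K1 \<Longrightarrow> \<phi> k x = 0"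
        using test_function_support[OF \<phi>(1)[of k]] by metis
      then show ?thesis using False by blast
    qed
    moreover have "b k \<ge> 0" for k using C by (simp add: b_def)
    ultimately show ?thesis by simp
  qed
  have "uniformly_Cauchy_on UNIV \<phi>"
  proof (rule uniformly_Cauchy_onI)
    fix e :: real assume "e > 0"
    then have "eventually (\<lambda>k. b k < e/2) sequentially" using order_tendstoD(2)[OF blim, of "e/2"] by simp
    then obtain M where M: "\<And>k. k \<ge> M \<Longrightarrow> b k < e/2" unfolding eventually_sequentially by blast
    have "dist (\<phi> m x) (\<phi> n x) < e" if "m \<ge> M" "n \<ge> M" for m n x
      using diff[of m x n] M[OF that(1)] M[OF that(2)] by (simp add: dist_real_def)
    then show "\<exists>M. \<forall>x\<in>UNIV. \<forall>m\<ge>M. \<forall>n\<ge>M. dist (\<phi> m x) (\<phi> n x) < e" by blast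
  qed
  then have "uniformly_convergent_on UNIV \<phi>" by (rule Cauchy_uniformly_convergent)
  then obtain w where w: "uniform_limit UNIV \<phi> w sequentially" unfolding uniformly_convergent_on_def by blast
  have cw: "continuous_on UNIV w"
    by (rule uniform_limit_theorem[OF always_eventually w]) (use test_function_C1(2)[OF \<phi>(1)] in auto)
  have wlim: "(\<lambda>k. \<phi> k x) \<longlonglongrightarrow> w x" for x using tendsto_uniform_limitI[OF w UNIV_I] .
  have w0: "w x = 0" if "x \<notin> \<Omega>" for x
  proof -
    have "\<phi> k x = 0" for k
    proof -
      obtain K1 where "K1 \<subseteq> \<Omega>" "\<And>x. x \<notin> K1 \<Longrightarrow> \<phi> k x = 0"
        using test_function_support[OF \<phi>(1)[of k]] by metis
      then show ?thesis using that by blast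
    qed
    then have "(\<lambda>k. \<phi> k x) = (\<lambda>k. 0)" by (rule ext)
    then show ?thesis using wlim[of x] LIMSEQ_unique tendsto_const by metis
  qed
  have "AE x in lebesgue_on \<Omega>. \<bar>u x - w x\<bar> \<le> 0"
  proof -
    have "(\<lambda>k. \<integral>x. norm (u x - \<phi> k x) \<partial>lebesgue_on \<Omega>) \<longlonglongrightarrow> 0"
      by (rule Lp_tendsto_imp_L1[OF assms(1,2) p0(3) \<phi>(4,6)])
    from tendsto_L1_AE_subseq[OF in_Lp_integrable(1)[OF assms(1,2) p0(3) \<phi>(4)] this]
    obtain r where r: "strict_mono r" "AE x in lebesgue_on \<Omega>. (\<lambda>n. u x - \<phi> (r n) x) \<longlonglongrightarrow> 0" by blast
    from r(2) show ?thesis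
    proof eventually_elim
      case (elim x)
      have "(\<lambda>n. \<phi> (r n) x) \<longlonglongrightarrow> w x" using LIMSEQ_subseq_LIMSEQ[OF wlim r(1)] by (simp add: o_def)
      then have "(\<lambda>n. u x - \<phi> (r n) x) \<longlonglongrightarrow> u x - w x" by (intro tendsto_intros)
      from LIMSEQ_unique[OF this elim] show ?case by simp
    qed
  qed
  note AE = this
  have "\<bar>u x - w x\<bar> \<le> 0" if "x \<in> \<Omega>" for x
    by (rule AE_lebesgue_on_open_imp[OF assms(1) _ AE that])
       (intro continuous_intros cu continuous_on_subset[OF cw], simp)
  then have "w = zero_ext \<Omega> u" using w0 by (intro ext) (auto simp: zero_ext_def)
  moreover have sw: "norm (grad (\<phi> k) x - G x) = norm (G x - grad (\<phi> k) x)" for k x by (rule norm_minus_commute)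
  moreover have "in_Lp p \<Omega> (\<lambda>x. grad (\<phi> k) x - G x)" for k
    by (rule in_Lp_diff[OF p0(2) in_Lp_test(2)[OF assms(1,2) p0(2) \<phi>(1)] \<phi>(3)])
  moreover have "(\<lambda>k. \<integral>x. norm (grad (\<phi> k) x - G x) powr p \<partial>lebesgue_on \<Omega>) \<longlonglongrightarrow> 0"
    unfolding sw by (rule \<phi>(7))
  ultimately show ?thesis using that[OF \<phi>(1)] w by simp
qed

text \<open>Both estimates are proved for the approximating test functions and pass to the uniform limit. The
  factors 2 in the Hoelder estimate come from the elementary inequality
  \<open>(a + b)^p \<le> 2^p (a^p + b^p)\<close> and are harmless after taking \<open>p\<close>-th roots; the Lipschitz estimate for
  means must not lose any such factor and uses the \<open>L^1\<close> distance of the gradients instead.\<close>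

lemma zero_ext_regular:
  fixes \<Omega> :: "'a::euclidean_space set"
  assumes "open \<Omega>" "bounded \<Omega>" and p: "2 * real DIM('a) < p" and W: "W1p0 p \<Omega> u G"
    and cu: "continuous_on \<Omega> u"
  defines "I \<equiv> \<integral>x. norm (G x) powr p \<partial>lebesgue_on \<Omega>"
  shows "continuous_on UNIV (zero_ext \<Omega> u)"
    and "\<bar>zero_ext \<Omega> u x - zero_ext \<Omega> u y\<bar> \<le> morrey_const \<Omega> * sqrt (norm (x - y)) * (2 * (2 * I) powr (1/p))"
    and "e > 0 \<Longrightarrow> \<bar>ball_average e (zero_ext \<Omega> u) y - ball_average e (zero_ext \<Omega> u) x\<bar> \<le>
      norm (y - x) * (measure lborel (cball (0::'a) e) powr (- 1/p) * I powr (1/p))"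
proof -
  have n1: "real DIM('a) \<ge> 1" using DIM_positive[where 'a='a] by linarith
  have p0: "p > 0" "p \<ge> 0" "p \<ge> 1" "p \<noteq> 0" "p > 1" using p n1 by linarith+
  obtain \<phi> where \<phi>: "\<And>k::nat. test_function \<Omega> (\<phi> k)"
    "uniform_limit UNIV \<phi> (zero_ext \<Omega> u) sequentially"
    "\<And>k. in_Lp p \<Omega> (\<lambda>x. grad (\<phi> k) x - G x)"
    "(\<lambda>k. \<integral>x. norm (grad (\<phi> k) x - G x) powr p \<partial>lebesgue_on \<Omega>) \<longlonglongrightarrow> 0"
    by (rule W1p0_uniform_approx[OF assms(1,2) p W cu]) (rule that)
  define w where "w = zero_ext \<Omega> u"
  have GL: "in_Lp p \<Omega> G" using W unfolding W1p0_def W1p_def by simp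
  have Gm: "(\<lambda>x. norm (G x)) \<in> borel_measurable (lebesgue_on \<Omega>)"
    and Gi: "integrable (lebesgue_on \<Omega>) (\<lambda>x. norm (G x) powr p)"
    using GL unfolding in_Lp_def by auto
  have I0: "I \<ge> 0" unfolding I_def by (rule Bochner_Integration.integral_nonneg) simp
  show cw: "continuous_on UNIV (zero_ext \<Omega> u)"
    by (rule uniform_limit_theorem[OF always_eventually \<phi>(2)]) (use test_function_C1(2)[OF \<phi>(1)] in auto)
  have wlim: "(\<lambda>k. \<phi> k x) \<longlonglongrightarrow> w x" for x unfolding w_def using tendsto_uniform_limitI[OF \<phi>(2) UNIV_I] .
  define a where "a = (\<lambda>k. \<integral>x. norm (grad (\<phi> k) x - G x) powr p \<partial>lebesgue_on \<Omega>)"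
  have a0: "a k \<ge> 0" for k unfolding a_def by (rule Bochner_Integration.integral_nonneg) simp
  have alim: "a \<longlonglongrightarrow> 0" using \<phi>(4) unfolding a_def .
  show "\<bar>zero_ext \<Omega> u x - zero_ext \<Omega> u y\<bar> \<le> morrey_const \<Omega> * sqrt (norm (x - y)) * (2 * (2 * I) powr (1/p))"
  proof (rule LIMSEQ_le)
    show "(\<lambda>k. \<bar>\<phi> k x - \<phi> k y\<bar>) \<longlonglongrightarrow> \<bar>zero_ext \<Omega> u x - zero_ext \<Omega> u y\<bar>"
      using wlim unfolding w_def by (intro tendsto_intros)
    have "(\<lambda>k. (2 * max I (a k)) powr (1/p)) \<longlonglongrightarrow> (2 * max I 0) powr (1/p)"
      by (rule tendsto_powr'[OF tendsto_mult[OF tendsto_const tendsto_max[OF tendsto_const alim]] tendsto_const]) (use p0 I0 in \<open>auto intro!: always_eventually\<close>)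
    then have "(\<lambda>k. morrey_const \<Omega> * sqrt (norm (x - y)) * (2 * (2 * max I (a k)) powr (1/p))) \<longlonglongrightarrow>
      morrey_const \<Omega> * sqrt (norm (x - y)) * (2 * (2 * max I 0) powr (1/p))" by (intro tendsto_mult_left)
    then show "(\<lambda>k. morrey_const \<Omega> * sqrt (norm (x - y)) * (2 * (2 * max I (a k)) powr (1/p))) \<longlonglongrightarrow>
      morrey_const \<Omega> * sqrt (norm (x - y)) * (2 * (2 * I) powr (1/p))" using I0 by (simp add: max_absorb1)
    have "\<bar>\<phi> k x - \<phi> k y\<bar> \<le> morrey_const \<Omega> * sqrt (norm (x - y)) * (2 * (2 * max I (a k)) powr (1/p))" for k
    proof -
      obtain K where K: "compact K" "K \<subseteq> \<Omega>" "\<And>x. x \<notin> K \<Longrightarrow> \<phi> k x = 0" "\<And>x. x \<notin> K \<Longrightarrow> grad (\<phi> k) x = 0"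
        using test_function_support[OF \<phi>(1)[of k]] by metis
      note C1 = test_function_C1[OF \<phi>(1)[of k]]
      define J where "J = (\<integral>z. norm (grad (\<phi> k) z) powr p \<partial>lebesgue_on \<Omega>)"
      have J0: "0 \<le> J" unfolding J_def by (rule Bochner_Integration.integral_nonneg) simp
      have "J \<le> (\<integral>z. 2 powr p * (norm (G z) powr p + norm (grad (\<phi> k) z - G z) powr p) \<partial>lebesgue_on \<Omega>)"
        unfolding J_def
      proof (rule integral_mono)
        show "integrable (lebesgue_on \<Omega>) (\<lambda>z. norm (grad (\<phi> k) z) powr p)"
          using in_Lp_test(2)[OF assms(1,2) p0(2) \<phi>(1)[of k]] unfolding in_Lp_def by simp
        show "integrable (lebesgue_on \<Omega>) (\<lambda>z. 2 powr p * (norm (G z) powr p + norm (grad (\<phi> k) z - G z) powr p))"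
          using \<phi>(3)[of k] Gi unfolding in_Lp_def by simp
        show "norm (grad (\<phi> k) z) powr p \<le> 2 powr p * (norm (G z) powr p + norm (grad (\<phi> k) z - G z) powr p)" for z
          using norm_powr_diff_le[OF p0(2), of "G z" "G z - grad (\<phi> k) z"] by (simp add: norm_minus_commute)
      qed
      also have "... = 2 powr p * (I + a k)"
        using \<phi>(3)[of k] Gi unfolding in_Lp_def a_def I_def by simp
      also have "... \<le> 2 powr p * (2 * max I (a k))" by (intro mult_left_mono) auto
      finally have "J powr (1/p) \<le> (2 powr p * (2 * max I (a k))) powr (1/p)"
        using J0 p0 by (intro powr_mono2) auto
      also have "... = 2 * (2 * max I (a k)) powr (1/p)" using p0 by (simp add: powr_mult powr_powr)
      finally have Jb: "J powr (1/p) \<le> 2 * (2 * max I (a k)) powr (1/p)" .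
      have "\<bar>\<phi> k x - \<phi> k y\<bar> \<le> morrey_const \<Omega> * sqrt (norm (x - y)) * J powr (1/p)"
        unfolding J_def by (rule morrey_on[OF assms(1,2) p C1(1,3) K(1,2,4)])
      also have "... \<le> morrey_const \<Omega> * sqrt (norm (x - y)) * (2 * (2 * max I (a k)) powr (1/p))"
        using morrey_const_nonneg[of \<Omega>] by (intro mult_left_mono Jb) simp
      finally show ?thesis .
    qed
    then show "\<exists>N. \<forall>k\<ge>N. \<bar>\<phi> k x - \<phi> k y\<bar> \<le> morrey_const \<Omega> * sqrt (norm (x - y)) * (2 * (2 * max I (a k)) powr (1/p))"
      by blast
  qed
  assume e: "e > 0"
  define v where "v = measure lborel (cball (0::'a) e)"
  have v: "v > 0" unfolding v_def using content_cball_pos[OF e] .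
  define N where "N = v powr (1 - 1/p) * I powr (1/p)"
  have N0: "N \<ge> 0" by (simp add: N_def)
  define b where "b = (\<lambda>k. \<integral>x. norm (grad (\<phi> k) x - G x) \<partial>lebesgue_on \<Omega>)"
  have blim: "b \<longlonglongrightarrow> 0" unfolding b_def by (rule Lp_tendsto_imp_L1[OF assms(1,2) p0(3) \<phi>(3,4)])
  have b0: "b k \<ge> 0" for k unfolding b_def by (rule Bochner_Integration.integral_nonneg) simp
  have avg: "\<bar>ball_average e (\<phi> k) y - ball_average e (\<phi> k) x\<bar> \<le> norm (y - x) * ((N + b k) / v)" for k
  proof (rule ball_average_diff[OF test_function_C1(2)[OF \<phi>(1)] e])
    show "0 \<le> norm (y - x) * ((N + b k) / v)" using N0 b0[of k] v by simp
    have "(\<integral>\<^sup>+z. ennreal \<bar>\<phi> k (y + z) - \<phi> k (x + z)\<bar> * indicator (cball 0 e) z \<partial>lborel) \<le> ennreal (norm (y - x) * (N + b k))"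
    proof (rule test_average_bound[OF assms(1,2) \<phi>(1) in_Lp_integrable(1)[OF assms(1,2) p0(3) GL] _ _ N0])
      show "(\<integral>x. norm (G x - grad (\<phi> k) x) \<partial>lebesgue_on \<Omega>) \<le> b k" by (simp add: b_def norm_minus_commute)
      fix c :: 'a
      have cm: "cball c e \<inter> \<Omega> \<in> sets (lebesgue_on \<Omega>)"
        using open_lebesgue[OF assms(1)] by (simp add: sets_restrict_space_iff sets.Int)
      have me: "emeasure (lebesgue_on \<Omega>) (cball c e \<inter> \<Omega>) \<le> ennreal v"
      proof -
        have "emeasure (lebesgue_on \<Omega>) (cball c e \<inter> \<Omega>) = emeasure lebesgue (cball c e \<inter> \<Omega>)"
          using open_lebesgue[OF assms(1)] by (intro emeasure_restrict_space) auto
        also have "... \<le> emeasure lebesgue (cball c e)" by (intro emeasure_mono) auto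
        also have "... = emeasure lborel (cball c e)" by simp
        also have "... = ennreal (measure lborel (cball c e))"
          using emeasure_lborel_cball_finite[of c e] by (simp add: emeasure_eq_ennreal_measure less_top)
        also have "measure lborel (cball c e) = v"
          unfolding v_def content_cball_conv_ball
          using content_ball_conv_unit_ball[of e c] content_ball_conv_unit_ball[of e "0::'a"] e by simp
        finally show ?thesis .
      qed
      then have mf: "emeasure (lebesgue_on \<Omega>) (cball c e \<inter> \<Omega>) < \<infinity>"
        by (rule le_less_trans) simp
      have mv: "measure (lebesgue_on \<Omega>) (cball c e \<inter> \<Omega>) \<le> v"
        using me v unfolding measure_def by (intro enn2real_leI) auto
      have "(\<integral>\<^sup>+x. ennreal (norm (G x)) * indicator (cball c e) x \<partial>lebesgue_on \<Omega>) =
        (\<integral>\<^sup>+x. ennreal (norm (G x)) * indicator (cball c e \<inter> \<Omega>) x \<partial>lebesgue_on \<Omega>)"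
        by (intro nn_integral_cong) (auto simp: indicator_def space_restrict_space)
      also have "... \<le> ennreal (measure (lebesgue_on \<Omega>) (cball c e \<inter> \<Omega>) powr (1 - 1/p) * I powr (1/p))"
        unfolding I_def by (rule nn_Holder_indicator[OF p0(5) Gm norm_ge_zero Gi cm mf])
      also have "... \<le> ennreal N"
        unfolding N_def using mv p0 by (intro ennreal_leI mult_right_mono powr_mono2) auto
      finally show "(\<integral>\<^sup>+x. ennreal (norm (G x)) * indicator (cball c e) x \<partial>lebesgue_on \<Omega>) \<le> ennreal N" .
    qed
    also have "norm (y - x) * (N + b k) = norm (y - x) * ((N + b k) / v) * v" using v by simp
    finally show "(\<integral>\<^sup>+z. ennreal \<bar>\<phi> k (y + z) - \<phi> k (x + z)\<bar> * indicator (cball 0 e) z \<partial>lborel) \<le>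
      ennreal (norm (y - x) * ((N + b k) / v) * measure lborel (cball (0::'a) e))" by (simp only: v_def)
  qed
  have alim: "(\<lambda>k. ball_average e (\<phi> k) x) \<longlonglongrightarrow> ball_average e w x" for x
  proof (rule LIMSEQ_I)
    fix d :: real assume "d > 0"
    then have "eventually (\<lambda>k. \<forall>x\<in>UNIV. dist (\<phi> k x) (w x) < d/2) sequentially"
      using uniform_limitD[OF \<phi>(2), of "d/2"] by (simp add: w_def)
    then obtain M where M: "\<And>k x. k \<ge> M \<Longrightarrow> dist (\<phi> k x) (w x) < d/2" unfolding eventually_sequentially by blast
    have "norm (ball_average e (\<phi> k) x - ball_average e w x) < d" if "k \<ge> M" for k
    proof -
      have "\<bar>ball_average e (\<phi> k) x - ball_average e w x\<bar> \<le> d/2"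
        by (rule ball_average_dist[OF test_function_C1(2)[OF \<phi>(1)] _ e])
           (use cw M[OF that] in \<open>auto simp: w_def dist_real_def less_imp_le\<close>)
      then show ?thesis using \<open>d > 0\<close> by simp
    qed
    then show "\<exists>M. \<forall>k\<ge>M. norm (ball_average e (\<phi> k) x - ball_average e w x) < d" by blast
  qed
  have l1: "(\<lambda>k. \<bar>ball_average e (\<phi> k) y - ball_average e (\<phi> k) x\<bar>) \<longlonglongrightarrow> \<bar>ball_average e w y - ball_average e w x\<bar>"
    by (intro tendsto_intros alim)
  have l2: "(\<lambda>k. norm (y - x) * ((N + b k) / v)) \<longlonglongrightarrow> norm (y - x) * ((N + 0) / v)"
    using v by (intro tendsto_intros blim) auto
  have "\<bar>ball_average e w y - ball_average e w x\<bar> \<le> norm (y - x) * ((N + 0) / v)"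
    by (rule LIMSEQ_le[OF l1 l2]) (use avg in blast)
  also have "(N + 0) / v = v powr (- 1/p) * I powr (1/p)"
    using v by (simp add: N_def powr_diff powr_minus divide_inverse)
  finally show "\<bar>ball_average e (zero_ext \<Omega> u) y - ball_average e (zero_ext \<Omega> u) x\<bar> \<le>
      norm (y - x) * (measure lborel (cball (0::'a) e) powr (- 1/p) * I powr (1/p))"
    unfolding w_def v_def .
qed

section \<open>Test functions as Sobolev functions\<close>

lemma test_function_scale:
  assumes "test_function \<Omega> \<phi>"
  shows "test_function \<Omega> (\<lambda>x. c * \<phi> x)" "grad (\<lambda>x. c * \<phi> x) = (\<lambda>x. c *\<^sub>R grad \<phi> x)"
proof -
  obtain K where K: "compact K" "K \<subseteq> \<Omega>" "\<And>x. x \<notin> K \<Longrightarrow> \<phi> x = 0"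
    using test_function_support[OF assms] by metis
  have "smooth_on UNIV (\<lambda>x. c * \<phi> x)"
    using assms unfolding test_function_def smooth_on_def by (intro allI C_on_mult C_on_const) blast
  then show "test_function \<Omega> (\<lambda>x. c * \<phi> x)" by (rule test_functionI[OF _ K(1,2)]) (simp add: K(3))
  have "GDERIV (\<lambda>x. c * \<phi> x) x :> c *\<^sub>R grad \<phi> x" for x
    using GDERIV_mult[OF GDERIV_const test_function_C1(1)[OF assms], of c x] by simp
  then show "grad (\<lambda>x. c * \<phi> x) = (\<lambda>x. c *\<^sub>R grad \<phi> x)" by (intro ext grad_eqI)
qed

lemma locally_integrable_continuous:
  fixes f :: "'a::euclidean_space \<Rightarrow> 'b::euclidean_space"
  assumes "continuous_on UNIV f"
  shows "locally_integrable_on \<Omega> f"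
  unfolding locally_integrable_on_def set_integrable_def
proof (intro allI impI)
  fix K assume "compact K \<and> K \<subseteq> \<Omega>"
  then have i: "integrable lborel (\<lambda>x. indicator K x *\<^sub>R f x)"
    using assms by (intro borel_integrable_compact) (auto intro: continuous_on_subset)
  then show "integrable lebesgue (\<lambda>x. indicator K x *\<^sub>R f x)"
    by (subst integrable_completion) auto
qed

text \<open>Integration by parts for the product of two test functions.\<close>

lemma weak_gradient_test:
  fixes \<Omega> :: "'a::euclidean_space set"
  assumes "open \<Omega>" and t: "test_function \<Omega> \<phi>"
  shows "weak_gradient \<Omega> \<phi> (grad \<phi>)"
  unfolding weak_gradient_def
proof (intro conjI allI impI ballI)
  note C = test_function_C1[OF t]
  show "locally_integrable_on \<Omega> \<phi>" "locally_integrable_on \<Omega> (grad \<phi>)"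
    by (rule locally_integrable_continuous[OF C(2)], rule locally_integrable_continuous[OF C(3)])
  fix \<psi> :: "'a \<Rightarrow> real" and i :: 'a
  assume s: "test_function \<Omega> \<psi>" and i: "i \<in> Basis"
  note D = test_function_C1[OF s]
  obtain K where K: "compact K" "K \<subseteq> \<Omega>" "\<And>x. x \<notin> K \<Longrightarrow> \<phi> x = 0" "\<And>x. x \<notin> K \<Longrightarrow> grad \<phi> x = 0"
    using test_function_support[OF t] by metis
  have out: "\<phi> x = 0" "grad \<phi> x = 0" if "x \<notin> \<Omega>" for x
  proof -
    have "x \<notin> K" using that K(2) by blast
    then show "\<phi> x = 0" "grad \<phi> x = 0" by (rule K(3), rule K(4))
  qed
  have c1: "continuous_on UNIV (\<lambda>x. \<phi> x * (grad \<psi> x \<bullet> i))" by (intro continuous_intros C D)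
  have c2: "continuous_on UNIV (\<lambda>x. (grad \<phi> x \<bullet> i) * \<psi> x)" by (intro continuous_intros C D)
  have i1: "integrable lborel (\<lambda>x. \<phi> x * (grad \<psi> x \<bullet> i))"
    by (rule continuous_supp_integrable[OF c1 K(1)]) (simp add: K(3))
  have i2: "integrable lborel (\<lambda>x. (grad \<phi> x \<bullet> i) * \<psi> x)"
    by (rule continuous_supp_integrable[OF c2 K(1)]) (simp add: K(4))
  have "(\<integral>x. (\<phi> x *\<^sub>R grad \<psi> x + \<psi> x *\<^sub>R grad \<phi> x) \<bullet> i \<partial>lborel) = 0"
    by (rule integral_partial_zero[OF GDERIV_mult[OF C(1) D(1)] _ K(1)])
       (auto intro!: continuous_intros C D simp: K(3,4))
  then have "(\<integral>x. \<phi> x * (grad \<psi> x \<bullet> i) + (grad \<phi> x \<bullet> i) * \<psi> x \<partial>lborel) = 0"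
    by (simp add: inner_add_left mult.commute)
  then have z: "(\<integral>x. \<phi> x * (grad \<psi> x \<bullet> i) \<partial>lborel) = - (\<integral>x. (grad \<phi> x \<bullet> i) * \<psi> x \<partial>lborel)"
    using Bochner_Integration.integral_add[OF i1 i2] by simp
  have "(\<integral>x. \<phi> x * partial_deriv i \<psi> x \<partial>lebesgue_on \<Omega>) = (\<integral>x. \<phi> x * (grad \<psi> x \<bullet> i) \<partial>lebesgue_on \<Omega>)"
    by (simp add: grad_inner_Basis[OF i])
  also have "... = (\<integral>x. \<phi> x * (grad \<psi> x \<bullet> i) \<partial>lborel)"
    by (rule integral_lebesgue_on_supp[OF assms(1) borel_measurable_continuous_onI[OF c1]]) (simp add: out)
  also have "... = - (\<integral>x. (grad \<phi> x \<bullet> i) * \<psi> x \<partial>lborel)" by (rule z)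
  also have "(\<integral>x. (grad \<phi> x \<bullet> i) * \<psi> x \<partial>lborel) = (\<integral>x. (grad \<phi> x \<bullet> i) * \<psi> x \<partial>lebesgue_on \<Omega>)"
    by (rule integral_lebesgue_on_supp[symmetric, OF assms(1) borel_measurable_continuous_onI[OF c2]]) (simp add: out)
  finally show "(\<integral>x. \<phi> x * partial_deriv i \<psi> x \<partial>lebesgue_on \<Omega>) = - (\<integral>x. (grad \<phi> x \<bullet> i) * \<psi> x \<partial>lebesgue_on \<Omega>)" .
qed

lemma W1p0_test:
  assumes "open \<Omega>" "bounded \<Omega>" "p > 0" "test_function \<Omega> \<phi>"
  shows "W1p0 p \<Omega> \<phi> (grad \<phi>)"
  unfolding W1p0_def W1p_def
  using weak_gradient_test[OF assms(1,4)] in_Lp_test[OF assms(1,2) _ assms(4), of p] assms(3,4)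
  by (auto intro!: exI[of _ "\<lambda>_. \<phi>"] simp: Lp_norm_def)

section \<open>Essential supremum norms\<close>

lemma not_AE_False:
  fixes \<Omega> :: "'a::euclidean_space set"
  assumes "open \<Omega>" "x \<in> \<Omega>"
  shows "\<not> (AE x in lebesgue_on \<Omega>. False)"
proof
  assume "AE x in lebesgue_on \<Omega>. False"
  then have "AE x in lebesgue_on \<Omega>. (0::real) \<le> -1" by eventually_elim simp
  from AE_lebesgue_on_open_imp[OF assms(1) continuous_on_const this assms(2)] show False by simp
qed

lemma Linf_normI:
  fixes f :: "'a::euclidean_space \<Rightarrow> 'b::euclidean_space"
  assumes "f \<in> borel_measurable (lebesgue_on \<Omega>)" "AE x in lebesgue_on \<Omega>. norm (f x) \<le> c" "c \<ge> 0"
  shows "in_Linf \<Omega> f" "Linf_norm \<Omega> f \<le> c"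
proof -
  have m: "(\<lambda>x. ereal (norm (f x))) \<in> borel_measurable (lebesgue_on \<Omega>)" using assms(1) by measurable
  have "esssup (lebesgue_on \<Omega>) (\<lambda>x. ereal (norm (f x))) \<le> ereal c"
    using assms(2) by (intro esssup_I[OF m]) simp
  note le = this
  show "in_Linf \<Omega> f" unfolding in_Linf_def using assms(1) le by (auto intro: le_less_trans)
  show "Linf_norm \<Omega> f \<le> c" unfolding Linf_norm_def using le assms(3)
    by (cases "esssup (lebesgue_on \<Omega>) (\<lambda>x. ereal (norm (f x)))") auto
qed

lemma Linf_normD:
  fixes f :: "'a::euclidean_space \<Rightarrow> 'b::euclidean_space"
  assumes "open \<Omega>" "x0 \<in> \<Omega>" "in_Linf \<Omega> f"
  shows "AE x in lebesgue_on \<Omega>. norm (f x) \<le> Linf_norm \<Omega> f" "Linf_norm \<Omega> f \<ge> 0"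
proof -
  have ae: "AE x in lebesgue_on \<Omega>. ereal (norm (f x)) \<le> esssup (lebesgue_on \<Omega>) (\<lambda>x. ereal (norm (f x)))"
    by (rule esssup_AE)
  have "esssup (lebesgue_on \<Omega>) (\<lambda>x. ereal (norm (f x))) \<noteq> -\<infinity>"
  proof
    assume "esssup (lebesgue_on \<Omega>) (\<lambda>x. ereal (norm (f x))) = -\<infinity>"
    then have "AE x in lebesgue_on \<Omega>. False" using ae by simp
    then show False using not_AE_False[OF assms(1,2)] by simp
  qed
  moreover have "esssup (lebesgue_on \<Omega>) (\<lambda>x. ereal (norm (f x))) < \<infinity>" using assms(3) unfolding in_Linf_def by simp
  ultimately have e: "esssup (lebesgue_on \<Omega>) (\<lambda>x. ereal (norm (f x))) = ereal (Linf_norm \<Omega> f)"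
    unfolding Linf_norm_def by (cases "esssup (lebesgue_on \<Omega>) (\<lambda>x. ereal (norm (f x)))") auto
  show a: "AE x in lebesgue_on \<Omega>. norm (f x) \<le> Linf_norm \<Omega> f" using ae unfolding e by simp
  show "Linf_norm \<Omega> f \<ge> 0"
  proof (rule ccontr)
    assume n: "\<not> ?thesis"
    have "AE x in lebesgue_on \<Omega>. False" using a
    proof eventually_elim
      case (elim x)
      then show ?case using n norm_ge_zero[of "f x"] by linarith
    qed
    then show False using not_AE_False[OF assms(1,2)] by simp
  qed
qed

lemma Linf_norm_continuous:
  fixes f :: "'a::euclidean_space \<Rightarrow> real"
  assumes "open \<Omega>" "continuous_on \<Omega> f" "x \<in> \<Omega>" "in_Linf \<Omega> f"
  shows "\<bar>f x\<bar> \<le> Linf_norm \<Omega> f"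
  by (rule AE_lebesgue_on_open_imp[OF assms(1) _ Linf_normD(1)[OF assms(1,3,4), unfolded real_norm_def] assms(3)])
     (intro continuous_intros assms(2))

section \<open>The inradius and the first infinity eigenvalue\<close>

text \<open>The distance to the complement attains its maximum on the compact closure of \<open>\<Omega>\<close>.\<close>

lemma inradius_exists:
  fixes \<Omega> :: "'a::euclidean_space set"
  assumes "open \<Omega>" "bounded \<Omega>" "\<Omega> \<noteq> {}"
  obtains R x0 where "R > 0" "x0 \<in> \<Omega>" "ball x0 R \<subseteq> \<Omega>" "\<And>x. x \<in> \<Omega> \<Longrightarrow> infdist x (- \<Omega>) \<le> R"
proof -
  have ne: "- \<Omega> \<noteq> {}"
  proof
    assume "- \<Omega> = {}"
    then have "\<Omega> = UNIV" by blast
    then show False using assms(2) not_bounded_UNIV by simp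
  qed
  have cl: "closed (- \<Omega>)" using assms(1) by (simp add: closed_Compl)
  have "compact (closure \<Omega>)" using assms(2) by (simp add: compact_closure)
  moreover have "closure \<Omega> \<noteq> {}" using assms(3) by simp
  moreover have "continuous_on (closure \<Omega>) (\<lambda>x. infdist x (- \<Omega>))" by (intro continuous_intros)
  ultimately obtain x0 where x0: "x0 \<in> closure \<Omega>" "\<And>y. y \<in> closure \<Omega> \<Longrightarrow> infdist y (- \<Omega>) \<le> infdist x0 (- \<Omega>)"
    using continuous_attains_sup[of "closure \<Omega>" "\<lambda>x. infdist x (- \<Omega>)"] by metis
  define R where "R = infdist x0 (- \<Omega>)"
  obtain z where z: "z \<in> \<Omega>" using assms(3) by blast
  have "infdist z (- \<Omega>) > 0" by (rule infdist_pos_not_in_closed[OF cl ne]) (simp add: z)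
  moreover have "z \<in> closure \<Omega>" using z closure_subset by blast
  ultimately have R: "R > 0" using x0(2)[of z] by (simp add: R_def)
  have "x0 \<in> \<Omega>"
  proof (rule ccontr)
    assume "x0 \<notin> \<Omega>"
    then have "infdist x0 (- \<Omega>) = 0" by simp
    then show False using R by (simp add: R_def)
  qed
  moreover have "ball x0 R \<subseteq> \<Omega>"
  proof
    fix y assume y: "y \<in> ball x0 R"
    show "y \<in> \<Omega>"
    proof (rule ccontr)
      assume "y \<notin> \<Omega>"
      then have "infdist x0 (- \<Omega>) \<le> dist x0 y" by (intro infdist_le) simp
      then show False using y by (simp add: R_def)
    qed
  qed
  moreover have "infdist x (- \<Omega>) \<le> R" if "x \<in> \<Omega>" for x
    using x0(2)[of x] that closure_subset[of \<Omega>] by (auto simp: R_def)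
  ultimately show ?thesis using that[OF R] by blast
qed

text \<open>Near a boundary point the domain lies above a graph; the points straight below the boundary point
  lie strictly below the graph and are therefore interior to the complement. A punctured ball,
  for instance, does not have this property.\<close>

lemma smooth_boundary_exterior:
  fixes \<Omega> :: "'a::euclidean_space set"
  assumes "open \<Omega>" "smooth_boundary \<Omega>" "y \<notin> \<Omega>" "d > 0"
  shows "\<exists>y'. dist y y' < d \<and> y' \<in> interior (- \<Omega>)"
proof (cases "y \<in> closure \<Omega>")
  case False
  then have "y \<in> interior (- \<Omega>)" by (simp add: interior_complement)
  then show ?thesis using assms(4) by (intro exI[of _ y]) simp
next
  case True
  then have "y \<in> frontier \<Omega>" using assms(1,3) by (simp add: frontier_def interior_open)
  from bspec[OF assms(2)[unfolded smooth_boundary_def] this]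
  obtain r e \<gamma> where r: "r > 0" "norm e = 1" "smooth_on UNIV \<gamma>" "\<forall>x t. \<gamma> (x + t *\<^sub>R e) = \<gamma> x"
    "\<Omega> \<inter> ball y r = {x \<in> ball y r. \<gamma> x < x \<bullet> e}"
    by (elim exE conjE) (rule that; assumption)
  have c\<gamma>: "continuous_on UNIV \<gamma>" using smooth_on_D(3)[OF r(3)] .
  have ge: "\<gamma> y \<ge> y \<bullet> e"
  proof (rule ccontr)
    assume "\<not> ?thesis"
    then have "y \<in> \<Omega> \<inter> ball y r" unfolding r(5) using r(1) by simp
    then show False using assms(3) by simp
  qed
  define t where "t = min d r / 2"
  have t: "t > 0" "t < d" "t < r" using assms(4) r(1) by (auto simp: t_def)
  define y' where "y' = y + (- t) *\<^sub>R e"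
  have dy: "dist y y' = t" using t r(2) by (simp add: y'_def dist_norm)
  have "\<gamma> y' = \<gamma> y" unfolding y'_def using r(4) by (elim allE)
  moreover have "y' \<bullet> e = y \<bullet> e - t"
    using r(2) by (simp add: y'_def inner_diff_left norm_eq_1)
  ultimately have gt: "\<gamma> y' > y' \<bullet> e" using ge t by simp
  define S where "S = ball y r \<inter> {x. x \<bullet> e < \<gamma> x}"
  have "open S" unfolding S_def by (intro open_Int open_ball open_Collect_less continuous_intros c\<gamma>)
  moreover have "S \<subseteq> - \<Omega>"
  proof
    fix x assume x: "x \<in> S"
    show "x \<in> - \<Omega>"
    proof
      assume "x \<in> \<Omega>"
      then have "x \<in> \<Omega> \<inter> ball y r" using x by (simp add: S_def)
      then show False unfolding r(5) using x by (simp add: S_def)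
    qed
  qed
  moreover have "y' \<in> S" using dy t gt by (simp add: S_def)
  ultimately have "y' \<in> interior (- \<Omega>)" using interior_maximal by blast
  then show ?thesis using dy t by (intro exI[of _ y']) simp
qed

text \<open>No competitor beats \<open>1/R\<close> because its supremum norm is at most \<open>R\<close> times that of its gradient; the
  mollified cones over the largest ball come arbitrarily close.\<close>

lemma lambda_1_inf_eq:
  fixes \<Omega> :: "'a::euclidean_space set"
  assumes "open \<Omega>" "bounded \<Omega>" "smooth_boundary \<Omega>"
    and R: "R > 0" "x0 \<in> \<Omega>" "ball x0 R \<subseteq> \<Omega>" "\<And>x. x \<in> \<Omega> \<Longrightarrow> infdist x (- \<Omega>) \<le> R"
  shows "lambda_1_inf \<Omega> = 1 / R"
proof -
  define S where "S = {Linf_norm \<Omega> G / Linf_norm \<Omega> u | u G. W1inf0 \<Omega> u G \<and> \<not> (AE x in lebesgue_on \<Omega>. u x = 0)}"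
  have nU: "\<Omega> \<noteq> UNIV" using assms(2) not_bounded_UNIV by auto
  have low: "1 / R \<le> s" if s: "s \<in> S" for s
  proof -
    obtain u G where uG: "s = Linf_norm \<Omega> G / Linf_norm \<Omega> u" "W1inf0 \<Omega> u G" "\<not> (AE x in lebesgue_on \<Omega>. u x = 0)"
      using s unfolding S_def by blast
    have L: "in_Linf \<Omega> u" "in_Linf \<Omega> G" "W1p0 1 \<Omega> u G" using uG(2) unfolding W1inf0_def by auto
    note u = Linf_normD[OF assms(1) R(2) L(1)] and G = Linf_normD[OF assms(1) R(2) L(2)]
    have um: "u \<in> borel_measurable (lebesgue_on \<Omega>)" using L(1) unfolding in_Linf_def by simp
    have "AE x in lebesgue_on \<Omega>. \<bar>u x\<bar> \<le> Linf_norm \<Omega> G * R"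
      by (rule W11_sup_bound[OF assms(1,2) smooth_boundary_exterior[OF assms(1,3)] R(4) nU L(3) G])
    then have le: "Linf_norm \<Omega> u \<le> Linf_norm \<Omega> G * R"
      using G(2) R(1) by (intro Linf_normI(2)[OF um]) auto
    have "Linf_norm \<Omega> u \<noteq> 0"
    proof
      assume z: "Linf_norm \<Omega> u = 0"
      have "AE x in lebesgue_on \<Omega>. u x = 0" using u(1) by eventually_elim (simp add: z)
      then show False using uG(3) by simp
    qed
    then have "Linf_norm \<Omega> u > 0" using u(2) by simp
    then show ?thesis using le R(1) unfolding uG(1) by (simp add: field_simps)
  qed
  have up: "\<exists>s\<in>S. s \<le> 1 / (R - d)" if d: "0 < d" "d < R" for d
  proof -
    obtain \<theta> where \<theta>: "test_function \<Omega> \<theta>" "\<And>x. norm (grad \<theta> x) \<le> 1" "\<theta> x0 \<ge> R - d"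
      using mollified_cone[OF R(1,3) d(1)] by metis
    note C = test_function_C1[OF \<theta>(1)]
    obtain K where K: "compact K" "\<And>x. x \<notin> K \<Longrightarrow> \<theta> x = 0" using test_function_support[OF \<theta>(1)] by metis
    obtain B where B: "\<And>x. norm (\<theta> x) \<le> B" "B \<ge> 0" using compact_support_bounded[OF C(2) K] by metis
    have m: "\<theta> \<in> borel_measurable (lebesgue_on \<Omega>)" "grad \<theta> \<in> borel_measurable (lebesgue_on \<Omega>)"
      by (intro borel_imp_lebesgue_on borel_measurable_continuous_onI C)+
    note t = Linf_normI[OF m(1) AE_I2[OF B(1)] B(2)]
    note g = Linf_normI[OF m(2) AE_I2[OF \<theta>(2)] zero_le_one]
    have W: "W1inf0 \<Omega> \<theta> (grad \<theta>)" unfolding W1inf0_def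
      using t(1) g(1) W1p0_test[OF assms(1,2) zero_less_one \<theta>(1)] by blast
    have ge: "R - d \<le> Linf_norm \<Omega> \<theta>"
      using Linf_norm_continuous[OF assms(1) continuous_on_subset[OF C(2)] R(2) t(1)] \<theta>(3) by simp
    have nz: "\<not> (AE x in lebesgue_on \<Omega>. \<theta> x = 0)"
    proof
      assume "AE x in lebesgue_on \<Omega>. \<theta> x = 0"
      then have "AE x in lebesgue_on \<Omega>. \<theta> x \<le> 0" by eventually_elim simp
      from AE_lebesgue_on_open_imp[OF assms(1) continuous_on_subset[OF C(2)] this R(2)] \<theta>(3) d
      show False by simp
    qed
    have "Linf_norm \<Omega> (grad \<theta>) / Linf_norm \<Omega> \<theta> \<le> 1 / (R - d)"
      using ge g(2) d by (intro frac_le) auto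
    moreover have "Linf_norm \<Omega> (grad \<theta>) / Linf_norm \<Omega> \<theta> \<in> S" unfolding S_def using W nz by blast
    ultimately show ?thesis by blast
  qed
  have ne: "S \<noteq> {}" using up[of "R/2"] R(1) by auto
  have bb: "bdd_below S" using low by (rule bdd_belowI)
  have lam: "lambda_1_inf \<Omega> = Inf S" unfolding lambda_1_inf_def S_def ..
  have "1 / R \<le> Inf S" by (rule cInf_greatest[OF ne low])
  moreover have "Inf S \<le> 1 / R"
  proof (rule tendsto_lowerbound)
    show "((\<lambda>d. 1 / (R - d)) \<longlongrightarrow> 1 / R) (at_right 0)"
    proof -
      have "((\<lambda>d. 1 / (R - d)) \<longlongrightarrow> 1 / (R - 0)) (at_right 0)" by (intro tendsto_intros) (use R in simp)
      then show ?thesis by simp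
    qed
    have "eventually (\<lambda>d. d \<in> {0<..<R}) (at_right 0)"
      using eventually_at_right_real[OF R(1)] by simp
    then show "eventually (\<lambda>d. Inf S \<le> 1 / (R - d)) (at_right 0)"
    proof eventually_elim
      case (elim d)
      then have "0 < d" "d < R" by auto
      from up[OF this] obtain s where s: "s \<in> S" "s \<le> 1 / (R - d)" by blast
      have "Inf S \<le> s" by (rule cInf_lower[OF s(1) bb])
      then show ?case using s(2) by linarith
    qed
  qed simp
  ultimately show ?thesis unfolding lam by (rule antisym[rotated])
qed

section \<open>Upper bound for the eigenvalues\<close>

lemma Lp_norm_power:
  assumes "p > 0"
  shows "Lp_norm p \<Omega> f powr p = (\<integral>x. norm (f x) powr p \<partial>lebesgue_on \<Omega>)"
proof -
  have "0 \<le> (\<integral>x. norm (f x) powr p \<partial>lebesgue_on \<Omega>)" by (rule Bochner_Integration.integral_nonneg) simp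
  then show ?thesis using assms by (simp add: Lp_norm_def powr_powr)
qed

lemma Lp_norm_ge:
  fixes f :: "'a::euclidean_space \<Rightarrow> 'b::euclidean_space"
  assumes "open \<Omega>" "q > 0" "in_Lp q \<Omega> f" "ball x r \<subseteq> \<Omega>" "c \<ge> 0" "\<And>y. y \<in> ball x r \<Longrightarrow> c \<le> norm (f y)"
  shows "c * measure lborel (ball x r) powr (1/q) \<le> Lp_norm q \<Omega> f"
proof -
  have sm: "ball x r \<in> sets (lebesgue_on \<Omega>)"
    using open_lebesgue[OF assms(1)] assms(4) by (simp add: sets_restrict_space_iff)
  have em: "emeasure (lebesgue_on \<Omega>) (ball x r) = emeasure lebesgue (ball x r)"
    using open_lebesgue[OF assms(1)] assms(4) by (intro emeasure_restrict_space) auto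
  have fin: "emeasure (lebesgue_on \<Omega>) (ball x r) < \<infinity>"
    unfolding em using emeasure_lborel_ball_finite[of x r] by simp
  have i: "integrable (lebesgue_on \<Omega>) (\<lambda>y. norm (f y) powr q)" using assms(3) unfolding in_Lp_def by simp
  have "(\<integral>y. c powr q * indicator (ball x r) y \<partial>lebesgue_on \<Omega>) \<le> (\<integral>y. norm (f y) powr q \<partial>lebesgue_on \<Omega>)"
  proof (rule integral_mono[OF _ i])
    show "integrable (lebesgue_on \<Omega>) (\<lambda>y. c powr q * indicator (ball x r) y)"
      using sm fin by (intro integrable_mult_right integrable_real_indicator)
    show "c powr q * indicator (ball x r) y \<le> norm (f y) powr q" for y
      using assms(2,5,6) by (auto simp: indicator_def intro: powr_mono2)
  qed
  moreover have "(\<integral>y. c powr q * indicator (ball x r) y \<partial>lebesgue_on \<Omega>) = c powr q * measure lborel (ball x r)"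
  proof -
    have "(\<integral>y. indicator (ball x r) y \<partial>lebesgue_on \<Omega>) = measure (lebesgue_on \<Omega>) (ball x r)"
      using sm assms(4) by (simp add: Int_absorb1 Int_absorb2)
    also have "... = measure lborel (ball x r)" using em by (simp add: measure_def)
    finally show ?thesis by simp
  qed
  ultimately have "c powr q * measure lborel (ball x r) \<le> (\<integral>y. norm (f y) powr q \<partial>lebesgue_on \<Omega>)" by (simp only:)
  then have "(c powr q * measure lborel (ball x r)) powr (1/q) \<le> Lp_norm q \<Omega> f"
    unfolding Lp_norm_def using assms(2) by (intro powr_mono2) auto
  then show ?thesis using assms(2,5) by (simp add: powr_mult powr_powr)
qed

lemma Lp_norm_le:
  fixes f :: "'a::euclidean_space \<Rightarrow> 'b::euclidean_space"
  assumes "open \<Omega>" "bounded \<Omega>" "q > 0" "f \<in> borel_measurable (lebesgue_on \<Omega>)" "\<And>y. y \<in> \<Omega> \<Longrightarrow> norm (f y) \<le> c" "c \<ge> 0"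
  shows "Lp_norm q \<Omega> f \<le> c * measure (lebesgue_on \<Omega>) \<Omega> powr (1/q)"
proof -
  interpret finite_measure "lebesgue_on \<Omega>" by (rule finite_measure_bounded_open[OF assms(1,2)])
  have q: "q \<ge> 0" using assms(3) by simp
  have i: "integrable (lebesgue_on \<Omega>) (\<lambda>y. norm (f y) powr q)"
    using in_Lp_bounded[OF assms(1,2) q assms(4,5)] unfolding in_Lp_def by simp
  have "(\<integral>y. norm (f y) powr q \<partial>lebesgue_on \<Omega>) \<le> (\<integral>y. c powr q \<partial>lebesgue_on \<Omega>)"
    using assms(3,5) by (intro integral_mono i) (auto intro: powr_mono2)
  also have "... = c powr q * measure (lebesgue_on \<Omega>) \<Omega>" by (simp add: space_restrict_space)
  finally have "Lp_norm q \<Omega> f \<le> (c powr q * measure (lebesgue_on \<Omega>) \<Omega>) powr (1/q)"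
    unfolding Lp_norm_def using assms(3) by (intro powr_mono2 Bochner_Integration.integral_nonneg) auto
  then show ?thesis using assms(3,6) by (simp add: powr_mult powr_powr)
qed

lemma Lambda_pq_le:
  assumes "W1p0 p \<Omega> u G" "Lp_norm q \<Omega> u = 1"
  shows "Lambda_pq p q \<Omega> \<le> (\<integral>x. norm (G x) powr p \<partial>lebesgue_on \<Omega>)"
  unfolding Lambda_pq_def
proof (rule cInf_lower)
  show "bdd_below {(\<integral>x. norm (G x) powr p \<partial>lebesgue_on \<Omega>) | u G. W1p0 p \<Omega> u G \<and> Lp_norm q \<Omega> u = 1}"
    by (rule bdd_belowI[of _ 0]) (auto intro: Bochner_Integration.integral_nonneg)
qed (use assms in blast)

lemma Lambda_pq_nonneg:
  assumes "W1p0 p \<Omega> u G" "Lp_norm q \<Omega> u = 1"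
  shows "0 \<le> Lambda_pq p q \<Omega>"
  unfolding Lambda_pq_def
  using assms by (intro cInf_greatest) (auto intro: Bochner_Integration.integral_nonneg)

text \<open>The competitor is \<open>\<theta>\<close> divided by its \<open>L^q\<close> norm.\<close>

lemma Lambda_pq_upper:
  fixes \<Omega> :: "'a::euclidean_space set"
  assumes "open \<Omega>" "bounded \<Omega>" "p > 0" "q > 0" and t: "test_function \<Omega> \<theta>" "\<And>x. norm (grad \<theta> x) \<le> 1"
    and N: "0 < c" "c \<le> Lp_norm q \<Omega> \<theta>"
  shows "Lambda_pq p q \<Omega> powr (1/p) \<le> measure (lebesgue_on \<Omega>) \<Omega> powr (1/p) / c"
proof -
  define n where "n = Lp_norm q \<Omega> \<theta>"
  have n: "n > 0" "c \<le> n" using N by (auto simp: n_def)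
  define w where "w = (\<lambda>x. (1/n) * \<theta> x)"
  have wt: "test_function \<Omega> w" "grad w = (\<lambda>x. (1/n) *\<^sub>R grad \<theta> x)"
    unfolding w_def by (rule test_function_scale[OF t(1)])+
  have W: "W1p0 p \<Omega> w (grad w)" by (rule W1p0_test[OF assms(1-3) wt(1)])
  have "(\<integral>x. norm (w x) powr q \<partial>lebesgue_on \<Omega>) = (\<integral>x. (1/n) powr q * norm (\<theta> x) powr q \<partial>lebesgue_on \<Omega>)"
    using n(1) by (simp add: w_def abs_mult powr_mult[symmetric] abs_of_pos)
  also have "... = (1/n) powr q * n powr q" using Lp_norm_power[OF assms(4), of \<Omega> \<theta>] by (simp add: n_def)
  also have "... = 1" using n(1) by (simp add: powr_divide)
  finally have N1: "Lp_norm q \<Omega> w = 1" by (simp add: Lp_norm_def)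
  have wm: "grad w \<in> borel_measurable (lebesgue_on \<Omega>)"
    by (intro borel_imp_lebesgue_on borel_measurable_continuous_onI test_function_C1(3)[OF wt(1)])
  have "norm (grad w y) \<le> 1/n" for y using t(2)[of y] n(1) by (simp add: wt(2) field_simps)
  then have Le: "Lp_norm p \<Omega> (grad w) \<le> (1/n) * measure (lebesgue_on \<Omega>) \<Omega> powr (1/p)"
    using n(1) by (intro Lp_norm_le[OF assms(1-3) wm]) auto
  have "Lambda_pq p q \<Omega> powr (1/p) \<le> (\<integral>x. norm (grad w x) powr p \<partial>lebesgue_on \<Omega>) powr (1/p)"
    using Lambda_pq_le[OF W N1] Lambda_pq_nonneg[OF W N1] assms(3) by (intro powr_mono2) auto
  also have "... \<le> (1/n) * measure (lebesgue_on \<Omega>) \<Omega> powr (1/p)" using Le by (simp add: Lp_norm_def)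
  also have "... \<le> (1/c) * measure (lebesgue_on \<Omega>) \<Omega> powr (1/p)"
    using n N(1) by (intro mult_right_mono frac_le) auto
  finally show ?thesis by simp
qed

lemma measure_lebesgue_on_pos:
  fixes \<Omega> :: "'a::euclidean_space set"
  assumes "open \<Omega>" "bounded \<Omega>" "ball x r \<subseteq> \<Omega>" "r > 0"
  shows "measure (lebesgue_on \<Omega>) \<Omega> > 0"
proof -
  have "measure (lebesgue_on \<Omega>) \<Omega> = measure lebesgue \<Omega>"
    using open_lebesgue[OF assms(1)] by (intro measure_restrict_space) auto
  moreover have "measure lebesgue (ball x r) \<le> measure lebesgue \<Omega>"
    using assms by (intro measure_mono_fmeasurable) (auto intro: lmeasurable_open)
  moreover have "measure lebesgue (ball x r) > 0" using content_ball_pos[OF assms(4), of x] by simp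
  ultimately show ?thesis by linarith
qed

lemma tendsto_powr_inverse:
  fixes p :: "nat \<Rightarrow> real"
  assumes "filterlim p at_top sequentially" "m > 0"
  shows "(\<lambda>k. m powr (1 / p k)) \<longlonglongrightarrow> 1"
proof -
  have "(\<lambda>k. 1 / p k) \<longlonglongrightarrow> 0" using tendsto_inverse_0_at_top[OF assms(1)] by (simp add: inverse_eq_divide)
  then have "(\<lambda>k. m powr (1 / p k)) \<longlonglongrightarrow> m powr 0" using assms(2) by (intro tendsto_powr tendsto_const) auto
  then show ?thesis using assms(2) by simp
qed

text \<open>For a fixed mollified cone the \<open>L^p\<close> norm of the gradient and the \<open>L^q\<close> norm of the function tend to
  the supremum norms, up to factors of the form \<open>(volume)^(1/p)\<close>, which tend to 1.\<close>

lemma Lambda_pq_limsup: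
  fixes \<Omega> :: "'a::euclidean_space set"
  assumes "open \<Omega>" "bounded \<Omega>" and R: "R > 0" "ball x0 R \<subseteq> \<Omega>"
    and p: "filterlim p at_top sequentially" and q: "filterlim q at_top sequentially" and "M > 1 / R"
  shows "eventually (\<lambda>k. Lambda_pq (p k) (q k) \<Omega> powr (1 / p k) < M) sequentially"
proof -
  have M: "M > 0" using R(1) assms(7) by (meson divide_pos_pos less_trans zero_less_one)
  have "1 / M < R" using R(1) M assms(7) by (simp add: field_simps)
  \<comment> \<open>The cone will be higher than \<open>c\<close> near its top, and \<open>1/c < M\<close>.\<close>
  then obtain c where c: "1 / M < c" "c < R" using dense by blast
  have cp: "c > 0" using M c(1) by (meson divide_pos_pos less_trans zero_less_one)
  have cM: "1 / c < M" using c(1) M cp by (simp add: field_simps)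
  define d where "d = (R - c) / 2"
  have d: "d > 0" using c by (simp add: d_def)
  obtain \<theta> where \<theta>: "test_function \<Omega> \<theta>" "\<And>x. norm (grad \<theta> x) \<le> 1" "\<theta> x0 \<ge> R - d"
    using mollified_cone[OF R d] by metis
  note C = test_function_C1[OF \<theta>(1)]
  have "\<theta> x0 > c" using \<theta>(3) c by (simp add: d_def field_simps)
  have "open (\<theta> -` {c<..})" using C(2) by (intro open_vimage) auto
  then obtain r1 where r1: "r1 > 0" "ball x0 r1 \<subseteq> \<theta> -` {c<..}"
    using \<open>\<theta> x0 > c\<close> open_contains_ball by (metis greaterThan_iff vimageI)
  define r where "r = min r1 R"
  have r: "r > 0" "ball x0 r \<subseteq> \<Omega>" "\<And>y. y \<in> ball x0 r \<Longrightarrow> c \<le> norm (\<theta> y)"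
    using r1 R by (auto simp: r_def subset_iff less_imp_le abs_of_pos intro: order_trans[OF _ abs_ge_self])
  define m where "m = measure lborel (ball x0 r)"
  have m: "m > 0" unfolding m_def using content_ball_pos[OF r(1)] .
  define \<mu> where "\<mu> = measure (lebesgue_on \<Omega>) \<Omega>"
  have \<mu>: "\<mu> > 0" unfolding \<mu>_def by (rule measure_lebesgue_on_pos[OF assms(1,2) r(2,1)])
  have "(\<lambda>k. \<mu> powr (1 / p k) / (c * m powr (1 / q k))) \<longlonglongrightarrow> 1 / (c * 1)"
    using cp by (intro tendsto_intros tendsto_powr_inverse p q \<mu> m) auto
  then have ev: "eventually (\<lambda>k. \<mu> powr (1 / p k) / (c * m powr (1 / q k)) < M) sequentially"
    using cM by (intro order_tendstoD(2)) auto
  have evp: "eventually (\<lambda>k. p k > 0) sequentially" "eventually (\<lambda>k. q k > 0) sequentially"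
    using p q by (simp_all add: filterlim_at_top_dense)
  show ?thesis
    using ev evp
  proof eventually_elim
    case (elim k)
    have "c * m powr (1 / q k) \<le> Lp_norm (q k) \<Omega> \<theta>"
      unfolding m_def using elim(3) cp r
      by (intro Lp_norm_ge[OF assms(1)] in_Lp_test(1)[OF assms(1,2) _ \<theta>(1)]) auto
    then have "Lambda_pq (p k) (q k) \<Omega> powr (1 / p k) \<le> \<mu> powr (1 / p k) / (c * m powr (1 / q k))"
      unfolding \<mu>_def using cp m by (intro Lambda_pq_upper[OF assms(1,2) elim(2,3) \<theta>(1,2)]) auto
    then show ?case using elim(1) by linarith
  qed
qed

section \<open>The p-Laplacian flux\<close>

definition flux :: "real \<Rightarrow> 'a::euclidean_space \<Rightarrow> 'a" where
  "flux p \<xi> = norm \<xi> powr (p - 2) *\<^sub>R \<xi>"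

lemma norm_flux: "norm (flux p \<xi>) = norm \<xi> powr (p - 1)"
proof (cases "\<xi> = 0")
  case False
  then have "norm \<xi> powr (p - 1) = norm \<xi> powr (p - 2) * norm \<xi> powr 1"
    by (simp only: powr_add[symmetric]) simp
  then show ?thesis using False by (simp add: flux_def)
qed (simp add: flux_def)

lemma flux_inner: "flux p \<xi> \<bullet> \<xi> = norm \<xi> powr p"
proof (cases "\<xi> = 0")
  case False
  then have "norm \<xi> powr p = norm \<xi> powr (p - 2) * norm \<xi> powr 2"
    by (simp only: powr_add[symmetric]) simp
  also have "norm \<xi> powr 2 = \<xi> \<bullet> \<xi>" using False by (simp add: power2_norm_eq_inner[symmetric])
  finally show ?thesis by (simp add: flux_def)
qed (simp add: flux_def)

lemma norm_flux_conj: "p > 1 \<Longrightarrow> norm (flux p \<xi>) powr (p / (p - 1)) = norm \<xi> powr p"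
  unfolding norm_flux by (simp add: powr_powr)

lemma flux_minus: "flux p (- \<xi>) = - flux p \<xi>"
  by (simp add: flux_def)

text \<open>By the Cauchy-Schwarz inequality it suffices that \<open>t \<mapsto> t^(p-2) t\<close> is increasing on \<open>t \<ge> 0\<close>.\<close>

lemma flux_monotone:
  assumes "p \<ge> 2"
  shows "0 \<le> (flux p \<xi> - flux p \<eta>) \<bullet> (\<xi> - \<eta>)"
proof -
  define a where "a = norm \<xi>"
  define b where "b = norm \<eta>"
  have ab: "a \<ge> 0" "b \<ge> 0" by (simp_all add: a_def b_def)
  define s where "s = a powr (p - 2) + b powr (p - 2)"
  have s: "s \<ge> 0" by (simp add: s_def)
  have sq: "\<xi> \<bullet> \<xi> = a * a" "\<eta> \<bullet> \<eta> = b * b" by (simp_all add: a_def b_def dot_square_norm power2_eq_square)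
  have "(flux p \<xi> - flux p \<eta>) \<bullet> (\<xi> - \<eta>) = a powr (p - 2) * (\<xi> \<bullet> \<xi>) + b powr (p - 2) * (\<eta> \<bullet> \<eta>) - s * (\<xi> \<bullet> \<eta>)"
    by (simp add: flux_def a_def[symmetric] b_def[symmetric] s_def algebra_simps inner_commute)
  moreover have "s * (\<xi> \<bullet> \<eta>) \<le> s * (a * b)"
    using s norm_cauchy_schwarz[of \<xi> \<eta>] by (intro mult_left_mono) (simp_all add: a_def b_def)
  moreover have "a powr (p - 2) * (a * a) + b powr (p - 2) * (b * b) - s * (a * b) =
      (a powr (p - 2) * a - b powr (p - 2) * b) * (a - b)"
    by (simp add: s_def algebra_simps)
  moreover have "0 \<le> (a powr (p - 2) * a - b powr (p - 2) * b) * (a - b)"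
  proof (cases "a \<le> b")
    case True
    then have "a powr (p - 2) * a \<le> b powr (p - 2) * b"
      using ab assms by (intro mult_mono powr_mono2) auto
    then show ?thesis using True by (intro mult_nonpos_nonpos) auto
  next
    case False
    then have "b powr (p - 2) * b \<le> a powr (p - 2) * a"
      using ab assms by (intro mult_mono powr_mono2) auto
    then show ?thesis using False by (intro mult_nonneg_nonneg) auto
  qed
  ultimately show ?thesis unfolding sq by linarith
qed

lemma flux_measurable:
  fixes G :: "'b \<Rightarrow> 'a::euclidean_space"
  assumes "G \<in> borel_measurable M"
  shows "(\<lambda>x. flux p (G x)) \<in> borel_measurable M"
  unfolding flux_def using assms by measurable

text \<open>The square makes the positive part continuously differentiable; comparison with \<open>((b - u)^+)^2\<close>
  instead of \<open>(b - u)^+\<close> thereby stays within \<open>C^1\<close> test functions.\<close>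

lemma DERIV_pos_part_sq: "DERIV (\<lambda>t::real. (max 0 t)\<^sup>2) t :> 2 * max 0 t"
proof (cases "t = 0")
  case False
  consider "t < 0" | "t > 0" using False by linarith
  then show ?thesis
  proof cases
    case 1
    have "DERIV (\<lambda>t. 0) t :> 0" by simp
    then have "DERIV (\<lambda>t::real. (max 0 t)\<^sup>2) t :> 0"
      by (rule has_field_derivative_transform_within_open[of _ _ _ "{..<0}"]) (use 1 in auto)
    then show ?thesis using 1 by simp
  next
    case 2
    have "DERIV (\<lambda>t. t\<^sup>2) t :> 2 * t" by (auto intro!: derivative_eq_intros)
    then have "DERIV (\<lambda>t::real. (max 0 t)\<^sup>2) t :> 2 * t"
      by (rule has_field_derivative_transform_within_open[of _ _ _ "{0<..}"]) (use 2 in auto)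
    then show ?thesis using 2 by simp
  qed
next
  case True
  have "((\<lambda>h::real. (max 0 h)\<^sup>2 / h) \<longlongrightarrow> 0) (at 0)"
  proof (rule tendsto_0_le[where K=1 and f="\<lambda>h. h"])
    have "norm ((max 0 h)\<^sup>2 / h) \<le> norm h * 1" for h :: real
      by (cases "h > 0") (auto simp: power2_eq_square)
    then show "eventually (\<lambda>h::real. norm ((max 0 h)\<^sup>2 / h) \<le> norm h * 1) (at 0)" by simp
  qed (rule tendsto_ident_at)
  then show ?thesis using True by (simp add: DERIV_def)
qed

lemma DERIV_abs_powr:
  fixes t a :: real
  assumes "a > 1" "t \<ge> 0"
  shows "DERIV (\<lambda>t. \<bar>t\<bar> powr a) t :> a * t powr (a - 1)"
proof (cases "t = 0")
  case False
  then have t: "t > 0" using assms by simp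
  have "DERIV (\<lambda>t. t powr a) t :> a * t powr (a - 1)" using t by (rule has_real_derivative_powr)
  then show ?thesis
    by (rule has_field_derivative_transform_within_open[of _ _ _ "{0<..}"]) (use t in auto)
next
  case True
  have "((\<lambda>h::real. \<bar>h\<bar> powr (a - 1)) \<longlongrightarrow> \<bar>0\<bar> powr (a - 1)) (at 0)"
    by (rule tendsto_powr'[OF tendsto_rabs[OF tendsto_ident_at] tendsto_const]) (use assms in auto)
  then have l: "((\<lambda>h::real. \<bar>h\<bar> powr (a - 1)) \<longlongrightarrow> 0) (at 0)" by simp
  have "((\<lambda>h::real. \<bar>h\<bar> powr a / h) \<longlongrightarrow> 0) (at 0)"
  proof (rule tendsto_0_le[OF l, of _ 1])
    have "norm (\<bar>h\<bar> powr a / h) \<le> norm (\<bar>h\<bar> powr (a - 1)) * 1" for h :: real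
      by (cases "h = 0") (auto simp: powr_diff abs_divide)
    then show "eventually (\<lambda>h::real. norm (\<bar>h\<bar> powr a / h) \<le> norm (\<bar>h\<bar> powr (a - 1)) * 1) (at 0)" by simp
  qed
  then show ?thesis using True assms by (simp add: DERIV_def)
qed

lemma GDERIV_sum:
  assumes "finite A" "\<And>j. j \<in> A \<Longrightarrow> GDERIV (f j) x :> g j"
  shows "GDERIV (\<lambda>x. \<Sum>j\<in>A. f j x) x :> (\<Sum>j\<in>A. g j)"
  using assms
proof (induction A rule: finite_induct)
  case empty then show ?case by (simp add: GDERIV_const)
next
  case (insert a A)
  then have "GDERIV (\<lambda>x. f a x + (\<Sum>j\<in>A. f j x)) x :> g a + (\<Sum>j\<in>A. g j)"
    by (intro GDERIV_add) auto
  then show ?case using insert by simp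
qed

text \<open>The norm power is written as \<open>|B \<bullet> B|^((p-2)/2)\<close>, which is differentiable also where \<open>B\<close> vanishes,
  because the exponent exceeds 1 for \<open>p > 4\<close>.\<close>

lemma GDERIV_flux:
  fixes B :: "'a::euclidean_space \<Rightarrow> 'a"
  assumes p: "p > 4" and H: "\<And>i. i \<in> Basis \<Longrightarrow> GDERIV (\<lambda>x. B x \<bullet> i) x :> H i" and i: "i \<in> Basis"
  shows "GDERIV (\<lambda>x. flux p (B x) \<bullet> i) x :>
     norm (B x) powr (p - 2) *\<^sub>R H i + (B x \<bullet> i) *\<^sub>R (((p - 2) * norm (B x) powr (p - 4)) *\<^sub>R (\<Sum>j\<in>Basis. (B x \<bullet> j) *\<^sub>R H j))"
proof -
  define a where "a = (p - 2) / 2"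
  have a: "a > 1" using p by (simp add: a_def)
  have a2: "2 * a = p - 2" by (simp add: a_def)
  have a4: "2 * (a - 1) = p - 4" by (simp add: a_def field_simps)
  have pw: "\<bar>y \<bullet> y\<bar> powr c = norm y powr (2 * c)" for y :: 'a and c
  proof (cases "y = 0")
    case False
    then have "y \<bullet> y = norm y powr 2" by (simp add: dot_square_norm)
    then have "\<bar>y \<bullet> y\<bar> powr c = (norm y powr 2) powr c" by simp
    then show ?thesis by (simp only: powr_powr)
  qed simp
  have "GDERIV (\<lambda>x. \<Sum>j\<in>Basis. (B x \<bullet> j) * (B x \<bullet> j)) x :> (\<Sum>j\<in>Basis. (B x \<bullet> j) *\<^sub>R H j + (B x \<bullet> j) *\<^sub>R H j)"
    by (intro GDERIV_sum GDERIV_mult H) auto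
  also have "(\<lambda>x. \<Sum>j\<in>Basis. (B x \<bullet> j) * (B x \<bullet> j)) = (\<lambda>x. B x \<bullet> B x)"
    by (intro ext euclidean_inner[symmetric])
  also have "(\<Sum>j\<in>Basis. (B x \<bullet> j) *\<^sub>R H j + (B x \<bullet> j) *\<^sub>R H j) = 2 *\<^sub>R (\<Sum>j\<in>Basis. (B x \<bullet> j) *\<^sub>R H j)"
    by (simp add: sum.distrib scaleR_2)
  finally have "GDERIV (\<lambda>x. \<bar>B x \<bullet> B x\<bar> powr a) x :>
     (a * (B x \<bullet> B x) powr (a - 1)) *\<^sub>R (2 *\<^sub>R (\<Sum>j\<in>Basis. (B x \<bullet> j) *\<^sub>R H j))"
    by (rule GDERIV_DERIV_compose) (rule DERIV_abs_powr[OF a], simp)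
  moreover have "(B x \<bullet> B x) powr (a - 1) = norm (B x) powr (p - 4)"
    using pw[of "B x" "a - 1"] unfolding a4 by simp
  moreover have "(\<lambda>x. \<bar>B x \<bullet> B x\<bar> powr a) = (\<lambda>x. norm (B x) powr (p - 2))"
    unfolding pw a2 ..
  ultimately have "GDERIV (\<lambda>x. norm (B x) powr (p - 2)) x :>
     ((p - 2) * norm (B x) powr (p - 4)) *\<^sub>R (\<Sum>j\<in>Basis. (B x \<bullet> j) *\<^sub>R H j)"
    by (simp add: a2[symmetric] mult_ac)
  from GDERIV_mult[OF this H[OF i]] show ?thesis by (simp add: flux_def)
qed

text \<open>The expanded \<open>p\<close>-Laplacian \<open>|b|^(p-4) (|b|^2 tr H + (p-2) \<langle>b, H b\<rangle>)\<close> of a function with gradient \<open>b\<close>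
  whose Hessian has the rows \<open>H i\<close>; at a critical point, where the convention \<open>0 powr a = 0\<close>
  applies, it has the value zero.\<close>

definition plaplace :: "real \<Rightarrow> 'a::euclidean_space \<Rightarrow> ('a \<Rightarrow> 'a) \<Rightarrow> real" where
  "plaplace p b H = norm b powr (p - 2) * (\<Sum>i\<in>Basis. H i \<bullet> i) +
     (p - 2) * norm b powr (p - 4) * (\<Sum>i\<in>Basis. (b \<bullet> H i) * (b \<bullet> i))"

lemma plaplace_eq_divergence:
  fixes b :: "'a::euclidean_space"
  shows "(\<Sum>i\<in>Basis. (norm b powr (p - 2) *\<^sub>R H i + (b \<bullet> i) *\<^sub>R (((p - 2) * norm b powr (p - 4)) *\<^sub>R (\<Sum>j\<in>Basis. (b \<bullet> j) *\<^sub>R H j))) \<bullet> i)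
    = plaplace p b H"
proof -
  have "(\<Sum>i\<in>Basis. (b \<bullet> i) * ((\<Sum>j\<in>Basis. (b \<bullet> j) *\<^sub>R H j) \<bullet> i)) = (\<Sum>j\<in>Basis. (b \<bullet> j) *\<^sub>R H j) \<bullet> b"
    by (subst euclidean_inner) (simp add: mult.commute)
  also have "... = (\<Sum>j\<in>Basis. (b \<bullet> j) * (H j \<bullet> b))"
    by (simp only: inner_sum_left inner_scaleR_left)
  also have "... = (\<Sum>i\<in>Basis. (b \<bullet> H i) * (b \<bullet> i))"
    by (intro sum.cong refl) (simp add: inner_commute mult.commute)
  finally have e: "(\<Sum>i\<in>Basis. (b \<bullet> i) * ((\<Sum>j\<in>Basis. (b \<bullet> j) *\<^sub>R H j) \<bullet> i)) = (\<Sum>i\<in>Basis. (b \<bullet> H i) * (b \<bullet> i))" .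
  have "(\<Sum>i\<in>Basis. (norm b powr (p - 2) *\<^sub>R H i + (b \<bullet> i) *\<^sub>R (((p - 2) * norm b powr (p - 4)) *\<^sub>R (\<Sum>j\<in>Basis. (b \<bullet> j) *\<^sub>R H j))) \<bullet> i)
    = (\<Sum>i\<in>Basis. norm b powr (p - 2) * (H i \<bullet> i) + ((p - 2) * norm b powr (p - 4)) * ((b \<bullet> i) * ((\<Sum>j\<in>Basis. (b \<bullet> j) *\<^sub>R H j) \<bullet> i)))"
    by (intro sum.cong refl) (simp only: inner_add_left inner_scaleR_left mult_ac)
  also have "... = norm b powr (p - 2) * (\<Sum>i\<in>Basis. H i \<bullet> i) + ((p - 2) * norm b powr (p - 4)) *
     (\<Sum>i\<in>Basis. (b \<bullet> i) * ((\<Sum>j\<in>Basis. (b \<bullet> j) *\<^sub>R H j) \<bullet> i))"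
    by (simp only: sum.distrib sum_distrib_left)
  finally show ?thesis unfolding e plaplace_def by simp
qed

section \<open>Weak equations\<close>

lemma integrable_inner_bounded:
  fixes V \<Psi> :: "'b \<Rightarrow> 'a::euclidean_space"
  assumes "integrable M V" "\<Psi> \<in> borel_measurable M" "\<And>x. norm (\<Psi> x) \<le> C"
  shows "integrable M (\<lambda>x. V x \<bullet> \<Psi> x)"
proof (rule Bochner_Integration.integrable_bound)
  show "integrable M (\<lambda>x. C * norm (V x))" using assms(1) by simp
  have [measurable]: "V \<in> borel_measurable M" "\<Psi> \<in> borel_measurable M" using assms by auto
  show "(\<lambda>x. V x \<bullet> \<Psi> x) \<in> borel_measurable M" by measurable
  have "\<bar>V x \<bullet> \<Psi> x\<bar> \<le> \<bar>C * norm (V x)\<bar>" for x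
  proof -
    have "\<bar>V x \<bullet> \<Psi> x\<bar> \<le> norm (V x) * norm (\<Psi> x)" by (rule Cauchy_Schwarz_ineq2)
    also have "... \<le> norm (V x) * C" by (intro mult_left_mono assms) simp
    finally show ?thesis by (simp add: mult.commute)
  qed
  then show "AE x in M. norm (V x \<bullet> \<Psi> x) \<le> norm (C * norm (V x))" by simp
qed

text \<open>Both sides are continuous with respect to uniform convergence of the test function and its
  gradient.\<close>

lemma weak_equation_C1:
  fixes \<Omega> :: "'a::euclidean_space set"
  assumes "open \<Omega>" and V: "integrable (lebesgue_on \<Omega>) V" and h: "integrable (lebesgue_on \<Omega>) h"
    and eq: "\<And>\<phi>. test_function \<Omega> \<phi> \<Longrightarrow> (\<integral>x. V x \<bullet> grad \<phi> x \<partial>lebesgue_on \<Omega>) = (\<integral>x. h x * \<phi> x \<partial>lebesgue_on \<Omega>)"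
    and GD: "\<And>x. GDERIV \<psi> x :> \<Psi> x" and c\<Psi>: "continuous_on UNIV \<Psi>"
    and K: "compact K" "K \<subseteq> \<Omega>" "\<And>x. x \<notin> K \<Longrightarrow> \<psi> x = 0" "\<And>x. x \<notin> K \<Longrightarrow> \<Psi> x = 0"
  shows "(\<integral>x. V x \<bullet> \<Psi> x \<partial>lebesgue_on \<Omega>) = (\<integral>x. h x * \<psi> x \<partial>lebesgue_on \<Omega>)"
proof -
  have c\<psi>: "continuous_on UNIV \<psi>" by (rule GDERIV_continuous_on[OF GD])
  obtain C1 where C1: "\<And>x. norm (\<Psi> x) \<le> C1" using compact_support_bounded[OF c\<Psi> K(1,4)] by metis
  obtain C0 where C0: "\<And>x. norm (\<psi> x) \<le> C0" using compact_support_bounded[OF c\<psi> K(1,3)] by metis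
  have m: "\<psi> \<in> borel_measurable (lebesgue_on \<Omega>)" "\<Psi> \<in> borel_measurable (lebesgue_on \<Omega>)"
    by (intro borel_imp_lebesgue_on borel_measurable_continuous_onI c\<psi> c\<Psi>)+
  have iV: "integrable (lebesgue_on \<Omega>) (\<lambda>x. V x \<bullet> \<Psi> x)" by (rule integrable_inner_bounded[OF V m(2) C1])
  have ih: "integrable (lebesgue_on \<Omega>) (\<lambda>x. h x * \<psi> x)" using integrable_inner_bounded[OF h m(1) C0] by simp
  define D where "D = (\<integral>x. V x \<bullet> \<Psi> x \<partial>lebesgue_on \<Omega>) - (\<integral>x. h x * \<psi> x \<partial>lebesgue_on \<Omega>)"
  define M where "M = (\<integral>x. norm (V x) \<partial>lebesgue_on \<Omega>) + (\<integral>x. \<bar>h x\<bar> \<partial>lebesgue_on \<Omega>)"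
  have "\<bar>D\<bar> \<le> e * M" if e: "e > 0" for e
  proof -
    obtain \<theta> where \<theta>: "test_function \<Omega> \<theta>" "\<And>x. \<bar>\<theta> x - \<psi> x\<bar> \<le> e" "\<And>x. norm (grad \<theta> x - \<Psi> x) \<le> e"
      using C1_approx[OF assms(1) K(1,2,3) GD c\<Psi> e] by metis
    note C = test_function_C1[OF \<theta>(1)]
    have mt: "\<theta> \<in> borel_measurable (lebesgue_on \<Omega>)" "grad \<theta> \<in> borel_measurable (lebesgue_on \<Omega>)"
      by (intro borel_imp_lebesgue_on borel_measurable_continuous_onI C)+
    have i1: "integrable (lebesgue_on \<Omega>) (\<lambda>x. V x \<bullet> (grad \<theta> x - \<Psi> x))"
      by (rule integrable_inner_bounded[OF V borel_measurable_diff[OF mt(2) m(2)] \<theta>(3)])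
    have i2: "integrable (lebesgue_on \<Omega>) (\<lambda>x. h x * (\<theta> x - \<psi> x))"
      using integrable_inner_bounded[OF h borel_measurable_diff[OF mt(1) m(1)], of e] \<theta>(2) by simp
    have "(\<integral>x. V x \<bullet> grad \<theta> x \<partial>lebesgue_on \<Omega>) = (\<integral>x. V x \<bullet> \<Psi> x \<partial>lebesgue_on \<Omega>) + (\<integral>x. V x \<bullet> (grad \<theta> x - \<Psi> x) \<partial>lebesgue_on \<Omega>)"
      using Bochner_Integration.integral_add[OF iV i1] by (simp add: inner_diff_right)
    moreover have "(\<integral>x. h x * \<theta> x \<partial>lebesgue_on \<Omega>) = (\<integral>x. h x * \<psi> x \<partial>lebesgue_on \<Omega>) + (\<integral>x. h x * (\<theta> x - \<psi> x) \<partial>lebesgue_on \<Omega>)"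
      using Bochner_Integration.integral_add[OF ih i2] by (simp add: right_diff_distrib)
    ultimately have D: "D = (\<integral>x. h x * (\<theta> x - \<psi> x) \<partial>lebesgue_on \<Omega>) - (\<integral>x. V x \<bullet> (grad \<theta> x - \<Psi> x) \<partial>lebesgue_on \<Omega>)"
      using eq[OF \<theta>(1)] by (simp add: D_def)
    have b1: "\<bar>\<integral>x. V x \<bullet> (grad \<theta> x - \<Psi> x) \<partial>lebesgue_on \<Omega>\<bar> \<le> (\<integral>x. norm (V x) * e \<partial>lebesgue_on \<Omega>)"
    proof (rule integral_abs_bound_integral[OF i1])
      show "integrable (lebesgue_on \<Omega>) (\<lambda>x. norm (V x) * e)" using V by simp
      show "\<bar>V x \<bullet> (grad \<theta> x - \<Psi> x)\<bar> \<le> norm (V x) * e" for x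
        using Cauchy_Schwarz_ineq2[of "V x" "grad \<theta> x - \<Psi> x"] mult_left_mono[OF \<theta>(3)[of x] norm_ge_zero[of "V x"]]
        by linarith
    qed
    have b2: "\<bar>\<integral>x. h x * (\<theta> x - \<psi> x) \<partial>lebesgue_on \<Omega>\<bar> \<le> (\<integral>x. \<bar>h x\<bar> * e \<partial>lebesgue_on \<Omega>)"
    proof (rule integral_abs_bound_integral[OF i2])
      show "integrable (lebesgue_on \<Omega>) (\<lambda>x. \<bar>h x\<bar> * e)" using h by simp
      show "\<bar>h x * (\<theta> x - \<psi> x)\<bar> \<le> \<bar>h x\<bar> * e" for x
        unfolding abs_mult by (rule mult_left_mono[OF \<theta>(2)]) simp
    qed
    have "(\<integral>x. norm (V x) * e \<partial>lebesgue_on \<Omega>) + (\<integral>x. \<bar>h x\<bar> * e \<partial>lebesgue_on \<Omega>) = e * M"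
      by (simp add: M_def distrib_left mult.commute)
    then show ?thesis using b1 b2 D by linarith
  qed
  note bnd = this
  have "((\<lambda>e. e * M) \<longlongrightarrow> 0 * M) (at_right 0)" by (intro tendsto_intros)
  moreover have "eventually (\<lambda>e. \<bar>D\<bar> \<le> e * M) (at_right 0)"
    using eventually_at_right_less[of 0] by eventually_elim (rule bnd)
  ultimately have "\<bar>D\<bar> \<le> 0 * M" by (rule tendsto_lowerbound) simp
  then show ?thesis by (simp add: D_def)
qed

lemma Holder_inner:
  fixes V f :: "'a::euclidean_space \<Rightarrow> 'a"
  assumes p: "1 < p" and V: "V \<in> borel_measurable (lebesgue_on \<Omega>)"
    and Vi: "integrable (lebesgue_on \<Omega>) (\<lambda>x. norm (V x) powr (p / (p - 1)))" and f: "in_Lp p \<Omega> f"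
  shows "integrable (lebesgue_on \<Omega>) (\<lambda>x. norm (V x) * norm (f x))"
    and "integrable (lebesgue_on \<Omega>) (\<lambda>x. V x \<bullet> f x)"
    and "(\<integral>x. norm (V x) * norm (f x) \<partial>lebesgue_on \<Omega>) \<le>
      (\<integral>x. norm (V x) powr (p / (p - 1)) \<partial>lebesgue_on \<Omega>) powr (1 / (p / (p - 1))) *
      (\<integral>x. norm (f x) powr p \<partial>lebesgue_on \<Omega>) powr (1/p)"
proof -
  have fm: "f \<in> borel_measurable (lebesgue_on \<Omega>)" and fi: "integrable (lebesgue_on \<Omega>) (\<lambda>x. norm (f x) powr p)"
    using f unfolding in_Lp_def by auto
  have c: "1 / (p / (p - 1)) + 1 / p = 1" using conj_exponent(2)[OF p] by simp
  have n: "(\<lambda>x. norm (V x)) \<in> borel_measurable (lebesgue_on \<Omega>)" "(\<lambda>x. norm (f x)) \<in> borel_measurable (lebesgue_on \<Omega>)"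
    using V fm by measurable
  note H = Holder[OF conj_exponent(1)[OF p] p c n norm_ge_zero norm_ge_zero Vi fi]
  show i: "integrable (lebesgue_on \<Omega>) (\<lambda>x. norm (V x) * norm (f x))" by (rule H(1))
  show "(\<integral>x. norm (V x) * norm (f x) \<partial>lebesgue_on \<Omega>) \<le>
      (\<integral>x. norm (V x) powr (p / (p - 1)) \<partial>lebesgue_on \<Omega>) powr (1 / (p / (p - 1))) *
      (\<integral>x. norm (f x) powr p \<partial>lebesgue_on \<Omega>) powr (1/p)" by (rule H(2))
  show "integrable (lebesgue_on \<Omega>) (\<lambda>x. V x \<bullet> f x)"
  proof (rule Bochner_Integration.integrable_bound[OF i])
    show "(\<lambda>x. V x \<bullet> f x) \<in> borel_measurable (lebesgue_on \<Omega>)" using V fm by measurable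
    show "AE x in lebesgue_on \<Omega>. norm (V x \<bullet> f x) \<le> norm (norm (V x) * norm (f x))"
      using Cauchy_Schwarz_ineq2 by (intro AE_I2) (simp add: abs_mult)
  qed
qed

lemma Lp_pairing_tendsto_0:
  fixes V :: "'a::euclidean_space \<Rightarrow> 'a" and f :: "nat \<Rightarrow> 'a \<Rightarrow> 'a"
  assumes p: "1 < p" and V: "V \<in> borel_measurable (lebesgue_on \<Omega>)"
    and Vi: "integrable (lebesgue_on \<Omega>) (\<lambda>x. norm (V x) powr (p / (p - 1)))"
    and f: "\<And>k. in_Lp p \<Omega> (f k)" and lim: "(\<lambda>k. \<integral>x. norm (f k x) powr p \<partial>lebesgue_on \<Omega>) \<longlonglongrightarrow> 0"
  shows "(\<lambda>k. \<integral>x. norm (V x) * norm (f k x) \<partial>lebesgue_on \<Omega>) \<longlonglongrightarrow> 0"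
proof -
  define A where "A = (\<integral>x. norm (V x) powr (p / (p - 1)) \<partial>lebesgue_on \<Omega>) powr (1 / (p / (p - 1)))"
  have "(\<lambda>k. (\<integral>x. norm (f k x) powr p \<partial>lebesgue_on \<Omega>) powr (1/p)) \<longlonglongrightarrow> 0 powr (1/p)"
    by (rule tendsto_powr'[OF lim tendsto_const])
       (use p in \<open>auto intro!: always_eventually Bochner_Integration.integral_nonneg\<close>)
  from tendsto_mult_left[OF this, of A]
  have l: "(\<lambda>k. A * (\<integral>x. norm (f k x) powr p \<partial>lebesgue_on \<Omega>) powr (1/p)) \<longlonglongrightarrow> 0" by simp
  show ?thesis
  proof (rule tendsto_sandwich[OF _ _ tendsto_const l])
    show "\<forall>\<^sub>F k in sequentially. 0 \<le> (\<integral>x. norm (V x) * norm (f k x) \<partial>lebesgue_on \<Omega>)"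
      by (intro always_eventually allI Bochner_Integration.integral_nonneg) simp
    show "\<forall>\<^sub>F k in sequentially. (\<integral>x. norm (V x) * norm (f k x) \<partial>lebesgue_on \<Omega>) \<le> A * (\<integral>x. norm (f k x) powr p \<partial>lebesgue_on \<Omega>) powr (1/p)"
      unfolding A_def by (intro always_eventually allI Holder_inner(3)[OF p V Vi f])
  qed
qed

lemma integral_tendsto_uniform:
  fixes h :: "'a::euclidean_space \<Rightarrow> real"
  assumes h: "integrable (lebesgue_on \<Omega>) h" and i: "\<And>k. integrable (lebesgue_on \<Omega>) (\<lambda>x. h x * \<psi> k x)"
    "integrable (lebesgue_on \<Omega>) (\<lambda>x. h x * \<psi>' x)" and lim: "uniform_limit \<Omega> \<psi> \<psi>' sequentially"
  shows "(\<lambda>k. \<integral>x. h x * \<psi> k x \<partial>lebesgue_on \<Omega>) \<longlonglongrightarrow> (\<integral>x. h x * \<psi>' x \<partial>lebesgue_on \<Omega>)"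
proof (rule LIMSEQ_I)
  fix e :: real assume e: "e > 0"
  define M where "M = (\<integral>x. \<bar>h x\<bar> \<partial>lebesgue_on \<Omega>)"
  have M: "M \<ge> 0" unfolding M_def by (rule Bochner_Integration.integral_nonneg) simp
  define d where "d = e / (M + 1)"
  have d: "d > 0" "M * d < e" using e M by (auto simp: d_def field_simps)
  obtain N where N: "\<And>k x. k \<ge> N \<Longrightarrow> x \<in> \<Omega> \<Longrightarrow> dist (\<psi> k x) (\<psi>' x) < d"
    using uniform_limitD[OF lim d(1)] unfolding eventually_sequentially by blast
  have "norm ((\<integral>x. h x * \<psi> k x \<partial>lebesgue_on \<Omega>) - (\<integral>x. h x * \<psi>' x \<partial>lebesgue_on \<Omega>)) < e" if k: "k \<ge> N" for k
  proof -
    have "(\<integral>x. h x * \<psi> k x \<partial>lebesgue_on \<Omega>) - (\<integral>x. h x * \<psi>' x \<partial>lebesgue_on \<Omega>) = (\<integral>x. h x * \<psi> k x - h x * \<psi>' x \<partial>lebesgue_on \<Omega>)"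
      using i by simp
    also have "\<bar>...\<bar> \<le> (\<integral>x. \<bar>h x\<bar> * d \<partial>lebesgue_on \<Omega>)"
    proof (rule integral_abs_bound_integral)
      show "integrable (lebesgue_on \<Omega>) (\<lambda>x. h x * \<psi> k x - h x * \<psi>' x)" using i by simp
      show "integrable (lebesgue_on \<Omega>) (\<lambda>x. \<bar>h x\<bar> * d)" using h by simp
      fix x assume "x \<in> space (lebesgue_on \<Omega>)"
      then have "\<bar>\<psi> k x - \<psi>' x\<bar> \<le> d" using N[OF k, of x] by (simp add: space_restrict_space dist_real_def less_imp_le)
      then show "\<bar>h x * \<psi> k x - h x * \<psi>' x\<bar> \<le> \<bar>h x\<bar> * d"
        unfolding right_diff_distrib[symmetric] abs_mult by (rule mult_left_mono) simp
    qed
    also have "... = M * d" by (simp add: M_def)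
    finally show ?thesis using d(2) by simp
  qed
  then show "\<exists>N. \<forall>k\<ge>N. norm ((\<integral>x. h x * \<psi> k x \<partial>lebesgue_on \<Omega>) - (\<integral>x. h x * \<psi>' x \<partial>lebesgue_on \<Omega>)) < e" by blast
qed

section \<open>The comparison principle\<close>

text \<open>A function that is \<open>C^1\<close> on an open set \<open>U\<close> and vanishes there outside a closed set \<open>K \<subseteq> U\<close> stays
  \<open>C^1\<close> when extended by zero, since \<open>U\<close> and the complement of \<open>K\<close> cover the space.\<close>

lemma GDERIV_glue_zero:
  fixes f :: "'a::euclidean_space \<Rightarrow> real"
  assumes "open U" "closed K" "K \<subseteq> U"
    and GD: "\<And>x. x \<in> U \<Longrightarrow> GDERIV f x :> g x" and cg: "continuous_on U g"
    and z: "\<And>x. x \<in> U \<Longrightarrow> x \<notin> K \<Longrightarrow> f x = 0"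
  shows "\<And>x. GDERIV (\<lambda>x. if x \<in> U then f x else 0) x :> (if x \<in> U then g x else 0)"
    and "continuous_on UNIV (\<lambda>x. if x \<in> U then g x else 0)"
    and "\<And>x. x \<notin> K \<Longrightarrow> (if x \<in> U then g x else 0) = 0"
proof -
  let ?f = "\<lambda>x. if x \<in> U then f x else 0"
  let ?g = "\<lambda>x. if x \<in> U then g x else 0"
  have fU: "GDERIV ?f x :> g x" if "x \<in> U" for x
    unfolding gderiv_def
    by (rule has_derivative_transform_within_open[OF GD[OF that, unfolded gderiv_def] assms(1) that]) simp
  have fz: "?f x = 0" if "x \<notin> K" for x using z that by simp
  have gz: "?g x = 0" if "x \<notin> K" for x
  proof (cases "x \<in> U")
    case True
    have "g x = 0" by (rule GDERIV_zero_outside[OF fU[OF True] assms(2) fz that])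
    then show ?thesis by simp
  qed simp
  then show "\<And>x. x \<notin> K \<Longrightarrow> ?g x = 0" .
  show "GDERIV ?f x :> ?g x" for x
  proof (cases "x \<in> U")
    case True
    then show ?thesis using fU[OF True] by simp
  next
    case False
    then have xK: "x \<in> - K" using assms(3) by blast
    have o: "open (- K)" using assms(2) by (simp add: open_Compl)
    have "(?f has_derivative (\<lambda>h. h \<bullet> 0)) (at x)"
      by (rule has_derivative_transform_within_open[OF GDERIV_const[of 0 x, unfolded gderiv_def] o xK])
         (simp only: fz Compl_iff not_False_eq_True)
    then show ?thesis using False unfolding gderiv_def by simp
  qed
  have "continuous_on (U \<union> - K) ?g"
  proof (rule continuous_on_open_Un)
    show "open U" "open (- K)" using assms by (auto simp: open_Compl)
    show "continuous_on U ?g" by (rule continuous_on_eq[OF cg]) simp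
    show "continuous_on (- K) ?g"
      by (rule continuous_on_eq[OF continuous_on_const[of _ 0]]) (simp only: gz Compl_iff not_False_eq_True)
  qed
  moreover have "U \<union> - K = UNIV" using assms(3) by blast
  ultimately show "continuous_on UNIV ?g" by simp
qed

lemma indicator_compact_bounded:
  fixes f :: "'a::euclidean_space \<Rightarrow> 'b::euclidean_space"
  assumes "compact K" "continuous_on K f"
  shows "(\<lambda>x. indicator K x *\<^sub>R f x) \<in> borel_measurable borel"
    and "\<exists>C\<ge>0. \<forall>x. norm (indicator K x *\<^sub>R f x) \<le> C"
proof -
  show "(\<lambda>x. indicator K x *\<^sub>R f x) \<in> borel_measurable borel"
    by (rule borel_measurable_continuous_on_indicator[OF _ assms(2)])
       (simp add: borel_closed compact_imp_closed[OF assms(1)])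
  have "bounded (f ` K)" using assms by (intro compact_imp_bounded compact_continuous_image)
  then obtain C where C: "\<And>x. x \<in> K \<Longrightarrow> norm (f x) \<le> C" unfolding bounded_iff by blast
  have "norm (indicator K x *\<^sub>R f x) \<le> max C 0" for x
    using C[of x] by (cases "x \<in> K") auto
  then show "\<exists>C\<ge>0. \<forall>x. norm (indicator K x *\<^sub>R f x) \<le> C" by (intro exI[of _ "max C 0"]) simp
qed

lemma uniform_limit_dominated_difference:
  fixes f :: "nat \<Rightarrow> 'a \<Rightarrow> real"
  assumes "\<And>k x. \<bar>f k x - f' x\<bar> \<le> \<bar>s k x - s' x\<bar>" "uniform_limit UNIV s s' sequentially"
  shows "uniform_limit X f f' sequentially"
proof (rule uniform_limitI)
  fix e :: real assume "e > 0"
  from uniform_limitD[OF assms(2) this] show "\<forall>\<^sub>F n in sequentially. \<forall>x\<in>X. dist (f n x) (f' x) < e"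
  proof eventually_elim
    case (elim n)
    then show ?case using assms(1)[of n] by (metis UNIV_I dist_real_def le_less_trans)
  qed
qed

text \<open>Let \<open>E = \<nabla>((b - u)^+)^2 = 2 (b - u)^+ (\<nabla>b - \<nabla>u)\<close>. Subtracting the weak equation of \<open>u\<close> from the
  classical one of \<open>b\<close>, both tested with \<open>((b - u)^+)^2\<close>, gives
  \<open>\<integral>(flux \<nabla>b - flux \<nabla>u) \<bullet> E = \<integral>(- \<Delta>_p b - h) ((b - u)^+)^2\<close>. The left-hand side is nonnegative by
  monotonicity of the flux and the right-hand side is nonpositive, so \<open>b \<le> u\<close> almost everywhere, hence
  everywhere, in \<open>U\<close>. As \<open>u\<close> has only a weak gradient \<open>G\<close>, it is replaced by smooth functions \<open>s j\<close> in
  the test function, and the identity is obtained in the limit.\<close>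

lemma weak_comparison:
  fixes \<Omega> U W :: "'a::euclidean_space set" and b u h :: "'a \<Rightarrow> real"
  assumes \<Omega>: "open \<Omega>" "bounded \<Omega>" and p: "p > 4"
    and \<phi>: "\<And>k::nat. test_function \<Omega> (\<phi> k)" "uniform_limit UNIV \<phi> u sequentially"
      "\<And>k. in_Lp p \<Omega> (\<lambda>x. grad (\<phi> k) x - G x)"
      "(\<lambda>k. \<integral>x. norm (grad (\<phi> k) x - G x) powr p \<partial>lebesgue_on \<Omega>) \<longlonglongrightarrow> 0"
    and G: "in_Lp p \<Omega> G" and h: "integrable (lebesgue_on \<Omega>) h"
    and eq: "\<And>\<psi>. test_function \<Omega> \<psi> \<Longrightarrow>
      (\<integral>x. flux p (G x) \<bullet> grad \<psi> x \<partial>lebesgue_on \<Omega>) = (\<integral>x. h x * \<psi> x \<partial>lebesgue_on \<Omega>)"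
    and U: "open U" "closure U \<subseteq> \<Omega>" and W: "open W" "closure U \<subseteq> W"
    and b: "\<And>x. x \<in> W \<Longrightarrow> GDERIV b x :> B x"
      "\<And>x i. x \<in> W \<Longrightarrow> i \<in> Basis \<Longrightarrow> GDERIV (\<lambda>x. B x \<bullet> i) x :> H i x"
      "\<And>i. i \<in> Basis \<Longrightarrow> continuous_on W (H i)"
    and strict: "\<And>x. x \<in> U \<Longrightarrow> - plaplace p (B x) (\<lambda>i. H i x) < h x"
    and bd: "\<And>x. x \<in> frontier U \<Longrightarrow> b x < u x"
    and x1: "x1 \<in> U"
  shows "b x1 \<le> u x1"
proof (rule ccontr)
  assume contra: "\<not> b x1 \<le> u x1"
  have p1: "p > 1" "p \<ge> 1" "p \<ge> 0" "p \<ge> 2" using p by auto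
  have UW: "U \<subseteq> W" "U \<subseteq> \<Omega>" using closure_subset U W by blast+
  have cu: "continuous_on UNIV u"
    by (rule uniform_limit_theorem[OF always_eventually \<phi>(2)]) (use test_function_C1(2)[OF \<phi>(1)] in auto)
  have cb: "continuous_on W b"
    by (rule continuous_at_imp_continuous_on, rule ballI, rule GDERIV_continuous, rule b(1))
  have cB: "continuous_on W B"
  proof (rule continuous_on_vectorI)
    fix i :: 'a assume i: "i \<in> Basis"
    show "continuous_on W (\<lambda>x. B x \<bullet> i)"
      by (rule continuous_at_imp_continuous_on, rule ballI, rule GDERIV_continuous, rule b(2)[OF _ i])
  qed
  have cl: "compact (closure U)" using bounded_subset[OF \<Omega>(2) U(2)] by (simp add: compact_eq_bounded_closed)
  have clf: "closure U = U \<union> frontier U" using U(1) by (auto simp: frontier_def interior_open closure_subset[THEN subsetD])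
  \<comment> \<open>A margin on the compact frontier keeps the functions \<open>s j\<close> above \<open>b\<close>
    there as well, and makes \<open>(b - s j)^+\<close> vanish outside the compact set \<open>K
    \<subseteq> U\<close> defined below.\<close>
  obtain \<delta> where \<delta>: "\<delta> > 0" "\<And>x. x \<in> frontier U \<Longrightarrow> b x - u x < - \<delta>"
  proof (cases "frontier U = {}")
    case True
    then show ?thesis using that[of 1] by simp
  next
    case False
    have cf: "compact (frontier U)" using bounded_subset[OF \<Omega>(2)] UW(2) by (intro compact_frontier_bounded) blast
    have fs: "frontier U \<subseteq> W" using clf W(2) by blast
    have "continuous_on (frontier U) (\<lambda>x. u x - b x)"
      by (rule continuous_on_diff[OF continuous_on_subset[OF cu subset_UNIV] continuous_on_subset[OF cb fs]])
    from continuous_attains_inf[OF cf False this]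
    obtain z where z: "z \<in> frontier U" "\<forall>x\<in>frontier U. u z - b z \<le> u x - b x"
      by (elim bexE) (rule that)
    have "u z - b z > 0" using bd[OF z(1)] by simp
    show ?thesis
    proof (rule that[of "(u z - b z) / 2"])
      show "(u z - b z) / 2 > 0" using \<open>u z - b z > 0\<close> by simp
      show "b x - u x < - ((u z - b z) / 2)" if "x \<in> frontier U" for x
        using bspec[OF z(2) that] \<open>u z - b z > 0\<close> by argo
    qed
  qed
  define K where "K = closure U \<inter> {x. - \<delta> \<le> b x - u x}"
  have "closedin (top_of_set (closure U)) (closure U \<inter> (\<lambda>x. b x - u x) -` {- \<delta>..})"
    by (rule continuous_closedin_preimage[OF continuous_on_diff[OF continuous_on_subset[OF cb W(2)] continuous_on_subset[OF cu subset_UNIV]] closed_atLeast])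
  then have "closedin (top_of_set (closure U)) K" unfolding K_def by (simp add: vimage_def)
  then have K: "compact K" using cl closedin_compact by blast
  have KU: "K \<subseteq> U"
  proof
    fix x assume x: "x \<in> K"
    show "x \<in> U"
    proof (rule ccontr)
      assume "x \<notin> U"
      then have "x \<in> frontier U" using x clf by (auto simp: K_def)
      then show False using \<delta>(2)[of x] x by (simp add: K_def)
    qed
  qed
  have K\<Omega>: "K \<subseteq> \<Omega>" "K \<subseteq> W" using KU UW by blast+
  have clK: "closed K" using K by (rule compact_imp_closed)
  have offK: "b x - u x < - \<delta>" if "x \<in> U" "x \<notin> K" for x
    using that closure_subset[of U] by (auto simp: K_def not_le)
  obtain J where J: "\<And>j x. j \<ge> J \<Longrightarrow> dist (\<phi> j x) (u x) < \<delta>"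
    using uniform_limitD[OF \<phi>(2) \<delta>(1)] unfolding eventually_sequentially by blast
  define s where "s = (\<lambda>j. \<phi> (j + J))"
  have s\<delta>: "\<bar>s j x - u x\<bar> < \<delta>" for j x using J[of "j + J" x] by (simp add: s_def dist_real_def)
  have st: "test_function \<Omega> (s j)" for j unfolding s_def by (rule \<phi>(1))
  have slim: "uniform_limit UNIV s u sequentially"
  proof (rule uniform_limitI)
    fix e :: real assume "e > 0"
    from uniform_limitD[OF \<phi>(2) this] obtain N where "\<And>n. n \<ge> N \<Longrightarrow> \<forall>x\<in>UNIV. dist (\<phi> n x) (u x) < e"
      unfolding eventually_sequentially by blast
    then show "\<forall>\<^sub>F n in sequentially. \<forall>x\<in>UNIV. dist (s n x) (u x) < e"
      unfolding eventually_sequentially s_def by (intro exI[of _ N]) simp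
  qed
  have sG: "in_Lp p \<Omega> (\<lambda>x. grad (s j) x - G x)" for j unfolding s_def by (rule \<phi>(3))
  have sGlim: "(\<lambda>j. \<integral>x. norm (grad (s j) x - G x) powr p \<partial>lebesgue_on \<Omega>) \<longlonglongrightarrow> 0"
    unfolding s_def using LIMSEQ_ignore_initial_segment[OF \<phi>(4), of J] .
  note Cs = test_function_C1[OF st]
  \<comment> \<open>The positive parts \<open>(b - s j)^+\<close> and \<open>(b - u)^+\<close>, and the flux, the
    \<open>p\<close>-Laplacian and the gradient of \<open>b\<close>; since \<open>b\<close> lives
    on \<open>W\<close> only, everything is cut off to \<open>K\<close>, which makes it globally
    measurable and bounded.\<close>
  define m where "m = (\<lambda>j x. indicator K x *\<^sub>R max 0 (b x - s j x))"
  define m' where "m' = (\<lambda>x. indicator K x *\<^sub>R max 0 (b x - u x))"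
  define F where "F = (\<lambda>x. indicator K x *\<^sub>R flux p (B x))"
  define D where "D = (\<lambda>x. indicator K x *\<^sub>R plaplace p (B x) (\<lambda>i. H i x))"
  define BK where "BK = (\<lambda>x. indicator K x *\<^sub>R B x)"
  have cbK: "continuous_on K b" and cBK: "continuous_on K B" and cuK: "continuous_on K u"
    and csK: "\<And>j. continuous_on K (s j)" and cHK: "\<And>i. i \<in> Basis \<Longrightarrow> continuous_on K (H i)"
    by (rule continuous_on_subset[OF cb K\<Omega>(2)], rule continuous_on_subset[OF cB K\<Omega>(2)], rule continuous_on_subset[OF cu subset_UNIV],
      rule continuous_on_subset[OF Cs(2) subset_UNIV], rule continuous_on_subset[OF b(3) K\<Omega>(2)])
  have cflux: "continuous_on X (\<lambda>x. flux p (B x))" if "continuous_on X B" for X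
    unfolding flux_def using p that by (intro continuous_on_scaleR continuous_on_norm_powr) auto
  have cplap: "continuous_on X (\<lambda>x. plaplace p (B x) (\<lambda>i. H i x))"
    if "continuous_on X B" "\<And>i. i \<in> Basis \<Longrightarrow> continuous_on X (H i)" for X
    unfolding plaplace_def using p that by (intro continuous_intros continuous_on_norm_powr) auto
  have cm: "continuous_on K (\<lambda>x. max 0 (b x - s j x))" for j by (intro continuous_intros cbK csK)
  have cm': "continuous_on K (\<lambda>x. max 0 (b x - u x))" by (intro continuous_intros cbK cuK)
  have im: "m j \<in> borel_measurable borel" for j
    unfolding m_def by (rule indicator_compact_bounded(1)[OF K cm])
  have im': "m' \<in> borel_measurable borel" "\<exists>C\<ge>0. \<forall>x. norm (m' x) \<le> C"
    unfolding m'_def by (rule indicator_compact_bounded[OF K cm'])+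
  have iF: "F \<in> borel_measurable borel" "\<exists>C\<ge>0. \<forall>x. norm (F x) \<le> C"
    unfolding F_def by (rule indicator_compact_bounded[OF K cflux[OF cBK]])+
  have iD: "D \<in> borel_measurable borel" "\<exists>C\<ge>0. \<forall>x. norm (D x) \<le> C"
    unfolding D_def by (rule indicator_compact_bounded[OF K cplap[OF cBK cHK]]; assumption)+
  have iB: "BK \<in> borel_measurable borel" "\<exists>C\<ge>0. \<forall>x. norm (BK x) \<le> C"
    unfolding BK_def by (rule indicator_compact_bounded[OF K cBK])+
  obtain Cm' where Cm': "Cm' \<ge> 0" "\<And>x. norm (m' x) \<le> Cm'" using im'(2) by blast
  define C where "C = Cm' + \<delta>"
  have C: "C \<ge> 0" using Cm' \<delta> by (simp add: C_def)
  have md: "\<bar>m j x - m' x\<bar> \<le> \<bar>s j x - u x\<bar>" for j x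
    unfolding m_def m'_def by (cases "x \<in> K") (auto simp: max_def)
  have mb: "\<bar>m j x\<bar> \<le> C" for j x
    using md[of j x] s\<delta>[of j x] Cm'(2)[of x] by (simp add: C_def)
  have m'b: "\<bar>m' x\<bar> \<le> C" for x using Cm'(2)[of x] \<delta> by (simp add: C_def)
  have m0: "m j x \<ge> 0" "m' x \<ge> 0" for j x by (simp_all add: m_def m'_def)
  have mm: "m j \<in> borel_measurable (lebesgue_on \<Omega>)" "m' \<in> borel_measurable (lebesgue_on \<Omega>)"
    "F \<in> borel_measurable (lebesgue_on \<Omega>)" "D \<in> borel_measurable (lebesgue_on \<Omega>)" "BK \<in> borel_measurable (lebesgue_on \<Omega>)" for j
    using im im'(1) iF(1) iD(1) iB(1) by (simp_all add: borel_imp_lebesgue_on)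
  have mlim: "uniform_limit \<Omega> m m' sequentially" by (rule uniform_limit_dominated_difference[OF md slim])
  interpret fm: finite_measure "lebesgue_on \<Omega>" by (rule finite_measure_bounded_open[OF \<Omega>])
  have Gm: "G \<in> borel_measurable (lebesgue_on \<Omega>)" using G unfolding in_Lp_def by simp
  have fGm: "(\<lambda>x. flux p (G x)) \<in> borel_measurable (lebesgue_on \<Omega>)" by (rule flux_measurable[OF Gm])
  have fGi: "integrable (lebesgue_on \<Omega>) (\<lambda>x. norm (flux p (G x)) powr (p / (p - 1)))"
    unfolding norm_flux_conj[OF p1(1)] using G unfolding in_Lp_def by simp
  have q1: "p / (p - 1) \<ge> 1" "p / (p - 1) \<ge> 0" using p by auto
  have fGL: "in_Lp (p / (p - 1)) \<Omega> (\<lambda>x. flux p (G x))" unfolding in_Lp_def using fGm fGi by blast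
  have FL: "in_Lp (p / (p - 1)) \<Omega> F"
    using iF(2) by (elim exE conjE) (rule in_Lp_bounded[OF \<Omega> q1(2) mm(3)], blast)
  define V where "V = (\<lambda>x. F x - flux p (G x))"
  have VL: "in_Lp (p / (p - 1)) \<Omega> V" unfolding V_def by (rule in_Lp_diff[OF q1(2) FL fGL])
  have Vm: "V \<in> borel_measurable (lebesgue_on \<Omega>)" and Vi: "integrable (lebesgue_on \<Omega>) (\<lambda>x. norm (V x) powr (p / (p - 1)))"
    using VL unfolding in_Lp_def by auto
  have fG1: "integrable (lebesgue_on \<Omega>) (\<lambda>x. flux p (G x))" by (rule in_Lp_integrable(1)[OF \<Omega> q1(1) fGL])
  have BGL: "in_Lp p \<Omega> (\<lambda>x. BK x - G x)"
  proof (rule in_Lp_diff[OF p1(3) _ G])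
    show "in_Lp p \<Omega> BK" using iB(2) by (elim exE conjE) (rule in_Lp_bounded[OF \<Omega> p1(3) mm(5)], blast)
  qed
  \<comment> \<open>The test function is \<open>w j\<close> with gradient \<open>E j\<close>. On \<open>U\<close>
    they agree with \<open>f j\<close> and \<open>g j\<close>, which are visibly of class
    \<open>C^1\<close>; off \<open>U\<close> they are zero.\<close>
  define E where "E = (\<lambda>j x. (2 * m j x) *\<^sub>R (BK x - grad (s j) x))"
  define w where "w = (\<lambda>j x. (m j x)\<^sup>2)"
  define f where "f = (\<lambda>j x. (max 0 (b x - s j x))\<^sup>2)"
  define g where "g = (\<lambda>j x. (2 * max 0 (b x - s j x)) *\<^sub>R (B x - grad (s j) x))"
  have fz: "max 0 (b x - s j x) = 0" if "x \<in> U" "x \<notin> K" for j x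
    using offK[OF that] s\<delta>[of j x] by simp
  have fg: "GDERIV (f j) x :> g j x" if "x \<in> U" for j x
    unfolding f_def g_def
    by (rule GDERIV_DERIV_compose[OF GDERIV_diff[OF b(1) Cs(1)] DERIV_pos_part_sq]) (use that UW in blast)
  have cbU: "continuous_on U b" and cBU: "continuous_on U B" and csU: "continuous_on U (s j)" and cgU: "continuous_on U (grad (s j))" for j
    by (rule continuous_on_subset[OF cb UW(1)], rule continuous_on_subset[OF cB UW(1)], rule continuous_on_subset[OF Cs(2) subset_UNIV],
      rule continuous_on_subset[OF Cs(3) subset_UNIV])
  have cg: "continuous_on U (g j)" for j unfolding g_def by (intro continuous_intros cbU cBU csU cgU)
  have fzero: "f j x = 0" if "x \<in> U" "x \<notin> K" for j x using fz[OF that] by (simp add: f_def)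
  have w_eq: "(if x \<in> U then f j x else 0) = w j x" for j x
    using fz[of x j] KU by (cases "x \<in> K") (auto simp: w_def m_def f_def)
  have E_eq: "(if x \<in> U then g j x else 0) = E j x" for j x
    using fz[of x j] KU by (cases "x \<in> K") (auto simp: E_def m_def g_def BK_def)
  have wE: "GDERIV (w j) x :> E j x" "continuous_on UNIV (E j)" "x \<notin> K \<Longrightarrow> E j x = 0" "x \<notin> K \<Longrightarrow> w j x = 0" for j x
  proof -
    note gl = GDERIV_glue_zero[where f="f j" and g="g j", OF U(1) clK KU fg cg fzero, unfolded w_eq E_eq]
    show "GDERIV (w j) x :> E j x" by (rule gl(1))
    show "continuous_on UNIV (E j)" by (rule gl(2))
    show "E j x = 0" if "x \<notin> K" by (rule gl(3)) (use that in simp_all)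
    show "w j x = 0" if "x \<notin> K" using that by (simp add: w_def m_def)
  qed
  have cw: "continuous_on UNIV (w j)" for j by (rule GDERIV_continuous_on[OF wE(1)])
  have eq1: "(\<integral>x. flux p (G x) \<bullet> E j x \<partial>lebesgue_on \<Omega>) = (\<integral>x. h x * w j x \<partial>lebesgue_on \<Omega>)" for j
    by (rule weak_equation_C1[OF \<Omega>(1) fG1 h eq wE(1,2) K K\<Omega>(1) wE(4,3)])
  \<comment> \<open>The classical equation of \<open>b\<close> with the same test function: each component of
    \<open>w j\<close> times the flux of \<open>b\<close> has compact support, so the integral of
    its partial derivative vanishes.\<close>
  define DF where "DF = (\<lambda>i x. norm (B x) powr (p - 2) *\<^sub>R H i x +
     (B x \<bullet> i) *\<^sub>R (((p - 2) * norm (B x) powr (p - 4)) *\<^sub>R (\<Sum>j\<in>Basis. (B x \<bullet> j) *\<^sub>R H j x)))"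
  have cHU: "continuous_on U (H i)" if "i \<in> Basis" for i by (rule continuous_on_subset[OF b(3)[OF that] UW(1)])
  have part: "integrable lborel (\<lambda>x. (F x \<bullet> i) * (E j x \<bullet> i) + w j x * (indicator K x *\<^sub>R DF i x \<bullet> i)) \<and>
     (\<integral>x. (F x \<bullet> i) * (E j x \<bullet> i) + w j x * (indicator K x *\<^sub>R DF i x \<bullet> i) \<partial>lborel) = 0" if i: "i \<in> Basis" for i j
  proof -
    let ?f = "\<lambda>x. (flux p (B x) \<bullet> i) * f j x"
    let ?g = "\<lambda>x. (flux p (B x) \<bullet> i) *\<^sub>R g j x + f j x *\<^sub>R DF i x"
    have d: "GDERIV ?f x :> ?g x" if "x \<in> U" for x
      unfolding DF_def
      by (rule GDERIV_mult[OF GDERIV_flux[OF p b(2) i] fg[OF that]]) (use that UW in blast)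
    have c: "continuous_on U ?g"
      unfolding DF_def f_def using p
      by (intro continuous_intros cflux cg cbU cBU csU cHU i continuous_on_norm_powr) auto
    have z: "?f x = 0" if "x \<in> U" "x \<notin> K" for x using fzero[OF that] by simp
    have gl1: "GDERIV (\<lambda>x. if x \<in> U then ?f x else 0) x :> (if x \<in> U then ?g x else 0)" for x
      by (rule GDERIV_glue_zero(1)[OF U(1) clK KU d c z])
    have gl2: "continuous_on UNIV (\<lambda>x. if x \<in> U then ?g x else 0)"
      by (rule GDERIV_glue_zero(2)[OF U(1) clK KU d c z])
    have gl3: "(if x \<in> U then ?g x else 0) = 0" if "x \<notin> K" for x
      by (rule GDERIV_glue_zero(3)[OF U(1) clK KU d c z]) (use that in simp_all)
    have zf: "(if x \<in> U then ?f x else 0) = 0" if "x \<notin> K" for x using z[of x] that by simp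
    have "(\<integral>x. (if x \<in> U then ?g x else 0) \<bullet> i \<partial>lborel) = 0"
      by (rule integral_partial_zero[OF gl1 gl2 K zf gl3])
    moreover have "(if x \<in> U then ?g x else 0) \<bullet> i = (F x \<bullet> i) * (E j x \<bullet> i) + w j x * (indicator K x *\<^sub>R DF i x \<bullet> i)" for x
    proof (cases "x \<in> K")
      case True
      then have "x \<in> U" using KU by blast
      then show ?thesis using True E_eq[of x j] w_eq[of x j] by (simp add: F_def inner_add_left)
    next
      case False
      then show ?thesis using gl3[OF False] wE(3,4)[OF False, of j] by (simp only: inner_zero_left mult_zero_right mult_zero_left add_0)
    qed
    moreover have "integrable lborel (\<lambda>x. (if x \<in> U then ?g x else 0) \<bullet> i)"
    proof (rule continuous_supp_integrable[OF _ K])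
      show "continuous_on UNIV (\<lambda>x. (if x \<in> U then ?g x else 0) \<bullet> i)"
        by (intro continuous_on_inner gl2 continuous_on_const)
      show "(if x \<in> U then ?g x else 0) \<bullet> i = 0" if "x \<notin> K" for x using gl3[OF that] by (simp only: inner_zero_left)
    qed
    ultimately show ?thesis by (simp only: simp_thms)
  qed
  have sumF: "(\<Sum>i\<in>Basis. (F x \<bullet> i) * (E j x \<bullet> i) + w j x * (indicator K x *\<^sub>R DF i x \<bullet> i)) = F x \<bullet> E j x + D x * w j x" for j x
  proof -
    have "(\<Sum>i\<in>Basis. DF i x \<bullet> i) = plaplace p (B x) (\<lambda>i. H i x)"
      unfolding DF_def by (rule plaplace_eq_divergence)
    then have "(\<Sum>i\<in>Basis. w j x * (indicator K x *\<^sub>R DF i x \<bullet> i)) = D x * w j x"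
      unfolding D_def by (simp add: sum_distrib_left[symmetric] mult_ac)
    then show ?thesis by (simp add: sum.distrib euclidean_inner[symmetric])
  qed
  have eq2: "(\<integral>x. F x \<bullet> E j x + D x * w j x \<partial>lebesgue_on \<Omega>) = 0" for j
  proof -
    have "(\<integral>x. F x \<bullet> E j x + D x * w j x \<partial>lborel) =
       (\<integral>x. (\<Sum>i\<in>Basis. (F x \<bullet> i) * (E j x \<bullet> i) + w j x * (indicator K x *\<^sub>R DF i x \<bullet> i)) \<partial>lborel)"
      unfolding sumF ..
    also have "... = (\<Sum>i\<in>Basis. (\<integral>x. (F x \<bullet> i) * (E j x \<bullet> i) + w j x * (indicator K x *\<^sub>R DF i x \<bullet> i) \<partial>lborel))"
      using part by (intro Bochner_Integration.integral_sum) blast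
    also have "... = 0" using part by (intro sum.neutral) blast
    finally have z: "(\<integral>x. F x \<bullet> E j x + D x * w j x \<partial>lborel) = 0" .
    have [measurable]: "F \<in> borel_measurable borel" "D \<in> borel_measurable borel" "E j \<in> borel_measurable borel" "w j \<in> borel_measurable borel"
      using iF(1) iD(1) borel_measurable_continuous_onI[OF wE(2)] borel_measurable_continuous_onI[OF cw] by auto
    have "(\<integral>x. F x \<bullet> E j x + D x * w j x \<partial>lebesgue_on \<Omega>) = (\<integral>x. F x \<bullet> E j x + D x * w j x \<partial>lborel)"
    proof (rule integral_lebesgue_on_supp[OF \<Omega>(1)])
      show "(\<lambda>x. F x \<bullet> E j x + D x * w j x) \<in> borel_measurable borel" by measurable
      fix x assume "x \<notin> \<Omega>"
      then have "x \<notin> K" using K\<Omega>(1) by blast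
      then show "F x \<bullet> E j x + D x * w j x = 0" by (simp add: F_def D_def)
    qed
    then show ?thesis using z by simp
  qed
  define k where "k = (\<lambda>x. - D x - h x)"
  obtain CD where CD: "\<forall>x. norm (D x) \<le> CD" using iD(2) by blast
  have iDi: "integrable (lebesgue_on \<Omega>) D"
    by (rule fm.integrable_const_bound[OF _ mm(4), of CD]) (use CD in \<open>simp add: always_eventually\<close>)
  have ki: "integrable (lebesgue_on \<Omega>) k" unfolding k_def using iDi h by simp
  have wm: "w j \<in> borel_measurable (lebesgue_on \<Omega>)" for j unfolding w_def using mm(1)[of j] by measurable
  have Em: "E j \<in> borel_measurable (lebesgue_on \<Omega>)" for j
    by (intro borel_imp_lebesgue_on borel_measurable_continuous_onI wE)
  have wb: "\<bar>w j x\<bar> \<le> C * C" for j x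
    unfolding w_def power2_eq_square abs_mult by (intro mult_mono mb) (simp_all add: C)
  have Eb: "\<exists>c. \<forall>x. norm (E j x) \<le> c" for j using compact_support_bounded[OF wE(2) K wE(3)] by metis
  have bmi: "integrable (lebesgue_on \<Omega>) (\<lambda>x. r x * t x)"
    if "integrable (lebesgue_on \<Omega>) r" "t \<in> borel_measurable (lebesgue_on \<Omega>)" "\<And>x. \<bar>t x\<bar> \<le> c" for r t :: "'a \<Rightarrow> real" and c
    using integrable_inner_bounded[OF that(1,2), of c] that(3) by simp
  have V1: "integrable (lebesgue_on \<Omega>) V" by (rule in_Lp_integrable(1)[OF \<Omega> q1(1) VL])
  have iVE: "integrable (lebesgue_on \<Omega>) (\<lambda>x. V x \<bullet> E j x)" for j
    using Eb[of j] by (elim exE) (rule integrable_inner_bounded[OF V1 Em], blast)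
  have ifE: "integrable (lebesgue_on \<Omega>) (\<lambda>x. flux p (G x) \<bullet> E j x)" for j
    using Eb[of j] by (elim exE) (rule integrable_inner_bounded[OF fG1 Em], blast)
  have iFE: "integrable (lebesgue_on \<Omega>) (\<lambda>x. F x \<bullet> E j x)" for j
    using Eb[of j] by (elim exE) (rule integrable_inner_bounded[OF in_Lp_integrable(1)[OF \<Omega> q1(1) FL] Em], blast)
  have main: "(\<integral>x. V x \<bullet> E j x \<partial>lebesgue_on \<Omega>) = (\<integral>x. k x * w j x \<partial>lebesgue_on \<Omega>)" for j
  proof -
    have iDw: "integrable (lebesgue_on \<Omega>) (\<lambda>x. D x * w j x)" by (rule bmi[OF iDi wm wb])
    have ihw: "integrable (lebesgue_on \<Omega>) (\<lambda>x. h x * w j x)" by (rule bmi[OF h wm wb])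
    have a: "(\<integral>x. F x \<bullet> E j x \<partial>lebesgue_on \<Omega>) = - (\<integral>x. D x * w j x \<partial>lebesgue_on \<Omega>)"
      using eq2[of j] Bochner_Integration.integral_add[OF iFE[of j] iDw] by linarith
    have "(\<integral>x. V x \<bullet> E j x \<partial>lebesgue_on \<Omega>) = (\<integral>x. F x \<bullet> E j x - flux p (G x) \<bullet> E j x \<partial>lebesgue_on \<Omega>)"
      by (simp add: V_def inner_diff_left)
    also have "... = - (\<integral>x. D x * w j x \<partial>lebesgue_on \<Omega>) - (\<integral>x. h x * w j x \<partial>lebesgue_on \<Omega>)"
      using Bochner_Integration.integral_diff[OF iFE[of j] ifE[of j]] a eq1[of j] by linarith
    also have "... = (\<integral>x. k x * w j x \<partial>lebesgue_on \<Omega>)"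
    proof -
      have "(\<integral>x. k x * w j x \<partial>lebesgue_on \<Omega>) = (\<integral>x. - (D x * w j x) - h x * w j x \<partial>lebesgue_on \<Omega>)"
        by (simp add: k_def algebra_simps)
      also have "... = (\<integral>x. - (D x * w j x) \<partial>lebesgue_on \<Omega>) - (\<integral>x. h x * w j x \<partial>lebesgue_on \<Omega>)"
        by (rule Bochner_Integration.integral_diff) (use iDw ihw in auto)
      finally show ?thesis by simp
    qed
    finally show ?thesis .
  qed
  \<comment> \<open>Replacing \<open>\<nabla>(s j)\<close> by \<open>G\<close> in \<open>E j\<close> costs an
    error that tends to zero, since the flux difference \<open>V\<close> is in the dual space of
    \<open>L^p\<close>; the remaining factors converge uniformly.\<close>
  define a where "a = (\<lambda>x. 2 * (V x \<bullet> (BK x - G x)))"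
  have ai: "integrable (lebesgue_on \<Omega>) a" unfolding a_def using Holder_inner(2)[OF p1(1) Vm Vi BGL] by simp
  have L1: "(\<lambda>j. \<integral>x. a x * m j x \<partial>lebesgue_on \<Omega>) \<longlonglongrightarrow> (\<integral>x. a x * m' x \<partial>lebesgue_on \<Omega>)"
    by (rule integral_tendsto_uniform[OF ai bmi[OF ai mm(1) mb] bmi[OF ai mm(2) m'b] mlim])
  have L2: "(\<lambda>j. \<integral>x. V x \<bullet> E j x - a x * m j x \<partial>lebesgue_on \<Omega>) \<longlonglongrightarrow> 0"
  proof -
    have "(\<lambda>j. 2 * C * (\<integral>x. norm (V x) * norm (grad (s j) x - G x) \<partial>lebesgue_on \<Omega>)) \<longlonglongrightarrow> 2 * C * 0"
      by (intro tendsto_mult_left Lp_pairing_tendsto_0[OF p1(1) Vm Vi sG sGlim])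
    then have "(\<lambda>j. 2 * C * (\<integral>x. norm (V x) * norm (grad (s j) x - G x) \<partial>lebesgue_on \<Omega>)) \<longlonglongrightarrow> 0" by simp
    then show ?thesis
    proof (rule tendsto_0_le[where K=1], intro always_eventually allI)
      fix j
      have n: "0 \<le> (\<integral>x. norm (V x) * norm (grad (s j) x - G x) \<partial>lebesgue_on \<Omega>)"
        by (rule Bochner_Integration.integral_nonneg) simp
      have "\<bar>\<integral>x. V x \<bullet> E j x - a x * m j x \<partial>lebesgue_on \<Omega>\<bar> \<le> (\<integral>x. 2 * C * (norm (V x) * norm (grad (s j) x - G x)) \<partial>lebesgue_on \<Omega>)"
      proof (rule integral_abs_bound_integral)
        show "integrable (lebesgue_on \<Omega>) (\<lambda>x. V x \<bullet> E j x - a x * m j x)"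
          by (rule Bochner_Integration.integrable_diff[OF iVE bmi[OF ai mm(1) mb]])
        show "integrable (lebesgue_on \<Omega>) (\<lambda>x. 2 * C * (norm (V x) * norm (grad (s j) x - G x)))"
          by (rule integrable_mult_right) (rule Holder_inner(1)[OF p1(1) Vm Vi sG])
        fix x
        have "V x \<bullet> E j x - a x * m j x = (2 * m j x) * (V x \<bullet> (G x - grad (s j) x))"
          by (simp add: E_def a_def inner_diff_right algebra_simps)
        moreover have "\<bar>V x \<bullet> (G x - grad (s j) x)\<bar> \<le> norm (V x) * norm (grad (s j) x - G x)"
          using Cauchy_Schwarz_ineq2[of "V x" "G x - grad (s j) x"] by (simp add: norm_minus_commute)
        ultimately show "\<bar>V x \<bullet> E j x - a x * m j x\<bar> \<le> 2 * C * (norm (V x) * norm (grad (s j) x - G x))"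
          using mb[of j x] C by (simp only: abs_mult) (intro mult_mono, auto)
      qed
      then show "norm (\<integral>x. V x \<bullet> E j x - a x * m j x \<partial>lebesgue_on \<Omega>) \<le>
         norm (2 * C * (\<integral>x. norm (V x) * norm (grad (s j) x - G x) \<partial>lebesgue_on \<Omega>)) * 1"
        using n C by (simp add: abs_mult)
    qed
  qed
  have "(\<lambda>j. (\<integral>x. V x \<bullet> E j x - a x * m j x \<partial>lebesgue_on \<Omega>) + (\<integral>x. a x * m j x \<partial>lebesgue_on \<Omega>)) \<longlonglongrightarrow> 0 + (\<integral>x. a x * m' x \<partial>lebesgue_on \<Omega>)"
    by (intro tendsto_add L1 L2)
  moreover have "(\<integral>x. V x \<bullet> E j x - a x * m j x \<partial>lebesgue_on \<Omega>) + (\<integral>x. a x * m j x \<partial>lebesgue_on \<Omega>) = (\<integral>x. k x * w j x \<partial>lebesgue_on \<Omega>)" for j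
    using Bochner_Integration.integral_diff[OF iVE[of j] bmi[OF ai mm(1)[of j] mb]] main[of j] by linarith
  ultimately have La: "(\<lambda>j. \<integral>x. k x * w j x \<partial>lebesgue_on \<Omega>) \<longlonglongrightarrow> (\<integral>x. a x * m' x \<partial>lebesgue_on \<Omega>)" by simp
  define w' where "w' = (\<lambda>x. (m' x)\<^sup>2)"
  have w'm: "w' \<in> borel_measurable (lebesgue_on \<Omega>)" unfolding w'_def using mm(2) by measurable
  have w'b: "\<bar>w' x\<bar> \<le> C * C" for x
    unfolding w'_def power2_eq_square abs_mult by (intro mult_mono m'b) (simp_all add: C)
  have wlim: "uniform_limit \<Omega> w w' sequentially"
  proof (rule uniform_limitI)
    fix e :: real assume e: "e > 0"
    have e2: "e / (2 * C + 1) > 0" using e C by simp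
    from uniform_limitD[OF mlim e2] show "\<forall>\<^sub>F n in sequentially. \<forall>x\<in>\<Omega>. dist (w n x) (w' x) < e"
    proof eventually_elim
      case (elim n)
      show ?case
      proof
        fix x assume "x \<in> \<Omega>"
        then have d: "\<bar>m n x - m' x\<bar> < e / (2 * C + 1)" using elim by (simp add: dist_real_def)
        have "\<bar>w n x - w' x\<bar> = \<bar>m n x + m' x\<bar> * \<bar>m n x - m' x\<bar>"
          unfolding w_def w'_def abs_mult[symmetric] by (simp add: power2_eq_square algebra_simps)
        also have "... \<le> (2 * C + 1) * \<bar>m n x - m' x\<bar>"
          using mb[of n x] m'b[of x] by (intro mult_right_mono) auto
        also have "... < e" using d C by (simp add: field_simps)
        finally show "dist (w n x) (w' x) < e" by (simp add: dist_real_def)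
      qed
    qed
  qed
  have "(\<lambda>j. \<integral>x. k x * w j x \<partial>lebesgue_on \<Omega>) \<longlonglongrightarrow> (\<integral>x. k x * w' x \<partial>lebesgue_on \<Omega>)"
    by (rule integral_tendsto_uniform[OF ki bmi[OF ki wm wb] bmi[OF ki w'm w'b] wlim])
  from LIMSEQ_unique[OF La this] have fin: "(\<integral>x. a x * m' x \<partial>lebesgue_on \<Omega>) = (\<integral>x. k x * w' x \<partial>lebesgue_on \<Omega>)" .
  have "0 \<le> (\<integral>x. a x * m' x \<partial>lebesgue_on \<Omega>)"
  proof (rule Bochner_Integration.integral_nonneg)
    fix x
    show "0 \<le> a x * m' x"
    proof (cases "x \<in> K")
      case True
      then have "a x = 2 * ((flux p (B x) - flux p (G x)) \<bullet> (B x - G x))" by (simp add: a_def V_def F_def BK_def)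
      then have "a x \<ge> 0" using flux_monotone[OF p1(4), of "B x" "G x"] by simp
      then show ?thesis using m0(2) by simp
    qed (simp add: m'_def)
  qed
  then have ge: "0 \<le> (\<integral>x. k x * w' x \<partial>lebesgue_on \<Omega>)" using fin by simp
  \<comment> \<open>The integral of \<open>k w'\<close> is nonnegative although \<open>k < 0\<close> on the
    support of \<open>w'\<close>, so \<open>w'\<close> is zero almost everywhere.\<close>
  have kneg: "k x < 0" if "x \<in> K" for x
  proof -
    have "x \<in> U" using that KU by blast
    from strict[OF this] show ?thesis using that by (simp add: k_def D_def)
  qed
  have np: "0 \<le> - (k x * w' x)" for x
  proof (cases "x \<in> K")
    case True
    then show ?thesis using kneg[OF True] by (simp add: w'_def mult_nonpos_nonneg)
  qed (simp add: w'_def m'_def)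
  have "(\<integral>x. - (k x * w' x) \<partial>lebesgue_on \<Omega>) = 0"
  proof (rule antisym)
    show "(\<integral>x. - (k x * w' x) \<partial>lebesgue_on \<Omega>) \<le> 0" using ge by simp
    show "0 \<le> (\<integral>x. - (k x * w' x) \<partial>lebesgue_on \<Omega>)" by (rule Bochner_Integration.integral_nonneg[OF np])
  qed
  moreover have "integrable (lebesgue_on \<Omega>) (\<lambda>x. - (k x * w' x))" using bmi[OF ki w'm w'b] by simp
  ultimately have "AE x in lebesgue_on \<Omega>. - (k x * w' x) = 0"
    using integral_nonneg_eq_0_iff_AE[of "lebesgue_on \<Omega>" "\<lambda>x. - (k x * w' x)"] np by simp
  then have ae\<Omega>: "AE x in lebesgue_on \<Omega>. x \<in> U \<longrightarrow> b x - u x \<le> 0"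
  proof eventually_elim
    case (elim x)
    show ?case
    proof (intro impI, rule ccontr)
      assume x: "x \<in> U" "\<not> b x - u x \<le> 0"
      then have xK: "x \<in> K" using \<delta>(1) closure_subset[of U] by (auto simp: K_def)
      then have "m' x > 0" using x by (simp add: m'_def)
      then have "w' x > 0" by (simp add: w'_def)
      then show False using elim kneg[OF xK] by simp
    qed
  qed
  have "AE x in lebesgue_on U. b x - u x \<le> 0"
  proof -
    have "AE x in lebesgue. x \<in> \<Omega> \<longrightarrow> x \<in> U \<longrightarrow> b x - u x \<le> 0"
      using ae\<Omega> open_lebesgue[OF \<Omega>(1)] by (subst (asm) AE_restrict_space_iff) auto
    then have "AE x in lebesgue. x \<in> U \<longrightarrow> b x - u x \<le> 0"
      by eventually_elim (use UW(2) in blast)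
    then show ?thesis using open_lebesgue[OF U(1)] by (subst AE_restrict_space_iff) auto
  qed
  from AE_lebesgue_on_open_imp[OF U(1) _ this x1] have "b x1 - u x1 \<le> 0"
    by (simp add: continuous_on_diff cbU continuous_on_subset[OF cu])
  then show False using contra by simp
qed

section \<open>Weak solutions\<close>

text \<open>A weak solution comes with its approximation by test functions, uniform for the function and in
  \<open>L^p\<close> for the gradient. This carries the zero boundary values and is the only regularity
  that the comparison principle uses.\<close>

definition weak_solution ::
  "real \<Rightarrow> 'a::euclidean_space set \<Rightarrow> ('a \<Rightarrow> real) \<Rightarrow> ('a \<Rightarrow> 'a) \<Rightarrow> ('a \<Rightarrow> real) \<Rightarrow> bool" where
  "weak_solution p \<Omega> w G h \<longleftrightarrow>
     in_Lp p \<Omega> G \<and> integrable (lebesgue_on \<Omega>) h \<and>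
     (\<forall>\<psi>. test_function \<Omega> \<psi> \<longrightarrow>
       (\<integral>x. flux p (G x) \<bullet> grad \<psi> x \<partial>lebesgue_on \<Omega>) = (\<integral>x. h x * \<psi> x \<partial>lebesgue_on \<Omega>)) \<and>
     (\<exists>\<phi>. (\<forall>k::nat. test_function \<Omega> (\<phi> k)) \<and> uniform_limit UNIV \<phi> w sequentially \<and>
       (\<forall>k. in_Lp p \<Omega> (\<lambda>x. grad (\<phi> k) x - G x)) \<and>
       (\<lambda>k. \<integral>x. norm (grad (\<phi> k) x - G x) powr p \<partial>lebesgue_on \<Omega>) \<longlonglongrightarrow> 0)"

lemma weak_solution_minus:
  assumes "weak_solution p \<Omega> w G h"
  shows "weak_solution p \<Omega> (\<lambda>x. - w x) (\<lambda>x. - G x) (\<lambda>x. - h x)"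
proof -
  have A: "in_Lp p \<Omega> G" "integrable (lebesgue_on \<Omega>) h"
     "\<And>\<psi>. test_function \<Omega> \<psi> \<Longrightarrow>
       (\<integral>x. flux p (G x) \<bullet> grad \<psi> x \<partial>lebesgue_on \<Omega>) = (\<integral>x. h x * \<psi> x \<partial>lebesgue_on \<Omega>)"
    using assms unfolding weak_solution_def by simp_all
  from assms obtain \<phi> where \<phi>: "\<forall>k::nat. test_function \<Omega> (\<phi> k)" "uniform_limit UNIV \<phi> w sequentially"
     "\<forall>k. in_Lp p \<Omega> (\<lambda>x. grad (\<phi> k) x - G x)"
     "(\<lambda>k. \<integral>x. norm (grad (\<phi> k) x - G x) powr p \<partial>lebesgue_on \<Omega>) \<longlonglongrightarrow> 0"
    unfolding weak_solution_def by (elim conjE exE) (rule that)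
  have t: "test_function \<Omega> (\<lambda>x. - \<phi> k x)" "grad (\<lambda>x. - \<phi> k x) = (\<lambda>x. - grad (\<phi> k) x)" for k
    using test_function_scale[OF \<phi>(1)[rule_format, of k], of "-1"] by simp_all
  have n: "norm (- grad (\<phi> k) x - - G x) = norm (grad (\<phi> k) x - G x)" for k x
    using norm_minus_commute[of "G x" "grad (\<phi> k) x"] by simp
  have m: "(\<lambda>x. - G x) \<in> borel_measurable (lebesgue_on \<Omega>)" using A(1) unfolding in_Lp_def by simp
  have L: "in_Lp p \<Omega> (\<lambda>x. - f x)" if "in_Lp p \<Omega> f" for f :: "'a \<Rightarrow> 'a"
    using that unfolding in_Lp_def by simp
  have d: "(\<lambda>x. - grad (\<phi> k) x - - G x) = (\<lambda>x. - (grad (\<phi> k) x - G x))" for k by simp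
  have u: "uniform_limit UNIV (\<lambda>k x. - \<phi> k x) (\<lambda>x. - w x) sequentially"
    by (rule uniform_limit_uminus[OF \<phi>(2)])
  show ?thesis unfolding weak_solution_def
  proof (intro conjI allI impI exI[of _ "\<lambda>k x. - \<phi> k x"])
    show "in_Lp p \<Omega> (\<lambda>x. - G x)" by (rule L[OF A(1)])
    show "integrable (lebesgue_on \<Omega>) (\<lambda>x. - h x)" using A(2) by simp
    show "(\<integral>x. flux p (- G x) \<bullet> grad \<psi> x \<partial>lebesgue_on \<Omega>) = (\<integral>x. - h x * \<psi> x \<partial>lebesgue_on \<Omega>)" if "test_function \<Omega> \<psi>" for \<psi>
      using A(3)[OF that] by (simp add: flux_minus)
    show "test_function \<Omega> (\<lambda>x. - \<phi> k x)" for k by (rule t(1))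
    show "in_Lp p \<Omega> (\<lambda>x. grad (\<lambda>x. - \<phi> k x) x - - G x)" for k
      unfolding t(2) d by (rule L[OF \<phi>(3)[rule_format]])
    show "(\<lambda>k. \<integral>x. norm (grad (\<lambda>x. - \<phi> k x) x - - G x) powr p \<partial>lebesgue_on \<Omega>) \<longlonglongrightarrow> 0"
      unfolding t(2) n by (rule \<phi>(4))
  qed (rule u)
qed

text \<open>The gradient \<open>B\<close> and the rows \<open>H i\<close> of the Hessian are recorded explicitly. Negation and
  adding a constant, which turn touching from above into touching from below and produce the shifted
  function in the comparison argument, are then immediate.\<close>

definition C2_data :: "'a::euclidean_space set \<Rightarrow> ('a \<Rightarrow> real) \<Rightarrow> ('a \<Rightarrow> 'a) \<Rightarrow> ('a \<Rightarrow> 'a \<Rightarrow> 'a) \<Rightarrow> bool" where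
  "C2_data W b B H \<longleftrightarrow> open W \<and> (\<forall>x\<in>W. GDERIV b x :> B x) \<and>
     (\<forall>i\<in>Basis. \<forall>x\<in>W. GDERIV (\<lambda>x. B x \<bullet> i) x :> H i x) \<and> (\<forall>i\<in>Basis. continuous_on W (H i))"

definition inf_laplace :: "'a::euclidean_space \<Rightarrow> ('a \<Rightarrow> 'a) \<Rightarrow> real" where
  "inf_laplace b H = (\<Sum>i\<in>Basis. (b \<bullet> H i) * (b \<bullet> i))"

lemma C2_dataD:
  assumes "C2_data W b B H"
  shows "open W" "\<And>x. x \<in> W \<Longrightarrow> GDERIV b x :> B x"
    "\<And>x i. x \<in> W \<Longrightarrow> i \<in> Basis \<Longrightarrow> GDERIV (\<lambda>x. B x \<bullet> i) x :> H i x"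
    "\<And>i. i \<in> Basis \<Longrightarrow> continuous_on W (H i)"
    "continuous_on W b" "continuous_on W B" "continuous_on W (\<lambda>x. inf_laplace (B x) (\<lambda>i. H i x))"
proof -
  show o: "open W" and 1: "\<And>x. x \<in> W \<Longrightarrow> GDERIV b x :> B x"
    and 2: "\<And>x i. x \<in> W \<Longrightarrow> i \<in> Basis \<Longrightarrow> GDERIV (\<lambda>x. B x \<bullet> i) x :> H i x"
    and 3: "\<And>i. i \<in> Basis \<Longrightarrow> continuous_on W (H i)"
    using assms unfolding C2_data_def by simp_all
  show "continuous_on W b" by (rule continuous_at_imp_continuous_on, rule ballI, rule GDERIV_continuous, rule 1)
  show B: "continuous_on W B"
    by (rule continuous_on_vectorI, rule continuous_at_imp_continuous_on, rule ballI, rule GDERIV_continuous, rule 2)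
  show "continuous_on W (\<lambda>x. inf_laplace (B x) (\<lambda>i. H i x))"
    unfolding inf_laplace_def by (intro continuous_intros B 3)
qed

lemma C2_data_minus:
  assumes "C2_data W b B H"
  shows "C2_data W (\<lambda>x. - b x) (\<lambda>x. - B x) (\<lambda>i x. - H i x)"
  unfolding C2_data_def inner_minus_left
  by (intro conjI ballI GDERIV_minus continuous_on_minus C2_dataD[OF assms]; assumption)

lemma C2_data_add_const:
  assumes "C2_data W b B H"
  shows "C2_data W (\<lambda>x. b x + c) B H"
proof -
  have "GDERIV (\<lambda>x. b x + c) x :> B x" if "x \<in> W" for x
    using GDERIV_add[OF C2_dataD(2)[OF assms that] GDERIV_const[of c]] by simp
  then show ?thesis using assms unfolding C2_data_def by simp
qed

lemma plaplace_minus: "plaplace p (- b) (\<lambda>i. - H i) = - plaplace p b H"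
  unfolding plaplace_def by (simp add: sum_negf)

lemma inf_laplace_minus: "inf_laplace (- b) (\<lambda>i. - H i) = - inf_laplace b H"
  unfolding inf_laplace_def by (simp add: sum_negf)

lemma comparison_below:
  fixes \<Omega> U W :: "'a::euclidean_space set"
  assumes \<Omega>: "open \<Omega>" "bounded \<Omega>" and p: "p > 4" and ws: "weak_solution p \<Omega> w G h"
    and U: "open U" "closure U \<subseteq> \<Omega>" "closure U \<subseteq> W" and b: "C2_data W b B H"
    and strict: "\<And>x. x \<in> U \<Longrightarrow> - plaplace p (B x) (\<lambda>i. H i x) < h x"
    and bd: "\<And>x. x \<in> frontier U \<Longrightarrow> b x < w x" and x: "x \<in> U"
  shows "b x \<le> w x"
proof -
  have A: "in_Lp p \<Omega> G" "integrable (lebesgue_on \<Omega>) h"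
     "\<And>\<psi>. test_function \<Omega> \<psi> \<Longrightarrow>
       (\<integral>x. flux p (G x) \<bullet> grad \<psi> x \<partial>lebesgue_on \<Omega>) = (\<integral>x. h x * \<psi> x \<partial>lebesgue_on \<Omega>)"
    using ws unfolding weak_solution_def by simp_all
  from ws obtain \<phi> where \<phi>: "\<forall>k::nat. test_function \<Omega> (\<phi> k)" "uniform_limit UNIV \<phi> w sequentially"
     "\<forall>k. in_Lp p \<Omega> (\<lambda>x. grad (\<phi> k) x - G x)"
     "(\<lambda>k. \<integral>x. norm (grad (\<phi> k) x - G x) powr p \<partial>lebesgue_on \<Omega>) \<longlonglongrightarrow> 0"
    unfolding weak_solution_def by (elim conjE exE) (rule that)
  show ?thesis
    by (rule weak_comparison[OF \<Omega> p \<phi>(1)[rule_format] \<phi>(2) \<phi>(3)[rule_format] \<phi>(4) A(1,2,3) U(1,2)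
      C2_dataD(1)[OF b] U(3) C2_dataD(2,3,4)[OF b] strict bd x])
qed

section \<open>Comparison for uniform limits of weak solutions\<close>

text \<open>On the compact frontier of \<open>U\<close> the strict inequality has a margin, which survives in the
  uniformly close functions \<open>w k\<close>.\<close>

lemma limit_comparison_below:
  fixes \<Omega> U W :: "'a::euclidean_space set" and w :: "nat \<Rightarrow> 'a \<Rightarrow> real"
  assumes \<Omega>: "open \<Omega>" "bounded \<Omega>" and p: "filterlim p at_top sequentially"
    and ws: "\<And>k. weak_solution (p k) \<Omega> (w k) (G k) (h k)"
    and lim: "uniform_limit UNIV w v sequentially"
    and U: "open U" "closure U \<subseteq> \<Omega>" "closure U \<subseteq> W" and b: "C2_data W b B H"
    and strict: "eventually (\<lambda>k. \<forall>x\<in>U. - plaplace (p k) (B x) (\<lambda>i. H i x) < h k x) sequentially"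
    and v: "continuous_on UNIV v"
    and bd: "\<And>x. x \<in> frontier U \<Longrightarrow> b x < v x" and x: "x \<in> U"
  shows "b x \<le> v x"
proof -
  have clf: "frontier U \<subseteq> closure U" by (simp add: frontier_def)
  obtain \<delta> where \<delta>: "\<delta> > 0" "\<And>x. x \<in> frontier U \<Longrightarrow> b x \<le> v x - \<delta>"
  proof (cases "frontier U = {}")
    case True
    then show ?thesis using that[of 1] by simp
  next
    case False
    have "bounded U" using bounded_subset[OF \<Omega>(2)] U(2) closure_subset by blast
    then have cf: "compact (frontier U)" by (rule compact_frontier_bounded)
    have fs: "frontier U \<subseteq> W" using clf U(3) by blast
    have "continuous_on (frontier U) (\<lambda>x. v x - b x)"
      by (rule continuous_on_diff[OF continuous_on_subset[OF v subset_UNIV] continuous_on_subset[OF C2_dataD(5)[OF b] fs]])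
    from continuous_attains_inf[OF cf False this]
    obtain z where z: "z \<in> frontier U" "\<forall>x\<in>frontier U. v z - b z \<le> v x - b x"
      by (elim bexE) (rule that)
    show ?thesis
    proof (rule that[of "v z - b z"])
      show "v z - b z > 0" using bd[OF z(1)] by simp
      show "b x \<le> v x - (v z - b z)" if "x \<in> frontier U" for x using bspec[OF z(2) that] by simp
    qed
  qed
  have ev: "eventually (\<lambda>k. b x \<le> w k x) sequentially"
    using strict uniform_limitD[OF lim \<delta>(1)] filterlim_at_top_dense[THEN iffD1, OF p, rule_format, of 4]
  proof eventually_elim
    case (elim k)
    have st: "- plaplace (p k) (B y) (\<lambda>i. H i y) < h k y" if "y \<in> U" for y using elim(1) that by simp
    have "b y < w k y" if "y \<in> frontier U" for y
    proof -
      have "\<bar>w k y - v y\<bar> < \<delta>" using elim(2) by (simp add: dist_real_def)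
      then show ?thesis using \<delta>(2)[OF that] by linarith
    qed
    from comparison_below[OF \<Omega> elim(3) ws U b st this x] show ?case .
  qed
  show ?thesis
    by (rule tendsto_lowerbound[OF tendsto_uniform_limitI[OF lim UNIV_I] ev]) simp
qed

lemma limit_comparison_above:
  fixes \<Omega> U W :: "'a::euclidean_space set" and w :: "nat \<Rightarrow> 'a \<Rightarrow> real"
  assumes \<Omega>: "open \<Omega>" "bounded \<Omega>" and p: "filterlim p at_top sequentially"
    and ws: "\<And>k. weak_solution (p k) \<Omega> (w k) (G k) (h k)"
    and lim: "uniform_limit UNIV w v sequentially"
    and U: "open U" "closure U \<subseteq> \<Omega>" "closure U \<subseteq> W" and b: "C2_data W b B H"
    and strict: "eventually (\<lambda>k. \<forall>x\<in>U. h k x < - plaplace (p k) (B x) (\<lambda>i. H i x)) sequentially"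
    and v: "continuous_on UNIV v"
    and bd: "\<And>x. x \<in> frontier U \<Longrightarrow> v x < b x" and x: "x \<in> U"
  shows "v x \<le> b x"
proof -
  have lim': "uniform_limit UNIV (\<lambda>k x. - w k x) (\<lambda>x. - v x) sequentially"
    by (rule uniform_limit_uminus[OF lim])
  have st: "eventually (\<lambda>k. \<forall>x\<in>U. - plaplace (p k) (- B x) (\<lambda>i. - H i x) < - h k x) sequentially"
    using strict unfolding plaplace_minus
  proof eventually_elim
    case (elim k)
    show ?case
    proof
      fix x assume "x \<in> U"
      with elim have "h k x < - plaplace (p k) (B x) (\<lambda>i. H i x)" by blast
      then show "- (- plaplace (p k) (B x) (\<lambda>i. H i x)) < - h k x" by linarith
    qed
  qed
  have "- b x \<le> - v x"
    by (rule limit_comparison_below[OF \<Omega> p weak_solution_minus[OF ws] lim' U C2_data_minus[OF b] st continuous_on_minus[OF v] _ x])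
       (use bd in simp)
  then show ?thesis by simp
qed

section \<open>The p-Laplacian for large exponents\<close>

lemma compact_norm_bound:
  fixes f :: "'a::euclidean_space \<Rightarrow> 'b::euclidean_space"
  assumes "compact K" "continuous_on K f"
  obtains C where "C \<ge> 0" "\<And>x. x \<in> K \<Longrightarrow> norm (f x) \<le> C"
proof -
  have "bounded (f ` K)" using assms by (intro compact_imp_bounded compact_continuous_image)
  then obtain C where C: "\<And>x. x \<in> K \<Longrightarrow> norm (f x) \<le> C" unfolding bounded_iff by blast
  show ?thesis
  proof (rule that[of "max C 0"])
    show "norm (f x) \<le> max C 0" if "x \<in> K" for x using C[OF that] by simp
  qed simp
qed

text \<open>In \<open>|b|^(p-4) (|b|^2 tr H + (p-2) \<langle>b, H b\<rangle>)\<close> the second summand grows linearly in \<open>p\<close>, uniformly on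
  the compact set, so the bracket eventually exceeds 1.\<close>

lemma eventually_plaplace_ge:
  assumes K: "compact K" "K \<subseteq> W" and b: "C2_data W b B H"
    and pos: "\<And>x. x \<in> K \<Longrightarrow> inf_laplace (B x) (\<lambda>i. H i x) > 0"
  shows "eventually (\<lambda>p. \<forall>x\<in>K. norm (B x) powr (p - 4) \<le> plaplace p (B x) (\<lambda>i. H i x)) at_top"
proof -
  have cB: "continuous_on K B" by (rule continuous_on_subset[OF C2_dataD(6)[OF b] K(2)])
  have cH: "continuous_on K (H i)" if "i \<in> Basis" for i by (rule continuous_on_subset[OF C2_dataD(4)[OF b that] K(2)])
  have cS: "continuous_on K (\<lambda>x. inf_laplace (B x) (\<lambda>i. H i x))"
    by (rule continuous_on_subset[OF C2_dataD(7)[OF b] K(2)])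
  obtain c where c: "c > 0" "\<And>x. x \<in> K \<Longrightarrow> c \<le> inf_laplace (B x) (\<lambda>i. H i x)"
  proof (cases "K = {}")
    case True then show ?thesis using that[of 1] by simp
  next
    case False
    from continuous_attains_inf[OF K(1) False cS]
    obtain z where z: "z \<in> K" "\<forall>y\<in>K. inf_laplace (B z) (\<lambda>i. H i z) \<le> inf_laplace (B y) (\<lambda>i. H i y)"
      by (elim bexE) (rule that)
    show ?thesis by (rule that[OF pos[OF z(1)]]) (use z(2) in simp)
  qed
  have cT: "continuous_on K (\<lambda>x. (norm (B x))\<^sup>2 * (\<Sum>i\<in>Basis. H i x \<bullet> i))"
    by (intro continuous_intros cB cH)
  obtain C where C: "C \<ge> 0" "\<And>x. x \<in> K \<Longrightarrow> norm ((norm (B x))\<^sup>2 * (\<Sum>i\<in>Basis. H i x \<bullet> i)) \<le> C"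
    using compact_norm_bound[OF K(1) cT] by metis
  show ?thesis
    using eventually_ge_at_top[of "2 + (C + 1) / c"]
  proof eventually_elim
    case (elim p)
    show ?case
    proof
      fix x assume x: "x \<in> K"
      have Bn: "B x \<noteq> 0" using pos[OF x] by (auto simp: inf_laplace_def)
      define N where "N = norm (B x) powr (p - 4)"
      have N: "N \<ge> 0" by (simp add: N_def)
      have "norm (B x) powr (p - 2) = norm (B x) powr (p - 4) * norm (B x) powr 2"
        by (simp only: powr_add[symmetric]) simp
      then have e: "norm (B x) powr (p - 2) = N * (norm (B x))\<^sup>2" using Bn by (simp add: N_def)
      have "plaplace p (B x) (\<lambda>i. H i x) = N * ((norm (B x))\<^sup>2 * (\<Sum>i\<in>Basis. H i x \<bullet> i) + (p - 2) * inf_laplace (B x) (\<lambda>i. H i x))"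
        unfolding plaplace_def e inf_laplace_def N_def[symmetric] by (simp add: algebra_simps)
      moreover have "1 \<le> (norm (B x))\<^sup>2 * (\<Sum>i\<in>Basis. H i x \<bullet> i) + (p - 2) * inf_laplace (B x) (\<lambda>i. H i x)"
      proof -
        have "0 \<le> (C + 1) / c" using C(1) c(1) by simp
        then have p2: "(C + 1) / c \<le> p - 2" "p - 2 \<ge> 0" using elim by linarith+
        have "C + 1 \<le> (p - 2) * c" using p2(1) c(1) by (simp add: pos_divide_le_eq)
        also have "... \<le> (p - 2) * inf_laplace (B x) (\<lambda>i. H i x)" using p2(2) c(2)[OF x] by (intro mult_left_mono) auto
        finally show ?thesis using C(2)[OF x] unfolding real_norm_def by linarith
      qed
      ultimately show "norm (B x) powr (p - 4) \<le> plaplace p (B x) (\<lambda>i. H i x)"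
        using mult_left_mono[of 1 _ N] N by (simp add: N_def)
    qed
  qed
qed

lemma eventually_powr_dominates:
  fixes a b C D :: real
  assumes "0 < a" "a < b"
  shows "eventually (\<lambda>p. a powr (p - 2) * (C + (p - 2) * D) < b powr p) at_top"
proof -
  define r where "r = ln b - ln a"
  have r: "r > 0" using assms by (simp add: r_def)
  have "((\<lambda>p. (C + (p - 2) * D) * exp (- (r * p))) \<longlongrightarrow> 0) at_top" using r by real_asymp
  moreover have "(a powr 2) > 0" using assms by simp
  ultimately have "eventually (\<lambda>p. (C + (p - 2) * D) * exp (- (r * p)) < a powr 2) at_top"
    by (rule order_tendstoD(2))
  then show ?thesis
  proof eventually_elim
    case (elim p)
    have "a powr (p - 2) * (C + (p - 2) * D) = a powr (p - 2) * exp (r * p) * ((C + (p - 2) * D) * exp (- (r * p)))"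
      by (simp add: exp_minus)
    also have "... < a powr (p - 2) * exp (r * p) * a powr 2"
      using elim assms by (intro mult_strict_left_mono) auto
    also have "... = (a powr (p - 2) * a powr 2) * exp (r * p)" by simp
    also have "a powr (p - 2) * a powr 2 = a powr p" by (simp only: powr_add[symmetric]) simp
    also have "a powr p * exp (r * p) = b powr p"
      using assms by (simp add: powr_def r_def exp_add[symmetric] algebra_simps)
    finally show ?case .
  qed
qed

lemma eventually_powr_shift:
  fixes a b :: real
  assumes "0 < b" "b < a"
  shows "eventually (\<lambda>p. b powr p < a powr (p - 4)) at_top"
proof -
  define r where "r = ln a - ln b"
  have r: "r > 0" using assms by (simp add: r_def)
  show ?thesis
    using eventually_gt_at_top[of "4 * ln a / r"]
  proof eventually_elim
    case (elim p)
    then have "4 * ln a < p * r" using r by (simp add: pos_divide_less_eq)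
    then have "p * ln b < (p - 4) * ln a" by (simp add: r_def algebra_simps)
    then show ?case using assms by (simp add: powr_def)
  qed
qed

text \<open>Where the gradient is at most \<open>a\<close>, the \<open>p\<close>-Laplacian is at most of the order \<open>p a^p\<close>.\<close>

lemma eventually_plaplace_small:
  assumes K: "compact K" "K \<subseteq> W" and d: "C2_data W f B H" and a: "0 < a" "a < b"
    and le: "\<And>x. x \<in> K \<Longrightarrow> norm (B x) \<le> a"
  shows "eventually (\<lambda>p. \<forall>x\<in>K. \<bar>plaplace p (B x) (\<lambda>i. H i x)\<bar> < b powr p) at_top"
proof -
  have cH: "continuous_on K (H i)" if "i \<in> Basis" for i by (rule continuous_on_subset[OF C2_dataD(4)[OF d that] K(2)])
  have c1: "continuous_on K (\<lambda>x. \<Sum>i\<in>Basis. H i x \<bullet> i)" by (intro continuous_intros cH)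
  have c2: "continuous_on K (\<lambda>x. \<Sum>i\<in>Basis. norm (H i x))" by (intro continuous_intros cH)
  obtain C where C: "C \<ge> 0" "\<And>x. x \<in> K \<Longrightarrow> norm (\<Sum>i\<in>Basis. H i x \<bullet> i) \<le> C"
    using compact_norm_bound[OF K(1) c1] by metis
  obtain D where D: "D \<ge> 0" "\<And>x. x \<in> K \<Longrightarrow> norm (\<Sum>i\<in>Basis. norm (H i x)) \<le> D"
    using compact_norm_bound[OF K(1) c2] by metis
  show ?thesis
    using eventually_powr_dominates[OF a, of C D] eventually_ge_at_top[of "4::real"]
  proof eventually_elim
    case (elim p)
    show ?case
    proof
      fix x assume x: "x \<in> K"
      define n where "n = norm (B x)"
      have n: "0 \<le> n" "n \<le> a" using le[OF x] by (simp_all add: n_def)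
      have pw: "n powr (p - 2) \<le> a powr (p - 2)" using n elim(2) by (intro powr_mono2) auto
      have S: "\<bar>\<Sum>i\<in>Basis. (B x \<bullet> H i x) * (B x \<bullet> i)\<bar> \<le> n\<^sup>2 * D"
      proof -
        have "\<bar>\<Sum>i\<in>Basis. (B x \<bullet> H i x) * (B x \<bullet> i)\<bar> \<le> (\<Sum>i\<in>Basis. \<bar>(B x \<bullet> H i x) * (B x \<bullet> i)\<bar>)" by (rule sum_abs)
        also have "... \<le> (\<Sum>i\<in>Basis. n\<^sup>2 * norm (H i x))"
        proof (rule sum_mono)
          fix i :: 'a assume i: "i \<in> Basis"
          have "\<bar>B x \<bullet> H i x\<bar> * \<bar>B x \<bullet> i\<bar> \<le> (n * norm (H i x)) * n"
            unfolding n_def using Basis_le_norm[OF i, of "B x"] Cauchy_Schwarz_ineq2[of "B x" "H i x"]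
            by (intro mult_mono) auto
          then show "\<bar>(B x \<bullet> H i x) * (B x \<bullet> i)\<bar> \<le> n\<^sup>2 * norm (H i x)"
            by (simp add: abs_mult power2_eq_square mult_ac)
        qed
        also have "... = n\<^sup>2 * (\<Sum>i\<in>Basis. norm (H i x))" by (rule sum_distrib_left[symmetric])
        also have "... \<le> n\<^sup>2 * D" using D(2)[OF x] by (intro mult_left_mono) auto
        finally show ?thesis .
      qed
      have n4: "n powr (p - 4) * n\<^sup>2 = n powr (p - 2)"
      proof (cases "n = 0")
        case False
        then have "n powr (p - 4) * n powr 2 = n powr (p - 2)" by (simp only: powr_add[symmetric]) simp
        then show ?thesis using False n(1) by simp
      qed simp
      have "\<bar>plaplace p (B x) (\<lambda>i. H i x)\<bar> \<le> \<bar>n powr (p - 2) * (\<Sum>i\<in>Basis. H i x \<bullet> i)\<bar> +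
          \<bar>(p - 2) * n powr (p - 4) * (\<Sum>i\<in>Basis. (B x \<bullet> H i x) * (B x \<bullet> i))\<bar>"
        unfolding plaplace_def n_def by (rule abs_triangle_ineq)
      also have "\<bar>n powr (p - 2) * (\<Sum>i\<in>Basis. H i x \<bullet> i)\<bar> \<le> n powr (p - 2) * C"
        using C(2)[OF x] by (simp add: abs_mult mult_left_mono)
      also have "\<bar>(p - 2) * n powr (p - 4) * (\<Sum>i\<in>Basis. (B x \<bullet> H i x) * (B x \<bullet> i))\<bar> =
          ((p - 2) * n powr (p - 4)) * \<bar>\<Sum>i\<in>Basis. (B x \<bullet> H i x) * (B x \<bullet> i)\<bar>"
        using elim(2) by (simp add: abs_mult)
      also have "... \<le> ((p - 2) * n powr (p - 4)) * (n\<^sup>2 * D)"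
        using elim(2) by (intro mult_left_mono S) auto
      also have "n powr (p - 2) * C + ((p - 2) * n powr (p - 4)) * (n\<^sup>2 * D) = n powr (p - 2) * (C + (p - 2) * D)"
        unfolding n4[symmetric] by (simp add: algebra_simps)
      also have "... \<le> a powr (p - 2) * (C + (p - 2) * D)"
        using pw C(1) D(1) elim(2) by (intro mult_right_mono) auto
      finally show "\<bar>plaplace p (B x) (\<lambda>i. H i x)\<bar> < b powr p" using elim(1) by linarith
    qed
  qed
qed

section \<open>Eigenfunctions as weak solutions\<close>

text \<open>The energy identity comes from testing the equation with the eigenfunction: the approximating
  test functions may be inserted, and both sides converge.\<close>

lemma eigenfunction_weak_solution:
  fixes \<Omega> :: "'a::euclidean_space set"
  assumes \<Omega>: "open \<Omega>" "bounded \<Omega>" and p: "2 * real DIM('a) < p" and q: "1 < q"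
    and u: "eigenfunction p q \<Omega> u" "Lp_norm q \<Omega> u = 1"
  obtains G where "W1p0 p \<Omega> u G" "continuous_on \<Omega> u"
    "weak_solution p \<Omega> (zero_ext \<Omega> u) G (\<lambda>x. Lambda_pq p q \<Omega> * u x powr (q - 1))"
    "(\<integral>x. norm (G x) powr p \<partial>lebesgue_on \<Omega>) = Lambda_pq p q \<Omega>" "0 \<le> Lambda_pq p q \<Omega>"
proof -
  define L where "L = Lambda_pq p q \<Omega>"
  have n1: "real DIM('a) \<ge> 1" using DIM_positive[where 'a='a] by linarith
  have p1: "p > 1" "p \<ge> 1" using p n1 by linarith+
  have cu: "continuous_on \<Omega> u" and up: "\<And>x. x \<in> \<Omega> \<Longrightarrow> 0 < u x"
    using u(1) unfolding eigenfunction_def by simp_all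
  obtain G where W: "W1p0 p \<Omega> u G" and e: "\<And>\<phi>. test_function \<Omega> \<phi> \<Longrightarrow>
           (\<integral>x. norm (G x) powr (p - 2) * (G x \<bullet> grad \<phi> x) \<partial>lebesgue_on \<Omega>) =
           (\<integral>x. Lambda_pq p q \<Omega> * Lp_norm q \<Omega> u powr (p - q) *
                 \<bar>u x\<bar> powr (q - 2) * u x * \<phi> x \<partial>lebesgue_on \<Omega>)"
    using u(1) unfolding eigenfunction_def by blast
  define h where "h = (\<lambda>x. L * u x powr (q - 1))"
  have L0: "L \<ge> 0" unfolding L_def by (rule Lambda_pq_nonneg[OF W u(2)])
  have eq: "(\<integral>x. flux p (G x) \<bullet> grad \<phi> x \<partial>lebesgue_on \<Omega>) = (\<integral>x. h x * \<phi> x \<partial>lebesgue_on \<Omega>)"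
    if "test_function \<Omega> \<phi>" for \<phi>
  proof -
    have "(\<integral>x. flux p (G x) \<bullet> grad \<phi> x \<partial>lebesgue_on \<Omega>) =
        (\<integral>x. Lambda_pq p q \<Omega> * Lp_norm q \<Omega> u powr (p - q) * \<bar>u x\<bar> powr (q - 2) * u x * \<phi> x \<partial>lebesgue_on \<Omega>)"
      using e[OF that] by (simp add: flux_def)
    also have "... = (\<integral>x. h x * \<phi> x \<partial>lebesgue_on \<Omega>)"
    proof (rule Bochner_Integration.integral_cong[OF refl])
      fix x assume "x \<in> space (lebesgue_on \<Omega>)"
      then have ux: "u x > 0" using up by (simp add: space_restrict_space)
      have "u x powr (q - 2) * u x powr 1 = u x powr (q - 1)" by (simp only: powr_add[symmetric]) simp
      then have "u x powr (q - 2) * u x = u x powr (q - 1)" using ux by simp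
      then show "Lambda_pq p q \<Omega> * Lp_norm q \<Omega> u powr (p - q) * \<bar>u x\<bar> powr (q - 2) * u x * \<phi> x = h x * \<phi> x"
        using ux u(2) by (simp add: h_def L_def mult.assoc)
    qed
    finally show ?thesis .
  qed
  define w where "w = zero_ext \<Omega> u"
  have cw: "continuous_on UNIV w" unfolding w_def by (rule zero_ext_regular(1)[OF \<Omega> p W cu])
  have cc: "compact (closure \<Omega>)" using \<Omega>(2) by (simp add: compact_closure)
  obtain C where C: "C \<ge> 0" "\<And>x. x \<in> closure \<Omega> \<Longrightarrow> norm (w x) \<le> C"
    using compact_norm_bound[OF cc continuous_on_subset[OF cw subset_UNIV]] by metis
  have wC: "\<bar>w x\<bar> \<le> C" for x
  proof (cases "x \<in> \<Omega>")
    case True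
    then have "x \<in> closure \<Omega>" using closure_subset by blast
    then show ?thesis using C(2) by simp
  qed (simp add: w_def zero_ext_def C)
  have wu: "w x = u x" if "x \<in> \<Omega>" for x using that by (simp add: w_def zero_ext_def)
  have um: "u \<in> borel_measurable (lebesgue_on \<Omega>)"
    by (rule continuous_imp_measurable_on_sets_lebesgue[OF cu open_lebesgue[OF \<Omega>(1)]])
  have hm: "h \<in> borel_measurable (lebesgue_on \<Omega>)" unfolding h_def using um by measurable
  have hb: "norm (h x) \<le> L * C powr (q - 1)" if "x \<in> \<Omega>" for x
    unfolding h_def using L0 up[OF that] wC[of x] wu[OF that] q
    by (auto simp: abs_mult intro!: mult_left_mono powr_mono2)
  have hi: "integrable (lebesgue_on \<Omega>) h"
    by (rule in_Lp_integrable(1)[OF \<Omega>, of 1]) (auto intro!: in_Lp_bounded[OF \<Omega> _ hm hb])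
  obtain \<phi> where \<phi>: "\<And>k::nat. test_function \<Omega> (\<phi> k)"
    "uniform_limit UNIV \<phi> (zero_ext \<Omega> u) sequentially"
    "\<And>k. in_Lp p \<Omega> (\<lambda>x. grad (\<phi> k) x - G x)"
    "(\<lambda>k. \<integral>x. norm (grad (\<phi> k) x - G x) powr p \<partial>lebesgue_on \<Omega>) \<longlonglongrightarrow> 0"
    by (rule W1p0_uniform_approx[OF \<Omega> p W cu]) (rule that)
  have GL: "in_Lp p \<Omega> G" using W unfolding W1p0_def W1p_def by simp
  have ws: "weak_solution p \<Omega> (zero_ext \<Omega> u) G h"
    unfolding weak_solution_def
    by (intro conjI allI impI exI[of _ \<phi>] GL hi eq \<phi>; assumption)
  have Gm: "G \<in> borel_measurable (lebesgue_on \<Omega>)" using GL unfolding in_Lp_def by simp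
  have fGm: "(\<lambda>x. flux p (G x)) \<in> borel_measurable (lebesgue_on \<Omega>)" by (rule flux_measurable[OF Gm])
  have fGi: "integrable (lebesgue_on \<Omega>) (\<lambda>x. norm (flux p (G x)) powr (p / (p - 1)))"
    unfolding norm_flux_conj[OF p1(1)] using GL unfolding in_Lp_def by simp
  have Gi: "integrable (lebesgue_on \<Omega>) (\<lambda>x. norm (G x) powr p)" using GL unfolding in_Lp_def by simp
  \<comment> \<open>The flux of \<open>G\<close> lies in the dual space of \<open>L^p\<close>.\<close>
  have l1: "(\<lambda>k. \<integral>x. flux p (G x) \<bullet> grad (\<phi> k) x \<partial>lebesgue_on \<Omega>) \<longlonglongrightarrow> (\<integral>x. norm (G x) powr p \<partial>lebesgue_on \<Omega>)"
  proof (rule LIM_zero_cancel, rule tendsto_0_le[where K=1, OF Lp_pairing_tendsto_0[OF p1(1) fGm fGi \<phi>(3,4)]], intro always_eventually allI)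
    fix k
    note H = Holder_inner[OF p1(1) fGm fGi \<phi>(3)[of k]]
    have "(\<integral>x. flux p (G x) \<bullet> grad (\<phi> k) x \<partial>lebesgue_on \<Omega>) = (\<integral>x. norm (G x) powr p + flux p (G x) \<bullet> (grad (\<phi> k) x - G x) \<partial>lebesgue_on \<Omega>)"
      by (simp add: inner_diff_right flux_inner)
    also have "... = (\<integral>x. norm (G x) powr p \<partial>lebesgue_on \<Omega>) + (\<integral>x. flux p (G x) \<bullet> (grad (\<phi> k) x - G x) \<partial>lebesgue_on \<Omega>)"
      by (rule Bochner_Integration.integral_add[OF Gi H(2)])
    finally have "(\<integral>x. flux p (G x) \<bullet> grad (\<phi> k) x \<partial>lebesgue_on \<Omega>) - (\<integral>x. norm (G x) powr p \<partial>lebesgue_on \<Omega>) =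
      (\<integral>x. flux p (G x) \<bullet> (grad (\<phi> k) x - G x) \<partial>lebesgue_on \<Omega>)" by simp
    moreover have "\<bar>\<integral>x. flux p (G x) \<bullet> (grad (\<phi> k) x - G x) \<partial>lebesgue_on \<Omega>\<bar> \<le> (\<integral>x. norm (flux p (G x)) * norm (grad (\<phi> k) x - G x) \<partial>lebesgue_on \<Omega>)"
      by (rule integral_abs_bound_integral[OF H(2,1) Cauchy_Schwarz_ineq2])
    ultimately show "norm ((\<integral>x. flux p (G x) \<bullet> grad (\<phi> k) x \<partial>lebesgue_on \<Omega>) - (\<integral>x. norm (G x) powr p \<partial>lebesgue_on \<Omega>)) \<le>
      norm (\<integral>x. norm (flux p (G x)) * norm (grad (\<phi> k) x - G x) \<partial>lebesgue_on \<Omega>) * 1" by simp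
  qed
  have bmi: "integrable (lebesgue_on \<Omega>) (\<lambda>x. h x * t x)"
    if "t \<in> borel_measurable (lebesgue_on \<Omega>)" "\<And>x. \<bar>t x\<bar> \<le> c" for t :: "'a \<Rightarrow> real" and c
    using integrable_inner_bounded[OF hi that(1), of c] that(2) by simp
  have wm: "w \<in> borel_measurable (lebesgue_on \<Omega>)"
    by (intro borel_imp_lebesgue_on borel_measurable_continuous_onI cw)
  have i\<phi>: "integrable (lebesgue_on \<Omega>) (\<lambda>x. h x * \<phi> k x)" for k
  proof -
    obtain K where K: "compact K" "\<And>x. x \<notin> K \<Longrightarrow> \<phi> k x = 0" using test_function_support[OF \<phi>(1)[of k]] by metis
    obtain c where c: "\<And>x. norm (\<phi> k x) \<le> c" using compact_support_bounded[OF test_function_C1(2)[OF \<phi>(1)] K] by metis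
    show ?thesis
    proof (rule bmi)
      show "\<phi> k \<in> borel_measurable (lebesgue_on \<Omega>)"
        by (intro borel_imp_lebesgue_on borel_measurable_continuous_onI test_function_C1(2)[OF \<phi>(1)])
      show "\<bar>\<phi> k x\<bar> \<le> c" for x using c[of x] by simp
    qed
  qed
  have "uniform_limit \<Omega> \<phi> w sequentially" unfolding w_def by (rule uniform_limit_on_subset[OF \<phi>(2)]) simp
  from integral_tendsto_uniform[OF hi i\<phi> bmi[OF wm wC] this]
  have l2: "(\<lambda>k. \<integral>x. h x * \<phi> k x \<partial>lebesgue_on \<Omega>) \<longlonglongrightarrow> (\<integral>x. h x * w x \<partial>lebesgue_on \<Omega>)" .
  have "(\<integral>x. norm (G x) powr p \<partial>lebesgue_on \<Omega>) = (\<integral>x. h x * w x \<partial>lebesgue_on \<Omega>)"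
    using LIMSEQ_unique[OF l1] l2 unfolding eq[OF \<phi>(1)] by blast
  also have "... = (\<integral>x. L * norm (u x) powr q \<partial>lebesgue_on \<Omega>)"
  proof (rule Bochner_Integration.integral_cong[OF refl])
    fix x assume "x \<in> space (lebesgue_on \<Omega>)"
    then have x: "x \<in> \<Omega>" by (simp add: space_restrict_space)
    have "u x powr (q - 1) * u x powr 1 = u x powr q" by (simp only: powr_add[symmetric]) simp
    then show "h x * w x = L * norm (u x) powr q" using up[OF x] by (simp add: h_def wu[OF x] mult.assoc)
  qed
  also have "... = L"
  proof -
    have q0: "q > 0" using q by simp
    show ?thesis using Lp_norm_power[OF q0, of \<Omega> u] u(2) by simp
  qed
  finally have en: "(\<integral>x. norm (G x) powr p \<partial>lebesgue_on \<Omega>) = L" .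
  show ?thesis using that[OF W cu ws[unfolded h_def L_def] en[unfolded L_def] L0[unfolded L_def]] .
qed

section \<open>The limit of the eigenfunctions\<close>

text \<open>The situation after all subsequences have been taken, for an arbitrary positive limit \<open>L\<close> of \<open>\<Lambda>^(1/p)\<close>. That
  \<open>\<Lambda>\<close> is an eigenvalue is expressed only by the equation.\<close>

locale eigenfunction_limit =
  fixes \<Omega> :: "'a::euclidean_space set" and p q \<Lambda> :: "nat \<Rightarrow> real" and u :: "nat \<Rightarrow> 'a \<Rightarrow> real"
    and G :: "nat \<Rightarrow> 'a \<Rightarrow> 'a" and v :: "'a \<Rightarrow> real" and l L :: real
  assumes \<Omega>: "open \<Omega>" "bounded \<Omega>" "connected \<Omega>"
    and p: "filterlim p at_top sequentially" "\<And>k. p k > 0"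
    and q: "\<And>k. 1 < q k" "(\<lambda>k. q k / p k) \<longlonglongrightarrow> l"
    and \<Lambda>: "\<And>k. \<Lambda> k \<ge> 0" "(\<lambda>k. \<Lambda> k powr (1 / p k)) \<longlonglongrightarrow> L" "L > 0"
    and ws: "\<And>k. weak_solution (p k) \<Omega> (zero_ext \<Omega> (u k)) (G k) (\<lambda>x. \<Lambda> k * u k x powr (q k - 1))"
    and u_pos: "\<And>k x. x \<in> \<Omega> \<Longrightarrow> 0 < u k x"
    and lim: "uniform_limit UNIV (\<lambda>k. zero_ext \<Omega> (u k)) v sequentially"
    and cv: "continuous_on UNIV v"
    and v_pos_somewhere: "\<exists>x\<in>\<Omega>. v x > 0"
begin

lemma v_nonneg: "v x \<ge> 0"
proof (rule tendsto_lowerbound[OF tendsto_uniform_limitI[OF lim UNIV_I]])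
  show "\<forall>\<^sub>F k in sequentially. 0 \<le> zero_ext \<Omega> (u k) x"
    using u_pos by (intro always_eventually allI) (auto simp: zero_ext_def less_imp_le)
qed simp

text \<open>For positive \<open>\<alpha>\<close> and \<open>m\<close> the function \<open>m (exp (- \<alpha> |x - y|^2) - c)\<close> has positive infinity Laplacian wherever
  \<open>2 \<alpha> |x - y|^2 > 1\<close>: the first factor in the formula below is a negative cube and the last
  factor is negative there.\<close>

lemma barrier_data:
  fixes y :: 'a and \<alpha> m c :: real
  defines "E \<equiv> \<lambda>x. exp (- \<alpha> * ((x - y) \<bullet> (x - y)))"
  defines "B \<equiv> \<lambda>x. (- 2 * \<alpha> * m * E x) *\<^sub>R (x - y)"
  defines "H \<equiv> \<lambda>i x. (- 2 * \<alpha> * m * E x) *\<^sub>R i + ((x - y) \<bullet> i) *\<^sub>R ((4 * \<alpha> * \<alpha> * m * E x) *\<^sub>R (x - y))"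
  shows "C2_data UNIV (\<lambda>x. m * (E x - c)) B H"
    and "inf_laplace (B x) (\<lambda>i. H i x) =
      (- 2 * \<alpha> * m * E x) ^ 3 * ((x - y) \<bullet> (x - y)) * (1 - 2 * \<alpha> * ((x - y) \<bullet> (x - y)))"
proof -
  have d: "GDERIV (\<lambda>x. (x - y) \<bullet> (x - y)) x :> 2 *\<^sub>R (x - y)" for x
    unfolding gderiv_def by (auto intro!: derivative_eq_intros simp: inner_commute)
  have dE: "DERIV (\<lambda>s. exp (- \<alpha> * s)) s :> - \<alpha> * exp (- \<alpha> * s)" for s
    by (auto intro!: derivative_eq_intros)
  have gE: "GDERIV E x :> (- 2 * \<alpha> * E x) *\<^sub>R (x - y)" for x
    using GDERIV_DERIV_compose[OF d dE, of x] by (simp add: E_def mult_ac)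
  have g1: "GDERIV (\<lambda>x. m * (E x - c)) x :> B x" for x
    using GDERIV_mult[OF GDERIV_const[of m x] GDERIV_diff[OF gE[of x] GDERIV_const[of c x]]] by (simp add: B_def mult_ac)
  have gl: "GDERIV (\<lambda>x. (x - y) \<bullet> i) x :> i" for x i
    unfolding gderiv_def by (auto intro!: derivative_eq_intros)
  have g2: "GDERIV (\<lambda>x. B x \<bullet> i) x :> H i x" for x i
  proof -
    have "GDERIV (\<lambda>x. (- 2 * \<alpha> * m * E x) * ((x - y) \<bullet> i)) x :>
       (- 2 * \<alpha> * m * E x) *\<^sub>R i + ((x - y) \<bullet> i) *\<^sub>R ((- 2 * \<alpha> * m) *\<^sub>R ((- 2 * \<alpha> * E x) *\<^sub>R (x - y)) + E x *\<^sub>R 0)"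
      by (intro GDERIV_mult GDERIV_const gE gl)
    then show ?thesis by (simp add: B_def H_def mult_ac)
  qed
  have cE: "continuous_on UNIV E" unfolding E_def by (intro continuous_intros)
  have "continuous_on UNIV (H i)" for i unfolding H_def by (intro continuous_intros cE)
  then show "C2_data UNIV (\<lambda>x. m * (E x - c)) B H" unfolding C2_data_def using g1 g2 by simp
  define e where "e = - 2 * \<alpha> * m * E x"
  define d where "d = x - y"
  have B: "B x = e *\<^sub>R d" by (simp add: B_def e_def d_def)
  have H: "H i x = e *\<^sub>R i + (d \<bullet> i) *\<^sub>R ((- 2 * \<alpha> * e) *\<^sub>R d)" for i by (simp add: H_def e_def d_def)
  have "inf_laplace (B x) (\<lambda>i. H i x) = (\<Sum>i\<in>Basis. (e ^ 3 * (1 - 2 * \<alpha> * (d \<bullet> d))) * ((d \<bullet> i) * (d \<bullet> i)))"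
    unfolding inf_laplace_def B H
    by (intro sum.cong refl) (simp add: inner_add_right power3_eq_cube algebra_simps)
  also have "... = (e ^ 3 * (1 - 2 * \<alpha> * (d \<bullet> d))) * (d \<bullet> d)"
    unfolding sum_distrib_left[symmetric] euclidean_inner[of d d, symmetric] ..
  finally show "inf_laplace (B x) (\<lambda>i. H i x) =
      (- 2 * \<alpha> * m * E x) ^ 3 * ((x - y) \<bullet> (x - y)) * (1 - 2 * \<alpha> * ((x - y) \<bullet> (x - y)))"
    unfolding e_def d_def by (simp only: mult_ac)
qed

lemma source_nonneg: "x \<in> \<Omega> \<Longrightarrow> 0 \<le> \<Lambda> k * u k x powr (q k - 1)"
  using \<Lambda>(1)[of k] by simp

text \<open>Where the infinity Laplacian is positive, so is the \<open>p\<close>-Laplacian for large \<open>p\<close>, and the right-hand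
  sides are nonnegative.\<close>

lemma strict_of_inf_laplace_pos:
  assumes K: "compact K" "K \<subseteq> W" "K \<subseteq> \<Omega>" and b: "C2_data W b B H"
    and pos: "\<And>x. x \<in> K \<Longrightarrow> inf_laplace (B x) (\<lambda>i. H i x) > 0" and U: "U \<subseteq> K"
  shows "eventually (\<lambda>k. \<forall>x\<in>U. - plaplace (p k) (B x) (\<lambda>i. H i x) < \<Lambda> k * u k x powr (q k - 1)) sequentially"
proof -
  have "eventually (\<lambda>k. \<forall>x\<in>K. norm (B x) powr (p k - 4) \<le> plaplace (p k) (B x) (\<lambda>i. H i x)) sequentially"
    by (rule eventually_compose_filterlim[OF eventually_plaplace_ge[OF K(1,2) b pos] p(1)])
  then show ?thesis
  proof eventually_elim
    case (elim k)
    show ?case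
    proof
      fix x assume "x \<in> U"
      then have x: "x \<in> K" using U by blast
      have "B x \<noteq> 0" using pos[OF x] by (auto simp: inf_laplace_def)
      then have "0 < norm (B x) powr (p k - 4)" by simp
      then have "0 < plaplace (p k) (B x) (\<lambda>i. H i x)" using bspec[OF elim x] by linarith
      moreover have "0 \<le> \<Lambda> k * u k x powr (q k - 1)" using x K(3) by (intro source_nonneg) blast
      ultimately show "- plaplace (p k) (B x) (\<lambda>i. H i x) < \<Lambda> k * u k x powr (q k - 1)" by linarith
    qed
  qed
qed

text \<open>On an annulus about \<open>y\<close> the barrier of \<open>barrier_data\<close> is compared with \<open>v\<close>. It is below \<open>v\<close> on the
  inner sphere, where \<open>v > m\<close>, and negative on the outer one, but positive up to radius \<open>\<rho>/2\<close>.\<close>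

lemma positivity_spreads:
  assumes y: "y \<in> \<Omega>" "v y > 0" and \<rho>: "\<rho> > 0" "cball y \<rho> \<subseteq> \<Omega>" and x: "x \<in> ball y (\<rho> / 2)"
  shows "v x > 0"
proof -
  define m where "m = v y / 2"
  have m: "m > 0" "m < v y" using y(2) by (simp_all add: m_def)
  have "open (v -` {m<..})" using cv by (intro open_vimage) auto
  moreover have "y \<in> v -` {m<..}" using m(2) by simp
  ultimately obtain r1 where r1: "r1 > 0" "cball y r1 \<subseteq> v -` {m<..}"
    using open_contains_cball by blast
  define r0 where "r0 = min r1 (\<rho> / 2)"
  have r0: "r0 > 0" "r0 < \<rho>" "\<And>z. dist y z \<le> r0 \<Longrightarrow> m < v z"
    using r1 \<rho>(1) by (auto simp: r0_def subset_iff)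
  show ?thesis
  proof (cases "dist y x \<le> r0")
    case True
    then show ?thesis using r0(3)[of x] m(1) by simp
  next
    case False
    \<comment> \<open>With this steepness \<open>2 \<alpha> |z - y|^2 \<ge> 2 > 1\<close> outside the inner ball,
      as the barrier requires.\<close>
    define \<alpha> where "\<alpha> = 1 / r0\<^sup>2"
    have \<alpha>: "\<alpha> > 0" using r0(1) by (simp add: \<alpha>_def)
    \<comment> \<open>The barrier changes sign on the sphere of radius \<open>\<rho>/2\<close>.\<close>
    define c where "c = exp (- \<alpha> * (\<rho> / 2)\<^sup>2)"
    define E where "E = (\<lambda>x. exp (- \<alpha> * ((x - y) \<bullet> (x - y))))"
    define B where "B = (\<lambda>x. (- 2 * \<alpha> * m * E x) *\<^sub>R (x - y))"
    define H where "H = (\<lambda>i x. (- 2 * \<alpha> * m * E x) *\<^sub>R i + ((x - y) \<bullet> i) *\<^sub>R ((4 * \<alpha> * \<alpha> * m * E x) *\<^sub>R (x - y)))"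
    have b: "C2_data UNIV (\<lambda>x. m * (E x - c)) B H"
      unfolding B_def H_def E_def by (rule barrier_data(1))
    have S: "inf_laplace (B z) (\<lambda>i. H i z) =
      (- 2 * \<alpha> * m * E z) ^ 3 * ((z - y) \<bullet> (z - y)) * (1 - 2 * \<alpha> * ((z - y) \<bullet> (z - y)))" for z
      unfolding B_def H_def E_def by (rule barrier_data(2))
    have dd: "(z - y) \<bullet> (z - y) = (dist y z)\<^sup>2" for z
      by (simp add: dot_square_norm dist_norm norm_minus_commute)
    define K where "K = {z. r0 \<le> dist y z \<and> dist y z \<le> \<rho>}"
    define U where "U = {z. r0 < dist y z \<and> dist y z < \<rho>}"
    have K: "closed K" "K \<subseteq> cball y \<rho>" unfolding K_def
      by (auto intro!: closed_Collect_conj closed_Collect_le continuous_intros)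
    then have cK: "compact K" using compact_cball[of y \<rho>] by (metis Int_absorb1 closed_Int_compact inf.commute)
    have U: "open U" unfolding U_def by (intro open_Collect_conj open_Collect_less continuous_intros)
    have UK: "U \<subseteq> K" by (auto simp: U_def K_def)
    have clU: "closure U \<subseteq> K" by (rule closure_minimal[OF UK K(1)])
    have K\<Omega>: "K \<subseteq> \<Omega>" using K(2) \<rho>(2) by blast
    have pos: "inf_laplace (B z) (\<lambda>i. H i z) > 0" if z: "z \<in> K" for z
    proof -
      have "r0\<^sup>2 \<le> (dist y z)\<^sup>2" using z r0(1) by (intro power_mono) (auto simp: K_def)
      moreover have r02: "0 < r0\<^sup>2" using r0(1) by simp
      ultimately have "r0\<^sup>2 < 2 * (dist y z)\<^sup>2" "0 < (dist y z)\<^sup>2" by linarith+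
      then have a: "1 - 2 * \<alpha> * ((z - y) \<bullet> (z - y)) < 0" "0 < (z - y) \<bullet> (z - y)"
        unfolding dd \<alpha>_def using r02 by (simp_all add: pos_less_divide_eq)
      have "- 2 * \<alpha> * m * E z < 0" using \<alpha> m(1) by (simp add: E_def)
      then have "(- 2 * \<alpha> * m * E z) ^ 3 < 0" by (simp add: power_less_zero_eq)
      then have "(- 2 * \<alpha> * m * E z) ^ 3 * ((z - y) \<bullet> (z - y)) < 0" using a(2) by (rule mult_neg_pos)
      then show ?thesis unfolding S using a(1) by (rule mult_neg_neg)
    qed
    have bd: "m * (E z - c) < v z" if z: "z \<in> frontier U" for z
    proof -
      have zK: "z \<in> K" "z \<notin> U" using z clU U by (auto simp: frontier_def interior_open)
      then consider "dist y z = r0" | "dist y z = \<rho>" by (auto simp: U_def K_def)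
      then show ?thesis
      proof cases
        case 1
        have "E z \<le> 1" using \<alpha> by (simp add: E_def)
        moreover have "c > 0" by (simp add: c_def)
        ultimately have "m * (E z - c) \<le> m * 1" using m(1) by (intro mult_left_mono) auto
        then show ?thesis using r0(3)[of z] 1 by simp
      next
        case 2
        have "(\<rho> / 2)\<^sup>2 < \<rho>\<^sup>2" using \<rho>(1) by (intro power_strict_mono) auto
        then have "E z < c" unfolding E_def c_def dd 2 using \<alpha> by simp
        then have "m * (E z - c) < 0" using m(1) by (simp add: mult_pos_neg)
        then show ?thesis using v_nonneg[of z] by linarith
      qed
    qed
    have xd: "dist y x < \<rho> / 2" using x by simp
    have xU: "x \<in> U" using False xd \<rho>(1) by (auto simp: U_def)
    have "m * (E x - c) \<le> v x"
      by (rule limit_comparison_below[OF \<Omega>(1,2) p(1) ws lim U order_trans[OF clU K\<Omega>] subset_UNIV b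
          strict_of_inf_laplace_pos[OF cK subset_UNIV K\<Omega> b pos UK] cv bd xU])
    moreover have "0 < m * (E x - c)"
    proof -
      have "(dist y x)\<^sup>2 < (\<rho> / 2)\<^sup>2" using xd by (intro power_strict_mono) auto
      then have "c < E x" unfolding E_def c_def dd using \<alpha> by simp
      then show ?thesis using m(1) by simp
    qed
    ultimately show ?thesis by linarith
  qed
qed

text \<open>The zero set of \<open>v\<close> in \<open>\<Omega>\<close> is relatively open as well as relatively closed: positivity at a
  point near enough to \<open>z\<close> would spread to \<open>z\<close>, with a radius that depends only on the distance of \<open>z\<close> to
  the boundary.\<close>

lemma v_positive:
  assumes "x \<in> \<Omega>"
  shows "v x > 0"
proof -
  define P where "P = \<Omega> \<inter> v -` {0<..}"
  define Z where "Z = \<Omega> - P"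
  have oP: "open P" unfolding P_def using \<Omega>(1) cv by (intro open_Int open_vimage) auto
  have oZ: "open Z"
    unfolding open_contains_ball
  proof
    fix z assume z: "z \<in> Z"
    then have z\<Omega>: "z \<in> \<Omega>" by (simp add: Z_def)
    then obtain \<rho> where \<rho>: "\<rho> > 0" "cball z \<rho> \<subseteq> \<Omega>" using \<Omega>(1) open_contains_cball by blast
    have "ball z (\<rho> / 4) \<subseteq> Z"
    proof
      fix y assume y: "y \<in> ball z (\<rho> / 4)"
      then have y\<Omega>: "y \<in> \<Omega>" using \<rho> by (auto simp: subset_iff)
      show "y \<in> Z"
      proof (rule ccontr)
        assume "y \<notin> Z"
        then have vy: "v y > 0" using y\<Omega> by (simp add: Z_def P_def)
        have sub: "cball y (\<rho> / 2) \<subseteq> \<Omega>"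
        proof
          fix t assume t: "t \<in> cball y (\<rho> / 2)"
          have "dist z t \<le> dist z y + dist y t" by (rule dist_triangle)
          also have "... \<le> \<rho>" using y t \<rho>(1) by auto
          finally show "t \<in> \<Omega>" using \<rho>(2) by auto
        qed
        have "v z > 0"
          by (rule positivity_spreads[OF y\<Omega> vy _ sub]) (use \<rho>(1) y in \<open>auto simp: dist_commute\<close>)
        then show False using z by (simp add: Z_def P_def)
      qed
    qed
    then show "\<exists>e>0. ball z e \<subseteq> Z" using \<rho>(1) by (intro exI[of _ "\<rho> / 4"]) simp
  qed
  have "P \<noteq> {}" using v_pos_somewhere by (auto simp: P_def)
  moreover have "\<Omega> \<subseteq> P \<union> Z" "P \<inter> Z \<inter> \<Omega> = {}" "P \<inter> \<Omega> = P" "Z \<inter> \<Omega> = Z" by (auto simp: P_def Z_def)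
  ultimately have "Z = {}" using \<Omega>(3) oP oZ unfolding connected_def by blast
  then show ?thesis using assms by (auto simp: Z_def P_def)
qed

lemma exponent_limit: "(\<lambda>k. (q k - 1) / p k) \<longlonglongrightarrow> l"
proof -
  have "(\<lambda>k. 1 / p k) \<longlonglongrightarrow> 0" using tendsto_inverse_0_at_top[OF p(1)] by (simp add: inverse_eq_divide)
  from tendsto_diff[OF q(2) this] show ?thesis by (simp add: diff_divide_distrib)
qed

lemma source_eq:
  assumes "t \<ge> 0"
  shows "\<Lambda> k * t powr (q k - 1) = (\<Lambda> k powr (1 / p k) * t powr ((q k - 1) / p k)) powr p k"
proof -
  have "(\<Lambda> k powr (1 / p k)) powr p k = \<Lambda> k" using p(2)[of k] \<Lambda>(1)[of k] by (simp add: powr_powr)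
  moreover have "(t powr ((q k - 1) / p k)) powr p k = t powr (q k - 1)" using p(2)[of k] by (simp add: powr_powr)
  ultimately show ?thesis by (simp only: powr_mult)
qed

lemma near_limit:
  assumes x0: "x0 \<in> \<Omega>" and t: "t1 < v x0" "v x0 < t2"
  obtains r where "r > 0" "cball x0 r \<subseteq> \<Omega>"
    "eventually (\<lambda>k. \<forall>x\<in>cball x0 r. t1 < u k x \<and> u k x < t2) sequentially"
proof -
  define d where "d = min (v x0 - t1) (t2 - v x0) / 2"
  have d: "d > 0" "t1 + 2 * d \<le> v x0" "v x0 \<le> t2 - 2 * d" using t by (auto simp: d_def)
  have "open (\<Omega> \<inter> v -` {v x0 - d<..<v x0 + d})"
    using \<Omega>(1) cv by (intro open_Int open_vimage) auto
  moreover have "x0 \<in> \<Omega> \<inter> v -` {v x0 - d<..<v x0 + d}" using x0 d(1) by simp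
  ultimately obtain r where r: "r > 0" "cball x0 r \<subseteq> \<Omega> \<inter> v -` {v x0 - d<..<v x0 + d}"
    using open_contains_cball by blast
  have "eventually (\<lambda>k. \<forall>x\<in>cball x0 r. t1 < u k x \<and> u k x < t2) sequentially"
    using uniform_limitD[OF lim d(1)]
  proof eventually_elim
    case (elim k)
    show ?case
    proof
      fix x assume x: "x \<in> cball x0 r"
      then have "x \<in> \<Omega>" "v x0 - d < v x" "v x < v x0 + d" using r(2) by auto
      moreover have "\<bar>zero_ext \<Omega> (u k) x - v x\<bar> < d" using elim by (simp add: dist_real_def)
      ultimately show "t1 < u k x \<and> u k x < t2" using d(2,3) by (auto simp: zero_ext_def)
    qed
  qed
  then show ?thesis using that[OF r(1)] r(2) by blast
qed

text \<open>The right-hand side is the \<open>p\<close>-th power of \<open>\<Lambda>^(1/p) u^((q-1)/p)\<close>, whose limit at \<open>x0\<close> is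
  \<open>L (v x0)^l\<close>. To make this uniform near \<open>x0\<close>, \<open>u\<close> is replaced by a constant \<open>t < v x0\<close>.\<close>

lemma source_lower:
  assumes x0: "x0 \<in> \<Omega>" and b: "0 < b" "b < L * v x0 powr l"
  obtains r where "r > 0" "cball x0 r \<subseteq> \<Omega>"
    "eventually (\<lambda>k. \<forall>x\<in>cball x0 r. b powr p k \<le> \<Lambda> k * u k x powr (q k - 1)) sequentially"
proof -
  have v0: "v x0 > 0" by (rule v_positive[OF x0])
  have "((\<lambda>s. L * (v x0 - s) powr l) \<longlongrightarrow> L * (v x0 - 0) powr l) (at_right 0)"
    by (intro tendsto_mult_left tendsto_powr tendsto_diff tendsto_const tendsto_ident_at) (use v0 in auto)
  then have "eventually (\<lambda>s. b < L * (v x0 - s) powr l) (at_right 0)"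
    using b(2) by (intro order_tendstoD(1)) auto
  moreover have "eventually (\<lambda>s. s \<in> {0<..<v x0}) (at_right 0)" by (rule eventually_at_right_real[OF v0])
  ultimately have "eventually (\<lambda>s. b < L * (v x0 - s) powr l \<and> s \<in> {0<..<v x0}) (at_right 0)" by (rule eventually_conj)
  from eventually_happens'[OF trivial_limit_at_right_real this]
  obtain s where s: "b < L * (v x0 - s) powr l" "0 < s" "s < v x0" by auto
  define t where "t = v x0 - s"
  have t: "0 < t" "t < v x0" "b < L * t powr l" using s by (auto simp: t_def)
  obtain r where r: "r > 0" "cball x0 r \<subseteq> \<Omega>"
    "eventually (\<lambda>k. \<forall>x\<in>cball x0 r. t < u k x \<and> u k x < v x0 + 1) sequentially"
    by (rule near_limit[OF x0 t(2), of "v x0 + 1"]) (simp, rule that)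
  have "(\<lambda>k. \<Lambda> k powr (1 / p k) * t powr ((q k - 1) / p k)) \<longlonglongrightarrow> L * t powr l"
    using t(1) by (intro tendsto_mult \<Lambda>(2) tendsto_powr tendsto_const exponent_limit) simp
  then have "eventually (\<lambda>k. b < \<Lambda> k powr (1 / p k) * t powr ((q k - 1) / p k)) sequentially"
    using t(3) by (intro order_tendstoD(1))
  with r(3) have "eventually (\<lambda>k. \<forall>x\<in>cball x0 r. b powr p k \<le> \<Lambda> k * u k x powr (q k - 1)) sequentially"
  proof eventually_elim
    case (elim k)
    show ?case
    proof
      fix x assume "x \<in> cball x0 r"
      then have ux: "t < u k x" using elim(1) by blast
      have "b powr p k \<le> (\<Lambda> k powr (1 / p k) * t powr ((q k - 1) / p k)) powr p k"
        using elim(2) b(1) p(2)[of k] by (intro powr_mono2) auto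
      also have "... = \<Lambda> k * t powr (q k - 1)" using t(1) by (simp only: source_eq less_imp_le)
      also have "... \<le> \<Lambda> k * u k x powr (q k - 1)"
        using ux t(1) q(1)[of k] \<Lambda>(1)[of k] by (intro mult_left_mono powr_mono2) auto
      finally show "b powr p k \<le> \<Lambda> k * u k x powr (q k - 1)" .
    qed
  qed
  then show ?thesis using that[OF r(1,2)] by blast
qed

lemma source_upper:
  assumes x0: "x0 \<in> \<Omega>" and b: "L * v x0 powr l < b"
  obtains r where "r > 0" "cball x0 r \<subseteq> \<Omega>"
    "eventually (\<lambda>k. \<forall>x\<in>cball x0 r. \<Lambda> k * u k x powr (q k - 1) \<le> b powr p k) sequentially"
proof -
  have v0: "v x0 > 0" by (rule v_positive[OF x0])
  have "((\<lambda>s. L * (v x0 + s) powr l) \<longlongrightarrow> L * (v x0 + 0) powr l) (at_right 0)"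
    by (intro tendsto_mult_left tendsto_powr tendsto_add tendsto_const tendsto_ident_at) (use v0 in auto)
  then have "eventually (\<lambda>s. L * (v x0 + s) powr l < b) (at_right 0)"
    using b by (intro order_tendstoD(2)) auto
  moreover have "eventually (\<lambda>s. s \<in> {0<..<v x0}) (at_right 0)" by (rule eventually_at_right_real[OF v0])
  ultimately have "eventually (\<lambda>s. L * (v x0 + s) powr l < b \<and> s \<in> {0<..<v x0}) (at_right 0)" by (rule eventually_conj)
  from eventually_happens'[OF trivial_limit_at_right_real this]
  obtain s where s: "L * (v x0 + s) powr l < b" "0 < s" by auto
  define t where "t = v x0 + s"
  have t: "0 < t" "v x0 < t" "L * t powr l < b" using s v0 by (auto simp: t_def)
  obtain r where r: "r > 0" "cball x0 r \<subseteq> \<Omega>"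
    "eventually (\<lambda>k. \<forall>x\<in>cball x0 r. 0 < u k x \<and> u k x < t) sequentially"
    by (rule near_limit[OF x0 v0 t(2)]) (rule that)
  have "(\<lambda>k. \<Lambda> k powr (1 / p k) * t powr ((q k - 1) / p k)) \<longlonglongrightarrow> L * t powr l"
    using t(1) by (intro tendsto_mult \<Lambda>(2) tendsto_powr tendsto_const exponent_limit) simp
  then have "eventually (\<lambda>k. \<Lambda> k powr (1 / p k) * t powr ((q k - 1) / p k) < b) sequentially"
    using t(3) by (intro order_tendstoD(2))
  with r(3) have "eventually (\<lambda>k. \<forall>x\<in>cball x0 r. \<Lambda> k * u k x powr (q k - 1) \<le> b powr p k) sequentially"
  proof eventually_elim
    case (elim k)
    show ?case
    proof
      fix x assume "x \<in> cball x0 r"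
      then have ux: "0 < u k x" "u k x < t" using elim(1) by blast+
      have "\<Lambda> k * u k x powr (q k - 1) \<le> \<Lambda> k * t powr (q k - 1)"
        using ux q(1)[of k] \<Lambda>(1)[of k] by (intro mult_left_mono powr_mono2) auto
      also have "... = (\<Lambda> k powr (1 / p k) * t powr ((q k - 1) / p k)) powr p k" using t(1) by (simp only: source_eq less_imp_le)
      also have "... \<le> b powr p k"
        using elim(2) p(2)[of k] by (intro powr_mono2) auto
      finally show "\<Lambda> k * u k x powr (q k - 1) \<le> b powr p k" .
    qed
  qed
  then show ?thesis using that[OF r(1,2)] by blast
qed

lemma touching_gap:
  fixes f g :: "'a \<Rightarrow> real"
  assumes cb: "cball x0 r \<subseteq> \<Omega>" and r: "r > 0" and f: "continuous_on (cball x0 r) f" and g: "continuous_on (cball x0 r) g"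
    and lt: "\<And>x. x \<in> \<Omega> \<Longrightarrow> x \<noteq> x0 \<Longrightarrow> f x < g x"
  obtains d where "d > 0" "\<And>x. x \<in> frontier (ball x0 r) \<Longrightarrow> f x + d < g x"
proof -
  have fr: "frontier (ball x0 r) = sphere x0 r" using r by (simp add: frontier_ball)
  have sc: "sphere x0 r \<subseteq> cball x0 r" by auto
  have s\<Omega>: "x \<in> \<Omega>" "x \<noteq> x0" if "x \<in> sphere x0 r" for x using that cb r by auto
  show ?thesis
  proof (cases "sphere x0 r = {}")
    case True
    then show ?thesis using that[of 1] unfolding fr by simp
  next
    case False
    have "continuous_on (sphere x0 r) (\<lambda>x. g x - f x)"
      by (rule continuous_on_diff[OF continuous_on_subset[OF g sc] continuous_on_subset[OF f sc]])
    from continuous_attains_inf[OF compact_sphere False this]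
    obtain z where z: "z \<in> sphere x0 r" "\<forall>x\<in>sphere x0 r. g z - f z \<le> g x - f x"
      by (elim bexE) (rule that)
    have zp: "f z < g z" by (rule lt[OF s\<Omega>[OF z(1)]])
    show ?thesis
    proof (rule that[of "(g z - f z) / 2"])
      show "(g z - f z) / 2 > 0" using zp by simp
      show "f x + (g z - f z) / 2 < g x" if "x \<in> frontier (ball x0 r)" for x
        using bspec[OF z(2), of x] that zp unfolding fr by argo
    qed
  qed
qed

text \<open>Shifted up by the gap \<open>d\<close> on the sphere, \<open>b\<close> would still be below \<open>v\<close> there and hence, by
  comparison, at the centre, where it touches.\<close>

lemma no_strict_touching_below:
  assumes x0: "x0 \<in> \<Omega>" and b: "C2_data \<Omega> b B H" and touch: "v x0 = b x0"
    and below: "\<And>x. x \<in> \<Omega> \<Longrightarrow> x \<noteq> x0 \<Longrightarrow> b x < v x"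
    and r: "r > 0" "cball x0 r \<subseteq> \<Omega>"
    and strict: "eventually (\<lambda>k. \<forall>x\<in>ball x0 r. - plaplace (p k) (B x) (\<lambda>i. H i x) < \<Lambda> k * u k x powr (q k - 1)) sequentially"
  shows False
proof -
  obtain d where d: "d > 0" "\<And>x. x \<in> frontier (ball x0 r) \<Longrightarrow> b x + d < v x"
    by (rule touching_gap[OF r(2,1) continuous_on_subset[OF C2_dataD(5)[OF b] r(2)] continuous_on_subset[OF cv subset_UNIV] below])
       (assumption, assumption, rule that)
  have cl: "closure (ball x0 r) \<subseteq> \<Omega>" using r by (simp add: closure_ball)
  have "b x0 + d \<le> v x0"
    by (rule limit_comparison_below[OF \<Omega>(1,2) p(1) ws lim open_ball cl cl C2_data_add_const[OF b] strict cv d(2)])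
       (use r(1) in simp_all)
  then show False using touch d(1) by simp
qed

lemma no_strict_touching_above:
  assumes x0: "x0 \<in> \<Omega>" and b: "C2_data \<Omega> b B H" and touch: "v x0 = b x0"
    and above: "\<And>x. x \<in> \<Omega> \<Longrightarrow> x \<noteq> x0 \<Longrightarrow> v x < b x"
    and r: "r > 0" "cball x0 r \<subseteq> \<Omega>"
    and strict: "eventually (\<lambda>k. \<forall>x\<in>ball x0 r. \<Lambda> k * u k x powr (q k - 1) < - plaplace (p k) (B x) (\<lambda>i. H i x)) sequentially"
  shows False
proof -
  obtain d where d: "d > 0" "\<And>x. x \<in> frontier (ball x0 r) \<Longrightarrow> v x + d < b x"
    by (rule touching_gap[OF r(2,1) continuous_on_subset[OF cv subset_UNIV] continuous_on_subset[OF C2_dataD(5)[OF b] r(2)] above])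
       (assumption, assumption, rule that)
  have cl: "closure (ball x0 r) \<subseteq> \<Omega>" using r by (simp add: closure_ball)
  have d': "v x < b x + - d" if "x \<in> frontier (ball x0 r)" for x using d(2)[OF that] by simp
  have "v x0 \<le> b x0 + - d"
    by (rule limit_comparison_above[OF \<Omega>(1,2) p(1) ws lim open_ball cl cl C2_data_add_const[OF b] strict cv d'])
       (use r(1) in simp_all)
  then show False using touch d(1) by simp
qed

lemma continuous_cball_less:
  fixes f :: "'a \<Rightarrow> real"
  assumes "continuous_on \<Omega> f" "x0 \<in> \<Omega>" "f x0 < c" "r0 > 0"
  obtains r where "r > 0" "r \<le> r0" "cball x0 r \<subseteq> \<Omega>" "\<And>x. x \<in> cball x0 r \<Longrightarrow> f x < c"
proof -
  have "open (\<Omega> \<inter> f -` {..<c})" using continuous_open_preimage[OF assms(1) \<Omega>(1) open_lessThan] .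
  moreover have "x0 \<in> \<Omega> \<inter> f -` {..<c}" using assms(2,3) by simp
  ultimately obtain r1 where r1: "r1 > 0" "cball x0 r1 \<subseteq> \<Omega> \<inter> f -` {..<c}"
    using open_contains_cball by blast
  show ?thesis
  proof (rule that[of "min r0 r1"])
    show "cball x0 (min r0 r1) \<subseteq> \<Omega>" "\<And>x. x \<in> cball x0 (min r0 r1) \<Longrightarrow> f x < c"
      using r1(2) by (auto simp: subset_iff)
  qed (use assms(4) r1(1) in auto)
qed

lemma supersolution_inf_laplace:
  assumes x0: "x0 \<in> \<Omega>" and b: "C2_data \<Omega> b B H" and touch: "v x0 = b x0"
    and below: "\<And>x. x \<in> \<Omega> \<Longrightarrow> x \<noteq> x0 \<Longrightarrow> b x < v x"
  shows "inf_laplace (B x0) (\<lambda>i. H i x0) \<le> 0"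
proof (rule ccontr)
  assume "\<not> ?thesis"
  then have n: "- inf_laplace (B x0) (\<lambda>i. H i x0) < 0" by simp
  obtain r where r: "r > 0" "cball x0 r \<subseteq> \<Omega>" "\<And>x. x \<in> cball x0 r \<Longrightarrow> - inf_laplace (B x) (\<lambda>i. H i x) < 0"
    using continuous_cball_less[OF continuous_on_minus[OF C2_dataD(7)[OF b]] x0 n zero_less_one] by metis
  have pos: "inf_laplace (B x) (\<lambda>i. H i x) > 0" if "x \<in> cball x0 r" for x using r(3)[OF that] by simp
  show False
    by (rule no_strict_touching_below[OF x0 b touch below r(1,2)
        strict_of_inf_laplace_pos[OF compact_cball r(2) r(2) b pos ball_subset_cball]])
qed

text \<open>If \<open>|\<nabla>b| < a < c < L v^l\<close> near \<open>x0\<close>, then \<open>|\<Delta>_p b| < c^p\<close> eventually, while the right-hand side is at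
  least \<open>c^p\<close>; so \<open>b\<close> is a strict subsolution, which cannot touch.\<close>

lemma supersolution_gradient:
  assumes x0: "x0 \<in> \<Omega>" and b: "C2_data \<Omega> b B H" and touch: "v x0 = b x0"
    and below: "\<And>x. x \<in> \<Omega> \<Longrightarrow> x \<noteq> x0 \<Longrightarrow> b x < v x"
  shows "L * v x0 powr l \<le> norm (B x0)"
proof (rule ccontr)
  assume "\<not> ?thesis"
  then have n: "norm (B x0) < L * v x0 powr l" by simp
  then obtain a where a: "norm (B x0) < a" "a < L * v x0 powr l" using dense by blast
  then obtain c where c: "a < c" "c < L * v x0 powr l" using dense by blast
  have a0: "a > 0" using a(1) norm_ge_zero[of "B x0"] by linarith
  have c0: "c > 0" using a0 c(1) by linarith
  obtain r1 where r1: "r1 > 0" "cball x0 r1 \<subseteq> \<Omega>"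
    "eventually (\<lambda>k. \<forall>x\<in>cball x0 r1. c powr p k \<le> \<Lambda> k * u k x powr (q k - 1)) sequentially"
    by (rule source_lower[OF x0 c0 c(2)]) (rule that)
  obtain r where r: "r > 0" "r \<le> r1" "cball x0 r \<subseteq> \<Omega>" "\<And>x. x \<in> cball x0 r \<Longrightarrow> norm (B x) < a"
    using continuous_cball_less[OF continuous_on_norm[OF C2_dataD(6)[OF b]] x0 a(1) r1(1)] by metis
  have le: "norm (B x) \<le> a" if "x \<in> cball x0 r" for x using r(4)[OF that] by simp
  have ev: "eventually (\<lambda>k. \<forall>x\<in>cball x0 r. \<bar>plaplace (p k) (B x) (\<lambda>i. H i x)\<bar> < c powr p k) sequentially"
    by (rule eventually_compose_filterlim[OF eventually_plaplace_small[OF compact_cball r(3) b a0 c(1) le] p(1)])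
  have strict: "eventually (\<lambda>k. \<forall>x\<in>ball x0 r. - plaplace (p k) (B x) (\<lambda>i. H i x) < \<Lambda> k * u k x powr (q k - 1)) sequentially"
    using ev r1(3)
  proof eventually_elim
    case (elim k)
    show ?case
    proof
      fix x assume "x \<in> ball x0 r"
      then have x: "x \<in> cball x0 r" "x \<in> cball x0 r1" using r(2) by auto
      show "- plaplace (p k) (B x) (\<lambda>i. H i x) < \<Lambda> k * u k x powr (q k - 1)"
        using bspec[OF elim(1) x(1)] bspec[OF elim(2) x(2)] by linarith
    qed
  qed
  show False by (rule no_strict_touching_below[OF x0 b touch below r(1,3) strict])
qed

text \<open>If \<open>\<Delta>_\<infinity> b < 0\<close> and \<open>|\<nabla>b| > a > c > L v^l\<close> near \<open>x0\<close>, then eventually \<open>-\<Delta>_p b \<ge> a^(p-4) > c^p\<close>, while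
  the right-hand side is at most \<open>c^p\<close>; so \<open>b\<close> is a strict supersolution, which cannot touch.\<close>

lemma subsolution:
  assumes x0: "x0 \<in> \<Omega>" and b: "C2_data \<Omega> b B H" and touch: "v x0 = b x0"
    and above: "\<And>x. x \<in> \<Omega> \<Longrightarrow> x \<noteq> x0 \<Longrightarrow> v x < b x"
  shows "0 \<le> inf_laplace (B x0) (\<lambda>i. H i x0) \<or> norm (B x0) \<le> L * v x0 powr l"
proof (rule ccontr)
  assume "\<not> ?thesis"
  then have n: "inf_laplace (B x0) (\<lambda>i. H i x0) < 0" "L * v x0 powr l < norm (B x0)" by auto
  obtain a where a: "L * v x0 powr l < a" "a < norm (B x0)" using dense[OF n(2)] by blast
  obtain c where c: "L * v x0 powr l < c" "c < a" using dense[OF a(1)] by blast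
  have "0 \<le> L * v x0 powr l" using \<Lambda>(3) by simp
  then have c0: "c > 0" using c(1) by linarith
  obtain r1 where r1: "r1 > 0" "cball x0 r1 \<subseteq> \<Omega>"
    "eventually (\<lambda>k. \<forall>x\<in>cball x0 r1. \<Lambda> k * u k x powr (q k - 1) \<le> c powr p k) sequentially"
    by (rule source_upper[OF x0 c(1)]) (rule that)
  have a': "- norm (B x0) < - a" using a(2) by simp
  obtain r2 where r2: "r2 > 0" "r2 \<le> r1" "cball x0 r2 \<subseteq> \<Omega>" "\<And>x. x \<in> cball x0 r2 \<Longrightarrow> - norm (B x) < - a"
    using continuous_cball_less[OF continuous_on_minus[OF continuous_on_norm[OF C2_dataD(6)[OF b]]] x0 a' r1(1)] by metis
  obtain r where r: "r > 0" "r \<le> r2" "cball x0 r \<subseteq> \<Omega>" "\<And>x. x \<in> cball x0 r \<Longrightarrow> inf_laplace (B x) (\<lambda>i. H i x) < 0"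
    using continuous_cball_less[OF C2_dataD(7)[OF b] x0 n(1) r2(1)] by metis
  \<comment> \<open>The lower bound for the \<open>p\<close>-Laplacian is applied to \<open>-b\<close>.\<close>
  have pos: "inf_laplace (- B x) (\<lambda>i. - H i x) > 0" if "x \<in> cball x0 r" for x
    unfolding inf_laplace_minus using r(4)[OF that] by simp
  have ev: "eventually (\<lambda>k. \<forall>x\<in>cball x0 r. norm (- B x) powr (p k - 4) \<le> plaplace (p k) (- B x) (\<lambda>i. - H i x)) sequentially"
    by (rule eventually_compose_filterlim[OF eventually_plaplace_ge[OF compact_cball r(3) C2_data_minus[OF b] pos] p(1)])
  have ev2: "eventually (\<lambda>k. c powr p k < a powr (p k - 4)) sequentially"
    by (rule eventually_compose_filterlim[OF eventually_powr_shift[OF c0 c(2)] p(1)])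
  have strict: "eventually (\<lambda>k. \<forall>x\<in>ball x0 r. \<Lambda> k * u k x powr (q k - 1) < - plaplace (p k) (B x) (\<lambda>i. H i x)) sequentially"
    using ev ev2 r1(3) filterlim_at_top_dense[THEN iffD1, OF p(1), rule_format, of 4]
  proof eventually_elim
    case (elim k)
    show ?case
    proof
      fix x assume "x \<in> ball x0 r"
      then have x: "x \<in> cball x0 r" "x \<in> cball x0 r1" "x \<in> cball x0 r2" using r(2) r2(2) by auto
      have "a powr (p k - 4) \<le> norm (B x) powr (p k - 4)"
        using r2(4)[OF x(3)] c0 c(2) elim(4) by (intro powr_mono2) auto
      moreover have "norm (B x) powr (p k - 4) \<le> - plaplace (p k) (B x) (\<lambda>i. H i x)"
        using bspec[OF elim(1) x(1)] unfolding plaplace_minus by simp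
      ultimately show "\<Lambda> k * u k x powr (q k - 1) < - plaplace (p k) (B x) (\<lambda>i. H i x)"
        using bspec[OF elim(3) x(2)] elim(2) by linarith
    qed
  qed
  show False by (rule no_strict_touching_above[OF x0 b touch above r(1,3) strict])
qed

end

lemma C_on_2_data:
  fixes \<phi> :: "'a::euclidean_space \<Rightarrow> real"
  assumes "open \<Omega>" "C_on 2 \<Omega> \<phi>"
  shows "C2_data \<Omega> \<phi> (grad \<phi>) (\<lambda>i. grad (partial_deriv i \<phi>))"
proof -
  have c: "C_on (Suc (Suc 0)) \<Omega> \<phi>" using assms(2) by (simp only: numeral_2_eq_2)
  have 1: "GDERIV \<phi> x :> grad \<phi> x" if "x \<in> \<Omega>" for x
    using C_on_Suc_continuous_grad(1)[OF C_on_SucD[OF c] that] .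
  have i: "C_on (Suc 0) \<Omega> (partial_deriv i \<phi>)" if "i \<in> Basis" for i
    using c that unfolding C_on.simps(2)[of "Suc 0"] by blast
  have e: "(\<lambda>x. grad \<phi> x \<bullet> i) = partial_deriv i \<phi>" if "i \<in> Basis" for i
    by (rule ext) (rule grad_inner_Basis[OF that])
  show ?thesis unfolding C2_data_def
    using assms(1) 1 e C_on_Suc_continuous_grad[OF i] by simp
qed

lemma infinity_laplacian_eq:
  fixes \<phi> :: "'a::euclidean_space \<Rightarrow> real"
  shows "infinity_laplacian \<phi> x = inf_laplace (grad \<phi> x) (\<lambda>i. grad (partial_deriv i \<phi>) x)"
  unfolding infinity_laplacian_def inf_laplace_def
proof (rule sum.cong[OF refl])
  fix i :: 'a assume i: "i \<in> Basis"
  have "grad \<phi> x \<bullet> grad (partial_deriv i \<phi>) x = (\<Sum>j\<in>Basis. partial_deriv j \<phi> x * partial_deriv j (partial_deriv i \<phi>) x)"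
    by (subst euclidean_inner) (simp add: grad_inner_Basis)
  then show "(\<Sum>j\<in>Basis. partial_deriv j \<phi> x * partial_deriv j (partial_deriv i \<phi>) x * partial_deriv i \<phi> x) =
     grad \<phi> x \<bullet> grad (partial_deriv i \<phi>) x * (grad \<phi> x \<bullet> i)"
    by (simp add: grad_inner_Basis[OF i] sum_distrib_right)
qed

text \<open>Since \<open>v\<close> is positive, the convention for \<open>0^0\<close> in the equation is not met.\<close>

lemma (in eigenfunction_limit) viscosity:
  assumes "L = lambda_1_inf \<Omega>"
  shows "viscosity_solution l \<Omega> v"
  unfolding viscosity_solution_def
proof (intro conjI ballI allI impI)
  show "continuous_on \<Omega> v" by (rule continuous_on_subset[OF cv]) simp
  show "0 \<le> v x" for x by (rule v_nonneg)
next
  fix x0 \<phi> assume x0: "x0 \<in> \<Omega>"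
    and h: "C_on 2 \<Omega> \<phi> \<and> v x0 = \<phi> x0 \<and> (\<forall>x\<in>\<Omega>. x \<noteq> x0 \<longrightarrow> v x < \<phi> x)"
  have b: "C2_data \<Omega> \<phi> (grad \<phi>) (\<lambda>i. grad (partial_deriv i \<phi>))" using C_on_2_data[OF \<Omega>(1)] h by blast
  have "rpow (\<phi> x0) l = v x0 powr l" using h v_positive[OF x0] by (simp add: rpow_def)
  then show "- infinity_laplacian \<phi> x0 \<le> 0 \<or> norm (grad \<phi> x0) - lambda_1_inf \<Omega> * rpow (\<phi> x0) l \<le> 0"
    using subsolution[OF x0 b] h assms unfolding infinity_laplacian_eq by auto
next
  fix x0 \<phi> assume x0: "x0 \<in> \<Omega>"
    and h: "C_on 2 \<Omega> \<phi> \<and> v x0 = \<phi> x0 \<and> (\<forall>x\<in>\<Omega>. x \<noteq> x0 \<longrightarrow> \<phi> x < v x)"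
  have b: "C2_data \<Omega> \<phi> (grad \<phi>) (\<lambda>i. grad (partial_deriv i \<phi>))" using C_on_2_data[OF \<Omega>(1)] h by blast
  show "0 \<le> - infinity_laplacian \<phi> x0"
    using supersolution_inf_laplace[OF x0 b] h unfolding infinity_laplacian_eq by auto
  have "rpow (\<phi> x0) l = v x0 powr l" using h v_positive[OF x0] by (simp add: rpow_def)
  then show "0 \<le> norm (grad \<phi> x0) - lambda_1_inf \<Omega> * rpow (\<phi> x0) l"
    using supersolution_gradient[OF x0 b] h assms by auto
qed

section \<open>Uniform limits: Lipschitz constant and maximum\<close>

text \<open>For a fixed radius \<open>e\<close> the factor \<open>measure (cball 0 e) powr (- 1/p)\<close> tends to 1, so the means of \<open>v\<close>
  have Lipschitz constant \<open>L\<close>; then the radius tends to 0.\<close>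

lemma limit_lipschitz:
  fixes w :: "nat \<Rightarrow> 'a::euclidean_space \<Rightarrow> real"
  assumes lim: "uniform_limit UNIV w v sequentially" and cw: "\<And>k. continuous_on UNIV (w k)" and cv: "continuous_on UNIV v"
    and avg: "\<And>k e x y. e > 0 \<Longrightarrow> \<bar>ball_average e (w k) y - ball_average e (w k) x\<bar> \<le>
      norm (y - x) * (measure lborel (cball (0::'a) e) powr (- 1 / p k) * \<mu> k)"
    and p: "filterlim p at_top sequentially" and \<mu>: "\<mu> \<longlonglongrightarrow> L"
  shows "\<bar>v y - v x\<bar> \<le> L * norm (y - x)"
proof -
  have avg_lim: "(\<lambda>k. ball_average e (w k) z) \<longlonglongrightarrow> ball_average e v z" if e: "e > 0" for e z
  proof (rule LIMSEQ_I)
    fix d :: real assume d: "d > 0"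
    then have d2: "d / 2 > 0" by simp
    obtain N where N: "\<And>k. k \<ge> N \<Longrightarrow> \<forall>x\<in>UNIV. dist (w k x) (v x) < d / 2"
      using uniform_limitD[OF lim d2] unfolding eventually_sequentially by blast
    have "norm (ball_average e (w k) z - ball_average e v z) < d" if k: "k \<ge> N" for k
    proof -
      have "\<bar>w k (z + t) - v (z + t)\<bar> \<le> d / 2" for t
        using N[OF k] by (simp add: dist_real_def less_imp_le)
      then have "\<bar>ball_average e (w k) z - ball_average e v z\<bar> \<le> d / 2"
        by (rule ball_average_dist[OF cw cv e])
      then show ?thesis using d by simp
    qed
    then show "\<exists>N. \<forall>k\<ge>N. norm (ball_average e (w k) z - ball_average e v z) < d" by blast
  qed
  have inv: "(\<lambda>k. - 1 / p k) \<longlonglongrightarrow> 0"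
    using tendsto_minus[OF tendsto_inverse_0_at_top[OF p]] by (simp add: inverse_eq_divide)
  have A: "\<bar>ball_average e v y - ball_average e v x\<bar> \<le> L * norm (y - x)" if e: "e > 0" for e
  proof (rule LIMSEQ_le)
    show "(\<lambda>k. \<bar>ball_average e (w k) y - ball_average e (w k) x\<bar>) \<longlonglongrightarrow> \<bar>ball_average e v y - ball_average e v x\<bar>"
      by (intro tendsto_rabs tendsto_diff avg_lim e)
    have m: "measure lborel (cball (0::'a) e) > 0" by (rule content_cball_pos[OF e])
    have "(\<lambda>k. norm (y - x) * (measure lborel (cball (0::'a) e) powr (- 1 / p k) * \<mu> k)) \<longlonglongrightarrow>
       norm (y - x) * (measure lborel (cball (0::'a) e) powr 0 * L)"
      by (intro tendsto_mult tendsto_const tendsto_powr inv \<mu>) (use m in simp)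
    then show "(\<lambda>k. norm (y - x) * (measure lborel (cball (0::'a) e) powr (- 1 / p k) * \<mu> k)) \<longlonglongrightarrow> L * norm (y - x)"
      using m by (simp add: mult.commute)
    show "\<exists>N. \<forall>k\<ge>N. \<bar>ball_average e (w k) y - ball_average e (w k) x\<bar> \<le>
      norm (y - x) * (measure lborel (cball (0::'a) e) powr (- 1 / p k) * \<mu> k)" using avg[OF e] by blast
  qed
  have "\<bar>v y - v x\<bar> \<le> L * norm (y - x) + d" if d: "d > 0" for d
  proof -
    have near: "\<exists>s>0. \<forall>t. norm t \<le> s \<longrightarrow> \<bar>v (z + t) - v z\<bar> \<le> d / 2" for z
    proof -
      have "isCont v z" using cv by (simp add: continuous_on_eq_continuous_at)
      then obtain s where s: "s > 0" "\<And>z'. dist z' z < s \<Longrightarrow> dist (v z') (v z) < d / 2"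
        unfolding continuous_at_eps_delta using d by (metis half_gt_zero)
      have "\<bar>v (z + t) - v z\<bar> \<le> d / 2" if "norm t \<le> s / 2" for t
        using s(2)[of "z + t"] that s(1) by (simp add: dist_norm less_imp_le)
      then show ?thesis using s(1) by (intro exI[of _ "s / 2"]) simp
    qed
    obtain s1 where s1: "s1 > 0" "\<And>t. norm t \<le> s1 \<Longrightarrow> \<bar>v (x + t) - v x\<bar> \<le> d / 2" using near[of x] by blast
    obtain s2 where s2: "s2 > 0" "\<And>t. norm t \<le> s2 \<Longrightarrow> \<bar>v (y + t) - v y\<bar> \<le> d / 2" using near[of y] by blast
    define e where "e = min s1 s2"
    have e: "e > 0" using s1(1) s2(1) by (simp add: e_def)
    have const: "ball_average e (\<lambda>_. c) (z::'a) = c" for c z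
      using content_cball_pos[OF e, of "0::'a"] by (simp add: ball_average_def)
    have "\<bar>ball_average e v x - ball_average e (\<lambda>_. v x) x\<bar> \<le> d / 2"
      by (rule ball_average_dist[OF cv continuous_on_const e]) (use s1(2) in \<open>simp add: e_def\<close>)
    moreover have "\<bar>ball_average e v y - ball_average e (\<lambda>_. v y) y\<bar> \<le> d / 2"
      by (rule ball_average_dist[OF cv continuous_on_const e]) (use s2(2) in \<open>simp add: e_def\<close>)
    ultimately show ?thesis using A[OF e] unfolding const by linarith
  qed
  then show ?thesis by (rule field_le_epsilon)
qed

text \<open>If \<open>v\<close> stayed below 1, its norms in \<open>L^q\<close> would have upper limit below 1; if \<open>v\<close> exceeded 1 somewhere,
  it would do so on a ball, and the norms would have lower limit above 1.\<close>

lemma limit_maximum: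
  fixes \<Omega> :: "'a::euclidean_space set" and w :: "nat \<Rightarrow> 'a \<Rightarrow> real"
  assumes \<Omega>: "open \<Omega>" "bounded \<Omega>" "x0 \<in> \<Omega>"
    and lim: "uniform_limit UNIV w v sequentially" and cw: "\<And>k. continuous_on UNIV (w k)" and cv: "continuous_on UNIV v"
    and v0: "\<And>x. x \<notin> \<Omega> \<Longrightarrow> v x = 0" and wn: "\<And>k x. w k x \<ge> 0"
    and N: "\<And>k. Lp_norm (q k) \<Omega> (w k) = 1" and q: "filterlim q at_top sequentially" "\<And>k. q k > 0"
  shows "\<exists>x\<in>\<Omega>. v x \<ge> 1" and "v x \<le> 1"
proof -
  have cl: "compact (closure \<Omega>)" using \<Omega>(2) by (simp add: compact_closure)
  have wm: "w k \<in> borel_measurable (lebesgue_on \<Omega>)" for k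
    by (intro borel_imp_lebesgue_on borel_measurable_continuous_onI cw)
  obtain \<rho> where \<rho>: "\<rho> > 0" "ball x0 \<rho> \<subseteq> \<Omega>" using \<Omega>(1,3) open_contains_ball by blast
  define m where "m = measure (lebesgue_on \<Omega>) \<Omega>"
  have m: "m > 0" unfolding m_def by (rule measure_lebesgue_on_pos[OF \<Omega>(1,2) \<rho>(2,1)])
  show "\<exists>x\<in>\<Omega>. v x \<ge> 1"
  proof (rule ccontr)
    assume n: "\<not> ?thesis"
    have ne: "closure \<Omega> \<noteq> {}" using \<Omega>(3) closure_subset by blast
    from continuous_attains_sup[OF cl ne continuous_on_subset[OF cv subset_UNIV]]
    obtain z where z: "z \<in> closure \<Omega>" "\<forall>y\<in>closure \<Omega>. v y \<le> v z" by (elim bexE) (rule that)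
    have "v z < 1" using n v0[of z] by (cases "z \<in> \<Omega>") auto
    define c where "c = (max 0 (v z) + 1) / 2"
    define d where "d = (1 - max 0 (v z)) / 2"
    have c: "0 < c" "c < 1" "d > 0" "v z + d \<le> c" using \<open>v z < 1\<close> by (auto simp: c_def d_def max_def field_simps)
    have "(\<lambda>k. c * m powr (1 / q k)) \<longlonglongrightarrow> c * 1" by (intro tendsto_mult_left tendsto_powr_inverse q m)
    then have "eventually (\<lambda>k. c * m powr (1 / q k) < 1) sequentially" using c(2) by (intro order_tendstoD(2)) auto
    with uniform_limitD[OF lim c(3)] have "eventually (\<lambda>k. False) sequentially"
    proof eventually_elim
      case (elim k)
      have "norm (w k y) \<le> c" if "y \<in> \<Omega>" for y
      proof -
        have "y \<in> closure \<Omega>" using that closure_subset by blast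
        then have "v y \<le> v z" using z(2) by blast
        moreover have "\<bar>w k y - v y\<bar> < d" using elim(1) by (simp add: dist_real_def)
        ultimately show ?thesis using wn[of k y] c(4) by simp
      qed
      then have "Lp_norm (q k) \<Omega> (w k) \<le> c * m powr (1 / q k)"
        unfolding m_def using c(1) q(2) by (intro Lp_norm_le[OF \<Omega>(1,2) _ wm]) auto
      then show False using elim(2) N[of k] by simp
    qed
    then show False by simp
  qed
  show "v x \<le> 1"
  proof (rule ccontr)
    assume n: "\<not> ?thesis"
    then have x\<Omega>: "x \<in> \<Omega>" using v0[of x] by (cases "x \<in> \<Omega>") auto
    define c where "c = (1 + v x) / 2"
    define d where "d = (v x - 1) / 4"
    have c: "1 < c" "d > 0" "c + d < v x" using n by (auto simp: c_def d_def field_simps)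
    have "open (\<Omega> \<inter> v -` {c + d<..})" using \<Omega>(1) cv by (intro open_Int open_vimage) auto
    moreover have "x \<in> \<Omega> \<inter> v -` {c + d<..}" using x\<Omega> c(3) by simp
    ultimately obtain r where r: "r > 0" "ball x r \<subseteq> \<Omega> \<inter> v -` {c + d<..}" using open_contains_ball by blast
    define mb where "mb = measure lborel (ball x r)"
    have mb: "mb > 0" unfolding mb_def by (rule content_ball_pos[OF r(1)])
    have "(\<lambda>k. c * mb powr (1 / q k)) \<longlonglongrightarrow> c * 1" by (intro tendsto_mult_left tendsto_powr_inverse q mb)
    then have "eventually (\<lambda>k. 1 < c * mb powr (1 / q k)) sequentially" using c(1) by (intro order_tendstoD(1)) auto
    with uniform_limitD[OF lim c(2)] have "eventually (\<lambda>k. False) sequentially"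
    proof eventually_elim
      case (elim k)
      have qk: "q k \<ge> 0" using q(2)[of k] by simp
      obtain B where B: "\<And>y. y \<in> closure \<Omega> \<Longrightarrow> norm (w k y) \<le> B"
        using compact_norm_bound[OF cl continuous_on_subset[OF cw subset_UNIV]] by metis
      have B': "norm (w k y) \<le> B" if "y \<in> \<Omega>" for y using B closure_subset that by blast
      have L: "in_Lp (q k) \<Omega> (w k)" by (rule in_Lp_bounded[OF \<Omega>(1,2) qk wm B'])
      have "c \<le> norm (w k y)" if "y \<in> ball x r" for y
      proof -
        have "c + d < v y" using r(2) that by auto
        moreover have "\<bar>w k y - v y\<bar> < d" using elim(1) by (simp add: dist_real_def)
        ultimately show ?thesis by simp
      qed
      then have "c * mb powr (1 / q k) \<le> Lp_norm (q k) \<Omega> (w k)"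
        unfolding mb_def using c(1) r(2) by (intro Lp_norm_ge[OF \<Omega>(1) q(2) L]) auto
      then show False using elim(2) N[of k] by simp
    qed
    then show False by simp
  qed
qed

lemma Lp_norm_zero_ext: "Lp_norm q \<Omega> (zero_ext \<Omega> u) = Lp_norm q \<Omega> u"
proof -
  have "(\<integral>x. norm (zero_ext \<Omega> u x) powr q \<partial>lebesgue_on \<Omega>) = (\<integral>x. norm (u x) powr q \<partial>lebesgue_on \<Omega>)"
    by (rule Bochner_Integration.integral_cong) (simp_all add: zero_ext_def space_restrict_space)
  then show ?thesis unfolding Lp_norm_def by simp
qed

section \<open>Compactness\<close>

text \<open>Arzela-Ascoli on the closure of \<open>\<Omega>\<close>; boundedness follows from the Hoelder estimate and the zero
  value at a point outside \<open>\<Omega>\<close>.\<close>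

lemma uniform_subsequence_zero_ext:
  fixes \<Omega> :: "'a::euclidean_space set" and u :: "nat \<Rightarrow> 'a \<Rightarrow> real"
  assumes \<Omega>: "bounded \<Omega>"
    and eqc: "\<And>k x y. \<bar>zero_ext \<Omega> (u k) x - zero_ext \<Omega> (u k) y\<bar> \<le> C * sqrt (norm (x - y))" and C: "C \<ge> 0"
  obtains v r where "strict_mono (r :: nat \<Rightarrow> nat)" "uniform_limit UNIV (\<lambda>n. zero_ext \<Omega> (u (r n))) v sequentially"
    "\<And>x. x \<notin> \<Omega> \<Longrightarrow> v x = 0"
proof -
  define w where "w = (\<lambda>k. zero_ext \<Omega> (u k))"
  have w0: "w k x = 0" if "x \<notin> \<Omega>" for k x using that by (simp add: w_def zero_ext_def)
  obtain y0 where y0: "y0 \<notin> \<Omega>" using \<Omega> not_bounded_UNIV by (metis UNIV_eq_I)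
  have cl: "compact (closure \<Omega>)" using \<Omega> by (simp add: compact_closure)
  have "bounded ((\<lambda>x. x - y0) ` closure \<Omega>)"
    by (intro compact_imp_bounded compact_continuous_image cl continuous_intros)
  then obtain M where M: "\<And>x. x \<in> closure \<Omega> \<Longrightarrow> norm (x - y0) \<le> M" unfolding bounded_iff by blast
  have bd: "norm (w n x) \<le> C * sqrt M" if "x \<in> closure \<Omega>" for n x
  proof -
    have "\<bar>w n x - w n y0\<bar> \<le> C * sqrt (norm (x - y0))" unfolding w_def by (rule eqc)
    also have "... \<le> C * sqrt M" using M[OF that] C by (intro mult_left_mono) auto
    finally show ?thesis using w0[OF y0] by simp
  qed
  have ec: "\<exists>d>0. \<forall>n y. y \<in> closure \<Omega> \<and> norm (x - y) < d \<longrightarrow> norm (w n x - w n y) < e" if e: "0 < e" for x e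
  proof (intro exI[of _ "(e / (C + 1))\<^sup>2"] conjI allI impI)
    show "0 < (e / (C + 1))\<^sup>2" using e C by simp
    fix n y assume "y \<in> closure \<Omega> \<and> norm (x - y) < (e / (C + 1))\<^sup>2"
    then have "sqrt (norm (x - y)) < sqrt ((e / (C + 1))\<^sup>2)" by (intro real_sqrt_less_mono) auto
    also have "... = e / (C + 1)" using e C by simp
    finally have s: "sqrt (norm (x - y)) < e / (C + 1)" .
    have "\<bar>w n x - w n y\<bar> \<le> C * sqrt (norm (x - y))" unfolding w_def by (rule eqc)
    also have "... \<le> C * (e / (C + 1))" using s C by (intro mult_left_mono) auto
    also have "... < e" using e C by (simp add: field_simps)
    finally show "norm (w n x - w n y) < e" by simp
  qed
  obtain g r where r: "strict_mono (r :: nat \<Rightarrow> nat)"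
    "\<And>e. 0 < e \<Longrightarrow> \<exists>N. \<forall>n x. n \<ge> N \<and> x \<in> closure \<Omega> \<longrightarrow> norm (w (r n) x - g x) < e"
    by (rule Arzela_Ascoli[OF cl bd ec]) (assumption, assumption, rule that)
  show ?thesis
  proof (rule that[of r "zero_ext \<Omega> g"])
    show "uniform_limit UNIV (\<lambda>n. zero_ext \<Omega> (u (r n))) (zero_ext \<Omega> g) sequentially"
    proof (rule uniform_limitI)
      fix e :: real assume e: "e > 0"
      from r(2)[OF this] obtain N where N: "\<forall>n x. n \<ge> N \<and> x \<in> closure \<Omega> \<longrightarrow> norm (w (r n) x - g x) < e" ..
      have "dist (zero_ext \<Omega> (u (r n)) x) (zero_ext \<Omega> g x) < e" if n: "n \<ge> N" for n x
      proof (cases "x \<in> \<Omega>")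
        case True
        then have "x \<in> closure \<Omega>" using closure_subset by blast
        then have "norm (w (r n) x - g x) < e" using N n by blast
        then show ?thesis using True by (simp add: dist_real_def w_def zero_ext_def)
      qed (use e in \<open>simp add: zero_ext_def\<close>)
      then show "\<forall>\<^sub>F n in sequentially. \<forall>x\<in>UNIV. dist (zero_ext \<Omega> (u (r n)) x) (zero_ext \<Omega> g x) < e"
        unfolding eventually_sequentially by blast
    qed
  qed (use r(1) in \<open>auto simp: zero_ext_def\<close>)
qed

section \<open>The limit problem\<close>

theorem theorem1p2:
  fixes \<Omega> :: "'a::euclidean_space set"
    and p q :: "nat \<Rightarrow> real"
    and l :: real
    and u :: "nat \<Rightarrow> 'a \<Rightarrow> real"
  assumes "open \<Omega>" and "connected \<Omega>" and "bounded \<Omega>" and "smooth_boundary \<Omega>"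
    and "\<And>k. 1 < q k" and "\<And>k. q k < p k"
    and "filterlim p at_top sequentially" and "filterlim q at_top sequentially"
    and "(\<lambda>k. q k / p k) \<longlonglongrightarrow> l" and "l < 1"
    and "\<And>k. eigenfunction (p k) (q k) \<Omega> (u k)"
    and "\<And>k. Lp_norm (q k) \<Omega> (u k) = 1"
  shows "\<exists>v r. strict_mono (r :: nat \<Rightarrow> nat) \<and>
           uniform_limit (closure \<Omega>) (\<lambda>k. u (r k)) v sequentially \<and>
           viscosity_solution l \<Omega> v \<and>
           continuous_on (closure \<Omega>) v \<and> (\<forall>x\<in>frontier \<Omega>. v x = 0) \<and>
           Linf_norm \<Omega> v = 1"
proof -
  note \<Omega> = assms(1,3)
  have ne: "\<Omega> \<noteq> {}"
  proof
    assume "\<Omega> = {}"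
    then have "Lp_norm (q 0) \<Omega> (u 0) = 0" by (simp add: Lp_norm_def integral_lebesgue_on_empty)
    then show False using assms(12)[of 0] by simp
  qed
  obtain R x0 where R: "R > 0" "x0 \<in> \<Omega>" "ball x0 R \<subseteq> \<Omega>" "\<And>x. x \<in> \<Omega> \<Longrightarrow> infdist x (- \<Omega>) \<le> R"
    by (rule inradius_exists[OF \<Omega> ne]) (rule that)
  have lam: "lambda_1_inf \<Omega> = 1 / R" by (rule lambda_1_inf_eq[OF \<Omega> assms(4) R])
  define \<mu> where "\<mu> = (\<lambda>k. Lambda_pq (p k) (q k) \<Omega> powr (1 / p k))"
  have \<mu>_lim: "eventually (\<lambda>k. \<mu> k < M) sequentially" if "M > 1 / R" for M
    unfolding \<mu>_def by (rule Lambda_pq_limsup[OF \<Omega> R(1,3) assms(7,8) that])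
  have "eventually (\<lambda>k. \<mu> k < 1 / R + 1) sequentially" by (rule \<mu>_lim) simp
  moreover have "eventually (\<lambda>k. 2 * real DIM('a) < p k) sequentially"
    using assms(7) by (simp add: filterlim_at_top_dense)
  ultimately have "eventually (\<lambda>k. \<mu> k < 1 / R + 1 \<and> 2 * real DIM('a) < p k) sequentially" by (rule eventually_conj)
  then obtain k0 where k0: "\<And>k. k \<ge> k0 \<Longrightarrow> \<mu> k < 1 / R + 1 \<and> 2 * real DIM('a) < p k"
    unfolding eventually_sequentially by blast
  have "\<exists>G. W1p0 (p k) \<Omega> (u k) G \<and> continuous_on \<Omega> (u k) \<and>
    weak_solution (p k) \<Omega> (zero_ext \<Omega> (u k)) G (\<lambda>x. Lambda_pq (p k) (q k) \<Omega> * u k x powr (q k - 1)) \<and>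
    (\<integral>x. norm (G x) powr p k \<partial>lebesgue_on \<Omega>) = Lambda_pq (p k) (q k) \<Omega> \<and> 0 \<le> Lambda_pq (p k) (q k) \<Omega>"
    if "k \<ge> k0" for k
    using eigenfunction_weak_solution[OF \<Omega> conjunct2[OF k0[OF that]] assms(5) assms(11) assms(12)] by metis
  then obtain G where G: "\<And>k. k \<ge> k0 \<Longrightarrow> W1p0 (p k) \<Omega> (u k) (G k)" "\<And>k. k \<ge> k0 \<Longrightarrow> continuous_on \<Omega> (u k)"
    "\<And>k. k \<ge> k0 \<Longrightarrow> weak_solution (p k) \<Omega> (zero_ext \<Omega> (u k)) (G k) (\<lambda>x. Lambda_pq (p k) (q k) \<Omega> * u k x powr (q k - 1))"
    "\<And>k. k \<ge> k0 \<Longrightarrow> (\<integral>x. norm (G k x) powr p k \<partial>lebesgue_on \<Omega>) = Lambda_pq (p k) (q k) \<Omega>"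
    "\<And>k. k \<ge> k0 \<Longrightarrow> 0 \<le> Lambda_pq (p k) (q k) \<Omega>" by metis
  have p0: "p k > 0" "q k > 0" for k using assms(5)[of k] assms(6)[of k] by linarith+
  \<comment> \<open>From \<open>k0\<close> on, \<open>p k\<close> is in the range of Morrey's inequality and
    \<open>\<mu> k\<close> is bounded, so the Hoelder constants have a common bound.\<close>
  define C where "C = morrey_const \<Omega> * (4 * (1 / R + 1))"
  have C: "C \<ge> 0" using morrey_const_nonneg[of \<Omega>] R(1) by (simp add: C_def)
  have eqc: "\<bar>zero_ext \<Omega> (u (k + k0)) x - zero_ext \<Omega> (u (k + k0)) y\<bar> \<le> C * sqrt (norm (x - y))" for k x y
  proof -
    let ?k = "k + k0"
    have kk: "?k \<ge> k0" by simp
    have pk: "2 * real DIM('a) < p ?k" and mk: "\<mu> ?k < 1 / R + 1" using k0[OF kk] by auto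
    have n1: "real DIM('a) \<ge> 1" using DIM_positive[where 'a='a] by linarith
    have p1: "1 \<le> p ?k" using pk n1 by linarith
    have "(2 * Lambda_pq (p ?k) (q ?k) \<Omega>) powr (1 / p ?k) = 2 powr (1 / p ?k) * \<mu> ?k"
      unfolding \<mu>_def by (rule powr_mult)
    also have "... \<le> 2 powr 1 * (1 / R + 1)"
      using p1 mk by (intro mult_mono powr_mono) (auto simp: \<mu>_def)
    finally have le: "(2 * Lambda_pq (p ?k) (q ?k) \<Omega>) powr (1 / p ?k) \<le> 2 * (1 / R + 1)" by simp
    have "\<bar>zero_ext \<Omega> (u ?k) x - zero_ext \<Omega> (u ?k) y\<bar> \<le>
       morrey_const \<Omega> * sqrt (norm (x - y)) * (2 * (2 * Lambda_pq (p ?k) (q ?k) \<Omega>) powr (1 / p ?k))"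
      using zero_ext_regular(2)[OF \<Omega> pk G(1)[OF kk] G(2)[OF kk]] unfolding G(4)[OF kk] .
    also have "... \<le> morrey_const \<Omega> * sqrt (norm (x - y)) * (2 * (2 * (1 / R + 1)))"
      using morrey_const_nonneg[of \<Omega>] le by (intro mult_left_mono) auto
    finally show ?thesis by (simp add: C_def mult_ac)
  qed
  obtain v r1 where r1: "strict_mono (r1 :: nat \<Rightarrow> nat)"
    "uniform_limit UNIV (\<lambda>n. zero_ext \<Omega> (u (r1 n + k0))) v sequentially" "\<And>x. x \<notin> \<Omega> \<Longrightarrow> v x = 0"
    by (rule uniform_subsequence_zero_ext[OF \<Omega>(2) eqc C]) (rule that)
  have "\<mu> (r1 n + k0) \<in> {0..1 / R + 1}" for n using k0[of "r1 n + k0"] by (auto simp: \<mu>_def)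
  then obtain L r2 where r2: "strict_mono (r2 :: nat \<Rightarrow> nat)" "((\<lambda>n. \<mu> (r1 n + k0)) \<circ> r2) \<longlonglongrightarrow> L"
    using compact_imp_seq_compact[OF compact_Icc[of 0 "1 / R + 1"]] unfolding seq_compact_def by metis
  define r where "r = (\<lambda>n. r1 (r2 n) + k0)"
  have r: "strict_mono r" using r1(1) r2(1) by (simp add: r_def strict_mono_def)
  have rk: "r n \<ge> k0" for n by (simp add: r_def)
  have \<mu>L: "(\<lambda>n. \<mu> (r n)) \<longlonglongrightarrow> L" using r2(2) by (simp add: r_def o_def)
  have fr: "filterlim r sequentially sequentially" by (rule filterlim_subseq[OF r])
  have fp: "filterlim (\<lambda>n. p (r n)) at_top sequentially" by (rule filterlim_compose[OF assms(7) fr])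
  have fq: "filterlim (\<lambda>n. q (r n)) at_top sequentially" by (rule filterlim_compose[OF assms(8) fr])
  have lim: "uniform_limit UNIV (\<lambda>n. zero_ext \<Omega> (u (r n))) v sequentially"
  proof (rule uniform_limitI)
    fix e :: real assume "e > 0"
    from uniform_limitD[OF r1(2) this]
    show "\<forall>\<^sub>F n in sequentially. \<forall>x\<in>UNIV. dist (zero_ext \<Omega> (u (r n)) x) (v x) < e"
      unfolding r_def by (rule eventually_compose_filterlim[OF _ filterlim_subseq[OF r2(1)]])
  qed
  have pr: "2 * real DIM('a) < p (r n)" for n using k0[OF rk] by blast
  note reg = zero_ext_regular[OF \<Omega> pr G(1)[OF rk] G(2)[OF rk]]
  have cw: "continuous_on UNIV (zero_ext \<Omega> (u (r n)))" for n by (rule reg(1))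
  have cv: "continuous_on UNIV v"
    by (rule uniform_limit_theorem[OF always_eventually lim]) (use cw in auto)
  have up: "0 < u k x" if "x \<in> \<Omega>" for k x using assms(11)[of k] that unfolding eigenfunction_def by blast
  have wn: "zero_ext \<Omega> (u (r n)) x \<ge> 0" for n x using up by (simp add: zero_ext_def less_imp_le)
  have N: "Lp_norm (q (r n)) \<Omega> (zero_ext \<Omega> (u (r n))) = 1" for n
    unfolding Lp_norm_zero_ext by (rule assms(12))
  note mx = limit_maximum[OF \<Omega> R(2) lim cw cv r1(3) wn N fq p0(2)]
  obtain x1 where x1: "x1 \<in> \<Omega>" "v x1 \<ge> 1" using mx(1) by blast
  have L_le: "L \<le> 1 / R"
  proof (rule dense_ge)
    fix M assume M: "1 / R < M"
    have "eventually (\<lambda>n. \<mu> (r n) \<le> M) sequentially"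
      by (rule eventually_mono[OF eventually_compose_filterlim[OF \<mu>_lim[OF M] fr]]) simp
    then show "L \<le> M" by (intro tendsto_upperbound[OF \<mu>L]) simp_all
  qed
  have avg: "\<bar>ball_average e (zero_ext \<Omega> (u (r k))) y - ball_average e (zero_ext \<Omega> (u (r k))) x\<bar> \<le>
      norm (y - x) * (measure lborel (cball (0::'a) e) powr (- 1 / p (r k)) * \<mu> (r k))" if "e > 0" for k e x y
    using reg(3)[OF that, of k y x] unfolding G(4)[OF rk] \<mu>_def .
  have lip: "\<bar>v y - v x\<bar> \<le> L * norm (y - x)" for x y
    by (rule limit_lipschitz[OF lim cw cv avg fp \<mu>L])
  \<comment> \<open>A function with Lipschitz constant \<open>L\<close> that is zero outside
    \<open>\<Omega>\<close> can be 1 only at distance \<open>1/L\<close> from the complement, and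
    no point of \<open>\<Omega>\<close> is farther from it than \<open>R\<close>.\<close>
  have L_ge: "1 / R \<le> L"
  proof -
    have far: "1 \<le> L * dist x1 y" if "y \<in> - \<Omega>" for y
      using lip[of x1 y] r1(3)[of y] x1(2) that by (simp add: dist_norm)
    have neC: "- \<Omega> \<noteq> {}"
    proof
      assume "- \<Omega> = {}"
      then have "\<Omega> = UNIV" by blast
      then show False using \<Omega>(2) not_bounded_UNIV by simp
    qed
    then obtain y where "y \<in> - \<Omega>" by blast
    from far[OF this] have L0: "L > 0"
      by (metis mult_nonpos_nonneg not_le not_one_le_zero order_trans zero_le_dist)
    have "1 / L \<le> infdist x1 (- \<Omega>)"
      unfolding infdist_notempty[OF neC]
    proof (rule cINF_greatest[OF neC])
      show "1 / L \<le> dist x1 y" if "y \<in> - \<Omega>" for y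
        using far[OF that] L0 by (simp add: pos_divide_le_eq mult.commute)
    qed
    then have "1 / L \<le> R" using R(4)[OF x1(1)] by linarith
    then show ?thesis using L0 R(1) by (simp add: field_simps)
  qed
  have L: "L = lambda_1_inf \<Omega>" unfolding lam using L_le L_ge by simp
  have L0: "L > 0" unfolding L lam using R(1) by simp
  have ql: "(\<lambda>n. q (r n) / p (r n)) \<longlonglongrightarrow> l" using LIMSEQ_subseq_LIMSEQ[OF assms(9) r] by (simp add: o_def)
  interpret E: eigenfunction_limit \<Omega> "\<lambda>n. p (r n)" "\<lambda>n. q (r n)" "\<lambda>n. Lambda_pq (p (r n)) (q (r n)) \<Omega>"
    "\<lambda>n. u (r n)" "\<lambda>n. G (r n)" v l L
  proof
    show "open \<Omega>" "bounded \<Omega>" "connected \<Omega>" using assms by auto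
    show "filterlim (\<lambda>n. p (r n)) at_top sequentially" by (rule fp)
    show "p (r k) > 0" "1 < q (r k)" for k by (rule p0(1), rule assms(5))
    show "(\<lambda>k. q (r k) / p (r k)) \<longlonglongrightarrow> l" by (rule ql)
    show "0 \<le> Lambda_pq (p (r k)) (q (r k)) \<Omega>" for k by (rule G(5)[OF rk])
    show "(\<lambda>k. Lambda_pq (p (r k)) (q (r k)) \<Omega> powr (1 / p (r k))) \<longlonglongrightarrow> L" using \<mu>L unfolding \<mu>_def .
    show "0 < L" by (rule L0)
    show "weak_solution (p (r k)) \<Omega> (zero_ext \<Omega> (u (r k))) (G (r k)) (\<lambda>x. Lambda_pq (p (r k)) (q (r k)) \<Omega> * u (r k) x powr (q (r k) - 1))" for k
      by (rule G(3)[OF rk])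
    show "0 < u (r k) x" if "x \<in> \<Omega>" for k x by (rule up[OF that])
    show "uniform_limit UNIV (\<lambda>k. zero_ext \<Omega> (u (r k))) v sequentially" by (rule lim)
    show "continuous_on UNIV v" by (rule cv)
    show "\<exists>x\<in>\<Omega>. 0 < v x" using x1 by (intro bexI[of _ x1]) auto
  qed
  have unif: "uniform_limit (closure \<Omega>) (\<lambda>n. u (r n)) v sequentially"
  proof (rule uniform_limitI)
    fix e :: real assume "e > 0"
    from uniform_limitD[OF lim this] show "\<forall>\<^sub>F n in sequentially. \<forall>x\<in>closure \<Omega>. dist (u (r n) x) (v x) < e"
    proof eventually_elim
      case (elim n)
      show ?case
      proof
        fix x assume x: "x \<in> closure \<Omega>"
        have "u (r n) x = zero_ext \<Omega> (u (r n)) x"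
        proof (cases "x \<in> \<Omega>")
          case False
          then have "x \<in> frontier \<Omega>" using x assms(1) by (simp add: frontier_def interior_open)
          then have "u (r n) x = 0" using assms(11)[of "r n"] unfolding eigenfunction_def by blast
          then show ?thesis using False by (simp add: zero_ext_def)
        qed (simp add: zero_ext_def)
        then show "dist (u (r n) x) (v x) < e" using elim by simp
      qed
    qed
  qed
  have vm: "v \<in> borel_measurable (lebesgue_on \<Omega>)"
    by (intro borel_imp_lebesgue_on borel_measurable_continuous_onI cv)
  have "norm (v x) \<le> 1" for x using mx(2)[of x] E.v_nonneg[of x] by simp
  note Linf = Linf_normI[OF vm AE_I2[OF this] zero_le_one]
  have "1 \<le> Linf_norm \<Omega> v"
    using Linf_norm_continuous[OF assms(1) continuous_on_subset[OF cv subset_UNIV] x1(1) Linf(1)] x1(2) by simp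
  then have "Linf_norm \<Omega> v = 1" using Linf(2) by simp
  moreover have "\<forall>x\<in>frontier \<Omega>. v x = 0"
    using r1(3) assms(1) by (simp add: frontier_def interior_open)
  moreover have "continuous_on (closure \<Omega>) v" by (rule continuous_on_subset[OF cv]) simp
  ultimately show ?thesis using r unif E.viscosity[OF L] by blast
qed

end
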